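(* Let $n\ge 1$ be an integer and $s\in(1/2,1)$. Let $L\in C(\mathbb{R},\mathbb{R}^{n\times n})$ be such that $L(x)$ is symmetric for every $x\in\mathbb{R}$, and assume: - there exists $\alpha>0$ such that $L(x)q\cdot q\ge\alpha|q|^2$ for any $x\in\mathbb{R}$ and $q\in\mathbb{R}^n$; - $\lim_{x\to\pm\infty}\inf_{|\xi|=1}L(x)\xi\cdot\xi=+\infty$. Let $W\in C^1(\mathbb{R}\times\mathbb{R}^n,\mathbb{R})$ satisfy: - $W(x,0)=0$ for all $x\in\mathbb{R}$; - $\lim_{|q|\to0}\sup_{x\in\mathbb{R}}\frac{|\nabla_qW(x,q)|}{|q|}=0$; - there exists $\mu>2$ such that $0<\mu W(x,q)\le\nabla_qW(x,q)\cdot q$ for any $x\in\mathbb{R}$ and any $q\in\mathbb{R}^n\setminus\{0\}$; - for any $M>0$ there exists $\kappa_M>0$ such that $\left|\frac12\nabla_qW(x,q)\cdot q-W(x,q)\right|\le\kappa_M|q|^2$ for any $x\in\mathbb{R}$ and any $q\in\mathbb{R}^n$ with $|q|\le M$. Then there exists a nontrivial solution $q:\mathbb{R}\to\mathbb{R}^n$ of $$(-\Delta)^sq(x)+L(x)q(x)=\nabla_qW(x,q(x))\qquad\text{for all }x\in\mathbb{R}$$ such that $q\in C^{s-1/2}(\mathbb{R},\mathbb{R}^n)$ and $\|q\|_{C^{s-1/2}(\mathbb{R},\mathbb{R}^n)}\le C^\star$ for some $C^\star>0$ depending only on $n,s,W$ and $L$. Also, $q\in C^{2s}(B_{1/2},\mathbb{R}^n)$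 and $\|q\|_{C^{2s}(B_{1/2},\mathbb{R}^n)}\le C^{\star\star}$ for some $C^{\star\star}>0$ depending only on $n,s,W$ and $L$. Moreover, $\lim_{x\to\pm\infty}q(x)=0$.
   Context: $B_{1/2}=(-1/2,1/2)\subset\mathbb{R}$. Fractional Laplacian: $(-\Delta)^s u(x)=2c_s\int_{\mathbb{R}}\frac{u(x)-u(y)}{|x-y|^{1+2s}}\,dy$ (principal value), acting componentwise, with $c_s>0$ the usual normalizing constant (so that the Fourier symbol is $|2\pi\xi|^{2s}$). For a non-integer exponent $2s\in(1,2)$, $C^{2s}$ means $C^{1,2s-1}$. Solution is meant in the weak sense: $q$ is measurable with $c_s\iint_{\mathbb{R}^2}\frac{|q(x)-q(y)|^2}{|x-y|^{1+2s}}dx\,dy+\int_{\mathbb{R}}L(x)q(x)\cdot q(x)\,dx<+\infty$ and, for all $\varphi\in C_0^\infty(\mathbb{R},\mathbb{R}^n)$, $$c_s\iint_{\mathbb{R}^2}\frac{(q(x)-q(y))\cdot(\varphi(x)-\varphi(y))}{|x-y|^{1+2s}}\,dx\,dy+\int_{\mathbb{R}}L(x)q(x)\cdot\varphi(x)\,dx=\int_{\mathbb{R}}\nabla_qW(x,q(x))\cdot\varphi(x)\,dx.$$ Nontrivial means not identically zero. *)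

theory Defs
  imports "HOL-Analysis.Analysis"
begin

definition C1_fun :: "('a::real_normed_vector \<Rightarrow> 'b::real_normed_vector) \<Rightarrow> bool" where
  "C1_fun f \<longleftrightarrow>
     (\<exists>D :: 'a \<Rightarrow> 'a \<Rightarrow>\<^sub>L 'b.
        (\<forall>z. (f has_derivative blinfun_apply (D z)) (at z)) \<and> continuous_on UNIV D)"

definition grad :: "('a::real_inner \<Rightarrow> real) \<Rightarrow> 'a \<Rightarrow> 'a" where
  "grad f x = (THE D. GDERIV f x :> D)"

definition smooth_fun :: "(real \<Rightarrow> 'b::real_normed_vector) \<Rightarrow> bool" where
  "smooth_fun f \<longleftrightarrow>
     (\<forall>k::nat. ((\<lambda>g x. vector_derivative g (at x)) ^^ k) f differentiable_on UNIV)"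

definition test_functions :: "(real \<Rightarrow> 'b::real_normed_vector) set" where
  "test_functions = {\<phi>. smooth_fun \<phi> \<and> compact (closure {x. \<phi> x \<noteq> 0})}"

text \<open>
  The multiplier of \<open>u \<mapsto> 2 c_s PV\<integral> (u x - u y) / |x - y|^(1+2s) dy\<close> at frequency \<open>\<xi>\<close> is
  \<open>2 c_s \<integral> (1 - cos (2 \<pi> \<xi> t)) / |t|^(1+2s) dt\<close>, which scales to
  \<open>|2 \<pi> \<xi>|^(2s) * 2 c_s \<integral> (1 - cos t) / |t|^(1+2s) dt\<close>. Requiring the symbol
  \<open>|2 \<pi> \<xi>|^(2s)\<close> fixes \<open>c_s\<close>.
\<close>
definition frac_const :: "real \<Rightarrow> real" where
  "frac_const s = 1 / (2 * (LINT t|lborel. (1 - cos t) / \<bar>t\<bar> powr (1 + 2 * s)))"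

text \<open>
  The norms take values in the extended nonnegative reals, so that a bound by a real constant
  includes finiteness of the suprema.
\<close>
definition sup_norm_on :: "real set \<Rightarrow> (real \<Rightarrow> 'b::real_normed_vector) \<Rightarrow> ennreal" where
  "sup_norm_on S f = (SUP x\<in>S. ennreal (norm (f x)))"

definition holder_seminorm :: "real \<Rightarrow> real set \<Rightarrow> (real \<Rightarrow> 'b::real_normed_vector) \<Rightarrow> ennreal" where
  "holder_seminorm \<beta> S f =
     (SUP (x, y)\<in>{(x, y). x \<in> S \<and> y \<in> S \<and> x \<noteq> y}.
        ennreal (norm (f x - f y) / \<bar>x - y\<bar> powr \<beta>))"

definition holder_norm :: "real \<Rightarrow> real set \<Rightarrow> (real \<Rightarrow> 'b::real_normed_vector) \<Rightarrow> ennreal" where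
  "holder_norm \<beta> S f = sup_norm_on S f + holder_seminorm \<beta> S f"

definition holder_space :: "real \<Rightarrow> real set \<Rightarrow> (real \<Rightarrow> 'b::real_normed_vector) set" where
  "holder_space \<beta> S = {f. holder_norm \<beta> S f < \<infinity>}"

text \<open>
  \<open>C^{1,\<beta>}(S)\<close> for open \<open>S\<close>.
\<close>
definition C1_holder_norm :: "real \<Rightarrow> real set \<Rightarrow> (real \<Rightarrow> 'b::real_normed_vector) \<Rightarrow> ennreal" where
  "C1_holder_norm \<beta> S f = sup_norm_on S f + holder_norm \<beta> S (\<lambda>x. vector_derivative f (at x))"

definition C1_holder_space :: "real \<Rightarrow> real set \<Rightarrow> (real \<Rightarrow> 'b::real_normed_vector) set" where
  "C1_holder_space \<beta> S = {f. f differentiable_on S \<and> C1_holder_norm \<beta> S f < \<infinity>}"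

text \<open>
  \<open>L x\<close> is meant to be positive semidefinite, so that no negative part is lost in the
  potential part of the energy.
\<close>
definition frac_energy ::
  "real \<Rightarrow> (real \<Rightarrow> real^'n^'n) \<Rightarrow> (real \<Rightarrow> real^'n) \<Rightarrow> ennreal" where
  "frac_energy s L q =
     ennreal (frac_const s) *
       (\<integral>\<^sup>+(x, y). ennreal ((norm (q x - q y))\<^sup>2 / \<bar>x - y\<bar> powr (1 + 2 * s)) \<partial>lebesgue) +
     (\<integral>\<^sup>+x. ennreal ((L x *v q x) \<bullet> q x) \<partial>lebesgue)"

text \<open>
  Weak solutions of \<open>(-\<Delta>)^s q + L q = \<nabla>_q W(x, q)\<close>. The Bochner integral of a non-integrable
  function is 0, hence the explicit integrability requirements.
\<close>
definition weak_solution ::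
  "real \<Rightarrow> (real \<Rightarrow> real^'n^'n) \<Rightarrow> (real \<Rightarrow> real^'n \<Rightarrow> real) \<Rightarrow> (real \<Rightarrow> real^'n) \<Rightarrow> bool" where
  "weak_solution s L W q \<longleftrightarrow>
     q \<in> borel_measurable lebesgue \<and>
     frac_energy s L q < \<infinity> \<and>
     (\<forall>\<phi>\<in>test_functions.
        integrable lebesgue
          (\<lambda>(x, y). (q x - q y) \<bullet> (\<phi> x - \<phi> y) / \<bar>x - y\<bar> powr (1 + 2 * s)) \<and>
        integrable lebesgue (\<lambda>x. (L x *v q x) \<bullet> \<phi> x) \<and>
        integrable lebesgue (\<lambda>x. grad (W x) (q x) \<bullet> \<phi> x) \<and>
        frac_const s *
            (LINT (x, y)|lebesgue. (q x - q y) \<bullet> (\<phi> x - \<phi> y) / \<bar>x - y\<bar> powr (1 + 2 * s)) +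
          (LINT x|lebesgue. (L x *v q x) \<bullet> \<phi> x) =
        (LINT x|lebesgue. grad (W x) (q x) \<bullet> \<phi> x))"

end

theory Submission
  imports Defs
begin

text \<open>
  A solution is a critical point of \<open>I u = B(u, u) / 2 - \<integral> W(x, u)\<close>, where \<open>B\<close> is the energy form. For every
  finite set \<open>F\<close> of test functions a mountain pass inside a finite-dimensional space of test functions containing
  \<open>F\<close> gives a point at which the derivative of \<open>I\<close> vanishes on \<open>F\<close>. Its level is bounded independently of \<open>F\<close>,
  so the superquadraticity condition on \<open>W\<close> bounds its energy, and the smallness of the gradient of \<open>W\<close> near 0
  bounds its supremum norm from below. Functions of bounded energy are uniformly \<open>(s - 1/2)\<close>-Hoelder and, since
  \<open>L\<close> tends to infinity, decay uniformly at infinity; hence energy balls are compact in the supremum norm. The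
  finite intersection property then yields a nonzero continuous function satisfying the weak equation for all
  test functions.

  For the interior regularity let \<open>\<phi>\<close> be an even bump that decreases away from 0, \<open>\<psi>\<close> its fractional Laplacian
  and \<open>\<rho> z = \<integral>\<^bsub>1\<^esub>\<^bsup>\<infinity>\<^esup> \<epsilon>\<^bsup>-2\<^esup> \<psi> (z/\<epsilon>) d\<epsilon>\<close>. Then \<open>\<rho>\<close> is nonnegative with positive finite mass, and the derivative of
  \<open>\<rho> (z/\<epsilon>) / \<epsilon>\<close> with respect to \<open>\<epsilon>\<close> is \<open>- \<epsilon>\<^bsup>-2\<^esup> \<psi> (z/\<epsilon>)\<close>. Testing the equation with dilates of \<open>\<phi>\<close> and integrating over
  \<open>0 < \<epsilon> \<le> 1\<close> therefore expresses \<open>mass \<rho> \<cdot> u\<close> as the convolution of \<open>u\<close> with \<open>\<rho>\<close> plus the convolution of the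
  locally bounded right-hand side with a superposition of dilates of \<open>\<phi>\<close>. The derivatives of both kernels have an
  \<open>L\<^sup>1\<close> modulus of continuity of order \<open>2s - 1\<close>, so \<open>u\<close> is of class \<open>C\<^bsup>1,2s-1\<^esup>\<close>.
\<close>

text \<open>The obstacle is the choice of space. Everything lives among bounded continuous functions
  with the supremum norm, which avoids the completed energy space and a Palais-Smale condition. The
  energy is only lower semicontinuous for that norm, so the fractional Laplacian is moved onto the
  test function, which makes the weak equation continuous in the unknown. A finite-dimensional
  critical point lies in the space it is tested with, so it may be tested with itself; this yields
  its energy bound and the lower bound of its norm. Both survive the limit, the former by Fatou. The
  condition s > 1/2 enters twice: in the Hoelder estimate, and in the integrability near 0 of
  \<open>\<epsilon> powr (2 * s - 2)\<close>, the weight that homogeneity puts on the bump of scale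
  \<epsilon>. The monotone shape of the bump gives the sign of its kernel \<rho>, and hence a
  positive mass to divide by. Since L is unbounded, so may be the right-hand side. Bumps centred in
  (-1, 1) of scale at most 1 see it only on (-2, 2), which is why the regularity is local.\<close>

section \<open>Closure properties of smooth functions\<close>

text \<open>Iterated \<open>vector_derivative\<close>s are awkward to compute. A set in which every
  member has a derivative again in the set contains all iterates, by uniqueness of derivatives, so
  exhibiting such an invariant set proves smoothness.\<close>

lemma smooth_fun_coinduct:
  fixes f :: "real \<Rightarrow> 'b::real_normed_vector"
  assumes "f \<in> S"
    and step: "\<And>g. g \<in> S \<Longrightarrow> \<exists>g'\<in>S. \<forall>x. (g has_vector_derivative g' x) (at x)"
  shows "smooth_fun f"
proof -
  let ?D = "\<lambda>(g::real \<Rightarrow> 'b) x. vector_derivative g (at x)"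
  have D: "?D g \<in> S \<and> g differentiable_on UNIV" if "g \<in> S" for g
  proof -
    obtain g' where g': "g' \<in> S" "\<And>x. (g has_vector_derivative g' x) (at x)"
      using step[OF \<open>g \<in> S\<close>] by auto
    have "?D g = g'"
      using g'(2) by (auto intro!: vector_derivative_at)
    moreover have "g differentiable_on UNIV"
      using g'(2) by (auto simp: differentiable_on_def differentiable_def has_vector_derivative_def)
    ultimately show ?thesis
      using g'(1) by simp
  qed
  have "(?D ^^ k) f \<in> S" for k
    by (induction k) (use D assms(1) in auto)
  then show ?thesis
    using D by (auto simp: smooth_fun_def)
qed

lemma smooth_fun_has_derivative:
  fixes f :: "real \<Rightarrow> 'b::real_normed_vector"
  assumes "smooth_fun f"
  obtains f' where "smooth_fun f'" "\<And>x. (f has_vector_derivative f' x) (at x)"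
proof
  let ?D = "\<lambda>(g::real \<Rightarrow> 'b) x. vector_derivative g (at x)"
  have D: "((?D ^^ k) f) differentiable_on UNIV" for k
    using assms by (auto simp: smooth_fun_def)
  have "((?D ^^ k) (?D f)) differentiable_on UNIV" for k
    using D[of "Suc k"] unfolding funpow_Suc_right o_apply .
  then show "smooth_fun (?D f)"
    by (simp add: smooth_fun_def)
  show "(f has_vector_derivative ?D f x) (at x)" for x
    using D[of 0] by (simp add: differentiable_on_def vector_derivative_works[symmetric])
qed

lemma smooth_fun_add:
  fixes f g :: "real \<Rightarrow> 'b::real_normed_vector"
  assumes "smooth_fun f" "smooth_fun g"
  shows "smooth_fun (\<lambda>x. f x + g x)"
proof (rule smooth_fun_coinduct)
  let ?S = "{(\<lambda>x. f x + g x :: 'b) | f g. smooth_fun f \<and> smooth_fun g}"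
  show "(\<lambda>x. f x + g x) \<in> ?S"
    using assms by blast
  fix h assume "h \<in> ?S"
  then obtain f g :: "real \<Rightarrow> 'b" where h: "h = (\<lambda>x. f x + g x)" "smooth_fun f" "smooth_fun g"
    by blast
  obtain f' where f': "smooth_fun f'" "\<And>x. (f has_vector_derivative f' x) (at x)"
    using smooth_fun_has_derivative[OF h(2)] by blast
  obtain g' where g': "smooth_fun g'" "\<And>x. (g has_vector_derivative g' x) (at x)"
    using smooth_fun_has_derivative[OF h(3)] by blast
  show "\<exists>h'\<in>?S. \<forall>x. (h has_vector_derivative h' x) (at x)"
    using f' g' unfolding h(1) by (intro bexI[of _ "\<lambda>x. f' x + g' x"]) (auto intro!: derivative_intros)
qed

text \<open>The product rule turns one product into a sum of two, so products alone are not closed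
  under differentiation. This family is, and it is the invariant set for
  \<open>smooth_fun_scaleR\<close>.\<close>

inductive_set scaleR_sums :: "(real \<Rightarrow> 'b::real_normed_vector) set" where
  base: "smooth_fun a \<Longrightarrow> smooth_fun b \<Longrightarrow> (\<lambda>x. (a x :: real) *\<^sub>R b x) \<in> scaleR_sums"
| add: "f \<in> scaleR_sums \<Longrightarrow> g \<in> scaleR_sums \<Longrightarrow> (\<lambda>x. f x + g x) \<in> scaleR_sums"

lemma smooth_fun_scaleR:
  fixes a :: "real \<Rightarrow> real" and b :: "real \<Rightarrow> 'b::real_normed_vector"
  assumes "smooth_fun a" "smooth_fun b"
  shows "smooth_fun (\<lambda>x. a x *\<^sub>R b x)"
proof (rule smooth_fun_coinduct)
  show "(\<lambda>x. a x *\<^sub>R b x) \<in> scaleR_sums"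
    using assms by (rule scaleR_sums.base)
  fix h :: "real \<Rightarrow> 'b" assume "h \<in> scaleR_sums"
  then show "\<exists>h'\<in>scaleR_sums. \<forall>x. (h has_vector_derivative h' x) (at x)"
  proof induction
    case (base a b)
    obtain a' where a': "smooth_fun a'" "\<And>x. (a has_vector_derivative a' x) (at x)"
      using smooth_fun_has_derivative[OF base(1)] by blast
    obtain b' where b': "smooth_fun b'" "\<And>x. (b has_vector_derivative b' x) (at x)"
      using smooth_fun_has_derivative[OF base(2)] by blast
    have "((\<lambda>x. a x *\<^sub>R b x) has_vector_derivative a x *\<^sub>R b' x + a' x *\<^sub>R b x) (at x)" for x
      using has_vector_derivative_scaleR[of a "a' x" x UNIV b "b' x"] a'(2)[of x] b'(2)[of x]
      by (simp add: has_real_derivative_iff_has_vector_derivative)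
    then show ?case
      using a'(1) b'(1) base
      by (intro bexI[of _ "\<lambda>x. a x *\<^sub>R b' x + a' x *\<^sub>R b x"]) (auto intro!: scaleR_sums.intros)
  next
    case (add f g)
    then obtain f' g' where "f' \<in> scaleR_sums" "g' \<in> scaleR_sums"
      "\<And>x. (f has_vector_derivative f' x) (at x)" "\<And>x. (g has_vector_derivative g' x) (at x)"
      by auto
    then show ?case
      by (intro bexI[of _ "\<lambda>x. f' x + g' x"]) (auto intro!: scaleR_sums.intros derivative_intros)
  qed
qed

lemma smooth_fun_const: "smooth_fun (\<lambda>x. c :: 'b::real_normed_vector)"
proof (rule smooth_fun_coinduct[of _ "{\<lambda>x. c, \<lambda>x. 0}"])
  fix g :: "real \<Rightarrow> 'b" assume "g \<in> {\<lambda>x. c, \<lambda>x. 0}"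
  then show "\<exists>g'\<in>{\<lambda>x. c, \<lambda>x. 0}. \<forall>x. (g has_vector_derivative g' x) (at x)"
    by (intro bexI[of _ "\<lambda>x. 0"]) auto
qed simp

lemma smooth_fun_affine:
  fixes f :: "real \<Rightarrow> 'b::real_normed_vector"
  assumes "smooth_fun f"
  shows "smooth_fun (\<lambda>x. f (a * x + b))"
proof (rule smooth_fun_coinduct)
  \<comment> \<open>The factor \<open>c\<close> collects the powers of \<open>a\<close> produced by
    the chain rule.\<close>
  let ?S = "{(\<lambda>x. c *\<^sub>R f (a * x + b) :: 'b) | c f. smooth_fun f}"
  show "(\<lambda>x. f (a * x + b)) \<in> ?S"
    using assms by (auto intro!: exI[of _ "1::real"] exI[of _ f])
  fix h assume "h \<in> ?S"
  then obtain c f where h: "h = (\<lambda>x. c *\<^sub>R f (a * x + b) :: 'b)" "smooth_fun f"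
    by blast
  obtain f' where f': "smooth_fun f'" "\<And>x. (f has_vector_derivative f' x) (at x)"
    using smooth_fun_has_derivative[OF h(2)] by blast
  have "(h has_vector_derivative (c * a) *\<^sub>R f' (a * x + b)) (at x)" for x
  proof -
    have 1: "((\<lambda>x. a * x + b) has_vector_derivative a) (at x)"
      by (auto intro!: derivative_eq_intros simp: has_real_derivative_iff_has_vector_derivative[symmetric])
    have "((f \<circ> (\<lambda>x. a * x + b)) has_vector_derivative a *\<^sub>R f' (a * x + b)) (at x)"
      by (rule vector_diff_chain_at[OF 1]) (rule f'(2))
    from bounded_linear.has_vector_derivative[OF bounded_linear_scaleR_right this, of c]
    show ?thesis
      unfolding h(1) by (simp add: o_def)
  qed
  then show "\<exists>h'\<in>?S. \<forall>x. (h has_vector_derivative h' x) (at x)"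
    using f'(1) by (intro bexI[of _ "\<lambda>x. (c * a) *\<^sub>R f' (a * x + b)"]) blast+
qed

section \<open>Bump functions\<close>

text \<open>The classical flat function exp(-1/x), with a polynomial in 1/x in front so that the
  family is closed under differentiation.\<close>

definition exp_inv_poly :: "real poly \<Rightarrow> real \<Rightarrow> real" where
  "exp_inv_poly p x = (if x > 0 then poly p (1 / x) * exp (- (1 / x)) else 0)"

lemma poly_mult_exp_minus_tendsto_0:
  "((\<lambda>y. poly p y * exp (- y)) \<longlongrightarrow> (0::real)) at_top"
proof -
  have "((\<lambda>y. \<Sum>i\<le>degree p. coeff p i * (y ^ i / exp y)) \<longlongrightarrow> (\<Sum>i\<le>degree p. coeff p i * 0)) at_top"
    by (intro tendsto_sum tendsto_mult tendsto_const tendsto_power_div_exp_0)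
  then show ?thesis
    by (simp add: poly_altdef sum_distrib_right exp_minus divide_inverse mult.assoc)
qed

text \<open>With y = 1/x one has d/dx = - y^2 d/dy, and d/dy of p(y) exp(-y) is (p' - p)(y) exp(-y);
  hence the polynomial y^2 (p - p').\<close>

lemma exp_inv_poly_has_derivative:
  "(exp_inv_poly p has_vector_derivative exp_inv_poly ([:0,0,1:] * (p - pderiv p)) x) (at x)"
proof -
  consider "x > 0" | "x < 0" | "x = 0"
    by linarith
  then show ?thesis
  proof cases
    case 1
    have "((\<lambda>x. poly p (1 / x) * exp (- (1 / x))) has_real_derivative
      exp_inv_poly ([:0,0,1:] * (p - pderiv p)) x) (at x)"
      using 1 by (auto intro!: derivative_eq_intros simp: exp_inv_poly_def algebra_simps divide_simps)
    then have "(exp_inv_poly p has_real_derivative exp_inv_poly ([:0,0,1:] * (p - pderiv p)) x) (at x)"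
      using 1
      by (subst DERIV_cong_ev[OF refl _ refl, where g = "\<lambda>x. poly p (1 / x) * exp (- (1 / x))"])
         (auto simp: exp_inv_poly_def eventually_at dist_real_def intro!: eventually_mono[OF eventually_nhds_in_open[of "{0<..}"]])
    then show ?thesis
      by (simp add: has_real_derivative_iff_has_vector_derivative)
  next
    case 2
    have "(exp_inv_poly p has_real_derivative 0) (at x)"
      using 2
      by (subst DERIV_cong_ev[OF refl _ refl, where g = "\<lambda>x. 0"])
         (auto simp: exp_inv_poly_def intro!: eventually_mono[OF eventually_nhds_in_open[of "{..<0}"]])
    then show ?thesis
      using 2 by (simp add: has_real_derivative_iff_has_vector_derivative exp_inv_poly_def)
  next
    case 3
    \<comment> \<open>The right difference quotient at 0 is p(y) exp(-y) times y = 1/h;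
      \<open>pCons 0 p\<close> is the polynomial with that extra factor y, so the quotient tends to
      0.\<close>
    have "((\<lambda>h. poly (pCons 0 p) (1 / h) * exp (- (1 / h))) \<longlongrightarrow> 0) (at_right 0)"
      using filterlim_compose[OF poly_mult_exp_minus_tendsto_0[of "pCons 0 p"] filterlim_inverse_at_top_right]
      by (simp add: inverse_eq_divide)
    moreover have "\<forall>\<^sub>F h in at_right 0. poly (pCons 0 p) (1 / h) * exp (- (1 / h)) = exp_inv_poly p h / h"
      by (auto simp: eventually_at exp_inv_poly_def intro!: exI[of _ 1])
    ultimately have R: "((\<lambda>h. exp_inv_poly p h / h) \<longlongrightarrow> 0) (at_right 0)"
      by (rule Lim_transform_eventually)
    have "\<forall>\<^sub>F h in at_left 0. exp_inv_poly p h / h = 0"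
      by (auto simp: eventually_at exp_inv_poly_def intro!: exI[of _ 1])
    then have L: "((\<lambda>h. exp_inv_poly p h / h) \<longlongrightarrow> 0) (at_left 0)"
      by (rule tendsto_eventually)
    have "((\<lambda>h. exp_inv_poly p h / h) \<longlongrightarrow> 0) (at 0)"
      using L R by (simp add: filterlim_split_at)
    then have "(exp_inv_poly p has_real_derivative 0) (at 0)"
      by (simp add: DERIV_def exp_inv_poly_def)
    then show ?thesis
      using 3 by (simp add: has_real_derivative_iff_has_vector_derivative exp_inv_poly_def)
  qed
qed

lemma smooth_exp_inv_poly: "smooth_fun (exp_inv_poly p)"
  by (rule smooth_fun_coinduct[of _ "range exp_inv_poly"]) (use exp_inv_poly_has_derivative in auto)

text \<open>The product of the flat functions of 1 + x and 1 - x equals exp(-2 / (1 - x^2)) inside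
  (-1, 1). This closed form shows the monotonicity in |x|, which later makes the kernel \<rho>
  nonnegative.\<close>

lemma even_decreasing_bump:
  obtains \<eta> :: "real \<Rightarrow> real" where "\<eta> \<in> test_functions" "\<And>x. \<eta> x \<ge> 0" "\<eta> 0 > 0"
    "\<And>x. \<bar>x\<bar> \<ge> 1 \<Longrightarrow> \<eta> x = 0" "\<And>x. \<eta> (- x) = \<eta> x" "\<And>x y. \<bar>x\<bar> \<le> \<bar>y\<bar> \<Longrightarrow> \<eta> y \<le> \<eta> x"
proof
  define f where "f = exp_inv_poly 1"
  define \<eta> where "\<eta> x = f (1 * x + 1) *\<^sub>R f (-1 * x + 1)" for x
  have "smooth_fun \<eta>"
    unfolding \<eta>_def[abs_def] f_def by (intro smooth_fun_scaleR smooth_fun_affine smooth_exp_inv_poly)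
  have f0: "f x = 0" if "x \<le> 0" for x
    using that by (simp add: f_def exp_inv_poly_def)
  show z: "\<eta> x = 0" if "\<bar>x\<bar> \<ge> 1" for x
    using that f0[of "1 + x"] f0[of "1 - x"] by (cases "x \<ge> 0") (auto simp: \<eta>_def add.commute)
  have "{x. \<eta> x \<noteq> 0} \<subseteq> {-1..1}"
    using z by force
  then have "bounded {x. \<eta> x \<noteq> 0}"
    using bounded_subset bounded_closed_interval by blast
  then show "\<eta> \<in> test_functions"
    using \<open>smooth_fun \<eta>\<close> by (simp add: test_functions_def)
  show "\<eta> x \<ge> 0" for x
    by (simp add: \<eta>_def f_def exp_inv_poly_def)
  show "\<eta> 0 > 0"
    by (simp add: \<eta>_def f_def exp_inv_poly_def)
  show "\<eta> (- x) = \<eta> x" for x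
    by (simp add: \<eta>_def)
  have E: "\<eta> x = (if \<bar>x\<bar> < 1 then exp (- (2 / (1 - x\<^sup>2))) else 0)" for x
  proof (cases "\<bar>x\<bar> < 1")
    case True
    then have "x\<^sup>2 < 1"
      by (simp add: abs_square_less_1)
    then have "1 / (1 + x) + 1 / (1 - x) = 2 / (1 - x\<^sup>2)"
      using True by (simp add: field_simps power2_eq_square)
    then have "exp (- (1 / (1 + x))) * exp (- (1 / (1 - x))) = exp (- (2 / (1 - x\<^sup>2)))"
      by (simp add: exp_add[symmetric])
    then show ?thesis
      using True by (auto simp: \<eta>_def f_def exp_inv_poly_def add.commute)
  qed (use z in auto)
  show "\<eta> y \<le> \<eta> x" if "\<bar>x\<bar> \<le> \<bar>y\<bar>" for x y
  proof (cases "\<bar>y\<bar> < 1")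
    case True
    have "x\<^sup>2 \<le> y\<^sup>2"
      using that by (simp add: abs_le_square_iff)
    moreover have "y\<^sup>2 < 1"
      using True by (simp add: abs_square_less_1)
    ultimately have "2 / (1 - x\<^sup>2) \<le> 2 / (1 - y\<^sup>2)"
      by (intro divide_left_mono) auto
    then show ?thesis
      using True that by (simp add: E)
  qed (use z[of y] \<open>\<eta> x \<ge> 0\<close> in auto)
qed

section \<open>Test functions\<close>

lemma bounded_support_imp_test_function:
  fixes \<phi> :: "real \<Rightarrow> 'b::real_normed_vector"
  assumes "smooth_fun \<phi>" "\<And>x. \<bar>x\<bar> \<ge> R \<Longrightarrow> \<phi> x = 0"
  shows "\<phi> \<in> test_functions"
proof -
  have "{x. \<phi> x \<noteq> 0} \<subseteq> {-R..R}"
    using assms(2) by force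
  then have "bounded {x. \<phi> x \<noteq> 0}"
    using bounded_subset bounded_closed_interval by blast
  then show ?thesis
    using assms(1) by (simp add: test_functions_def)
qed

lemma test_function_bounded_support:
  fixes \<phi> :: "real \<Rightarrow> 'b::real_normed_vector"
  assumes "\<phi> \<in> test_functions"
  obtains R where "R > 0" "\<And>x. \<bar>x\<bar> \<ge> R \<Longrightarrow> \<phi> x = 0"
proof -
  have "bounded (closure {x. \<phi> x \<noteq> 0})"
    using assms by (auto simp: test_functions_def compact_imp_bounded)
  then have "bounded {x. \<phi> x \<noteq> 0}"
    using bounded_subset closure_subset by blast
  then obtain R where R: "\<And>x. \<phi> x \<noteq> 0 \<Longrightarrow> \<bar>x\<bar> \<le> R"
    by (auto simp: bounded_iff)
  show ?thesis
  proof (rule that[of "\<bar>R\<bar> + 1"])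
    show "\<phi> x = 0" if "\<bar>R\<bar> + 1 \<le> \<bar>x\<bar>" for x
      using R[of x] that by force
  qed auto
qed

lemma test_function_has_derivative:
  fixes \<phi> :: "real \<Rightarrow> 'b::real_normed_vector"
  assumes "\<phi> \<in> test_functions"
  obtains \<phi>' where "\<phi>' \<in> test_functions" "\<And>x. (\<phi> has_vector_derivative \<phi>' x) (at x)"
proof -
  obtain \<phi>' where \<phi>': "smooth_fun \<phi>'" "\<And>x. (\<phi> has_vector_derivative \<phi>' x) (at x)"
    using assms smooth_fun_has_derivative by (auto simp: test_functions_def)
  \<comment> \<open>A derivative is determined only on the open set where |x| > R, so the derivative
    is known to vanish there strictly; this is why the support radius grows to R + 1 below.\<close>
  have z: "\<phi>' x = 0" if R: "\<And>x. \<bar>x\<bar> \<ge> R \<Longrightarrow> \<phi> x = 0" and x: "\<bar>x\<bar> > R" for R x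
  proof -
    have "open {x::real. \<bar>x\<bar> > R}"
      by (intro open_Collect_less continuous_intros)
    then have "((\<lambda>x. 0) has_vector_derivative \<phi>' x) (at x)"
      using has_vector_derivative_transform_within_open[OF \<phi>'(2), of "{x. \<bar>x\<bar> > R}" x "\<lambda>x. 0"] R x
      by auto
    then show ?thesis
      using vector_derivative_unique_at has_vector_derivative_const by blast
  qed
  obtain R where R: "\<And>x. \<bar>x\<bar> \<ge> R \<Longrightarrow> \<phi> x = 0"
    using test_function_bounded_support[OF assms] by blast
  have "\<phi>' \<in> test_functions"
    by (rule bounded_support_imp_test_function[of _ "R + 1"]) (use \<phi>'(1) z[OF R] in auto)
  with \<phi>'(2) show ?thesis
    using that by blast
qed

lemma test_function_continuous:
  fixes \<phi> :: "real \<Rightarrow> 'b::real_normed_vector"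
  assumes "\<phi> \<in> test_functions"
  shows "continuous_on UNIV \<phi>"
  using test_function_has_derivative[OF assms]
  by (metis continuous_at_imp_continuous_on has_vector_derivative_continuous)

lemma test_function_bounded:
  fixes \<phi> :: "real \<Rightarrow> 'b::real_normed_vector"
  assumes "\<phi> \<in> test_functions"
  obtains M where "M > 0" "\<And>x. norm (\<phi> x) \<le> M"
proof -
  obtain R where R: "R > 0" "\<And>x. \<bar>x\<bar> \<ge> R \<Longrightarrow> \<phi> x = 0"
    using test_function_bounded_support[OF assms] by blast
  have "compact (\<phi> ` {-R..R})"
    using test_function_continuous[OF assms] by (intro compact_continuous_image) (auto intro: continuous_on_subset)
  then obtain M where M: "\<And>x. x \<in> {-R..R} \<Longrightarrow> norm (\<phi> x) \<le> M"
    using compact_imp_bounded bounded_iff by (metis image_eqI)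
  show ?thesis
  proof (rule that[of "\<bar>M\<bar> + 1"])
    show "norm (\<phi> x) \<le> \<bar>M\<bar> + 1" for x
      using M[of x] R(2)[of x] by (cases "\<bar>x\<bar> \<ge> R") (force, force simp: abs_le_iff)
  qed auto
qed

lemma test_function_Lipschitz:
  fixes \<phi> :: "real \<Rightarrow> 'b::real_normed_vector"
  assumes "\<phi> \<in> test_functions"
  obtains M where "M > 0" "\<And>x y. norm (\<phi> x - \<phi> y) \<le> M * \<bar>x - y\<bar>"
proof -
  obtain \<phi>' where \<phi>': "\<phi>' \<in> test_functions" "\<And>x. (\<phi> has_vector_derivative \<phi>' x) (at x)"
    using test_function_has_derivative[OF assms] by blast
  obtain M where M: "M > 0" "\<And>x. norm (\<phi>' x) \<le> M"
    using test_function_bounded[OF \<phi>'(1)] by blast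
  have "norm (\<phi> x - \<phi> y) \<le> M * norm (x - y)" for x y
  proof (rule differentiable_bound[of UNIV _ "\<lambda>x h. h *\<^sub>R \<phi>' x"])
    show "(\<phi> has_derivative (\<lambda>h. h *\<^sub>R \<phi>' x)) (at x within UNIV)" for x
      using \<phi>'(2) by (simp add: has_vector_derivative_def)
    show "onorm (\<lambda>h. h *\<^sub>R \<phi>' x) \<le> M" for x
      using M by (intro onorm_bound) (auto simp: mult.commute[of M] intro!: mult_left_mono)
  qed auto
  with M show ?thesis
    using that by (metis real_norm_def)
qed

text \<open>The first-order terms cancel in the symmetric difference. The resulting order
  \<open>t\<^sup>2\<close> at 0 and boundedness at infinity are exactly what the singular kernel of
  exponent 1 + 2s integrates.\<close>

lemma test_function_second_difference:
  fixes \<phi> :: "real \<Rightarrow> 'b::real_normed_vector"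
  assumes "\<phi> \<in> test_functions"
  obtains M where "M > 0" "\<And>x t. norm (2 *\<^sub>R \<phi> x - \<phi> (x + t) - \<phi> (x - t)) \<le> M * min 1 (t\<^sup>2)"
proof -
  obtain \<phi>' where \<phi>': "\<phi>' \<in> test_functions" "\<And>x. (\<phi> has_vector_derivative \<phi>' x) (at x)"
    using test_function_has_derivative[OF assms] by blast
  obtain M where M: "M > 0" "\<And>x. norm (\<phi> x) \<le> M"
    using test_function_bounded[OF assms] by blast
  obtain M' where M': "M' > 0" "\<And>x y. norm (\<phi>' x - \<phi>' y) \<le> M' * \<bar>x - y\<bar>"
    using test_function_Lipschitz[OF \<phi>'(1)] by blast
  have 1: "norm (2 *\<^sub>R \<phi> x - \<phi> (x + t) - \<phi> (x - t)) \<le> 2 * M' * t\<^sup>2" for x t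
  proof -
    \<comment> \<open>Its derivative \<phi>'(x + \<tau>) - \<phi>'(x - \<tau>) is at most
      \<open>2 * M' * \<bar>\<tau>\<bar>\<close> because \<phi>' is Lipschitz; the mean value
      estimate supplies the second factor |t|.\<close>
    define g where "g \<tau> = \<phi> (x + \<tau>) + \<phi> (x - \<tau>)" for \<tau>
    have d: "(g has_derivative (\<lambda>h. h *\<^sub>R (\<phi>' (x + \<tau>) - \<phi>' (x - \<tau>)))) (at \<tau> within S)" for \<tau> S
    proof -
      have "((\<phi> \<circ> (\<lambda>\<tau>. x + \<tau>)) has_vector_derivative 1 *\<^sub>R \<phi>' (x + \<tau>)) (at \<tau>)"
        by (rule vector_diff_chain_at) (auto intro!: derivative_eq_intros \<phi>'(2))
      moreover have "((\<phi> \<circ> (\<lambda>\<tau>. x - \<tau>)) has_vector_derivative (-1) *\<^sub>R \<phi>' (x - \<tau>)) (at \<tau>)"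
        by (rule vector_diff_chain_at) (auto intro!: derivative_eq_intros \<phi>'(2))
      ultimately have "(g has_vector_derivative (\<phi>' (x + \<tau>) - \<phi>' (x - \<tau>))) (at \<tau>)"
        unfolding g_def[abs_def] by (auto intro!: derivative_eq_intros simp: o_def)
      then show ?thesis
        using has_derivative_at_withinI by (auto simp: has_vector_derivative_def)
    qed
    have "norm (g t - g 0) \<le> (2 * M' * \<bar>t\<bar>) * norm (t - 0)"
    proof (rule differentiable_bound[of "cball 0 \<bar>t\<bar>"])
      show "onorm (\<lambda>h. h *\<^sub>R (\<phi>' (x + \<tau>) - \<phi>' (x - \<tau>))) \<le> 2 * M' * \<bar>t\<bar>" if "\<tau> \<in> cball 0 \<bar>t\<bar>" for \<tau>
      proof (rule onorm_bound)
        fix h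
        have "norm (\<phi>' (x + \<tau>) - \<phi>' (x - \<tau>)) \<le> M' * \<bar>(x + \<tau>) - (x - \<tau>)\<bar>"
          by (rule M')
        also have "\<dots> \<le> M' * (2 * \<bar>t\<bar>)"
          using that M' by (intro mult_left_mono) auto
        finally show "norm (h *\<^sub>R (\<phi>' (x + \<tau>) - \<phi>' (x - \<tau>))) \<le> 2 * M' * \<bar>t\<bar> * norm h"
          using mult_left_mono[of "norm (\<phi>' (x + \<tau>) - \<phi>' (x - \<tau>))" "M' * (2 * \<bar>t\<bar>)" "\<bar>h\<bar>"]
          by (simp add: mult_ac)
      qed (use M' in auto)
      show "(g has_derivative (\<lambda>h. h *\<^sub>R (\<phi>' (x + \<tau>) - \<phi>' (x - \<tau>)))) (at \<tau> within cball 0 \<bar>t\<bar>)" for \<tau>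
        by (rule d)
    qed auto
    moreover have "norm (g t - g 0) = norm (2 *\<^sub>R \<phi> x - \<phi> (x + t) - \<phi> (x - t))"
      by (subst norm_minus_commute) (simp add: g_def scaleR_2 algebra_simps)
    ultimately show ?thesis
      by (simp add: power2_eq_square)
  qed
  have 2: "norm (2 *\<^sub>R \<phi> x - \<phi> (x + t) - \<phi> (x - t)) \<le> 4 * M" for x t
    using norm_triangle_ineq4[of "2 *\<^sub>R \<phi> x - \<phi> (x + t)" "\<phi> (x - t)"]
      norm_triangle_ineq4[of "2 *\<^sub>R \<phi> x" "\<phi> (x + t)"] M(2)[of x] M(2)[of "x + t"] M(2)[of "x - t"]
    by simp
  show ?thesis
  proof (rule that[of "max (2 * M') (4 * M)"])
    show "max (2 * M') (4 * M) > 0"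
      using M by auto
    show "norm (2 *\<^sub>R \<phi> x - \<phi> (x + t) - \<phi> (x - t)) \<le> max (2 * M') (4 * M) * min 1 (t\<^sup>2)" for x t
    proof (cases "t\<^sup>2 \<le> 1")
      case True
      have "2 * M' * t\<^sup>2 \<le> max (2 * M') (4 * M) * t\<^sup>2"
        by (intro mult_right_mono) auto
      with 1[of x t] True show ?thesis
        by (simp add: min_def)
    next
      case False
      with 2[of x t] show ?thesis
        by (simp add: min_def)
    qed
  qed
qed

lemma test_function_add:
  fixes \<phi> \<psi> :: "real \<Rightarrow> 'b::real_normed_vector"
  assumes "\<phi> \<in> test_functions" "\<psi> \<in> test_functions"
  shows "(\<lambda>x. \<phi> x + \<psi> x) \<in> test_functions"
proof -
  obtain R R' where R: "\<And>x. \<bar>x\<bar> \<ge> R \<Longrightarrow> \<phi> x = 0" "\<And>x. \<bar>x\<bar> \<ge> R' \<Longrightarrow> \<psi> x = 0"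
    using test_function_bounded_support assms by metis
  then show ?thesis
    using assms
    by (intro bounded_support_imp_test_function[of _ "max R R'"] smooth_fun_add) (auto simp: test_functions_def)
qed

lemma test_function_scaleR:
  fixes \<phi> :: "real \<Rightarrow> 'b::real_normed_vector"
  assumes "\<phi> \<in> test_functions"
  shows "(\<lambda>x. c *\<^sub>R \<phi> x) \<in> test_functions"
proof -
  obtain R where R: "\<And>x. \<bar>x\<bar> \<ge> R \<Longrightarrow> \<phi> x = 0"
    using test_function_bounded_support assms by metis
  then show ?thesis
    using assms
    by (intro bounded_support_imp_test_function[of _ R] smooth_fun_scaleR smooth_fun_const) (auto simp: test_functions_def)
qed

lemma test_function_affine_scaleR:
  fixes \<phi> :: "real \<Rightarrow> real" and v :: "'b::real_normed_vector"
  assumes "\<phi> \<in> test_functions" "\<epsilon> > 0"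
  shows "(\<lambda>y. \<phi> ((x - y) / \<epsilon>) *\<^sub>R v) \<in> test_functions"
proof -
  obtain R where R: "R > 0" "\<And>x. \<bar>x\<bar> \<ge> R \<Longrightarrow> \<phi> x = 0"
    using test_function_bounded_support assms by metis
  have "(\<lambda>y. \<phi> ((x - y) / \<epsilon>) *\<^sub>R v) = (\<lambda>y. \<phi> ((- (1 / \<epsilon>)) * y + x / \<epsilon>) *\<^sub>R v)"
    by (simp add: diff_divide_distrib)
  moreover have "smooth_fun (\<lambda>y. \<phi> ((- (1 / \<epsilon>)) * y + x / \<epsilon>) *\<^sub>R v)"
    using assms by (intro smooth_fun_scaleR smooth_fun_const smooth_fun_affine[of \<phi>]) (auto simp: test_functions_def)
  ultimately have "smooth_fun (\<lambda>y. \<phi> ((x - y) / \<epsilon>) *\<^sub>R v)"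
    by simp
  moreover have "\<phi> ((x - y) / \<epsilon>) *\<^sub>R v = 0" if "\<bar>y\<bar> \<ge> R * \<epsilon> + \<bar>x\<bar>" for y
  proof -
    have "R * \<epsilon> \<le> \<bar>x - y\<bar>"
      using that by linarith
    then have "R \<le> \<bar>(x - y) / \<epsilon>\<bar>"
      using assms(2) by (simp add: abs_divide pos_le_divide_eq)
    then show ?thesis
      using R by simp
  qed
  ultimately show ?thesis
    by (rule bounded_support_imp_test_function)
qed

section \<open>Integrals of powers and the Levy density\<close>

text \<open>Nonnegative gauge integrable functions are absolutely integrable, which carries explicit
  gauge integrals of powers over to \<open>lborel\<close>.\<close>

lemma has_integral_nonneg_lborel:
  fixes f :: "real \<Rightarrow> real"
  assumes f: "(f has_integral I) S" "\<And>x. x \<in> S \<Longrightarrow> 0 \<le> f x"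
    and [measurable]: "f \<in> borel_measurable borel" "S \<in> sets borel"
  shows "integrable lborel (\<lambda>x. indicator S x * f x)" "(LINT x|lborel. indicator S x * f x) = I"
proof -
  have "f absolutely_integrable_on S"
    using f by (intro nonnegative_absolutely_integrable_1) (auto simp: has_integral_iff)
  then have 1: "integrable lebesgue (\<lambda>x. indicator S x * f x)" and 2: "(LINT x|lebesgue. indicator S x * f x) = I"
    using f(1) set_lebesgue_integral_eq_integral(2)[of S f]
    by (auto simp: set_integrable_def set_lebesgue_integral_def has_integral_iff)
  show "integrable lborel (\<lambda>x. indicator S x * f x)"
    using 1 by (subst (asm) integrable_completion) auto
  show "(LINT x|lborel. indicator S x * f x) = I"
    using 2 by (subst (asm) integral_completion) auto
qed

lemma powr_integrable_near_0:
  assumes "a > -1" "c \<ge> (0::real)"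
  shows "integrable lborel (\<lambda>x. indicator {0..c} x * x powr a)"
    "(LINT x|lborel. indicator {0..c} x * x powr a) = c powr (a + 1) / (a + 1)"
  using has_integral_nonneg_lborel[OF has_integral_powr_from_0[OF assms]] by auto

lemma powr_integrable_at_top:
  assumes "a < -1" "c > (0::real)"
  shows "integrable lborel (\<lambda>x. indicator {c..} x * x powr a)"
    "(LINT x|lborel. indicator {c..} x * x powr a) = - (c powr (a + 1)) / (a + 1)"
  using has_integral_nonneg_lborel[OF has_integral_powr_to_inf[OF assms]] by auto

lemma integrable_even:
  fixes f :: "real \<Rightarrow> real"
  assumes "integrable lborel (\<lambda>x. indicator {0..} x * f x)" "\<And>x. f (- x) = f x" "\<And>x. 0 \<le> f x"
    and [measurable]: "f \<in> borel_measurable borel"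
  shows "integrable lborel f"
proof (rule Bochner_Integration.integrable_bound)
  show "integrable lborel (\<lambda>x. indicator {0..} x * f x + indicator {0..} (0 + (-1) * x) * f (0 + (-1) * x))"
    using lborel_integrable_real_affine[OF assms(1), of "-1" 0] assms(1) by auto
  show "AE x in lborel. norm (f x) \<le> norm (indicator {0..} x * f x + indicator {0..} (0 + (-1) * x) * f (0 + (-1) * x))"
    using assms(2,3) by (auto split: split_indicator)
qed simp

definition levy :: "real \<Rightarrow> real \<Rightarrow> real" where
  "levy s t = 1 / \<bar>t\<bar> powr (1 + 2 * s)"

lemma levy_nonneg [simp]: "levy s t \<ge> 0"
  by (simp add: levy_def)

lemma levy_minus [simp]: "levy s (- t) = levy s t"
  by (simp add: levy_def)

lemma levy_measurable [measurable]: "levy s \<in> borel_measurable borel"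
  unfolding levy_def[abs_def] by measurable

text \<open>On [0, 1] the integrand is \<open>t powr (1 - 2 * s)\<close>, integrable since s < 1;
  beyond 1 it is \<open>t powr (-1 - 2 * s)\<close>, integrable since s > 0.\<close>

lemma levy_integrable:
  assumes "0 < s" "s < 1"
  shows "integrable lborel (\<lambda>t. min 1 (t\<^sup>2) * levy s t)"
proof (rule integrable_even)
  show "integrable lborel (\<lambda>t. indicator {0..} t * (min 1 (t\<^sup>2) * levy s t))"
  proof (rule Bochner_Integration.integrable_bound)
    show "integrable lborel (\<lambda>t. indicator {0..1} t * t powr (1 - 2 * s) + indicator {1..} t * t powr (-1 - 2 * s))"
      using assms by (intro Bochner_Integration.integrable_add powr_integrable_near_0 powr_integrable_at_top) auto
    have "norm (indicator {0..} t * (min 1 (t\<^sup>2) * levy s t))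
      \<le> norm (indicator {0..1} t * t powr (1 - 2 * s) + indicator {1..} t * t powr (-1 - 2 * s))" for t
    proof -
      consider "t < 0" | "t = 0" | "0 < t" "t \<le> 1" | "t > 1"
        by linarith
      then show ?thesis
      proof cases
        case 3
        have "t\<^sup>2 * levy s t = t powr 2 / t powr (1 + 2 * s)"
          using 3 by (simp add: levy_def)
        also have "\<dots> = t powr (1 - 2 * s)"
          by (simp add: powr_diff[symmetric])
        finally have "t\<^sup>2 * levy s t = t powr (1 - 2 * s)" .
        moreover have "min 1 (t\<^sup>2) = t\<^sup>2"
          using 3 by (simp add: power_le_one)
        ultimately show ?thesis
          using 3 by (auto split: split_indicator)
      next
        case 4
        have "levy s t = t powr (-1 - 2 * s)"
          using 4 by (simp add: levy_def powr_minus_divide[symmetric])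
        moreover have "min 1 (t\<^sup>2) = 1"
          using 4 by simp
        ultimately show ?thesis
          using 4 by (auto split: split_indicator)
      qed (auto simp: levy_def)
    qed
    then show "AE t in lborel. norm (indicator {0..} t * (min 1 (t\<^sup>2) * levy s t))
      \<le> norm (indicator {0..1} t * t powr (1 - 2 * s) + indicator {1..} t * t powr (-1 - 2 * s))"
      by simp
  qed measurable
qed auto

text \<open>Integrability must come first: a non-integrable integrand would have integral 0 and make
  the constant 1 / 0 = 0. For a positive lower bound the interval from 1 to 2 suffices, where cos t
  is at most cos 1 < 1.\<close>

lemma frac_const_pos:
  assumes "0 < s" "s < 1"
  shows "frac_const s > 0"
proof -
  have bound: "1 - cos t \<le> 2 * min 1 (t\<^sup>2)" for t :: real
  proof -
    have "1 - cos t = 2 * (sin (t / 2))\<^sup>2"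
      using cos_double_sin[of "t / 2"] by simp
    also have "\<dots> \<le> 2 * (t / 2)\<^sup>2"
      using abs_sin_x_le_abs_x[of "t / 2"] abs_le_square_iff by force
    also have "\<dots> \<le> 2 * t\<^sup>2"
      by (simp add: power_divide)
    finally show ?thesis
      using cos_ge_minus_one[of t] by linarith
  qed
  have int: "integrable lborel (\<lambda>t. (1 - cos t) * levy s t)"
  proof (rule Bochner_Integration.integrable_bound)
    show "integrable lborel (\<lambda>t. 2 * (min 1 (t\<^sup>2) * levy s t))"
      using levy_integrable[OF assms] by simp
    have "(1 - cos t) * levy s t \<le> 2 * min 1 (t\<^sup>2) * levy s t" for t
      using bound by (intro mult_right_mono) auto
    moreover have "0 \<le> (1 - cos t) * levy s t" for t
      by (intro mult_nonneg_nonneg) auto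
    ultimately show "AE t in lborel. norm ((1 - cos t) * levy s t) \<le> norm (2 * (min 1 (t\<^sup>2) * levy s t))"
      by (simp add: mult.assoc)
  qed measurable
  define c where "c = (1 - cos 1) / (2::real) powr (1 + 2 * s)"
  have "cos (1::real) < cos 0"
    by (rule cos_monotone_0_pi) (use pi_gt3 in auto)
  then have "c > 0"
    by (simp add: c_def)
  have low: "c * indicator {1..2} t \<le> (1 - cos t) * levy s t" for t :: real
  proof (cases "t \<in> {1..2}")
    case True
    have "cos t \<le> cos 1"
      using True pi_gt3 by (intro cos_monotone_0_pi_le) auto
    then have "c \<le> (1 - cos t) / t powr (1 + 2 * s)"
      unfolding c_def using True assms by (intro frac_le powr_mono2) auto
    then show ?thesis
      using True by (simp add: levy_def)
  qed (simp add: levy_def)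
  have "0 < c"
    by fact
  also have "c = (LINT t|lborel. c * indicator {1..2} (t::real))"
    by simp
  also have "\<dots> \<le> (LINT t|lborel. (1 - cos t) * levy s t)"
    by (intro integral_mono int low) auto
  finally have "0 < (LINT t|lborel. (1 - cos t) * levy s t)" .
  then show ?thesis
    by (simp add: frac_const_def levy_def)
qed

section \<open>The singular kernel in the plane\<close>

text \<open>The map (t, x) to (x, x + t) preserves the plane measure: for fixed x it is a
  translation in t. It turns the singular diagonal into the line t = 0, where the kernel depends on
  t alone.\<close>

lemma distr_shear:
  "distr (lborel \<Otimes>\<^sub>M lborel) (lborel \<Otimes>\<^sub>M lborel) (\<lambda>(t, x). (x, x + t)) = lborel \<Otimes>\<^sub>M (lborel :: real measure)"
proof (rule measure_eqI)
  fix A assume "A \<in> sets (distr (lborel \<Otimes>\<^sub>M lborel) (lborel \<Otimes>\<^sub>M (lborel::real measure)) (\<lambda>(t::real, x). (x, x + t)))"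
  note A = this
  then have A2 [measurable]: "A \<in> sets (lborel \<Otimes>\<^sub>M (lborel::real measure))"
    by simp
  have "emeasure (distr (lborel \<Otimes>\<^sub>M lborel) (lborel \<Otimes>\<^sub>M lborel) (\<lambda>(t, x). (x, x + t))) A
    = (\<integral>\<^sup>+z. indicator A z \<partial>(distr (lborel \<Otimes>\<^sub>M lborel) (lborel \<Otimes>\<^sub>M lborel) (\<lambda>(t, x). (x, x + t))))"
    by (rule nn_integral_indicator[symmetric]) (rule A)
  also have "\<dots> = (\<integral>\<^sup>+(t, x). indicator A (x, x + t) \<partial>(lborel \<Otimes>\<^sub>M lborel))"
    by (subst nn_integral_distr) (auto simp: case_prod_unfold)
  also have "\<dots> = (\<integral>\<^sup>+x. \<integral>\<^sup>+t. indicator A (x, x + t) \<partial>lborel \<partial>lborel)"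
    by (subst lborel_pair.nn_integral_snd[symmetric]) auto
  also have "\<dots> = (\<integral>\<^sup>+x. \<integral>\<^sup>+y. indicator A (x, y) \<partial>lborel \<partial>lborel)"
  proof (rule nn_integral_cong)
    fix x :: real
    show "(\<integral>\<^sup>+t. indicator A (x, x + t) \<partial>lborel) = (\<integral>\<^sup>+y. indicator A (x, y) \<partial>lborel)"
      using nn_integral_real_affine[of "\<lambda>y. indicator A (x, y)" 1 x] by simp
  qed
  also have "\<dots> = (\<integral>\<^sup>+z. indicator A z \<partial>(lborel \<Otimes>\<^sub>M lborel))"
    by (subst lborel.nn_integral_fst) auto
  also have "\<dots> = emeasure (lborel \<Otimes>\<^sub>M lborel) A"
    by (rule nn_integral_indicator) (rule A2)
  finally show "emeasure (distr (lborel \<Otimes>\<^sub>M lborel) (lborel \<Otimes>\<^sub>M lborel) (\<lambda>(t, x). (x, x + t))) A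
    = emeasure (lborel \<Otimes>\<^sub>M lborel) A" .
qed simp

lemma nn_integral_shear:
  fixes F :: "real \<Rightarrow> real \<Rightarrow> ennreal"
  assumes [measurable]: "case_prod F \<in> borel_measurable (borel \<Otimes>\<^sub>M borel)"
  shows "(\<integral>\<^sup>+(x, y). F x y \<partial>lebesgue) = (\<integral>\<^sup>+t. \<integral>\<^sup>+x. F x (x + t) \<partial>lborel \<partial>lborel)"
proof -
  have "(\<integral>\<^sup>+(x, y). F x y \<partial>lebesgue) = (\<integral>\<^sup>+(x, y). F x y \<partial>(lborel \<Otimes>\<^sub>M lborel))"
    by (simp add: nn_integral_completion lborel_prod)
  also have "\<dots> = (\<integral>\<^sup>+(t, x). F x (x + t) \<partial>(lborel \<Otimes>\<^sub>M lborel))"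
    by (subst distr_shear[symmetric], subst nn_integral_distr) (auto simp: case_prod_unfold)
  also have "\<dots> = (\<integral>\<^sup>+t. \<integral>\<^sup>+x. F x (x + t) \<partial>lborel \<partial>lborel)"
    by (subst lborel.nn_integral_fst[symmetric]) auto
  finally show ?thesis .
qed

lemma integral_shear:
  fixes F :: "real \<Rightarrow> real \<Rightarrow> 'b::{banach, second_countable_topology}"
  assumes [measurable]: "case_prod F \<in> borel_measurable (borel \<Otimes>\<^sub>M borel)"
    and int: "integrable lebesgue (\<lambda>(x, y). F x y)"
  shows "integrable (lborel \<Otimes>\<^sub>M lborel) (\<lambda>(t, x). F x (x + t))"
    "(LINT (x, y)|lebesgue. F x y) = (LINT t|lborel. LINT x|lborel. F x (x + t))"
proof -
  have m: "case_prod F \<in> borel_measurable lborel"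
    using assms(1) by (simp add: borel_prod)
  have "integrable lborel (case_prod F)"
    using int m by (subst (asm) integrable_completion) auto
  then have "integrable (distr (lborel \<Otimes>\<^sub>M lborel) (lborel \<Otimes>\<^sub>M lborel) (\<lambda>(t, x). (x, x + t))) (case_prod F)"
    unfolding distr_shear unfolding lborel_prod .
  then show *: "integrable (lborel \<Otimes>\<^sub>M lborel) (\<lambda>(t, x). F x (x + t))"
    by (subst (asm) integrable_distr_eq) (auto simp: case_prod_unfold)
  have "(LINT (x, y)|lebesgue. F x y) = (LINT (x, y)|(lborel \<Otimes>\<^sub>M lborel). F x y)"
    using m by (simp add: integral_completion lborel_prod)
  also have "\<dots> = (LINT (t, x)|(lborel \<Otimes>\<^sub>M lborel). F x (x + t))"
    by (subst distr_shear[symmetric], subst integral_distr) (auto simp: case_prod_unfold)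
  also have "\<dots> = (LINT t|lborel. LINT x|lborel. F x (x + t))"
    by (subst lborel_pair.integral_fst[OF *]) simp
  finally show "(LINT (x, y)|lebesgue. F x y) = (LINT t|lborel. LINT x|lborel. F x (x + t))" .
qed

text \<open>Translations preserve the integral norm of \<open>h\<close>, so the iterated integral
  factors. This is the standard source of dominating functions for Fubini below.\<close>

lemma integrable_mult_shear:
  fixes g h :: "real \<Rightarrow> real"
  assumes g: "integrable lborel g" and h: "integrable lborel h"
  shows "integrable (lborel \<Otimes>\<^sub>M lborel) (\<lambda>(t, x). g t * h (x + c * t))"
proof -
  have [measurable]: "g \<in> borel_measurable borel" "h \<in> borel_measurable borel"
    using g h borel_measurable_integrable by fastforce+
  have hc: "integrable lborel (\<lambda>x. h (x + d))" "(LINT x|lborel. norm (h (x + d))) = (LINT x|lborel. norm (h x))" for d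
    using lborel_integrable_real_affine[OF h, of 1 d] lborel_integral_real_affine[of 1 "\<lambda>x. norm (h x)" d]
    by (auto simp: add.commute)
  show ?thesis
  proof (rule lborel_pair.Fubini_integrable)
    have "(LINT x|lborel. norm (g t * h (x + c * t))) = norm (g t) * (LINT x|lborel. norm (h x))" for t
      using hc(2) by (simp add: abs_mult)
    then show "integrable lborel (\<lambda>t. LINT x|lborel. norm (case (t, x) of (t, x) \<Rightarrow> g t * h (x + c * t)))"
      using g by simp
  qed (use hc in auto)
qed

section \<open>The fractional Laplacian of a test function\<close>

definition second_diff :: "(real \<Rightarrow> 'b::real_vector) \<Rightarrow> real \<Rightarrow> real \<Rightarrow> 'b" where
  "second_diff \<phi> x t = 2 *\<^sub>R \<phi> x - \<phi> (x + t) - \<phi> (x - t)"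

text \<open>The fractional Laplacian without the factor \<open>c_s\<close>, symmetrised so that the integral converges absolutely.\<close>
definition frac_lap :: "real \<Rightarrow> (real \<Rightarrow> 'b::{banach, second_countable_topology}) \<Rightarrow> real \<Rightarrow> 'b" where
  "frac_lap s \<phi> x = (LINT t|lborel. levy s t *\<^sub>R second_diff \<phi> x t)"

lemma test_function_measurable:
  fixes \<phi> :: "real \<Rightarrow> 'b::real_normed_vector"
  shows "\<phi> \<in> test_functions \<Longrightarrow> \<phi> \<in> borel_measurable borel"
  using test_function_continuous borel_measurable_continuous_onI by blast

lemma test_function_integrable:
  fixes \<phi> :: "real \<Rightarrow> 'b::{banach, second_countable_topology}"
  assumes "\<phi> \<in> test_functions"
  shows "integrable lborel \<phi>"
proof -
  obtain R where R: "\<And>x. \<bar>x\<bar> \<ge> R \<Longrightarrow> \<phi> x = 0"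
    using test_function_bounded_support[OF assms] by blast
  obtain M where M: "\<And>x. norm (\<phi> x) \<le> M"
    using test_function_bounded[OF assms] by blast
  show ?thesis
    using test_function_measurable[OF assms] R M
    by (intro integrableI_bounded_set[of "{-R..R}" _ _ M] AE_I2) (auto simp: emeasure_lborel_Icc_eq abs_le_iff)
qed

text \<open>The second difference vanishes unless x, x + t or x - t lies in the support. Each of
  these three strips carries an integrable majorant: a function of t times a sheared
  indicator.\<close>

lemma second_diff_integrable_plane:
  fixes \<phi> :: "real \<Rightarrow> 'b::{banach, second_countable_topology}"
  assumes s: "0 < s" "s < 1" and \<phi>: "\<phi> \<in> test_functions"
  shows "integrable (lborel \<Otimes>\<^sub>M lborel) (\<lambda>(t, x). levy s t *\<^sub>R second_diff \<phi> x t)"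
proof -
  have [measurable]: "\<phi> \<in> borel_measurable borel"
    using test_function_measurable[OF \<phi>] .
  obtain R where R: "R > 0" "\<And>x. \<bar>x\<bar> \<ge> R \<Longrightarrow> \<phi> x = 0"
    using test_function_bounded_support[OF \<phi>] by blast
  obtain M where M: "M > 0" "\<And>x t. norm (second_diff \<phi> x t) \<le> M * min 1 (t\<^sup>2)"
    using test_function_second_difference[OF \<phi>] unfolding second_diff_def by blast
  let ?g = "\<lambda>t. M * (min 1 (t\<^sup>2) * levy s t)"
  let ?i = "indicator {-R..R} :: real \<Rightarrow> real"
  have g: "integrable lborel ?g"
    using levy_integrable[OF s] by simp
  have i: "integrable lborel ?i"
    by (rule integrable_real_indicator) (auto simp: emeasure_lborel_Icc_eq)
  have shear: "integrable (lborel \<Otimes>\<^sub>M lborel) (\<lambda>z. ?g (fst z) * ?i (snd z + c * fst z))" for c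
    using integrable_mult_shear[OF g i, of c] by (simp add: case_prod_unfold)
  show ?thesis
  proof (rule Bochner_Integration.integrable_bound)
    show "integrable (lborel \<Otimes>\<^sub>M lborel) (\<lambda>z. ?g (fst z) * ?i (snd z + 0 * fst z)
      + ?g (fst z) * ?i (snd z + 1 * fst z) + ?g (fst z) * ?i (snd z + (-1) * fst z))"
      by (intro Bochner_Integration.integrable_add shear)
    have "norm (levy s t *\<^sub>R second_diff \<phi> x t) \<le> ?g t * ?i (x + 0 * t) + ?g t * ?i (x + 1 * t) + ?g t * ?i (x + (-1) * t)" for t x
    proof (cases "\<bar>x\<bar> < R \<or> \<bar>x + t\<bar> < R \<or> \<bar>x - t\<bar> < R")
      case True
      have "?g t * 1 \<le> ?g t * (?i x + ?i (x + t) + ?i (x - t))"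
        using True M by (intro mult_left_mono) (auto split: split_indicator)
      moreover have "norm (levy s t *\<^sub>R second_diff \<phi> x t) \<le> ?g t"
        using mult_left_mono[OF M(2)[of x t], of "levy s t"] by (simp add: mult_ac)
      ultimately show ?thesis
        by (simp add: distrib_left)
    next
      case False
      then have "second_diff \<phi> x t = 0"
        using R by (simp add: second_diff_def)
      then show ?thesis
        using M by simp
    qed
    then show "AE z in lborel \<Otimes>\<^sub>M lborel. norm (case z of (t, x) \<Rightarrow> levy s t *\<^sub>R second_diff \<phi> x t)
      \<le> norm (?g (fst z) * ?i (snd z + 0 * fst z)
      + ?g (fst z) * ?i (snd z + 1 * fst z) + ?g (fst z) * ?i (snd z + (-1) * fst z))"
      by (intro AE_I2) (force simp: case_prod_unfold intro: order_trans[OF _ abs_ge_self])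
  qed (unfold second_diff_def, measurable)
qed

lemma second_diff_integrable:
  fixes \<phi> :: "real \<Rightarrow> 'b::{banach, second_countable_topology}"
  assumes s: "0 < s" "s < 1" and \<phi>: "\<phi> \<in> test_functions"
  shows "integrable lborel (\<lambda>t. levy s t *\<^sub>R second_diff \<phi> x t)"
proof -
  have [measurable]: "\<phi> \<in> borel_measurable borel"
    using test_function_measurable[OF \<phi>] .
  obtain M where M: "M > 0" "\<And>x t. norm (second_diff \<phi> x t) \<le> M * min 1 (t\<^sup>2)"
    using test_function_second_difference[OF \<phi>] unfolding second_diff_def by blast
  show ?thesis
  proof (rule Bochner_Integration.integrable_bound)
    show "integrable lborel (\<lambda>t. M * (min 1 (t\<^sup>2) * levy s t))"
      using levy_integrable[OF s] by simp
    show "AE t in lborel. norm (levy s t *\<^sub>R second_diff \<phi> x t) \<le> norm (M * (min 1 (t\<^sup>2) * levy s t))"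
      using mult_left_mono[OF M(2), of "levy s t" x t for t] M(1) by (simp add: mult_ac)
  qed (unfold second_diff_def, measurable)
qed

lemma frac_lap_bounded:
  fixes \<phi> :: "real \<Rightarrow> 'b::{banach, second_countable_topology}"
  assumes s: "0 < s" "s < 1" and \<phi>: "\<phi> \<in> test_functions"
  obtains C where "\<And>x. norm (frac_lap s \<phi> x) \<le> C"
proof -
  obtain M where M: "M > 0" "\<And>x t. norm (second_diff \<phi> x t) \<le> M * min 1 (t\<^sup>2)"
    using test_function_second_difference[OF \<phi>] unfolding second_diff_def by blast
  have "norm (frac_lap s \<phi> x) \<le> (LINT t|lborel. M * (min 1 (t\<^sup>2) * levy s t))" for x
    unfolding frac_lap_def
  proof (rule Bochner_Integration.integral_norm_bound_integral)
    show "norm (levy s t *\<^sub>R second_diff \<phi> x t) \<le> M * (min 1 (t\<^sup>2) * levy s t)" for t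
      using mult_left_mono[OF M(2), of "levy s t" x t for t] M(1) by (simp add: mult_ac)
  qed (use levy_integrable[OF s] second_diff_integrable[OF s \<phi>] in auto)
  then show ?thesis
    using that by blast
qed

lemma frac_lap_integrable:
  fixes \<phi> :: "real \<Rightarrow> 'b::{banach, second_countable_topology}"
  assumes s: "0 < s" "s < 1" and \<phi>: "\<phi> \<in> test_functions"
  shows "integrable lborel (frac_lap s \<phi>)"
  using lborel_pair.integrable_snd[OF second_diff_integrable_plane[OF assms]]
  by (simp add: frac_lap_def[abs_def])

lemma integrable_plane_bounded_inner:
  fixes f :: "real \<Rightarrow> real \<Rightarrow> 'b::euclidean_space" and q :: "real \<Rightarrow> 'b"
  assumes f: "integrable (lborel \<Otimes>\<^sub>M lborel) (case_prod f)"
    and [measurable]: "q \<in> borel_measurable borel" and M: "\<And>x. norm (q x) \<le> M"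
  shows "integrable (lborel \<Otimes>\<^sub>M lborel) (\<lambda>(t, x). q x \<bullet> f t x)"
proof (rule Bochner_Integration.integrable_bound)
  have [measurable]: "case_prod f \<in> borel_measurable (lborel \<Otimes>\<^sub>M lborel)"
    using f by auto
  show "integrable (lborel \<Otimes>\<^sub>M lborel) (\<lambda>z. M * norm (case_prod f z))"
    using f by simp
  show "(\<lambda>(t, x). q x \<bullet> f t x) \<in> borel_measurable (lborel \<Otimes>\<^sub>M lborel)"
    by measurable
  have "M \<ge> 0"
    using M[of 0] norm_ge_zero order_trans by blast
  moreover have "\<bar>q x \<bullet> f t x\<bar> \<le> M * norm (f t x)" for t x
    using Cauchy_Schwarz_ineq2[of "q x" "f t x"] mult_right_mono[OF M[of x], of "norm (f t x)"] by simp
  ultimately show "AE z in lborel \<Otimes>\<^sub>M lborel. norm (case z of (t, x) \<Rightarrow> q x \<bullet> f t x) \<le> norm (M * norm (case_prod f z))"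
    by (intro AE_I2) (auto simp: case_prod_unfold abs_mult)
qed

text \<open>Discrete integration by parts: for each fixed t, translating x by t in one of the terms
  moves both differences onto \<phi> and produces its second difference. The right-hand side depends
  on q only through an integral against an integrable function, hence continuously for the supremum
  norm.\<close>

lemma weak_frac_lap:
  fixes \<phi> q :: "real \<Rightarrow> 'b::euclidean_space"
  assumes s: "0 < s" "s < 1" and \<phi>: "\<phi> \<in> test_functions"
    and [measurable]: "q \<in> borel_measurable borel" and M: "\<And>x. norm (q x) \<le> M"
    and int: "integrable lebesgue (\<lambda>(x, y). (q x - q y) \<bullet> (\<phi> x - \<phi> y) / \<bar>x - y\<bar> powr (1 + 2 * s))"
  shows "integrable lborel (\<lambda>x. q x \<bullet> frac_lap s \<phi> x)"
    "(LINT (x, y)|lebesgue. (q x - q y) \<bullet> (\<phi> x - \<phi> y) / \<bar>x - y\<bar> powr (1 + 2 * s))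
      = (LINT x|lborel. q x \<bullet> frac_lap s \<phi> x)"
proof -
  have [measurable]: "\<phi> \<in> borel_measurable borel"
    using test_function_measurable[OF \<phi>] .
  have \<phi>_int: "integrable lborel (\<lambda>x. \<phi> (x + t))" for t
    using lborel_integrable_real_affine[OF test_function_integrable[OF \<phi>], of 1 t] by (simp add: add.commute)
  have q_int: "integrable lborel (\<lambda>x. q (x + u) \<bullet> g x)" if g: "integrable lborel g" for g u
  proof (rule Bochner_Integration.integrable_bound)
    have [measurable]: "g \<in> borel_measurable borel"
      using g by auto
    show "integrable lborel (\<lambda>x. M * norm (g x))"
      using g by simp
    have "M \<ge> 0"
      using M[of 0] norm_ge_zero order_trans by blast
    moreover have "\<bar>q (x + u) \<bullet> g x\<bar> \<le> M * norm (g x)" for x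
      using Cauchy_Schwarz_ineq2[of "q (x + u)" "g x"] mult_right_mono[OF M[of "x + u"], of "norm (g x)"] by simp
    ultimately show "AE x in lborel. norm (q (x + u) \<bullet> g x) \<le> norm (M * norm (g x))"
      by (intro AE_I2) (auto simp: abs_mult)
    show "(\<lambda>x. q (x + u) \<bullet> g x) \<in> borel_measurable lborel"
      by measurable
  qed
  have inner: "(LINT x|lborel. (q x - q (x + t)) \<bullet> (\<phi> x - \<phi> (x + t)) / \<bar>x - (x + t)\<bar> powr (1 + 2 * s))
    = (LINT x|lborel. q x \<bullet> (levy s t *\<^sub>R second_diff \<phi> x t))" for t
  proof -
    have 1: "integrable lborel (\<lambda>x. q x \<bullet> (\<phi> x - \<phi> (x + t)))"
      using q_int[of "\<lambda>x. \<phi> x - \<phi> (x + t)" 0] \<phi>_int[of 0] \<phi>_int[of t] by simp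
    have 2: "integrable lborel (\<lambda>x. q (x + t) \<bullet> (\<phi> x - \<phi> (x + t)))"
      using q_int[of "\<lambda>x. \<phi> x - \<phi> (x + t)" t] \<phi>_int[of 0] \<phi>_int[of t] by simp
    have 3: "integrable lborel (\<lambda>x. q x \<bullet> (\<phi> (x - t) - \<phi> x))"
      using q_int[of "\<lambda>x. \<phi> (x - t) - \<phi> x" 0] \<phi>_int[of 0] \<phi>_int[of "-t"] by simp
    have "(LINT x|lborel. (q x - q (x + t)) \<bullet> (\<phi> x - \<phi> (x + t)))
      = (LINT x|lborel. q x \<bullet> (\<phi> x - \<phi> (x + t))) - (LINT x|lborel. q (x + t) \<bullet> (\<phi> x - \<phi> (x + t)))"
      using 1 2 by (simp add: inner_diff_left)
    also have "(LINT x|lborel. q (x + t) \<bullet> (\<phi> x - \<phi> (x + t))) = (LINT x|lborel. q x \<bullet> (\<phi> (x - t) - \<phi> x))"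
      using lborel_integral_real_affine[of 1 "\<lambda>x. q x \<bullet> (\<phi> (x - t) - \<phi> x)" t] by (simp add: add.commute)
    also have "(LINT x|lborel. q x \<bullet> (\<phi> x - \<phi> (x + t))) - (LINT x|lborel. q x \<bullet> (\<phi> (x - t) - \<phi> x))
      = (LINT x|lborel. q x \<bullet> second_diff \<phi> x t)"
      using 1 3 by (simp add: Bochner_Integration.integral_diff[symmetric] second_diff_def inner_diff_right algebra_simps scaleR_2 inner_add_right)
    finally have *: "(LINT x|lborel. (q x - q (x + t)) \<bullet> (\<phi> x - \<phi> (x + t))) = (LINT x|lborel. q x \<bullet> second_diff \<phi> x t)" .
    have "(LINT x|lborel. (q x - q (x + t)) \<bullet> (\<phi> x - \<phi> (x + t)) / \<bar>x - (x + t)\<bar> powr (1 + 2 * s))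
      = levy s t * (LINT x|lborel. (q x - q (x + t)) \<bullet> (\<phi> x - \<phi> (x + t)))"
      by (simp add: levy_def)
    then show ?thesis
      by (simp add: *)
  qed
  have plane: "integrable (lborel \<Otimes>\<^sub>M lborel) (\<lambda>(t, x). q x \<bullet> (levy s t *\<^sub>R second_diff \<phi> x t))"
    by (rule integrable_plane_bounded_inner[OF second_diff_integrable_plane[OF s \<phi>]]) (use M in auto)
  have lap: "(LINT t|lborel. q x \<bullet> (levy s t *\<^sub>R second_diff \<phi> x t)) = q x \<bullet> frac_lap s \<phi> x" for x
    unfolding frac_lap_def by (rule integral_inner_right) (use second_diff_integrable[OF s \<phi>] in auto)
  show "integrable lborel (\<lambda>x. q x \<bullet> frac_lap s \<phi> x)"
    using lborel_pair.integrable_snd[OF plane] by (simp only: lap)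
  have "(LINT (x, y)|lebesgue. (q x - q y) \<bullet> (\<phi> x - \<phi> y) / \<bar>x - y\<bar> powr (1 + 2 * s))
    = (LINT t|lborel. LINT x|lborel. (q x - q (x + t)) \<bullet> (\<phi> x - \<phi> (x + t)) / \<bar>x - (x + t)\<bar> powr (1 + 2 * s))"
    by (rule integral_shear(2)[OF _ int]) measurable
  also have "\<dots> = (LINT t|lborel. LINT x|lborel. q x \<bullet> (levy s t *\<^sub>R second_diff \<phi> x t))"
    by (simp only: inner)
  also have "\<dots> = (LINT x|lborel. LINT t|lborel. q x \<bullet> (levy s t *\<^sub>R second_diff \<phi> x t))"
    by (rule lborel_pair.Fubini_integral[symmetric]) (rule plane)
  finally show "(LINT (x, y)|lebesgue. (q x - q y) \<bullet> (\<phi> x - \<phi> y) / \<bar>x - y\<bar> powr (1 + 2 * s))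
      = (LINT x|lborel. q x \<bullet> frac_lap s \<phi> x)"
    by (simp only: lap)
qed

section \<open>The Gagliardo form\<close>

text \<open>The squared Gagliardo seminorm of the fractional Sobolev space, without the factor c_s;
  being an extended real, it also represents infinite energy.\<close>

definition gagliardo :: "real \<Rightarrow> (real \<Rightarrow> 'b::real_normed_vector) \<Rightarrow> ennreal" where
  "gagliardo s u = (\<integral>\<^sup>+(x, y). ennreal ((norm (u x - u y))\<^sup>2 / \<bar>x - y\<bar> powr (1 + 2 * s)) \<partial>lebesgue)"

text \<open>The squared difference is at most \<open>K * min 1 (t\<^sup>2)\<close>, from boundedness
  and the Lipschitz bound, and vanishes unless x or x + t is within R of 0; two intervals of length
  2R give the factor 4R.\<close>

lemma gagliardo_test_function:
  fixes \<phi> :: "real \<Rightarrow> 'b::euclidean_space"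
  assumes s: "0 < s" "s < 1" and \<phi>: "\<phi> \<in> test_functions"
  shows "gagliardo s \<phi> < \<infinity>"
proof -
  have [measurable]: "\<phi> \<in> borel_measurable borel"
    using test_function_measurable[OF \<phi>] .
  obtain R where R: "R > 0" "\<And>x. \<bar>x\<bar> \<ge> R \<Longrightarrow> \<phi> x = 0"
    using test_function_bounded_support[OF \<phi>] by blast
  obtain M where M: "M > 0" "\<And>x. norm (\<phi> x) \<le> M"
    using test_function_bounded[OF \<phi>] by blast
  obtain M' where M': "M' > 0" "\<And>x y. norm (\<phi> x - \<phi> y) \<le> M' * \<bar>x - y\<bar>"
    using test_function_Lipschitz[OF \<phi>] by blast
  define K where "K = max (4 * M\<^sup>2) (M'\<^sup>2)"
  have K: "(norm (\<phi> x - \<phi> (x + t)))\<^sup>2 \<le> K * min 1 (t\<^sup>2)" for x t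
  proof -
    have "norm (\<phi> x - \<phi> (x + t)) \<le> 2 * M"
      using norm_triangle_ineq4[of "\<phi> x" "\<phi> (x + t)"] M(2)[of x] M(2)[of "x + t"] by simp
    then have "(norm (\<phi> x - \<phi> (x + t)))\<^sup>2 \<le> (2 * M)\<^sup>2"
      by (intro power_mono) auto
    moreover have "(norm (\<phi> x - \<phi> (x + t)))\<^sup>2 \<le> (M' * \<bar>t\<bar>)\<^sup>2"
      using M'(2)[of x "x + t"] by (intro power_mono) auto
    moreover have "4 * M\<^sup>2 \<le> K" "M'\<^sup>2 * t\<^sup>2 \<le> K * t\<^sup>2"
      by (auto simp: K_def intro!: mult_right_mono)
    ultimately show ?thesis
      by (simp add: power_mult_distrib min_def)
  qed
  have "K > 0"
    using M by (simp add: K_def less_max_iff_disj)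
  let ?g = "\<lambda>t. K * (min 1 (t\<^sup>2) * levy s t)"
  have g: "integrable lborel ?g"
    using levy_integrable[OF s] by simp
  let ?i = "indicator {-R..R} :: real \<Rightarrow> real"
  have "gagliardo s \<phi> = (\<integral>\<^sup>+t. \<integral>\<^sup>+x. ennreal ((norm (\<phi> x - \<phi> (x + t)))\<^sup>2 / \<bar>x - (x + t)\<bar> powr (1 + 2 * s)) \<partial>lborel \<partial>lborel)"
    unfolding gagliardo_def by (rule nn_integral_shear) measurable
  also have "\<dots> \<le> (\<integral>\<^sup>+t. \<integral>\<^sup>+x. ennreal (?g t) * (indicator {-R..R} x + indicator {-R-t..R-t} x) \<partial>lborel \<partial>lborel)"
  proof (intro nn_integral_mono)
    fix t x :: real
    have "(norm (\<phi> x - \<phi> (x + t)))\<^sup>2 / \<bar>x - (x + t)\<bar> powr (1 + 2 * s) = (norm (\<phi> x - \<phi> (x + t)))\<^sup>2 * levy s t"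
      by (simp add: levy_def)
    also have "\<dots> \<le> ?g t"
      using mult_right_mono[OF K[of x t] levy_nonneg[of s t]] by (simp add: mult_ac)
    finally have 1: "ennreal ((norm (\<phi> x - \<phi> (x + t)))\<^sup>2 / \<bar>x - (x + t)\<bar> powr (1 + 2 * s)) \<le> ennreal (?g t)"
      by (rule ennreal_leI)
    show "ennreal ((norm (\<phi> x - \<phi> (x + t)))\<^sup>2 / \<bar>x - (x + t)\<bar> powr (1 + 2 * s))
      \<le> ennreal (?g t) * (indicator {-R..R} x + indicator {-R-t..R-t} x)"
    proof (cases "\<bar>x\<bar> < R \<or> \<bar>x + t\<bar> < R")
      case True
      then have "ennreal (?g t) * 1 \<le> ennreal (?g t) * (indicator {-R..R} x + indicator {-R-t..R-t} x)"
        by (intro mult_left_mono) (auto split: split_indicator)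
      with 1 show ?thesis
        by simp
    qed (use R in simp)
  qed
  also have "\<dots> = (\<integral>\<^sup>+t. ennreal (?g t) * ennreal (4 * R) \<partial>lborel)"
  proof (rule nn_integral_cong)
    fix t :: real
    have "(\<integral>\<^sup>+x. (indicator {-R..R} x + indicator {-R-t..R-t} x) \<partial>lborel) = ennreal (2 * R) + ennreal (2 * R)"
      using R by (subst nn_integral_add) auto
    then show "(\<integral>\<^sup>+x. ennreal (?g t) * (indicator {-R..R} x + indicator {-R-t..R-t} x) \<partial>lborel) = ennreal (?g t) * ennreal (4 * R)"
      using R by (subst nn_integral_cmult) (auto simp: ennreal_plus[symmetric] simp del: ennreal_plus)
  qed
  also have "\<dots> = ennreal (LINT t|lborel. ?g t) * ennreal (4 * R)"
    using \<open>K > 0\<close> nn_integral_eq_integral[OF g] by (subst nn_integral_multc) auto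
  also have "\<dots> < \<infinity>"
    by (simp add: ennreal_mult_less_top)
  finally show ?thesis .
qed

text \<open>Pointwise Cauchy-Schwarz and 2ab at most a^2 + b^2 dominate the mixed integrand by the
  two squared ones.\<close>

lemma gagliardo_product_integrable:
  fixes u v :: "real \<Rightarrow> 'b::euclidean_space"
  assumes [measurable]: "u \<in> borel_measurable borel" "v \<in> borel_measurable borel"
    and fin: "gagliardo s u < \<infinity>" "gagliardo s v < \<infinity>"
  shows "integrable lebesgue (\<lambda>(x, y). (u x - u y) \<bullet> (v x - v y) / \<bar>x - y\<bar> powr (1 + 2 * s))"
proof -
  have sq: "integrable lebesgue (\<lambda>(x, y). (norm (w x - w y))\<^sup>2 / \<bar>x - y\<bar> powr (1 + 2 * s))"
    if [measurable]: "w \<in> borel_measurable borel" and "gagliardo s w < \<infinity>" for w :: "real \<Rightarrow> 'b"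
  proof (rule integrableI_nonneg)
    have "(\<lambda>(x, y). (norm (w x - w y))\<^sup>2 / \<bar>x - y\<bar> powr (1 + 2 * s)) \<in> borel_measurable (borel \<Otimes>\<^sub>M borel)"
      by measurable
    then show "(\<lambda>(x, y). (norm (w x - w y))\<^sup>2 / \<bar>x - y\<bar> powr (1 + 2 * s)) \<in> borel_measurable lebesgue"
      by (simp add: borel_prod measurable_completion)
    show "(\<integral>\<^sup>+z. ennreal (case z of (x, y) \<Rightarrow> (norm (w x - w y))\<^sup>2 / \<bar>x - y\<bar> powr (1 + 2 * s)) \<partial>lebesgue) < \<infinity>"
      using that(2) by (simp add: gagliardo_def case_prod_unfold)
  qed auto
  show ?thesis
  proof (rule Bochner_Integration.integrable_bound)
    show "integrable lebesgue (\<lambda>z. (case z of (x, y) \<Rightarrow> (norm (u x - u y))\<^sup>2 / \<bar>x - y\<bar> powr (1 + 2 * s))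
      + (case z of (x, y) \<Rightarrow> (norm (v x - v y))\<^sup>2 / \<bar>x - y\<bar> powr (1 + 2 * s)))"
      using sq[of u] sq[of v] fin by (intro Bochner_Integration.integrable_add) auto
    have "(\<lambda>(x, y). (u x - u y) \<bullet> (v x - v y) / \<bar>x - y\<bar> powr (1 + 2 * s)) \<in> borel_measurable (borel \<Otimes>\<^sub>M borel)"
      by measurable
    then show "(\<lambda>(x, y). (u x - u y) \<bullet> (v x - v y) / \<bar>x - y\<bar> powr (1 + 2 * s)) \<in> borel_measurable lebesgue"
      by (simp add: borel_prod measurable_completion)
    have "\<bar>a \<bullet> b\<bar> / d \<le> (norm a)\<^sup>2 / d + (norm b)\<^sup>2 / d" if "d \<ge> 0" for a b :: 'b and d :: real
    proof -
      have "2 * \<bar>a \<bullet> b\<bar> \<le> (norm a)\<^sup>2 + (norm b)\<^sup>2"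
        using Cauchy_Schwarz_ineq2[of a b] sum_squares_bound[of "norm a" "norm b"] by (simp add: power2_eq_square)
      then have "\<bar>a \<bullet> b\<bar> / d \<le> ((norm a)\<^sup>2 + (norm b)\<^sup>2) / d"
        using that by (intro divide_right_mono) auto
      then show ?thesis
        by (simp add: add_divide_distrib)
    qed
    then show "AE z in lebesgue. norm (case z of (x, y) \<Rightarrow> (u x - u y) \<bullet> (v x - v y) / \<bar>x - y\<bar> powr (1 + 2 * s))
      \<le> norm ((case z of (x, y) \<Rightarrow> (norm (u x - u y))\<^sup>2 / \<bar>x - y\<bar> powr (1 + 2 * s))
      + (case z of (x, y) \<Rightarrow> (norm (v x - v y))\<^sup>2 / \<bar>x - y\<bar> powr (1 + 2 * s)))"
      by (intro AE_I2) (auto simp: case_prod_unfold abs_divide)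
  qed
qed

section \<open>A mountain pass lemma on finite-dimensional spaces\<close>

lemma closed_if_compact_Int_cball:
  fixes S :: "'v::real_normed_vector set"
  assumes "\<And>r. compact (S \<inter> cball 0 r)"
  shows "closed S"
  unfolding closed_sequential_limits
proof (intro allI impI, elim conjE)
  fix x l assume x: "\<forall>n. x n \<in> S" "x \<longlonglongrightarrow> l"
  then have "bounded (range x)"
    using convergent_imp_bounded by blast
  then obtain r where "\<And>n. norm (x n) \<le> r"
    by (auto simp: bounded_iff)
  then have "\<forall>n. x n \<in> S \<inter> cball 0 r"
    using x by auto
  moreover have "closed (S \<inter> cball 0 r)"
    using assms compact_imp_closed by blast
  ultimately show "l \<in> S"
    using x(2) closed_sequentially by blast
qed

text \<open>A ball of radius \<delta> around b misses the closed subspace. Dividing by -t turns the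
  given element of S into b - u / t, so u / t has norm at least \<delta>.\<close>

lemma bounded_coordinate_outside_subspace:
  fixes S :: "'v::real_normed_vector set"
  assumes S: "subspace S" "closed S" and b: "b \<notin> S"
  obtains \<delta> where "\<delta> > 0" "\<And>u t. u - t *\<^sub>R b \<in> S \<Longrightarrow> \<bar>t\<bar> * \<delta> \<le> norm u"
proof -
  have "open (- S)"
    using S(2) by auto
  then obtain \<delta> where \<delta>: "\<delta> > 0" "ball b \<delta> \<subseteq> - S"
    using b openE by blast
  have "\<bar>t\<bar> * \<delta> \<le> norm u" if t: "u - t *\<^sub>R b \<in> S" for u t
  proof (cases "t = 0")
    case False
    have "(- 1 / t) *\<^sub>R (u - t *\<^sub>R b) \<in> S"
      using S(1) t by (rule subspace_scale)
    then have "b - (1 / t) *\<^sub>R u \<in> S"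
      using False by (simp add: scaleR_diff_right)
    then have "\<delta> \<le> norm ((1 / t) *\<^sub>R u)"
      using \<delta>(2) by (force simp: dist_norm subset_eq)
    then show ?thesis
      using False by (simp add: field_simps)
  qed auto
  with \<delta>(1) show ?thesis
    using that by blast
qed

text \<open>The ambient space is infinite-dimensional, so compactness is built up one generator at a
  time: a new direction has a bounded coordinate relative to the closed old span, and the ball
  becomes a piece of the continuous image of a compact product.\<close>

lemma compact_span_Int_cball:
  fixes B :: "'v::real_normed_vector set"
  assumes "finite B"
  shows "compact (span B \<inter> cball 0 r)"
  using assms
proof (induction B arbitrary: r)
  case empty
  then show ?case
    by (intro finite_imp_compact) auto
next
  case (insert b B)
  show ?case
  proof (cases "b \<in> span B")
    case True
    then show ?thesis
      using insert.IH span_redundant by metis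
  next
    case False
    have "closed (span B)"
      using insert.IH by (rule closed_if_compact_Int_cball)
    then obtain \<delta> where \<delta>: "\<delta> > 0" "\<And>u t. u - t *\<^sub>R b \<in> span B \<Longrightarrow> \<bar>t\<bar> * \<delta> \<le> norm u"
      using bounded_coordinate_outside_subspace[OF subspace_span] False by metis
    let ?f = "\<lambda>z. fst z + snd z *\<^sub>R b"
    let ?A = "(span B \<inter> cball 0 (r + r / \<delta> * norm b)) \<times> {- (r / \<delta>)..r / \<delta>}"
    have "compact (?f ` ?A)"
      by (intro compact_continuous_image continuous_intros compact_Times insert.IH compact_Icc)
    moreover have "span (insert b B) \<inter> cball 0 r = ?f ` ?A \<inter> cball 0 r"
    proof (intro equalityI subsetI)
      fix u assume u: "u \<in> span (insert b B) \<inter> cball 0 r"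
      then obtain t where t: "u - t *\<^sub>R b \<in> span B"
        by (auto simp: span_insert)
      have nu: "norm u \<le> r"
        using u by auto
      have tb: "\<bar>t\<bar> \<le> r / \<delta>"
        using \<delta>(2)[OF t] \<delta>(1) nu by (simp add: pos_le_divide_eq)
      have "norm (u - t *\<^sub>R b) \<le> norm u + \<bar>t\<bar> * norm b"
        by (metis norm_scaleR norm_triangle_ineq4)
      also have "\<dots> \<le> r + r / \<delta> * norm b"
        using nu tb by (intro add_mono mult_right_mono) auto
      finally have "(u - t *\<^sub>R b, t) \<in> ?A"
        using t tb by auto
      moreover have "u = ?f (u - t *\<^sub>R b, t)"
        by simp
      ultimately show "u \<in> ?f ` ?A \<inter> cball 0 r"
        using u by blast
    next
      fix u assume "u \<in> ?f ` ?A \<inter> cball 0 r"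
      then show "u \<in> span (insert b B) \<inter> cball 0 r"
        using span_mono[OF subset_insertI[of B b]]
        by (auto intro!: span_add span_scale intro: span_base[of b "insert b B"])
    qed
    ultimately show ?thesis
      by (simp add: compact_Int_closed)
  qed
qed

text \<open>
  If there were no critical point between the levels \<open>a/2\<close> and \<open>C\<close>, then on that compact set the
  gradient would be bounded away from zero, and a single explicit Euler step, damped by the height above
  \<open>a/2\<close>, would lower that height by a fixed factor. Iterating it deforms the segment from \<open>0\<close> to \<open>e\<close>
  below the level \<open>a\<close>, although every path from \<open>0\<close> to \<open>e\<close> meets \<open>{N = r}\<close>.
\<close>
lemma mountain_pass_finite_span:
  fixes J N :: "'v::real_normed_vector \<Rightarrow> real" and J' :: "'v \<Rightarrow> 'v \<Rightarrow> real"
  assumes fin: "finite B"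
    and deriv: "\<And>u v \<tau>. u \<in> span B \<Longrightarrow> v \<in> span B \<Longrightarrow>
      ((\<lambda>\<tau>. J (u + \<tau> *\<^sub>R v)) has_real_derivative J' (u + \<tau> *\<^sub>R v) v) (at \<tau>)"
    and lin: "\<And>u c. u \<in> span B \<Longrightarrow> J' u (\<Sum>b\<in>B. c b *\<^sub>R b) = (\<Sum>b\<in>B. c b * J' u b)"
    and contJ: "continuous_on (span B) J" and contJ': "\<And>b. b \<in> B \<Longrightarrow> continuous_on (span B) (\<lambda>u. J' u b)"
    and contN: "continuous_on (span B) N" and N: "N 0 < r" "r < N e"
    and e: "e \<in> span B" "J 0 \<le> 0" "J e \<le> 0" and path: "\<And>t. 0 \<le> t \<Longrightarrow> t \<le> 1 \<Longrightarrow> J (t *\<^sub>R e) \<le> C"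
    and a: "a > 0" "\<And>u. u \<in> span B \<Longrightarrow> N u = r \<Longrightarrow> a \<le> J u"
    and bnd: "\<And>u. u \<in> span B \<Longrightarrow> a / 2 \<le> J u \<Longrightarrow> norm u \<le> \<rho>"
  shows "\<exists>u\<in>span B. a / 2 \<le> J u \<and> J u \<le> C \<and> (\<forall>b\<in>B. J' u b = 0)"
proof (rule ccontr)
  assume neg: "\<not> ?thesis"
  define V where "V = span B"
  define K where "K = {u \<in> V. a / 2 \<le> J u \<and> J u \<le> C}"
  have "compact K"
  proof -
    have S: "compact (V \<inter> cball 0 \<rho>)"
      unfolding V_def by (rule compact_span_Int_cball[OF fin])
    have "closed ((V \<inter> cball 0 \<rho>) \<inter> J -` {a / 2..C})"
      using S contJ by (intro continuous_closed_preimage) (auto simp: V_def compact_imp_closed intro: continuous_on_subset)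
    then have "compact ((V \<inter> cball 0 \<rho>) \<inter> ((V \<inter> cball 0 \<rho>) \<inter> J -` {a / 2..C}))"
      by (rule compact_Int_closed[OF S])
    moreover have "K = (V \<inter> cball 0 \<rho>) \<inter> ((V \<inter> cball 0 \<rho>) \<inter> J -` {a / 2..C})"
      using bnd by (auto simp: K_def V_def)
    ultimately show ?thesis
      by simp
  qed
  \<comment> \<open>\<open>B\<close> may be linearly dependent, so this is only a gradient with
    respect to a spanning family. By linearity \<open>J' u (G u)\<close> is the sum of the squares
    of the \<open>J' u b\<close>, which vanishes only at critical points.\<close>
  define G where "G u = (\<Sum>b\<in>B. J' u b *\<^sub>R b)" for u
  have GV: "G u \<in> V" for u
    unfolding G_def V_def by (intro span_sum span_scale span_base)
  have contG: "continuous_on V G"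
    unfolding G_def V_def by (intro continuous_intros contJ')
  \<comment> \<open>Minus the slope of J after a step of length \<open>fst z\<close> from
    \<open>snd z\<close> along \<open>- G\<close>. The displaced point may leave K, so compactness
    is used for the parameters (step length, starting point) instead.\<close>
  define \<Phi> where "\<Phi> z = J' (snd z - fst z *\<^sub>R G (snd z)) (G (snd z))" for z
  have stepV: "u - \<sigma> *\<^sub>R G u \<in> V" if "u \<in> V" for u \<sigma>
    using that GV[of u] unfolding V_def by (intro span_diff span_scale)
  have \<Phi>_eq: "\<Phi> z = (\<Sum>b\<in>B. J' (snd z) b * J' (snd z - fst z *\<^sub>R G (snd z)) b)" if "snd z \<in> V" for z
    unfolding \<Phi>_def using lin[of "snd z - fst z *\<^sub>R G (snd z)" "\<lambda>b. J' (snd z) b"] stepV[OF that]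
    by (simp add: G_def V_def)
  have cont\<Phi>: "continuous_on ({0..1} \<times> K) \<Phi>"
  proof (subst continuous_on_cong[OF refl \<Phi>_eq])
    show "continuous_on ({0..1} \<times> K) (\<lambda>z. \<Sum>b\<in>B. J' (snd z) b * J' (snd z - fst z *\<^sub>R G (snd z)) b)"
    proof (intro continuous_intros)
      fix b assume "b \<in> B"
      show "continuous_on ({0..1} \<times> K) (\<lambda>z. J' (snd z) b)"
        by (rule continuous_on_compose2[OF contJ'[OF \<open>b \<in> B\<close>]]) (auto intro!: continuous_intros simp: K_def V_def)
      have "continuous_on ({0..1} \<times> K) (\<lambda>z. G (snd z))"
        by (rule continuous_on_compose2[OF contG]) (auto intro!: continuous_intros simp: K_def V_def)
      then show "continuous_on ({0..1} \<times> K) (\<lambda>z. J' (snd z - fst z *\<^sub>R G (snd z)) b)"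
        using stepV
        by (intro continuous_on_compose2[OF contJ'[OF \<open>b \<in> B\<close>]]) (auto intro!: continuous_intros simp: K_def V_def)
    qed
  qed (auto simp: K_def)
  \<comment> \<open>At step length 0 the value is a positive sum of squares, with a positive minimum
    on the compact K; uniform continuity preserves half of it for short steps.\<close>
  have "\<exists>\<delta>>0. \<exists>h>0. h \<le> 1 \<and> (\<forall>u\<in>K. \<forall>\<sigma>. 0 \<le> \<sigma> \<and> \<sigma> \<le> h \<longrightarrow> \<delta> \<le> \<Phi> (\<sigma>, u))"
  proof (cases "K = {}")
    case False
    have "continuous_on K (\<lambda>u. \<Phi> (0, u))"
      by (rule continuous_on_compose2[OF cont\<Phi>]) (auto intro!: continuous_intros)
    then obtain u0 where u0: "u0 \<in> K" "\<And>u. u \<in> K \<Longrightarrow> \<Phi> (0, u0) \<le> \<Phi> (0, u)"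
      using continuous_attains_inf[OF \<open>compact K\<close> False] by blast
    have "\<Phi> (0, u0) > 0"
    proof -
      have "\<exists>b\<in>B. J' u0 b \<noteq> 0"
        using neg u0(1) by (auto simp: K_def V_def)
      moreover have "\<Phi> (0, u0) = (\<Sum>b\<in>B. J' u0 b * J' u0 b)"
        using u0(1) by (subst \<Phi>_eq) (auto simp: K_def)
      ultimately show ?thesis
        using fin by (auto intro!: sum_pos2 simp: zero_less_mult_iff linorder_neq_iff)
    qed
    moreover have "uniformly_continuous_on ({0..1} \<times> K) \<Phi>"
      using \<open>compact K\<close> by (intro compact_uniformly_continuous cont\<Phi> compact_Times) auto
    ultimately obtain d where d: "d > 0"
      "\<And>z z'. z \<in> {0..1} \<times> K \<Longrightarrow> z' \<in> {0..1} \<times> K \<Longrightarrow> dist z' z < d \<Longrightarrow> dist (\<Phi> z') (\<Phi> z) < \<Phi> (0, u0) / 2"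
      unfolding uniformly_continuous_on_def by (metis half_gt_zero)
    have "\<Phi> (0, u0) / 2 \<le> \<Phi> (\<sigma>, u)" if "u \<in> K" "0 \<le> \<sigma>" "\<sigma> \<le> min 1 (d / 2)" for u \<sigma>
    proof -
      have "dist (\<Phi> (\<sigma>, u)) (\<Phi> (0, u)) < \<Phi> (0, u0) / 2"
        using that d(1) by (intro d(2)) (auto simp: dist_Pair_Pair)
      then show ?thesis
        using u0(2)[OF \<open>u \<in> K\<close>] by (simp add: dist_real_def abs_if split: if_splits)
    qed
    then show ?thesis
      using \<open>\<Phi> (0, u0) > 0\<close> d(1)
      by (intro exI[of _ "\<Phi> (0, u0) / 2"] conjI exI[of _ "min 1 (d / 2)"]) auto
  qed (auto intro: exI[of _ 1])
  then obtain \<delta> h1 where h1: "\<delta> > 0" "h1 > 0" "\<And>u \<sigma>. u \<in> K \<Longrightarrow> 0 \<le> \<sigma> \<Longrightarrow> \<sigma> \<le> h1 \<Longrightarrow> \<delta> \<le> \<Phi> (\<sigma>, u)"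
    by blast
  have descent: "J (u - \<tau> *\<^sub>R G u) \<le> J u - \<tau> * \<delta>" if "u \<in> K" "0 \<le> \<tau>" "\<tau> \<le> h1" for u \<tau>
  proof (cases "\<tau> = 0")
    case False
    define f where "f \<sigma> = J (u + \<sigma> *\<^sub>R (- G u))" for \<sigma>
    have J'_minus: "J' w (- G u) = - J' w (G u)" if "w \<in> V" for w
      using lin[of w "\<lambda>b. - J' u b"] lin[of w "\<lambda>b. J' u b"] that by (simp add: G_def V_def sum_negf)
    have "(f has_real_derivative J' (u + \<sigma> *\<^sub>R (- G u)) (- G u)) (at \<sigma>)" for \<sigma>
      unfolding f_def using \<open>u \<in> K\<close> GV[of u] by (intro deriv) (auto simp: K_def V_def intro: span_neg)
    then obtain \<sigma> where \<sigma>: "0 < \<sigma>" "\<sigma> < \<tau>" "f \<tau> - f 0 = (\<tau> - 0) * J' (u + \<sigma> *\<^sub>R (- G u)) (- G u)"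
      using MVT2[of 0 \<tau> f "\<lambda>\<sigma>. J' (u + \<sigma> *\<^sub>R (- G u)) (- G u)"] \<open>0 \<le> \<tau>\<close> False by force
    have "J' (u + \<sigma> *\<^sub>R (- G u)) (- G u) = - \<Phi> (\<sigma>, u)"
      using stepV[of u \<sigma>] \<open>u \<in> K\<close> by (subst J'_minus) (auto simp: \<Phi>_def K_def)
    moreover have "\<delta> \<le> \<Phi> (\<sigma>, u)"
      using \<sigma> that by (intro h1) auto
    ultimately have "f \<tau> - f 0 \<le> \<tau> * (- \<delta>)"
      using \<sigma>(3) that(2) by (simp add: mult_left_mono)
    then show ?thesis
      by (simp add: f_def)
  qed auto
  have VI: "\<exists>t. 0 \<le> t \<and> t \<le> 1 \<and> N (F t) = r"
    if "continuous_on {0..1} F" "F 0 = 0" "F 1 = e" "\<And>t. t \<in> {0..1} \<Longrightarrow> F t \<in> V" for F :: "real \<Rightarrow> 'v"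
    using N that by (intro IVT') (auto intro!: continuous_on_compose2[OF contN] simp: V_def)
  have eV: "t *\<^sub>R e \<in> V" for t
    using e(1) by (simp add: V_def span_scale)
  have "continuous_on {0..1} (\<lambda>t. t *\<^sub>R e)"
    by (intro continuous_intros)
  then obtain t0 where t0: "0 \<le> t0" "t0 \<le> 1" "N (t0 *\<^sub>R e) = r"
    using VI[of "\<lambda>t. t *\<^sub>R e"] eV by auto
  have "a \<le> C"
    using a(2)[OF _ t0(3)] path[OF t0(1,2)] e(1) span_scale by fastforce
  define M where "M = C - a / 2"
  have "M > 0"
    using \<open>a \<le> C\<close> \<open>a > 0\<close> by (simp add: M_def)
  \<comment> \<open>The first bound keeps every damped step within the range of
    \<open>descent\<close>; the second keeps the contraction factor \<open>1 - h * \<delta>\<close>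
    nonnegative.\<close>
  define h where "h = min (h1 / M) (1 / \<delta>)"
  have h: "h > 0" "h * M \<le> h1" "h * \<delta> \<le> 1"
    using h1 \<open>M > 0\<close> by (auto simp: h_def field_simps min_def)
  \<comment> \<open>Cutting the height off at 0 makes T continuous and lets it fix both end points
    of the path, where J is at most 0.\<close>
  define T where "T u = u - (h * max 0 (J u - a / 2)) *\<^sub>R G u" for u
  have TV: "T u \<in> V" if "u \<in> V" for u
    unfolding T_def using stepV[OF that] .
  have contT: "continuous_on V T"
    unfolding T_def using contJ contG by (intro continuous_intros) (auto simp: V_def)
  have Tfix: "T u = u" if "J u \<le> a / 2" for u
    using that by (simp add: T_def)
  define q where "q = 1 - h * \<delta>"
  have q: "0 \<le> q" "q < 1"
    using h h1(1) by (auto simp: q_def)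
  have Tdesc: "J (T u) - a / 2 \<le> q * m" if "u \<in> V" "J u - a / 2 \<le> m" "0 \<le> m" "m \<le> M" for u m
  proof (cases "J u \<le> a / 2")
    case True
    then show ?thesis
      using Tfix q(1) mult_nonneg_nonneg[OF q(1) \<open>0 \<le> m\<close>] by auto
  next
    case False
    then have uK: "u \<in> K"
      using that by (simp add: K_def M_def)
    have "h * (J u - a / 2) \<le> h * M"
      using that h(1) by (intro mult_left_mono) auto
    then have "h * (J u - a / 2) \<le> h1"
      using h(2) by linarith
    then have "J (T u) \<le> J u - (h * (J u - a / 2)) * \<delta>"
      unfolding T_def using False descent[OF uK, of "h * (J u - a / 2)"] h(1) by (simp add: max_def)
    moreover have "q * (J u - a / 2) = (J u - a / 2) - (h * (J u - a / 2)) * \<delta>"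
      unfolding q_def by algebra
    ultimately have "J (T u) - a / 2 \<le> q * (J u - a / 2)"
      by linarith
    also have "\<dots> \<le> q * m"
      using that q by (intro mult_left_mono) auto
    finally show ?thesis .
  qed
  have iter: "(T ^^ n) u \<in> V \<and> J ((T ^^ n) u) - a / 2 \<le> q ^ n * M" if "u \<in> V" "J u \<le> C" for n u
  proof (induction n)
    case 0
    then show ?case
      using that by (simp add: M_def)
  next
    case (Suc n)
    have "q ^ n * M \<le> 1 * M"
      using q \<open>M > 0\<close> by (intro mult_right_mono power_le_one) auto
    then show ?case
      using Suc Tdesc[of "(T ^^ n) u" "q ^ n * M"] TV q \<open>M > 0\<close> by (simp add: mult.assoc)
  qed
  have "(\<lambda>n. q ^ n * M) \<longlonglongrightarrow> 0 * M"
    using q by (intro tendsto_mult LIMSEQ_realpow_zero tendsto_const)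
  then have "\<forall>\<^sub>F n in sequentially. q ^ n * M < a / 2"
    using \<open>a > 0\<close> by (intro order_tendstoD) auto
  then obtain n where n: "q ^ n * M < a / 2"
    by (auto simp: eventually_sequentially)
  have contTn: "continuous_on V (T ^^ n)" for n
  proof (induction n)
    case (Suc n)
    have "(T ^^ n) ` V \<subseteq> V"
      by (induction n) (use TV in auto)
    then have "continuous_on V (\<lambda>u. T ((T ^^ n) u))"
      using Suc contT by (intro continuous_on_compose2[OF contT]) auto
    then show ?case
      by (simp add: o_def)
  qed (simp add: id_def continuous_intros)
  have fixn: "(T ^^ n) u = u" if "J u \<le> a / 2" for u
    by (induction n) (use Tfix that in auto)
  have "continuous_on {0..1} (\<lambda>t. (T ^^ n) (t *\<^sub>R e))"
    by (rule continuous_on_compose2[OF contTn]) (auto intro!: continuous_intros eV)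
  moreover have "(T ^^ n) (t *\<^sub>R e) \<in> V" if "t \<in> {0..1}" for t
    using iter[OF eV] path that by auto
  ultimately obtain t where t: "0 \<le> t" "t \<le> 1" "N ((T ^^ n) (t *\<^sub>R e)) = r"
    using VI[of "\<lambda>t. (T ^^ n) (t *\<^sub>R e)"] fixn[of 0] fixn[of e] e \<open>a > 0\<close> by auto
  have "J ((T ^^ n) (t *\<^sub>R e)) - a / 2 \<le> q ^ n * M" "(T ^^ n) (t *\<^sub>R e) \<in> V"
    using iter[OF eV path[OF t(1,2)]] by auto
  then show False
    using a(2)[OF _ t(3)] n by (auto simp: V_def)
qed

section \<open>Hoelder continuity and decay of functions of finite energy\<close>

text \<open>An averaging argument: if every pair of points of the two intervals violated the bound,
  the integrand would be at least S / l^2 on a square of area l^2, making the seminorm at least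
  S.\<close>

lemma gagliardo_pick:
  fixes u :: "real \<Rightarrow> 'b::real_normed_vector"
  assumes S: "gagliardo s u < ennreal S" and l: "l > 0" and s: "s > 0"
    and d: "\<And>x y. x \<in> {a..a + l} \<Longrightarrow> y \<in> {b..b + l} \<Longrightarrow> \<bar>x - y\<bar> \<le> d"
  shows "\<exists>x\<in>{a..a + l}. \<exists>y\<in>{b..b + l}. (norm (u x - u y))\<^sup>2 \<le> S * d powr (1 + 2 * s) / l\<^sup>2"
proof (rule ccontr)
  assume neg: "\<not> ?thesis"
  have "S > 0"
    using S by (cases "S > 0") (auto simp: ennreal_neg not_less)
  have "a \<in> {a..a + l}" "b \<in> {b..b + l}"
    using l by auto
  then have "d \<ge> 0"
    using d[of a b] by linarith
  have "ennreal S = ennreal (S / l\<^sup>2) * emeasure (lborel \<Otimes>\<^sub>M lborel) ({a..a + l} \<times> {b..b + l})"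
    using l \<open>S > 0\<close> by (subst lborel.emeasure_pair_measure_Times) (auto simp: ennreal_mult[symmetric] power2_eq_square)
  also have "\<dots> = (\<integral>\<^sup>+z. ennreal (S / l\<^sup>2) * indicator ({a..a + l} \<times> {b..b + l}) z \<partial>(lborel \<Otimes>\<^sub>M lborel))"
    by (rule nn_integral_cmult_indicator[symmetric]) simp
  also have "\<dots> \<le> (\<integral>\<^sup>+(x, y). ennreal ((norm (u x - u y))\<^sup>2 / \<bar>x - y\<bar> powr (1 + 2 * s)) \<partial>(lborel \<Otimes>\<^sub>M lborel))"
  proof (intro nn_integral_mono)
    fix z :: "real \<times> real"
    obtain x y where z: "z = (x, y)"
      by fastforce
    have "S / l\<^sup>2 \<le> (norm (u x - u y))\<^sup>2 / \<bar>x - y\<bar> powr (1 + 2 * s)" if xy: "x \<in> {a..a + l}" "y \<in> {b..b + l}"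
    proof -
      have *: "S * d powr (1 + 2 * s) / l\<^sup>2 < (norm (u x - u y))\<^sup>2"
        using neg xy by force
      have "x \<noteq> y"
      proof
        assume "x = y"
        then have "S * d powr (1 + 2 * s) / l\<^sup>2 < 0"
          using * by simp
        moreover have "0 \<le> S * d powr (1 + 2 * s) / l\<^sup>2"
          using \<open>S > 0\<close> by simp
        ultimately show False
          by simp
      qed
      have "S / l\<^sup>2 * \<bar>x - y\<bar> powr (1 + 2 * s) \<le> S / l\<^sup>2 * d powr (1 + 2 * s)"
        using d[OF xy] s \<open>S > 0\<close> by (intro mult_left_mono powr_mono2) auto
      with * show ?thesis
        using \<open>x \<noteq> y\<close> by (simp add: pos_le_divide_eq)
    qed
    then show "ennreal (S / l\<^sup>2) * indicator ({a..a + l} \<times> {b..b + l}) z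
      \<le> (case z of (x, y) \<Rightarrow> ennreal ((norm (u x - u y))\<^sup>2 / \<bar>x - y\<bar> powr (1 + 2 * s)))"
      by (auto simp: z intro!: ennreal_leI split: split_indicator)
  qed
  also have "\<dots> = gagliardo s u"
    by (simp add: gagliardo_def nn_integral_completion lborel_prod)
  finally show False
    using S by simp
qed

text \<open>This is 2 / \<theta> for the \<theta> with \<theta>^(s - 1/2) = 1/4. Moving both end
  points then costs 1/4 + 1/4 of the Hoelder quotient, and absorbing that half produces the factor
  2.\<close>

definition holder_const :: "real \<Rightarrow> real" where
  "holder_const s = 2 / (1 / 4) powr (1 / (s - 1 / 2))"

lemma holder_const_pos: "holder_const s > 0"
  by (simp add: holder_const_def)

text \<open>
  The Hoelder quotient is compared at two scales: moving the end points by a small fraction \<open>\<theta>\<close> of their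
  distance to where the difference is controlled by the energy costs only half of the quotient, which is
  finite beforehand.
\<close>
lemma holder_gagliardo:
  fixes u :: "real \<Rightarrow> 'b::real_normed_vector"
  assumes s: "1 / 2 < s" "s < 1" and S: "gagliardo s u < ennreal S"
    and M: "\<And>x. norm (u x) \<le> M" and M': "\<And>x y. norm (u x - u y) \<le> M' * \<bar>x - y\<bar>"
  shows "norm (u x - u y) \<le> holder_const s * sqrt S * \<bar>x - y\<bar> powr (s - 1 / 2)"
proof -
  define \<beta> where "\<beta> = s - 1 / 2"
  have \<beta>: "0 < \<beta>" "\<beta> < 1"
    using s by (auto simp: \<beta>_def)
  define \<theta> :: real where "\<theta> = (1 / 4) powr (1 / \<beta>)"
  have \<theta>: "0 < \<theta>" "\<theta> \<le> 1" "\<theta> powr \<beta> = 1 / 4"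
    using \<beta> by (auto simp: \<theta>_def powr_powr intro!: powr_le1)
  have "S > 0"
    using S by (cases "S > 0") (auto simp: ennreal_neg not_less)
  define Q where "Q z = norm (u (fst z) - u (snd z)) / \<bar>fst z - snd z\<bar> powr \<beta>" for z
  have "M \<ge> 0" "M' \<ge> 0"
    using order_trans[OF norm_ge_zero M[of 0]] order_trans[OF norm_ge_zero M'[of 0 1]] by auto
  \<comment> \<open>Finiteness of the supremum is what permits absorbing a multiple of it later. The
    Lipschitz bound serves distances up to 1, boundedness the larger ones.\<close>
  have Q_bdd: "bdd_above (range Q)"
  proof (rule bdd_aboveI2)
    fix z :: "real \<times> real"
    obtain x y where z: "z = (x, y)"
      by fastforce
    show "Q z \<le> 2 * M + M'"
    proof (cases "\<bar>x - y\<bar> \<le> 1")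
      case True
      have "norm (u x - u y) \<le> M' * (\<bar>x - y\<bar> powr 1)"
        using M'[of x y] by simp
      also have "\<dots> \<le> M' * \<bar>x - y\<bar> powr \<beta>"
        using True \<beta> \<open>M' \<ge> 0\<close> by (intro mult_left_mono powr_mono') auto
      finally have "Q z \<le> M'"
        by (cases "x = y") (auto simp: Q_def z divide_le_eq \<open>M' \<ge> 0\<close>)
      then show ?thesis
        using \<open>M \<ge> 0\<close> by simp
    next
      case False
      have "norm (u x - u y) \<le> 2 * M"
        using norm_triangle_ineq4[of "u x" "u y"] M[of x] M[of y] by simp
      moreover have "1 \<le> \<bar>x - y\<bar> powr \<beta>"
        using False \<beta> by (intro ge_one_powr_ge_zero) auto
      ultimately have "Q z \<le> 2 * M / 1"
        unfolding Q_def z by (intro frac_le) (auto simp: \<open>M \<ge> 0\<close>)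
      then show ?thesis
        using \<open>M' \<ge> 0\<close> by simp
    qed
  qed
  define H where "H = (SUP z. Q z)"
  have Q_le: "Q z \<le> H" for z
    unfolding H_def by (rule cSUP_upper[OF _ Q_bdd]) auto
  have H: "norm (u x - u y) \<le> H * \<bar>x - y\<bar> powr \<beta>" for x y
    using Q_le[of "(x, y)"] by (cases "x = y") (auto simp: Q_def pos_divide_le_eq)
  have "H \<ge> 0"
    using Q_le[of "(0, 0)"] by (simp add: Q_def)
  have step: "norm (u x - u y) \<le> (H / 2 + sqrt S / \<theta>) * (y - x) powr \<beta>" if "x < y" for x y
  proof -
    define d where "d = y - x"
    have d: "d > 0"
      using that by (simp add: d_def)
    have "\<theta> * d \<le> 1 * d"
      using \<theta> d by (intro mult_right_mono) auto
    then have "\<theta> * d \<le> d"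
      by simp
    obtain p r where pr: "p \<in> {x..x + \<theta> * d}" "r \<in> {y - \<theta> * d..y - \<theta> * d + \<theta> * d}"
      "(norm (u p - u r))\<^sup>2 \<le> S * d powr (1 + 2 * s) / (\<theta> * d)\<^sup>2"
    proof (atomize_elim, goal_cases)
      case 1
      have "\<exists>p\<in>{x..x + \<theta> * d}. \<exists>r\<in>{y - \<theta> * d..y - \<theta> * d + \<theta> * d}.
        (norm (u p - u r))\<^sup>2 \<le> S * d powr (1 + 2 * s) / (\<theta> * d)\<^sup>2"
      proof (rule gagliardo_pick[OF S])
        fix p r assume "p \<in> {x..x + \<theta> * d}" "r \<in> {y - \<theta> * d..y - \<theta> * d + \<theta> * d}"
        then show "\<bar>p - r\<bar> \<le> d"
          using \<open>\<theta> * d \<le> d\<close> d_def unfolding atLeastAtMost_iff abs_le_iff by linarith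
      qed (use \<theta> d s in auto)
      then show ?case
        by blast
    qed
    have 1: "norm (u x - u p) \<le> H * (1 / 4 * d powr \<beta>)"
    proof -
      have "\<bar>x - p\<bar> powr \<beta> \<le> (\<theta> * d) powr \<beta>"
        using pr(1) \<beta> by (intro powr_mono2) auto
      also have "\<dots> = 1 / 4 * d powr \<beta>"
        using \<theta> d by (simp add: powr_mult)
      finally show ?thesis
        using H[of x p] \<open>H \<ge> 0\<close> by (meson mult_left_mono order_trans)
    qed
    have 2: "norm (u r - u y) \<le> H * (1 / 4 * d powr \<beta>)"
    proof -
      have "\<bar>r - y\<bar> powr \<beta> \<le> (\<theta> * d) powr \<beta>"
        using pr(2) \<beta> by (intro powr_mono2) auto
      also have "\<dots> = 1 / 4 * d powr \<beta>"
        using \<theta> d by (simp add: powr_mult)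
      finally show ?thesis
        using H[of r y] \<open>H \<ge> 0\<close> by (meson mult_left_mono order_trans)
    qed
    have 3: "norm (u p - u r) \<le> sqrt S / \<theta> * d powr \<beta>"
    proof -
      \<comment> \<open>The scaling that selects the exponent: 1 + 2s = 2 (s - 1/2) + 2, and the
        extra d^2 cancels against the area of the square of side \<theta> d.\<close>
      have "d powr (1 + 2 * s) = (d powr \<beta>)\<^sup>2 * d\<^sup>2"
      proof -
        have "(d powr \<beta>)\<^sup>2 * d\<^sup>2 = d powr (\<beta> + \<beta>) * d powr 2"
          using d unfolding power2_eq_square[of "d powr \<beta>"] powr_add by simp
        also have "\<dots> = d powr (\<beta> + \<beta> + 2)"
          using powr_add[of d "\<beta> + \<beta>" 2] by simp
        also have "\<beta> + \<beta> + 2 = 1 + 2 * s"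
          by (simp add: \<beta>_def)
        finally show ?thesis
          by simp
      qed
      then have "S * d powr (1 + 2 * s) / (\<theta> * d)\<^sup>2 = (sqrt S / \<theta> * d powr \<beta>)\<^sup>2"
        using d \<theta>(1) \<open>S > 0\<close> by (simp add: power_mult_distrib power_divide)
      then have "(norm (u p - u r))\<^sup>2 \<le> (sqrt S / \<theta> * d powr \<beta>)\<^sup>2"
        using pr(3) by linarith
      then show ?thesis
        by (rule power2_le_imp_le) (use \<theta>(1) \<open>S > 0\<close> in simp)
    qed
    have "norm (u x - u y) \<le> norm (u x - u p) + norm (u p - u r) + norm (u r - u y)"
      using norm_triangle_ineq[of "u x - u p" "u p - u r"] norm_triangle_ineq[of "u x - u r" "u r - u y"] by simp
    also have "\<dots> \<le> H * (1 / 4 * d powr \<beta>) + sqrt S / \<theta> * d powr \<beta> + H * (1 / 4 * d powr \<beta>)"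
      using 1 2 3 by linarith
    finally show ?thesis
      by (simp add: d_def algebra_simps)
  qed
  have "Q z \<le> H / 2 + sqrt S / \<theta>" for z
  proof -
    obtain x y where z: "z = (x, y)"
      by fastforce
    consider "x < y" | "y < x" | "x = y"
      by linarith
    then show ?thesis
    proof cases
      case 1
      then show ?thesis
        using step[of x y] by (simp add: Q_def z pos_divide_le_eq)
    next
      case 2
      then show ?thesis
        using step[of y x] by (simp add: Q_def z pos_divide_le_eq norm_minus_commute)
    qed (use \<open>H \<ge> 0\<close> \<theta> \<open>S > 0\<close> in \<open>auto simp: Q_def z\<close>)
  qed
  \<comment> \<open>H is a real number, so H / 2 can be subtracted, leaving H at most 2 sqrt(S) /
    \<theta>.\<close>
  then have "H \<le> H / 2 + sqrt S / \<theta>"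
    unfolding H_def by (intro cSUP_least) auto
  then have "H \<le> holder_const s * sqrt S"
    by (simp add: holder_const_def \<theta>_def \<beta>_def)
  then have "H * \<bar>x - y\<bar> powr \<beta> \<le> holder_const s * sqrt S * \<bar>x - y\<bar> powr \<beta>"
    by (intro mult_right_mono) auto
  with H[of x y] show ?thesis
    by (simp add: \<beta>_def)
qed

text \<open>Averaging once more. The numerator E + 1 in place of E makes the contradiction strict,
  also for E = 0.\<close>

lemma weighted_L2_pick:
  fixes u :: "real \<Rightarrow> 'b::real_normed_vector" and g :: "real \<Rightarrow> real"
  assumes E: "(\<integral>\<^sup>+x. ennreal (g x) \<partial>lebesgue) \<le> ennreal E" "E \<ge> 0" and k: "k > 0" and l: "l > 0"
    and g: "\<And>x. x \<in> {a..a + l} \<Longrightarrow> k * (norm (u x))\<^sup>2 \<le> g x"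
  shows "\<exists>x\<in>{a..a + l}. (norm (u x))\<^sup>2 \<le> (E + 1) / (k * l)"
proof (rule ccontr)
  assume neg: "\<not> ?thesis"
  have "ennreal (E + 1) = ennreal ((E + 1) / l) * emeasure lborel {a..a + l}"
    using l E by (simp add: ennreal_mult[symmetric])
  also have "\<dots> = (\<integral>\<^sup>+x. ennreal ((E + 1) / l) * indicator {a..a + l} x \<partial>lborel)"
    by (rule nn_integral_cmult_indicator[symmetric]) simp
  also have "\<dots> \<le> (\<integral>\<^sup>+x. ennreal (g x) \<partial>lborel)"
  proof (intro nn_integral_mono)
    fix x
    have "(E + 1) / l \<le> g x" if "x \<in> {a..a + l}"
    proof -
      have "(E + 1) / (k * l) \<le> (norm (u x))\<^sup>2"
        using neg that by force
      then have "(E + 1) / l \<le> k * (norm (u x))\<^sup>2"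
        using k l by (simp add: field_simps)
      with g[OF that] show ?thesis
        by simp
    qed
    then show "ennreal ((E + 1) / l) * indicator {a..a + l} x \<le> ennreal (g x)"
      by (auto intro!: ennreal_leI split: split_indicator)
  qed
  also have "\<dots> \<le> ennreal E"
    using E by (simp add: nn_integral_completion)
  finally show False
    using E(2) by (simp add: ennreal_le_iff)
qed

text \<open>Some point within distance 1 has a norm controlled by the potential energy, and the
  Hoelder bound carries this to x.\<close>

lemma sup_bound_energy:
  fixes u :: "real \<Rightarrow> 'b::real_normed_vector" and g :: "real \<Rightarrow> real"
  assumes E: "(\<integral>\<^sup>+x. ennreal (g x) \<partial>lebesgue) \<le> ennreal E" "E \<ge> 0" and k: "k > 0"
    and g: "\<And>x. k * (norm (u x))\<^sup>2 \<le> g x"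
    and H: "\<And>x y. norm (u x - u y) \<le> H * \<bar>x - y\<bar> powr \<beta>" "H \<ge> 0" "\<beta> > 0"
  shows "norm (u x) \<le> H + sqrt ((E + 1) / k)"
proof -
  obtain y where y: "y \<in> {x..x + 1}" "(norm (u y))\<^sup>2 \<le> (E + 1) / (k * 1)"
    using weighted_L2_pick[OF E k zero_less_one, of x u] g by blast
  have "norm (u y) \<le> sqrt ((E + 1) / k)"
    using y(2) by (simp add: real_le_rsqrt)
  moreover have "norm (u x - u y) \<le> H * 1"
  proof -
    have "\<bar>x - y\<bar> powr \<beta> \<le> 1"
      using y(1) H(3) by (intro powr_le1) auto
    then show ?thesis
      using H(1)[of x y] H(2) by (meson mult_left_mono order_trans)
  qed
  ultimately show ?thesis
    using norm_triangle_ineq[of "u x - u y" "u y"] by simp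
qed

text \<open>Far out L exceeds a large constant k, so an interval of fixed length l contains a point
  where u is below \<epsilon>/4. The length is chosen first, so that the Hoelder oscillation over it
  is at most \<epsilon>/2; the radius depends on E, H and \<epsilon> only.\<close>

lemma uniform_decay_energy:
  fixes L :: "real \<Rightarrow> real^'n^'n"
  assumes L: "\<And>k. \<exists>R. \<forall>x v. \<bar>x\<bar> \<ge> R \<longrightarrow> k * (norm v)\<^sup>2 \<le> (L x *v v) \<bullet> v"
    and E: "E \<ge> 0" and H: "H \<ge> 0" "\<beta> > 0" and \<epsilon>: "\<epsilon> > 0"
  obtains R where "R > 0" "\<And>u x. (\<integral>\<^sup>+x. ennreal ((L x *v u x) \<bullet> u x) \<partial>lebesgue) \<le> ennreal E \<Longrightarrow>
    (\<And>x y. norm (u x - u y) \<le> H * \<bar>x - y\<bar> powr \<beta>) \<Longrightarrow> \<bar>x\<bar> \<ge> R \<Longrightarrow> norm (u x) < \<epsilon>"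
proof -
  define l where "l = (\<epsilon> / (2 * (H + 1))) powr (1 / \<beta>)"
  have l: "l > 0"
    using \<epsilon> H by (simp add: l_def)
  have Hl: "H * l powr \<beta> \<le> \<epsilon> / 2"
  proof -
    have "l powr \<beta> = \<epsilon> / (2 * (H + 1))"
      using \<epsilon> H by (simp add: l_def powr_powr)
    then have "H * l powr \<beta> = \<epsilon> / 2 * (H / (H + 1))"
      by simp
    also have "\<dots> \<le> \<epsilon> / 2 * 1"
      using \<epsilon> H by (intro mult_left_mono) auto
    finally show ?thesis
      by simp
  qed
  \<comment> \<open>Solves (E + 1) / (k l) = (\<epsilon>/4)^2, the bound that the averaging lemma
    returns.\<close>
  define k where "k = (E + 1) * 16 / (l * \<epsilon>\<^sup>2)"
  have k: "k > 0"
    using E l \<epsilon> by (simp add: k_def)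
  have kl: "(E + 1) / (k * l) = (\<epsilon> / 4)\<^sup>2"
  proof -
    have "k * l = (E + 1) * (16 / \<epsilon>\<^sup>2)"
      using l by (simp add: k_def)
    moreover have "(E + 1) / ((E + 1) * (16 / \<epsilon>\<^sup>2)) = 1 / (16 / \<epsilon>\<^sup>2)"
      using E by (intro nonzero_divide_mult_cancel_left) auto
    ultimately show ?thesis
      by (simp add: power_divide)
  qed
  obtain R0 where R0: "\<And>x v. \<bar>x\<bar> \<ge> R0 \<Longrightarrow> k * (norm v)\<^sup>2 \<le> (L x *v v) \<bullet> v"
    using L[of k] by blast
  show ?thesis
  proof (rule that)
    show "max 1 R0 > 0"
      by simp
    fix u :: "real \<Rightarrow> real^'n" and x
    assume uE: "(\<integral>\<^sup>+x. ennreal ((L x *v u x) \<bullet> u x) \<partial>lebesgue) \<le> ennreal E"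
      and uH: "\<And>x y. norm (u x - u y) \<le> H * \<bar>x - y\<bar> powr \<beta>" and x: "\<bar>x\<bar> \<ge> max 1 R0"
    \<comment> \<open>The interval lies on the side of x away from the origin, so all its points are
      at least as far out as x.\<close>
    define a where "a = (if x \<ge> 0 then x else x - l)"
    have "\<exists>y\<in>{a..a + l}. (norm (u y))\<^sup>2 \<le> (E + 1) / (k * l)"
    proof (rule weighted_L2_pick[OF uE E k l])
      fix y assume "y \<in> {a..a + l}"
      then have "R0 \<le> \<bar>y\<bar>"
        using x l by (cases "x \<ge> 0") (simp_all add: a_def abs_if split: if_splits)
      then show "k * (norm (u y))\<^sup>2 \<le> (L y *v u y) \<bullet> u y"
        by (rule R0)
    qed
    then obtain y where y: "y \<in> {a..a + l}" "(norm (u y))\<^sup>2 \<le> (\<epsilon> / 4)\<^sup>2"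
      by (auto simp: kl)
    have "norm (u y) \<le> \<epsilon> / 4"
      by (rule power2_le_imp_le[OF y(2)]) (use \<epsilon> in simp)
    moreover have "norm (u x - u y) \<le> \<epsilon> / 2"
    proof -
      have "\<bar>x - y\<bar> powr \<beta> \<le> l powr \<beta>"
        using y(1) H by (intro powr_mono2) (auto simp: a_def split: if_splits)
      then have "H * \<bar>x - y\<bar> powr \<beta> \<le> H * l powr \<beta>"
        using H by (intro mult_left_mono) auto
      then show ?thesis
        using uH[of x y] Hl by linarith
    qed
    ultimately show "norm (u x) < \<epsilon>"
      using norm_triangle_ineq[of "u x - u y" "u y"] \<epsilon> by simp
  qed
qed

section \<open>The energy form and the nonlinearity\<close>

text \<open>Generators may be dependent, so coordinates are chosen, not unique: a redundant
  generator receives 0. A new one has its coordinate bounded through its distance \<delta> from the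
  old span, and the remainder grows by at most 1 + norm b / \<delta>; both factors enter
  \<open>K\<close>.\<close>

lemma span_coordinates_bounded:
  fixes B :: "'v::real_normed_vector set"
  assumes "finite B"
  shows "\<exists>C\<ge>0. \<forall>u\<in>span B. \<exists>c. u = (\<Sum>b\<in>B. c b *\<^sub>R b) \<and> (\<forall>b\<in>B. \<bar>c b\<bar> \<le> C * norm u)"
  using assms
proof (induction B)
  case (insert b B)
  from insert.IH obtain C where C': "C \<ge> 0 \<and>
    (\<forall>u\<in>span B. \<exists>c. u = (\<Sum>b\<in>B. c b *\<^sub>R b) \<and> (\<forall>b\<in>B. \<bar>c b\<bar> \<le> C * norm u))"
    by (rule exE)
  note C = conjunct1[OF C'] bspec[OF conjunct2[OF C']]
  show ?case
  proof (cases "b \<in> span B")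
    case True
    then have sp: "span (insert b B) = span B"
      by (rule span_redundant)
    have "\<exists>c. u = (\<Sum>b\<in>insert b B. c b *\<^sub>R b) \<and> (\<forall>b\<in>insert b B. \<bar>c b\<bar> \<le> C * norm u)"
      if u: "u \<in> span (insert b B)" for u
    proof -
      obtain c where c: "u = (\<Sum>b\<in>B. c b *\<^sub>R b)" "\<And>b. b \<in> B \<Longrightarrow> \<bar>c b\<bar> \<le> C * norm u"
        using C(2)[of u] u sp by blast
      have "(\<Sum>b'\<in>B. (c(b := 0)) b' *\<^sub>R b') = (\<Sum>b\<in>B. c b *\<^sub>R b)"
        using insert.hyps by (intro sum.cong) auto
      then show ?thesis
        using insert.hyps c C(1) by (intro exI[of _ "c(b := 0)"]) auto
    qed
    then show ?thesis
      using C(1) by blast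
  next
    case False
    have "closed (span B)"
      using compact_span_Int_cball[OF insert.hyps(1)] by (rule closed_if_compact_Int_cball)
    then obtain \<delta> where \<delta>: "\<delta> > 0" "\<And>u t. u - t *\<^sub>R b \<in> span B \<Longrightarrow> \<bar>t\<bar> * \<delta> \<le> norm u"
      using bounded_coordinate_outside_subspace[OF subspace_span] False by metis
    define K where "K = max (1 / \<delta>) (C * (1 + norm b / \<delta>))"
    have "\<exists>c. u = (\<Sum>b\<in>insert b B. c b *\<^sub>R b) \<and> (\<forall>b\<in>insert b B. \<bar>c b\<bar> \<le> K * norm u)"
      if u: "u \<in> span (insert b B)" for u
    proof -
      obtain t where t: "u - t *\<^sub>R b \<in> span B"
        using u by (auto simp: span_insert)
      have tb: "\<bar>t\<bar> \<le> 1 / \<delta> * norm u"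
        using \<delta>(2)[OF t] \<delta>(1) by (simp add: field_simps)
      have "norm (u - t *\<^sub>R b) \<le> norm u + \<bar>t\<bar> * norm b"
        by (metis norm_scaleR norm_triangle_ineq4)
      also have "\<dots> \<le> norm u + 1 / \<delta> * norm u * norm b"
        using tb by (intro add_mono mult_right_mono) auto
      finally have nb: "norm (u - t *\<^sub>R b) \<le> (1 + norm b / \<delta>) * norm u"
        by (simp add: algebra_simps)
      from C(2)[OF t] obtain c where c': "u - t *\<^sub>R b = (\<Sum>b\<in>B. c b *\<^sub>R b) \<and> (\<forall>b'\<in>B. \<bar>c b'\<bar> \<le> C * norm (u - t *\<^sub>R b))"
        by (rule exE)
      note c = conjunct1[OF c'] conjunct2[OF c', rule_format]
      have "(\<Sum>b'\<in>B. (c(b := t)) b' *\<^sub>R b') = (\<Sum>b\<in>B. c b *\<^sub>R b)"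
        using insert.hyps by (intro sum.cong) auto
      then have 1: "u = (\<Sum>b'\<in>insert b B. (c(b := t)) b' *\<^sub>R b')"
        using insert.hyps c(1) by (simp add: algebra_simps)
      have 2: "\<bar>(c(b := t)) b'\<bar> \<le> K * norm u" if b': "b' \<in> insert b B" for b'
      proof (cases "b' = b")
        case True
        have "1 / \<delta> * norm u \<le> K * norm u"
          by (intro mult_right_mono) (auto simp: K_def)
        then show ?thesis
          using True tb by simp
      next
        case False
        have "\<bar>c b'\<bar> \<le> C * ((1 + norm b / \<delta>) * norm u)"
          using c(2)[of b'] b' False mult_left_mono[OF nb C(1)] by auto
        also have "\<dots> \<le> K * norm u"
          unfolding mult.assoc[symmetric] by (intro mult_right_mono) (auto simp: K_def)
        finally show ?thesis
          using False by simp
      qed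
      show ?thesis
        using 1 2 by blast
    qed
    moreover have "K \<ge> 0"
      using \<delta>(1) by (simp add: K_def le_max_iff_disj)
    ultimately show ?thesis
      by blast
  qed
qed auto

text \<open>Test functions as members of the space of bounded continuous functions, so that span,
  norm and compactness refer to the supremum norm.\<close>

definition test_bcontfuns :: "(real \<Rightarrow>\<^sub>C 'b::real_normed_vector) set" where
  "test_bcontfuns = {u. apply_bcontfun u \<in> test_functions}"

lemma subspace_test_bcontfuns: "subspace test_bcontfuns"
  unfolding subspace_def test_bcontfuns_def
  by (auto intro: test_function_add test_function_scaleR bounded_support_imp_test_function[OF smooth_fun_const])

lemma test_function_bcontfun:
  fixes \<phi> :: "real \<Rightarrow> 'b::real_normed_vector"
  assumes "\<phi> \<in> test_functions"
  obtains u where "u \<in> test_bcontfuns" "apply_bcontfun u = \<phi>"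
proof -
  obtain M where "\<And>x. norm (\<phi> x) \<le> M"
    using test_function_bounded[OF assms] by blast
  then have "\<phi> \<in> bcontfun"
    using test_function_continuous[OF assms] bcontfun_normI by blast
  then obtain u where "\<phi> = apply_bcontfun u"
    by (rule bcontfunE)
  then show ?thesis
    using assms that by (auto simp: test_bcontfuns_def)
qed

lemma common_support:
  fixes B :: "(real \<Rightarrow>\<^sub>C 'b::real_normed_vector) set"
  assumes "finite B" "B \<subseteq> test_bcontfuns"
  obtains R where "R > 0" "\<And>u x. u \<in> span B \<Longrightarrow> \<bar>x\<bar> \<ge> R \<Longrightarrow> apply_bcontfun u x = 0"
proof -
  have "\<exists>R>0. \<forall>u\<in>B. \<forall>x. \<bar>x\<bar> \<ge> R \<longrightarrow> apply_bcontfun u x = 0"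
    using assms
  proof (induction B)
    case (insert b B)
    then obtain R where R: "R > 0" "\<And>u x. u \<in> B \<Longrightarrow> \<bar>x\<bar> \<ge> R \<Longrightarrow> apply_bcontfun u x = 0"
      by auto
    have "apply_bcontfun b \<in> test_functions"
      using insert.prems by (auto simp: test_bcontfuns_def)
    then obtain R' where "R' > 0" "\<And>x. \<bar>x\<bar> \<ge> R' \<Longrightarrow> apply_bcontfun b x = 0"
      using test_function_bounded_support by blast
    with R show ?case
      by (intro exI[of _ "max R R'"]) auto
  qed (auto intro: exI[of _ 1])
  then obtain R where R: "R > 0" "\<And>u x. u \<in> B \<Longrightarrow> \<bar>x\<bar> \<ge> R \<Longrightarrow> apply_bcontfun u x = 0"
    by blast
  have "apply_bcontfun u x = 0" if "u \<in> span B" "\<bar>x\<bar> \<ge> R" for u x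
    using that(1)
  proof (induction rule: span_induct)
    show "subspace {u. apply_bcontfun u x = 0}"
      by (auto simp: subspace_def)
  qed (use R that in auto)
  with R(1) show ?thesis
    using that by blast
qed

lemma continuous_on_matrix_vector_mult [continuous_intros]:
  fixes A :: "'a::topological_space \<Rightarrow> real^'n^'m"
  assumes "continuous_on S A" "continuous_on S v"
  shows "continuous_on S (\<lambda>x. A x *v v x)"
  unfolding matrix_vector_mult_def by (intro continuous_intros assms)

text \<open>A convergent sequence is bounded, so on [-R, R] the integrands only see F on a compact
  set; dominated convergence applies without any growth condition on F.\<close>

lemma continuous_on_integral_superposition:
  fixes F :: "real \<Rightarrow> 'b::euclidean_space \<Rightarrow> real"
  assumes F: "continuous_on UNIV (\<lambda>(x, q). F x q)"
  shows "continuous_on UNIV (\<lambda>u :: real \<Rightarrow>\<^sub>C 'b. LINT x|lborel. indicator {-R..R} x * F x (apply_bcontfun u x))"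
proof (unfold continuous_on_sequentially, intro allI ballI impI, unfold o_def, elim conjE)
  fix u :: "real \<Rightarrow>\<^sub>C 'b" and v :: "nat \<Rightarrow> real \<Rightarrow>\<^sub>C 'b"
  assume v: "v \<longlonglongrightarrow> u"
  have "bounded (range v)"
    using v by (rule convergent_imp_bounded)
  then obtain M where M: "\<And>n. norm (v n) \<le> M"
    unfolding bounded_iff by blast
  have m: "(\<lambda>x. F x (apply_bcontfun w x)) \<in> borel_measurable borel" for w
    by (intro borel_measurable_continuous_onI continuous_on_compose2[OF F, where f = "\<lambda>x. (x, apply_bcontfun w x)", simplified])
       (auto intro!: continuous_intros)
  have "compact ((\<lambda>(x, q). F x q) ` ({-R..R} \<times> cball 0 M))"
    by (intro compact_continuous_image compact_Times continuous_on_subset[OF F]) auto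
  then obtain K where K': "\<forall>y\<in>(\<lambda>(x, q). F x q) ` ({-R..R} \<times> cball 0 M). norm y \<le> K"
    using compact_imp_bounded bounded_iff by blast
  have K: "\<bar>F x q\<bar> \<le> K" if "x \<in> {-R..R}" "norm q \<le> M" for x q
    using bspec[OF K' imageI, of "(x, q)"] that by simp
  show "(\<lambda>n. LINT x|lborel. indicator {-R..R} x * F x (apply_bcontfun (v n) x))
    \<longlonglongrightarrow> (LINT x|lborel. indicator {-R..R} x * F x (apply_bcontfun u x))"
  proof (rule integral_dominated_convergence[where w = "\<lambda>x. K * indicator {-R..R} x"])
    show "integrable lborel (\<lambda>x. K * indicator {-R..R} x)"
      by (intro integrable_mult_right integrable_real_indicator) (auto simp: emeasure_lborel_Icc_eq)
    show "AE x in lborel. norm (indicator {-R..R} x * F x (apply_bcontfun (v n) x)) \<le> K * indicator {-R..R} x" for n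
    proof (intro AE_I2)
      fix x
      show "norm (indicator {-R..R} x * F x (apply_bcontfun (v n) x)) \<le> K * indicator {-R..R} x"
        using K[of x "apply_bcontfun (v n) x"] order_trans[OF norm_bounded[of "v n" x] M[of n]]
        by (simp split: split_indicator)
    qed
    show "AE x in lborel. (\<lambda>n. indicator {-R..R} x * F x (apply_bcontfun (v n) x))
      \<longlonglongrightarrow> indicator {-R..R} x * F x (apply_bcontfun u x)"
    proof (intro AE_I2 tendsto_mult tendsto_const)
      fix x
      have "(\<lambda>n. apply_bcontfun (v n) x) \<longlonglongrightarrow> apply_bcontfun u x"
      proof (rule metric_tendsto_imp_tendsto[OF v always_eventually], rule allI)
        show "dist (apply_bcontfun (v n) x) (apply_bcontfun u x) \<le> dist (v n) u" for n
          by (rule dist_bounded)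
      qed
      then have "(\<lambda>n. (x, apply_bcontfun (v n) x)) \<longlonglongrightarrow> (x, apply_bcontfun u x)"
        by (intro tendsto_Pair tendsto_const)
      from continuous_on_tendsto_compose[OF F this]
      show "(\<lambda>n. F x (apply_bcontfun (v n) x)) \<longlonglongrightarrow> F x (apply_bcontfun u x)"
        by simp
    qed
  qed (use m in auto)
qed

lemma integral_cutoff:
  fixes f :: "real \<Rightarrow> real"
  assumes "\<And>x. \<bar>x\<bar> \<ge> R \<Longrightarrow> f x = 0"
  shows "(LINT x|lborel. f x) = (LINT x|lborel. indicator {-R..R} x * f x)"
  using assms by (intro Bochner_Integration.integral_cong) (auto split: split_indicator simp: abs_if not_le)

text \<open>Passing to the gauge integral over a compact interval gives access to differentiation
  under the integral and to the vanishing criterion for continuous nonnegative functions.\<close>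

lemma continuous_bounded_support_integrable:
  fixes f :: "real \<Rightarrow> real"
  assumes f: "continuous_on UNIV f" "\<And>x. \<bar>x\<bar> \<ge> R \<Longrightarrow> f x = 0"
  shows "integrable lborel f" "(LINT x|lborel. f x) = integral {-R..R} f"
proof -
  have "compact (f ` {-R..R})"
    using f by (intro compact_continuous_image) (auto intro: continuous_on_subset)
  then have "\<exists>M. \<forall>y\<in>f ` {-R..R}. norm y \<le> M"
    using compact_imp_bounded bounded_iff by blast
  then obtain M where M: "\<And>x. x \<in> {-R..R} \<Longrightarrow> \<bar>f x\<bar> \<le> M"
    unfolding ball_simps real_norm_def by blast
  show int: "integrable lborel f"
    using f M by (intro integrableI_bounded_set[of "{-R..R}" _ _ M] AE_I2 borel_measurable_continuous_onI[THEN measurable_completion])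
      (auto simp: emeasure_lborel_Icc_eq abs_le_iff borel_measurable_continuous_onI)
  have "(LINT x|lborel. f x) = integral UNIV f"
    using integral_lborel[OF int] by simp
  also have "\<dots> = integral UNIV (\<lambda>x. if x \<in> {-R..R} then f x else 0)"
    using f(2) by (intro Henstock_Kurzweil_Integration.integral_cong) (auto simp: abs_if)
  also have "\<dots> = integral {-R..R} f"
    by (rule integral_restrict_UNIV)
  finally show "(LINT x|lborel. f x) = integral {-R..R} f" .
qed

section \<open>Standing hypotheses and consequences for L and W\<close>

locale frac_hamiltonian =
  fixes s :: real and L :: "real \<Rightarrow> real^'n^'n" and W :: "real \<Rightarrow> real^'n \<Rightarrow> real" and \<alpha> \<mu> :: real
  assumes s: "1 / 2 < s" "s < 1"
    and L_cont: "continuous_on UNIV L"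
    and L_sym: "\<And>x. transpose (L x) = L x"
    and \<alpha>: "\<alpha> > 0" "\<And>x q. \<alpha> * (norm q)\<^sup>2 \<le> (L x *v q) \<bullet> q"
    and L_top: "filterlim (\<lambda>x. INF \<xi>\<in>{\<xi>. norm \<xi> = 1}. (L x *v \<xi>) \<bullet> \<xi>) at_top at_top"
    and L_bot: "filterlim (\<lambda>x. INF \<xi>\<in>{\<xi>. norm \<xi> = 1}. (L x *v \<xi>) \<bullet> \<xi>) at_top at_bot"
    and W_C1: "C1_fun (\<lambda>(x, q). W x q)"
    and W_zero: "\<And>x. W x 0 = 0"
    and W_small: "((\<lambda>q. SUP x. ennreal (norm (grad (W x) q) / norm q)) \<longlongrightarrow> 0) (at 0)"
    and \<mu>: "\<mu> > 2" "\<And>x q. q \<noteq> 0 \<Longrightarrow> 0 < \<mu> * W x q \<and> \<mu> * W x q \<le> grad (W x) q \<bullet> q"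
begin

lemma s': "0 < s" "s < 1"
  using s by auto

lemma L_nonneg: "0 \<le> (L x *v q) \<bullet> q"
  using \<alpha>(2)[of q x] \<alpha>(1) by (meson mult_nonneg_nonneg order_trans less_imp_le zero_le_power2)

text \<open>Normalising v reduces the claim to unit vectors. Coercivity bounds the quadratic form
  below, which is what makes the real-valued infimum a genuine lower bound.\<close>

lemma L_growth: "\<exists>R. \<forall>x v. \<bar>x\<bar> \<ge> R \<longrightarrow> k * (norm v)\<^sup>2 \<le> (L x *v v) \<bullet> v"
proof -
  let ?m = "\<lambda>x. INF \<xi>\<in>{\<xi>. norm \<xi> = 1}. (L x *v \<xi>) \<bullet> \<xi>"
  obtain R1 where R1: "\<And>x. x \<ge> R1 \<Longrightarrow> k \<le> ?m x"
    using L_top unfolding filterlim_at_top eventually_at_top_linorder by blast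
  obtain R2 where R2: "\<And>x. x \<le> R2 \<Longrightarrow> k \<le> ?m x"
    using L_bot unfolding filterlim_at_top eventually_at_bot_linorder by blast
  have m: "?m x * (norm v)\<^sup>2 \<le> (L x *v v) \<bullet> v" for x v
  proof (cases "v = 0")
    case False
    define \<xi> where "\<xi> = (1 / norm v) *\<^sub>R v"
    have "bdd_below ((\<lambda>\<xi>. (L x *v \<xi>) \<bullet> \<xi>) ` {\<xi>. norm \<xi> = 1})"
      using order_trans[OF _ \<alpha>(2)] \<alpha>(1) by (intro bdd_belowI2[of _ 0]) auto
    then have "?m x \<le> (L x *v \<xi>) \<bullet> \<xi>"
      using False by (intro cINF_lower) (auto simp: \<xi>_def)
    also have "\<dots> = ((L x *v v) \<bullet> v) / (norm v)\<^sup>2"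
      by (simp add: \<xi>_def matrix_vector_mult_scaleR power2_eq_square)
    finally show ?thesis
      using False by (simp add: pos_le_divide_eq)
  qed simp
  show ?thesis
  proof (intro exI allI impI)
    fix x and v :: "real^'n" assume "\<bar>x\<bar> \<ge> max R1 (- R2)"
    then have "k \<le> ?m x"
      using R1[of x] R2[of x] by (cases "x \<ge> 0") auto
    then have "k * (norm v)\<^sup>2 \<le> ?m x * (norm v)\<^sup>2"
      by (intro mult_right_mono) auto
    with m[of x v] show "k * (norm v)\<^sup>2 \<le> (L x *v v) \<bullet> v"
      by simp
  qed
qed

abbreviation "gW x q \<equiv> grad (W x) q"

text \<open>The joint derivative, restricted to directions (0, h), is a linear functional of h; its
  coefficients in the standard basis form a gradient that depends continuously on (x, q). Uniqueness
  of derivatives identifies it with the definite description in \<open>grad\<close>.\<close>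

lemma W_gradient:
  shows W_derivative: "((W x) has_derivative (\<lambda>h. h \<bullet> gW x q)) (at q)"
    and gW_continuous: "continuous_on UNIV (\<lambda>(x, q). gW x q)"
    and W_continuous: "continuous_on UNIV (\<lambda>(x, q). W x q)"
proof -
  obtain D where D: "\<And>z. ((\<lambda>(x, q). W x q) has_derivative blinfun_apply (D z)) (at z)" "continuous_on UNIV D"
    using W_C1 unfolding C1_fun_def by blast
  define G where "G x q = (\<Sum>b\<in>Basis. blinfun_apply (D (x, q)) (0, b) *\<^sub>R b)" for x :: real and q :: "real^'n"
  have der: "((W x) has_derivative (\<lambda>h. h \<bullet> G x q)) (at q)" for x q
  proof -
    have "((\<lambda>q. (x, q)) has_derivative (\<lambda>h. (0, h))) (at q)"
      by (auto intro!: derivative_eq_intros)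
    from has_derivative_compose[OF this D(1)]
    have "((W x) has_derivative (\<lambda>h. blinfun_apply (D (x, q)) (0, h))) (at q)"
      by simp
    moreover have "blinfun_apply (D (x, q)) (0, h) = h \<bullet> G x q" for h
    proof -
      have lin: "linear (\<lambda>h. blinfun_apply (D (x, q)) (0, h))"
        using blinfun.scaleR_right[of "D (x, q)" _ "(0, _)"]
        by (intro linearI) (simp_all add: blinfun.add_right[symmetric])
      then have "blinfun_apply (D (x, q)) (0, \<Sum>b\<in>Basis. (h \<bullet> b) *\<^sub>R b) = (\<Sum>b\<in>Basis. (h \<bullet> b) *\<^sub>R blinfun_apply (D (x, q)) (0, b))"
        by (simp only: linear_sum[OF lin] linear_scale[OF lin])
      then show ?thesis
        by (simp add: euclidean_representation G_def inner_sum_right mult.commute)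
    qed
    ultimately show ?thesis
      by simp
  qed
  have gW_eq: "gW x q = G x q" for x q
    unfolding grad_def
  proof (rule the_equality)
    show "GDERIV (W x) q :> G x q"
      using der by (simp add: gderiv_def)
    fix D' assume "GDERIV (W x) q :> D'"
    then have "((W x) has_derivative (\<lambda>h. h \<bullet> D')) (at q)"
      by (simp add: gderiv_def)
    from has_derivative_unique[OF this der[of x q]] have "\<forall>h. h \<bullet> D' = h \<bullet> G x q"
      by (auto dest: fun_cong)
    then show "D' = G x q"
      unfolding vector_eq_ldot .
  qed
  show "((W x) has_derivative (\<lambda>h. h \<bullet> gW x q)) (at q)"
    using der by (simp add: gW_eq)
  show "continuous_on UNIV (\<lambda>(x, q). gW x q)"
    unfolding gW_eq G_def case_prod_unfold
    using D(2) by (auto intro!: continuous_intros)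
  show "continuous_on UNIV (\<lambda>(x, q). W x q)"
    by (intro continuous_at_imp_continuous_on ballI has_derivative_continuous[OF D(1)])
qed

lemma gW_continuous_comp [continuous_intros]:
  "continuous_on S f \<Longrightarrow> continuous_on S g \<Longrightarrow> continuous_on S (\<lambda>z. gW (f z) (g z))"
  using continuous_on_compose2[OF gW_continuous, of S "\<lambda>z. (f z, g z)"] by (auto intro: continuous_intros)

lemma W_continuous_comp [continuous_intros]:
  "continuous_on S f \<Longrightarrow> continuous_on S g \<Longrightarrow> continuous_on S (\<lambda>z. W (f z) (g z))"
  using continuous_on_compose2[OF W_continuous, of S "\<lambda>z. (f z, g z)"] by (auto intro: continuous_intros)

lemma gW_small:
  assumes "\<epsilon> > 0"
  obtains r where "r > 0" "\<And>x q. norm q \<le> r \<Longrightarrow> norm (gW x q) \<le> \<epsilon> * norm q"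
proof -
  have "\<forall>\<^sub>F q in at 0. (SUP x. ennreal (norm (gW x q) / norm q)) < ennreal \<epsilon>"
    using W_small assms by (intro order_tendstoD) auto
  then obtain r where r: "r > 0" "\<And>q. q \<noteq> 0 \<Longrightarrow> norm q < r \<Longrightarrow> (SUP x. ennreal (norm (gW x q) / norm q)) < ennreal \<epsilon>"
    unfolding eventually_at by (auto simp: dist_norm)
  have 1: "norm (gW x q) \<le> \<epsilon> * norm q" if "q \<noteq> 0" "norm q < r" for x q
  proof -
    have "ennreal (norm (gW x q) / norm q) \<le> (SUP x. ennreal (norm (gW x q) / norm q))"
      by (rule SUP_upper) auto
    also have "\<dots> < ennreal \<epsilon>"
      using r that by blast
    finally have "norm (gW x q) / norm q < \<epsilon>"
      by (simp add: ennreal_less_iff)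
    then show ?thesis
      using that by (simp add: pos_divide_less_eq)
  qed
  \<comment> \<open>The limit hypothesis excludes q = 0, where the quotient would be a division by
    zero; the value there follows from continuity of the gradient.\<close>
  have 2: "gW x 0 = 0" for x
  proof -
    have c: "continuous_on UNIV (\<lambda>q. gW x q)"
      by (intro continuous_intros)
    then have "((\<lambda>q. gW x q) \<longlongrightarrow> gW x 0) (at 0)"
      by (simp add: continuous_on_def)
    moreover have "((\<lambda>q. gW x q) \<longlongrightarrow> 0) (at 0)"
    proof (rule Lim_null_comparison)
      show "\<forall>\<^sub>F q in at 0. norm (gW x q) \<le> \<epsilon> * norm q"
        using r(1) 1 by (auto simp: eventually_at dist_norm)
      have "((\<lambda>q::real^'n. \<epsilon> * norm q) \<longlongrightarrow> \<epsilon> * norm (0::real^'n)) (at 0)"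
        by (intro tendsto_intros)
      then show "((\<lambda>q::real^'n. \<epsilon> * norm q) \<longlongrightarrow> 0) (at 0)"
        by simp
    qed
    ultimately show ?thesis
      using tendsto_unique[OF trivial_limit_at] by blast
  qed
  show ?thesis
  proof (rule that[of "r / 2"])
    show "norm (gW x q) \<le> \<epsilon> * norm q" if "norm q \<le> r / 2" for x q
      using 1[of q x] 2[of x] that r(1) by (cases "q = 0") auto
  qed (use r in auto)
qed

lemma W_ray:
  "((\<lambda>t. W x (t *\<^sub>R q)) has_real_derivative q \<bullet> gW x (t *\<^sub>R q)) (at t)"
proof -
  have "((\<lambda>t. t *\<^sub>R q) has_derivative (\<lambda>h. h *\<^sub>R q)) (at t)"
    by (auto intro!: derivative_eq_intros)
  from has_derivative_compose[OF this W_derivative]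
  show ?thesis
    by (simp add: has_field_derivative_def mult_commute_abs)
qed

text \<open>The mean value theorem on the ray from 0 to q, where W vanishes at the start and the
  gradient bound holds throughout.\<close>

lemma W_small_quadratic:
  assumes "\<epsilon> > 0" "\<And>x q. norm q \<le> r \<Longrightarrow> norm (gW x q) \<le> \<epsilon> * norm q" "norm q \<le> r"
  shows "W x q \<le> \<epsilon> * (norm q)\<^sup>2"
proof -
  obtain t where t: "0 < t" "t < 1" "W x (1 *\<^sub>R q) - W x (0 *\<^sub>R q) = (1 - 0) * (q \<bullet> gW x (t *\<^sub>R q))"
    using MVT2[of 0 1 "\<lambda>t. W x (t *\<^sub>R q)" "\<lambda>t. q \<bullet> gW x (t *\<^sub>R q)"] W_ray by auto
  have "norm (t *\<^sub>R q) \<le> norm q"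
    using t by (simp add: mult_left_le_one_le)
  have "W x q = q \<bullet> gW x (t *\<^sub>R q)"
    using t(3) W_zero by simp
  also have "\<dots> \<le> norm q * norm (gW x (t *\<^sub>R q))"
    by (rule norm_cauchy_schwarz)
  also have "\<dots> \<le> norm q * (\<epsilon> * norm (t *\<^sub>R q))"
    using assms \<open>norm (t *\<^sub>R q) \<le> norm q\<close> by (intro mult_left_mono assms(2)) auto
  also have "\<dots> \<le> norm q * (\<epsilon> * norm q)"
    using assms \<open>norm (t *\<^sub>R q) \<le> norm q\<close> by (intro mult_left_mono) auto
  finally show ?thesis
    by (simp add: power2_eq_square mult_ac)
qed

lemma W_pos: "q \<noteq> 0 \<Longrightarrow> W x q > 0"
  using \<mu>(2)[of q x] \<mu>(1) by (simp add: zero_less_mult_iff)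

lemma W_nonneg: "W x q \<ge> 0"
  using W_pos[of q x] W_zero[of x] by (cases "q = 0") auto

lemma W_AR: "\<mu> * W x q \<le> gW x q \<bullet> q"
  using \<mu>(2)[of q x] W_zero[of x] by (cases "q = 0") auto

text \<open>The superquadraticity condition says that \<tau>^(-\<mu>) W(x, \<tau> q) is
  nondecreasing in \<tau>; compare \<tau> = 1 with \<tau> = t.\<close>

lemma W_superquadratic:
  assumes "t \<ge> 1"
  shows "t powr \<mu> * W x q \<le> W x (t *\<^sub>R q)"
proof -
  define h where "h t = t powr (- \<mu>) * W x (t *\<^sub>R q)" for t
  have "h 1 \<le> h t"
  proof (rule DERIV_nonneg_imp_nondecreasing[OF assms])
    fix \<tau> :: real assume \<tau>: "1 \<le> \<tau>" "\<tau> \<le> t"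
    have "(h has_real_derivative (- \<mu> * \<tau> powr (- \<mu> - 1) * W x (\<tau> *\<^sub>R q) + (q \<bullet> gW x (\<tau> *\<^sub>R q)) * \<tau> powr (- \<mu>))) (at \<tau>)"
      unfolding h_def using \<tau> by (auto intro!: derivative_eq_intros W_ray)
    moreover have "- \<mu> * \<tau> powr (- \<mu> - 1) * W x (\<tau> *\<^sub>R q) + (q \<bullet> gW x (\<tau> *\<^sub>R q)) * \<tau> powr (- \<mu>)
      = \<tau> powr (- \<mu> - 1) * (gW x (\<tau> *\<^sub>R q) \<bullet> (\<tau> *\<^sub>R q) - \<mu> * W x (\<tau> *\<^sub>R q))"
    proof -
      have "\<tau> powr (- \<mu>) = \<tau> powr (- \<mu> - 1) * \<tau>"
        using \<tau> powr_add[of \<tau> "- \<mu> - 1" 1] by simp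
      then show ?thesis
        by (simp add: algebra_simps inner_commute)
    qed
    moreover have "0 \<le> \<tau> powr (- \<mu> - 1) * (gW x (\<tau> *\<^sub>R q) \<bullet> (\<tau> *\<^sub>R q) - \<mu> * W x (\<tau> *\<^sub>R q))"
      using W_AR[of x "\<tau> *\<^sub>R q"] by (intro mult_nonneg_nonneg) auto
    ultimately show "\<exists>y. (h has_real_derivative y) (at \<tau>) \<and> 0 \<le> y"
      by auto
  qed
  then have "W x q \<le> t powr (- \<mu>) * W x (t *\<^sub>R q)"
    by (simp add: h_def)
  then have "t powr \<mu> * W x q \<le> t powr \<mu> * (t powr (- \<mu>) * W x (t *\<^sub>R q))"
    by (intro mult_left_mono) auto
  also have "\<dots> = W x (t *\<^sub>R q)"
    using assms by (simp add: mult.assoc[symmetric] powr_add[symmetric])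
  finally show ?thesis .
qed

end

section \<open>Critical points on finite-dimensional spaces of test functions\<close>

context frac_hamiltonian
begin

definition form :: "(real \<Rightarrow> real^'n) \<Rightarrow> (real \<Rightarrow> real^'n) \<Rightarrow> real" where
  "form u v = frac_const s * (LINT (x, y)|lebesgue. (u x - u y) \<bullet> (v x - v y) / \<bar>x - y\<bar> powr (1 + 2 * s)) +
    (LINT x|lborel. (L x *v u x) \<bullet> v x)"

text \<open>The energy form after integration by parts. For a fixed test function it is continuous
  in the first argument for the supremum norm, which \<open>form\<close> does not reveal.\<close>

definition weak_form :: "(real \<Rightarrow> real^'n) \<Rightarrow> (real \<Rightarrow> real^'n) \<Rightarrow> real" where
  "weak_form u v = frac_const s * (LINT x|lborel. u x \<bullet> frac_lap s v x) + (LINT x|lborel. (L x *v u x) \<bullet> v x)"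

lemma c_pos: "frac_const s > 0"
  using frac_const_pos s' by blast

lemma L_inner_sym: "(L x *v u) \<bullet> v = (L x *v v) \<bullet> u"
  by (metis L_sym dot_lmul_matrix inner_commute transpose_matrix_vector)

lemma test_pair_integrable:
  assumes "u \<in> test_functions" "v \<in> test_functions"
  shows "integrable lebesgue (\<lambda>(x, y). (u x - u y) \<bullet> (v x - v y :: real^'n) / \<bar>x - y\<bar> powr (1 + 2 * s))"
  using assms by (intro gagliardo_product_integrable gagliardo_test_function s' test_function_measurable)

lemma continuous_test_integrable:
  assumes u: "continuous_on UNIV u" and v: "v \<in> test_functions"
  shows "integrable lborel (\<lambda>x. u x \<bullet> (v x :: real^'n))"
proof -
  obtain R where R: "\<And>x. \<bar>x\<bar> \<ge> R \<Longrightarrow> v x = 0"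
    using test_function_bounded_support[OF v] by blast
  show ?thesis
    by (rule continuous_bounded_support_integrable(1)[of _ R])
       (use R u test_function_continuous[OF v] in \<open>auto intro!: continuous_intros\<close>)
qed

lemma test_potential_integrable:
  assumes "u \<in> test_functions" "v \<in> test_functions"
  shows "integrable lborel (\<lambda>x. (L x *v u x) \<bullet> v x)"
  using assms by (intro continuous_test_integrable continuous_on_matrix_vector_mult L_cont test_function_continuous)

lemma form_add_left:
  assumes u: "u \<in> test_functions" and v: "v \<in> test_functions" and w: "w \<in> test_functions"
  shows "form (\<lambda>x. u x + \<tau> *\<^sub>R v x) w = form u w + \<tau> * form v w"
proof -
  have "(\<lambda>(x, y). ((u x + \<tau> *\<^sub>R v x) - (u y + \<tau> *\<^sub>R v y)) \<bullet> (w x - w y) / \<bar>x - y\<bar> powr (1 + 2 * s))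
    = (\<lambda>z. (case z of (x, y) \<Rightarrow> (u x - u y) \<bullet> (w x - w y) / \<bar>x - y\<bar> powr (1 + 2 * s))
      + \<tau> * (case z of (x, y) \<Rightarrow> (v x - v y) \<bullet> (w x - w y) / \<bar>x - y\<bar> powr (1 + 2 * s)))"
    by (auto simp: inner_diff_left inner_add_left algebra_simps add_divide_distrib diff_divide_distrib)
  then have "(LINT (x, y)|lebesgue. ((u x + \<tau> *\<^sub>R v x) - (u y + \<tau> *\<^sub>R v y)) \<bullet> (w x - w y) / \<bar>x - y\<bar> powr (1 + 2 * s))
    = (LINT (x, y)|lebesgue. (u x - u y) \<bullet> (w x - w y) / \<bar>x - y\<bar> powr (1 + 2 * s))
     + \<tau> * (LINT (x, y)|lebesgue. (v x - v y) \<bullet> (w x - w y) / \<bar>x - y\<bar> powr (1 + 2 * s))"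
    using test_pair_integrable[OF u w] test_pair_integrable[OF v w] by simp
  moreover have "(LINT x|lborel. (L x *v (u x + \<tau> *\<^sub>R v x)) \<bullet> w x)
    = (LINT x|lborel. (L x *v u x) \<bullet> w x) + \<tau> * (LINT x|lborel. (L x *v v x) \<bullet> w x)"
    using test_potential_integrable[OF u w] test_potential_integrable[OF v w]
    by (simp add: matrix_vector_right_distrib matrix_vector_mult_scaleR inner_add_left)
  ultimately show ?thesis
    by (simp add: form_def algebra_simps)
qed

lemma form_commute: "form u v = form v u"
  by (simp add: form_def inner_commute[of "u _ - u _"] L_inner_sym[of _ "u _"])

lemma form_scaleR_left:
  assumes v: "v \<in> test_functions" and w: "w \<in> test_functions"
  shows "form (\<lambda>x. \<tau> *\<^sub>R v x) w = \<tau> * form v w"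
proof -
  have z: "(\<lambda>x. 0) \<in> test_functions"
    by (rule bounded_support_imp_test_function[OF smooth_fun_const]) auto
  show ?thesis
    using form_add_left[OF z v w, of \<tau>] by (simp add: form_def case_prod_unfold)
qed

lemma form_scaleR:
  assumes u: "u \<in> test_functions"
  shows "form (\<lambda>x. \<tau> *\<^sub>R u x) (\<lambda>x. \<tau> *\<^sub>R u x) = \<tau>\<^sup>2 * form u u"
proof -
  have t: "(\<lambda>x. \<tau> *\<^sub>R u x) \<in> test_functions"
    using u by (rule test_function_scaleR)
  have "form (\<lambda>x. \<tau> *\<^sub>R u x) (\<lambda>x. \<tau> *\<^sub>R u x) = \<tau> * form u (\<lambda>x. \<tau> *\<^sub>R u x)"
    by (rule form_scaleR_left[OF u t])
  also have "form u (\<lambda>x. \<tau> *\<^sub>R u x) = \<tau> * form u u"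
    by (subst form_commute) (rule form_scaleR_left[OF u u])
  finally show ?thesis
    by (simp add: power2_eq_square)
qed

lemma form_zero_left: "form (apply_bcontfun 0) v = 0"
  by (simp add: form_def case_prod_unfold)

lemma form_expand:
  assumes "u \<in> test_functions" "v \<in> test_functions"
  shows "form (\<lambda>x. u x + \<tau> *\<^sub>R v x) (\<lambda>x. u x + \<tau> *\<^sub>R v x) = form u u + 2 * \<tau> * form u v + \<tau>\<^sup>2 * form v v"
proof -
  let ?w = "\<lambda>x. u x + \<tau> *\<^sub>R v x"
  have w: "?w \<in> test_functions"
    using assms by (intro test_function_add test_function_scaleR)
  have "form ?w ?w = form u ?w + \<tau> * form v ?w"
    by (rule form_add_left[OF assms w])
  also have "form u ?w = form u u + \<tau> * form v u"
    by (subst form_commute) (rule form_add_left[OF assms assms(1)])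
  also have "form v ?w = form u v + \<tau> * form v v"
    by (subst form_commute) (rule form_add_left[OF assms assms(2)])
  finally show ?thesis
    by (simp add: form_commute[of v u] power2_eq_square algebra_simps)
qed

lemma
  assumes u: "u \<in> test_functions"
  shows form_nonneg: "form u u \<ge> 0"
    and potential_le_form: "(LINT x|lborel. (L x *v u x) \<bullet> u x) \<le> form u u"
    and gagliardo_le_form: "gagliardo s u \<le> ennreal (form u u / frac_const s)"
proof -
  let ?A = "LINT (x, y)|lebesgue. (u x - u y) \<bullet> (u x - u y) / \<bar>x - y\<bar> powr (1 + 2 * s)"
  let ?B = "LINT x|lborel. (L x *v u x) \<bullet> u x"
  have A0: "?A \<ge> 0"
    by (intro integral_nonneg_AE AE_I2) auto
  have B0: "?B \<ge> 0"
    using L_nonneg by (intro integral_nonneg_AE AE_I2) auto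
  have A: "gagliardo s u = ennreal ?A"
    unfolding gagliardo_def using nn_integral_eq_integral[OF test_pair_integrable[OF u u]]
    by (simp add: case_prod_unfold power2_norm_eq_inner)
  show "form u u \<ge> 0" "?B \<le> form u u"
    using A0 B0 c_pos by (simp_all add: form_def)
  have "?A \<le> form u u / frac_const s"
    using B0 c_pos by (simp add: form_def pos_le_divide_eq mult.commute)
  then show "gagliardo s u \<le> ennreal (form u u / frac_const s)"
    unfolding A by (rule ennreal_leI)
qed

lemma L2_le_form:
  assumes u: "u \<in> test_functions"
  shows "\<alpha> * (LINT x|lborel. (norm (u x))\<^sup>2) \<le> form u u"
proof -
  have i: "integrable lborel (\<lambda>x. (norm (u x))\<^sup>2)"
    using continuous_test_integrable[OF test_function_continuous[OF u] u] by (simp add: power2_norm_eq_inner)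
  have "\<alpha> * (LINT x|lborel. (norm (u x))\<^sup>2) = (LINT x|lborel. \<alpha> * (norm (u x))\<^sup>2)"
    by simp
  also have "\<dots> \<le> (LINT x|lborel. (L x *v u x) \<bullet> u x)"
    using i test_potential_integrable[OF u u] \<alpha>(2) by (intro integral_mono) auto
  also have "\<dots> \<le> form u u"
    by (rule potential_le_form[OF u])
  finally show ?thesis .
qed

lemma form_eq_weak_form:
  assumes "u \<in> borel_measurable borel" "\<And>x. norm (u x) \<le> M" "gagliardo s u < \<infinity>" "v \<in> test_functions"
  shows "form u v = weak_form u v"
  using weak_frac_lap(2)[OF s' assms(4,1,2) gagliardo_product_integrable[OF assms(1) test_function_measurable[OF assms(4)] assms(3) gagliardo_test_function[OF s' assms(4)]]]
  by (simp add: form_def weak_form_def)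

lemma form_eq_weak_form_test:
  assumes u: "u \<in> test_functions" and v: "v \<in> test_functions"
  shows "form u v = weak_form u v"
proof -
  obtain M where "\<And>x. norm (u x) \<le> M"
    using test_function_bounded[OF u] by blast
  then show ?thesis
    using form_eq_weak_form[OF test_function_measurable[OF u] _ gagliardo_test_function[OF s' u] v] by blast
qed

text \<open>The fractional Laplacian of v is integrable, so the nonlocal part is Lipschitz in u; the
  potential part lives on the bounded support of v. This makes each weak equation a closed
  condition.\<close>

lemma weak_form_continuous:
  fixes v :: "real \<Rightarrow> real^'n"
  assumes v: "v \<in> test_functions"
  shows "continuous_on UNIV (\<lambda>u :: real \<Rightarrow>\<^sub>C (real^'n). weak_form u v)"
proof -
  obtain R where R: "\<And>x. \<bar>x\<bar> \<ge> R \<Longrightarrow> v x = 0"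
    using test_function_bounded_support[OF v] by blast
  let ?g = "frac_lap s v"
  have g: "integrable lborel ?g"
    using frac_lap_integrable[OF s' v] .
  then have [measurable]: "?g \<in> borel_measurable borel"
    using borel_measurable_integrable by fastforce
  have ui: "integrable lborel (\<lambda>x. apply_bcontfun u x \<bullet> ?g x)" for u :: "real \<Rightarrow>\<^sub>C (real^'n)"
  proof (rule Bochner_Integration.integrable_bound)
    show "integrable lborel (\<lambda>x. norm u * norm (?g x))"
      using g by simp
    have "\<bar>apply_bcontfun u x \<bullet> ?g x\<bar> \<le> norm u * norm (?g x)" for x
      using Cauchy_Schwarz_ineq2[of "apply_bcontfun u x" "?g x"] mult_right_mono[OF norm_bounded[of u x], of "norm (?g x)"] by simp
    then show "AE x in lborel. norm (apply_bcontfun u x \<bullet> ?g x) \<le> norm (norm u * norm (?g x))"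
      by (auto simp: abs_mult)
    have [measurable]: "apply_bcontfun u \<in> borel_measurable borel"
      by (intro borel_measurable_continuous_onI) simp
    show "(\<lambda>x. apply_bcontfun u x \<bullet> ?g x) \<in> borel_measurable lborel"
      by measurable
  qed
  have "(LINT x|lborel. norm (?g x))-lipschitz_on UNIV (\<lambda>u :: real \<Rightarrow>\<^sub>C (real^'n). LINT x|lborel. apply_bcontfun u x \<bullet> ?g x)"
  proof (rule lipschitz_onI)
    fix u w :: "real \<Rightarrow>\<^sub>C (real^'n)"
    have "dist (LINT x|lborel. apply_bcontfun u x \<bullet> ?g x) (LINT x|lborel. apply_bcontfun w x \<bullet> ?g x)
      = norm (LINT x|lborel. apply_bcontfun (u - w) x \<bullet> ?g x)"
      using ui[of u] ui[of w] by (simp add: dist_norm inner_diff_left)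
    also have "\<dots> \<le> (LINT x|lborel. norm (u - w) * norm (?g x))"
    proof (rule Bochner_Integration.integral_norm_bound_integral)
      show "norm (apply_bcontfun (u - w) x \<bullet> ?g x) \<le> norm (u - w) * norm (?g x)" for x
        using Cauchy_Schwarz_ineq2[of "apply_bcontfun (u - w) x" "?g x"]
          mult_right_mono[OF norm_bounded[of "u - w" x], of "norm (?g x)"] by simp
    qed (use ui[of "u - w"] g in auto)
    also have "\<dots> = (LINT x|lborel. norm (?g x)) * dist u w"
      by (simp add: dist_norm)
    finally show "dist (LINT x|lborel. apply_bcontfun u x \<bullet> ?g x) (LINT x|lborel. apply_bcontfun w x \<bullet> ?g x)
      \<le> (LINT x|lborel. norm (?g x)) * dist u w" .
  qed (intro integral_nonneg_AE, auto)
  then have 1: "continuous_on UNIV (\<lambda>u :: real \<Rightarrow>\<^sub>C (real^'n). LINT x|lborel. apply_bcontfun u x \<bullet> ?g x)"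
    by (rule lipschitz_on_continuous_on)
  have 2: "continuous_on UNIV (\<lambda>u :: real \<Rightarrow>\<^sub>C (real^'n). LINT x|lborel. (L x *v apply_bcontfun u x) \<bullet> v x)"
  proof -
    have "continuous_on UNIV (\<lambda>(x, q). (L x *v q) \<bullet> v x)"
      unfolding case_prod_unfold
      by (intro continuous_intros continuous_on_compose2[OF L_cont] continuous_on_compose2[OF test_function_continuous[OF v]]) auto
    from continuous_on_integral_superposition[OF this, of R]
    show ?thesis
      using R by (subst integral_cutoff[of R]) auto
  qed
  show ?thesis
    unfolding weak_form_def by (intro continuous_intros 1 2)
qed

lemma nonlinearity_continuous:
  fixes v :: "real \<Rightarrow> real^'n"
  assumes v: "v \<in> test_functions"
  shows "continuous_on UNIV (\<lambda>u :: real \<Rightarrow>\<^sub>C (real^'n). LINT x|lborel. gW x (apply_bcontfun u x) \<bullet> v x)"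
proof -
  obtain R where R: "\<And>x. \<bar>x\<bar> \<ge> R \<Longrightarrow> v x = 0"
    using test_function_bounded_support[OF v] by blast
  have "continuous_on UNIV (\<lambda>(x, q). gW x q \<bullet> v x)"
    unfolding case_prod_unfold
    by (intro continuous_intros continuous_on_compose2[OF test_function_continuous[OF v]]) auto
  from continuous_on_integral_superposition[OF this, of R]
  show ?thesis
    using R by (subst integral_cutoff[of R]) auto
qed

lemma W_test_integrable:
  assumes u: "u \<in> test_functions"
  shows "integrable lborel (\<lambda>x. W x (u x))"
proof -
  obtain R where R: "\<And>x. \<bar>x\<bar> \<ge> R \<Longrightarrow> u x = 0"
    using test_function_bounded_support[OF u] by blast
  show ?thesis
    by (rule continuous_bounded_support_integrable(1)[of _ R])
       (use R W_zero test_function_continuous[OF u] in \<open>auto intro!: continuous_intros\<close>)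
qed

lemma gW_test_integrable:
  assumes u: "u \<in> test_functions" and v: "v \<in> test_functions"
  shows "integrable lborel (\<lambda>x. gW x (u x) \<bullet> v x)"
  by (intro continuous_test_integrable v gW_continuous_comp continuous_on_id test_function_continuous[OF u])

text \<open>The Hoelder and potential estimates give the bound for energy at most 1, and homogeneity
  extends it. The numerator 2 in the constant makes the inequality required by
  \<open>holder_gagliardo\<close> strict.\<close>

lemma test_sup_bound:
  obtains C where "C > 0" "\<And>u x. u \<in> test_functions \<Longrightarrow> norm (u x) \<le> C * sqrt (form u u)"
proof -
  let ?C = "holder_const s * sqrt (2 / frac_const s) + sqrt (2 / \<alpha>)"
  have one: "norm (u x) \<le> ?C" if u: "u \<in> test_functions" "form u u \<le> 1" for u x
  proof -
    have "gagliardo s u \<le> ennreal (1 / frac_const s)"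
      by (rule order_trans[OF gagliardo_le_form[OF u(1)]]) (use u(2) c_pos in \<open>auto intro!: ennreal_leI divide_right_mono\<close>)
    also have "\<dots> < ennreal (2 / frac_const s)"
      using c_pos by (intro ennreal_lessI) (auto intro: divide_strict_right_mono)
    finally have S: "gagliardo s u < ennreal (2 / frac_const s)" .
    obtain M where M: "\<And>x. norm (u x) \<le> M"
      using test_function_bounded[OF u(1)] by blast
    obtain M' where M': "\<And>x y. norm (u x - u y) \<le> M' * \<bar>x - y\<bar>"
      using test_function_Lipschitz[OF u(1)] by blast
    have "norm (u x) \<le> holder_const s * sqrt (2 / frac_const s) + sqrt ((1 + 1) / \<alpha>)"
    proof (rule sup_bound_energy[where g = "\<lambda>x. (L x *v u x) \<bullet> u x"])
      show "(\<integral>\<^sup>+x. ennreal ((L x *v u x) \<bullet> u x) \<partial>lebesgue) \<le> ennreal 1"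
        using nn_integral_eq_integral[OF test_potential_integrable[OF u(1) u(1)]] L_nonneg
          potential_le_form[OF u(1)] u(2)
        by (simp add: nn_integral_completion)
      show "norm (u x - u y) \<le> holder_const s * sqrt (2 / frac_const s) * \<bar>x - y\<bar> powr (s - 1 / 2)" for x y
        by (rule holder_gagliardo[OF s S M M'])
    qed (use \<alpha> s c_pos holder_const_pos[of s] in auto)
    then show ?thesis
      by simp
  qed
  show ?thesis
  proof (rule that)
    show "?C > 0"
      using \<alpha> c_pos holder_const_pos[of s] by (intro add_pos_pos) auto
    fix u :: "real \<Rightarrow> real^'n" and x
    assume u: "u \<in> test_functions"
    show "norm (u x) \<le> ?C * sqrt (form u u)"
    proof (cases "form u u = 0")
      case True
      \<comment> \<open>Without energy no rescaling to energy 1 is possible; instead all multiples n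
        u still have energy 0, which forces u to vanish.\<close>
      have *: "n * norm (u x) \<le> ?C" for n :: nat
      proof -
        have t: "(\<lambda>x. real n *\<^sub>R u x) \<in> test_functions"
          using u by (rule test_function_scaleR)
        have "form (\<lambda>x. real n *\<^sub>R u x) (\<lambda>x. real n *\<^sub>R u x) = 0"
          using True form_scaleR[OF u] by simp
        then show ?thesis
          using one[OF t, of x] by simp
      qed
      have "norm (u x) = 0"
      proof (rule ccontr)
        assume "norm (u x) \<noteq> 0"
        then obtain n :: nat where "?C < n * norm (u x)"
          using reals_Archimedean3[of "norm (u x)"] by auto
        with * show False
          by (meson not_less)
      qed
      then show ?thesis
        using True by simp
    next
      case False
      define E where "E = form u u"
      have E: "E > 0"
        using False form_nonneg[OF u] by (simp add: E_def)
      let ?w = "\<lambda>x. (1 / sqrt E) *\<^sub>R u x"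
      have w: "?w \<in> test_functions"
        using u by (rule test_function_scaleR)
      have "form ?w ?w = (1 / sqrt E)\<^sup>2 * E"
        unfolding E_def by (rule form_scaleR[OF u])
      also have "\<dots> = 1"
        using E by (simp add: power_divide)
      finally have "norm (?w x) \<le> ?C"
        using one[OF w, of x] by simp
      then show ?thesis
        using E by (simp add: E_def[symmetric] pos_divide_le_eq)
    qed
  qed
qed

text \<open>Continuity in one argument with the other fixed does not give continuity of the
  quadratic form. On a finite span the increment is expanded in bounded coordinates, reducing its
  energy to finitely many values \<open>form w b\<close> with b fixed.\<close>

lemma form_continuous_on_span:
  fixes B :: "(real \<Rightarrow>\<^sub>C (real^'n)) set"
  assumes fin: "finite B" and B: "B \<subseteq> test_bcontfuns"
  shows "continuous_on (span B) (\<lambda>u. form u u)"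
    "\<And>v. v \<in> test_functions \<Longrightarrow> continuous_on (span B) (\<lambda>u. form u v)"
proof -
  have test: "apply_bcontfun u \<in> test_functions" if "u \<in> span B" for u
    using that span_minimal[OF B subspace_test_bcontfuns] by (auto simp: test_bcontfuns_def)
  show c: "continuous_on (span B) (\<lambda>u. form u v)" if "v \<in> test_functions" for v
  proof (subst continuous_on_cong[OF refl])
    show "continuous_on (span B) (\<lambda>u. weak_form u v)"
      using weak_form_continuous[OF that] continuous_on_subset by blast
  qed (use form_eq_weak_form_test test that in auto)
  obtain C where C': "C \<ge> 0 \<and> (\<forall>u\<in>span B. \<exists>c. u = (\<Sum>b\<in>B. c b *\<^sub>R b) \<and> (\<forall>b\<in>B. \<bar>c b\<bar> \<le> C * norm u))"
    using span_coordinates_bounded[OF fin] by (rule exE)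
  note C = conjunct1[OF C'] bspec[OF conjunct2[OF C']]
  have sum_left: "form (apply_bcontfun (\<Sum>b\<in>A. c b *\<^sub>R b)) (apply_bcontfun w) = (\<Sum>b\<in>A. c b * form (apply_bcontfun b) (apply_bcontfun w))"
    if "finite A" "A \<subseteq> B" "w \<in> span B" for A c w
    using that
  proof (induction A)
    case empty
    then show ?case
      by (simp add: form_def case_prod_unfold)
  next
    case (insert b A)
    have b: "apply_bcontfun b \<in> test_functions"
      using insert.prems B by (auto simp: test_bcontfuns_def)
    have A: "apply_bcontfun (\<Sum>b\<in>A. c b *\<^sub>R b) \<in> test_functions"
      using insert.prems by (intro test span_sum span_scale span_base) auto
    have eq: "apply_bcontfun ((\<Sum>b\<in>A. c b *\<^sub>R b) + c b *\<^sub>R b) = (\<lambda>x. apply_bcontfun (\<Sum>b\<in>A. c b *\<^sub>R b) x + c b *\<^sub>R apply_bcontfun b x)"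
      by auto
    have "form (apply_bcontfun ((\<Sum>b\<in>A. c b *\<^sub>R b) + c b *\<^sub>R b)) (apply_bcontfun w)
      = form (apply_bcontfun (\<Sum>b\<in>A. c b *\<^sub>R b)) (apply_bcontfun w) + c b * form (apply_bcontfun b) (apply_bcontfun w)"
      unfolding eq by (rule form_add_left[OF A b test[OF insert.prems(2)]])
    then show ?case
      using insert by (simp add: add.commute)
  qed
  show "continuous_on (span B) (\<lambda>u. form u u)"
  proof (unfold continuous_on_sequentially, intro allI ballI impI, unfold o_def, elim conjE)
    fix u and v :: "nat \<Rightarrow> real \<Rightarrow>\<^sub>C (real^'n)"
    assume u: "u \<in> span B" and v: "\<forall>n. v n \<in> span B" "v \<longlonglongrightarrow> u"
    have w: "v n - u \<in> span B" for n
      using u v by (simp add: span_diff)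
    have form_w: "(\<lambda>n. form (v n - u) b) \<longlonglongrightarrow> 0" if "b \<in> test_functions" for b
    proof -
      have "(\<lambda>n. v n - u) \<longlonglongrightarrow> 0"
        using v(2) LIM_zero by blast
      then have "(\<lambda>n. form (v n - u) b) \<longlonglongrightarrow> form (0 :: real \<Rightarrow>\<^sub>C (real^'n)) b"
        using continuous_on_tendsto_compose[OF c[OF that], of "\<lambda>n. v n - u" 0 sequentially] w span_zero by auto
      then show ?thesis
        by (simp only: form_zero_left)
    qed
    have bt: "apply_bcontfun b \<in> test_functions" if "b \<in> B" for b
      using that B by (auto simp: test_bcontfuns_def)
    have form_ww: "(\<lambda>n. form (v n - u) (v n - u)) \<longlonglongrightarrow> 0"
    proof (rule Lim_null_comparison)
      show "\<forall>\<^sub>F n in sequentially. norm (form (v n - u) (v n - u)) \<le> (\<Sum>b\<in>B. (C * norm (v n - u)) * \<bar>form (v n - u) (apply_bcontfun b)\<bar>)"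
      proof (intro always_eventually allI)
        fix n
        obtain d where d: "v n - u = (\<Sum>b\<in>B. d b *\<^sub>R b) \<and> (\<forall>b\<in>B. \<bar>d b\<bar> \<le> C * norm (v n - u))"
          using C(2)[OF w[of n]] by (rule exE)
        have "form (v n - u) (v n - u) = form (apply_bcontfun (\<Sum>b\<in>B. d b *\<^sub>R b)) (v n - u)"
          by (rule arg_cong[where f = "\<lambda>w. form (apply_bcontfun w) (v n - u)"]) (rule conjunct1[OF d])
        also have "\<dots> = (\<Sum>b\<in>B. d b * form (apply_bcontfun b) (v n - u))"
          by (rule sum_left[OF fin _ w]) auto
        also have "norm \<dots> \<le> (\<Sum>b\<in>B. norm (d b * form (apply_bcontfun b) (v n - u)))"
          by (rule norm_sum)
        also have "\<dots> \<le> (\<Sum>b\<in>B. (C * norm (v n - u)) * \<bar>form (v n - u) (apply_bcontfun b)\<bar>)"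
        proof (rule sum_mono)
          fix b assume "b \<in> B"
          then have "\<bar>d b\<bar> * \<bar>form (v n - u) (apply_bcontfun b)\<bar> \<le> (C * norm (v n - u)) * \<bar>form (v n - u) (apply_bcontfun b)\<bar>"
            using d by (intro mult_right_mono) auto
          then show "norm (d b * form (apply_bcontfun b) (v n - u)) \<le> (C * norm (v n - u)) * \<bar>form (v n - u) (apply_bcontfun b)\<bar>"
            by (simp only: abs_mult real_norm_def form_commute[of "apply_bcontfun b"])
        qed
        finally show "norm (form (v n - u) (v n - u)) \<le> (\<Sum>b\<in>B. (C * norm (v n - u)) * \<bar>form (v n - u) (apply_bcontfun b)\<bar>)" .
      qed
      have "(\<lambda>n. norm (v n - u)) \<longlonglongrightarrow> 0"
        using v(2) LIM_zero tendsto_norm_zero by blast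
      then have "(\<lambda>n. \<Sum>b\<in>B. (C * norm (v n - u)) * \<bar>form (v n - u) (apply_bcontfun b)\<bar>) \<longlonglongrightarrow> (\<Sum>b\<in>B. (C * 0) * \<bar>0\<bar>)"
        by (intro tendsto_sum tendsto_mult tendsto_const tendsto_rabs form_w bt)
      then show "(\<lambda>n. \<Sum>b\<in>B. (C * norm (v n - u)) * \<bar>form (v n - u) (apply_bcontfun b)\<bar>) \<longlonglongrightarrow> 0"
        by simp
    qed
    have "form (v n) (v n) = form u u + 2 * 1 * form (v n - u) u + 1\<^sup>2 * form (v n - u) (v n - u)" for n
      using form_expand[OF test[OF u] test[OF w[of n]], of 1] by (simp add: form_commute[of "apply_bcontfun u" "\<lambda>x. apply_bcontfun (v n) x - apply_bcontfun u x"])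
    moreover have "(\<lambda>n. form u u + 2 * 1 * form (v n - u) u + 1\<^sup>2 * form (v n - u) (v n - u)) \<longlonglongrightarrow> form u u + 2 * 1 * 0 + 1\<^sup>2 * 0"
      by (intro tendsto_intros form_w form_ww test u)
    ultimately show "(\<lambda>n. form (v n) (v n)) \<longlonglongrightarrow> form u u"
      by simp
  qed
qed

end

section \<open>The action functional and its mountain pass geometry\<close>

context frac_hamiltonian
begin

definition action :: "(real \<Rightarrow> real^'n) \<Rightarrow> real" where
  "action u = 1 / 2 * form u u - (LINT x|lborel. W x (u x))"

definition action_deriv :: "(real \<Rightarrow> real^'n) \<Rightarrow> (real \<Rightarrow> real^'n) \<Rightarrow> real" where
  "action_deriv u v = form u v - (LINT x|lborel. gW x (u x) \<bullet> v x)"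

text \<open>The quadratic part is an explicit polynomial in \<tau>. For the W part the supports
  confine the integral to a fixed compact interval, where the Leibniz rule applies.\<close>

lemma action_has_derivative:
  assumes u: "u \<in> test_functions" and v: "v \<in> test_functions"
  shows "((\<lambda>\<tau>. action (\<lambda>x. u x + \<tau> *\<^sub>R v x)) has_real_derivative action_deriv (\<lambda>x. u x + \<tau> *\<^sub>R v x) v) (at \<tau>)"
proof -
  obtain R1 where R1: "\<And>x. \<bar>x\<bar> \<ge> R1 \<Longrightarrow> u x = 0"
    using test_function_bounded_support[OF u] by blast
  obtain R2 where R2: "\<And>x. \<bar>x\<bar> \<ge> R2 \<Longrightarrow> v x = 0"
    using test_function_bounded_support[OF v] by blast
  define R where "R = max R1 R2"
  have R: "u x = 0" "v x = 0" if "\<bar>x\<bar> \<ge> R" for x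
    using R1 R2 that by (auto simp: R_def)
  note cont = test_function_continuous[OF u] test_function_continuous[OF v]
  have cont': "continuous_on S u" "continuous_on S v" for S
    using cont continuous_on_subset by blast+
  define \<Phi> where "\<Phi> \<tau> x = W x (u x + \<tau> *\<^sub>R v x)" for \<tau> x
  define \<Phi>' where "\<Phi>' \<tau> x = gW x (u x + \<tau> *\<^sub>R v x) \<bullet> v x" for \<tau> x
  have I: "(LINT x|lborel. \<Phi> \<tau> x) = integral (cbox (-R) R) (\<Phi> \<tau>)"
    "(LINT x|lborel. \<Phi>' \<tau> x) = integral (cbox (-R) R) (\<Phi>' \<tau>)" for \<tau>
    unfolding cbox_interval \<Phi>_def \<Phi>'_def
    by (rule continuous_bounded_support_integrable(2);
        use R W_zero cont in \<open>auto intro!: continuous_intros\<close>)+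
  have "((\<lambda>\<tau>. integral (cbox (-R) R) (\<Phi> \<tau>)) has_field_derivative integral (cbox (-R) R) (\<Phi>' \<tau>)) (at \<tau> within UNIV)"
  proof (rule leibniz_rule_field_derivative)
    fix \<tau> x :: real
    have "((\<lambda>\<tau>. u x + \<tau> *\<^sub>R v x) has_derivative (\<lambda>h. h *\<^sub>R v x)) (at \<tau>)"
      by (auto intro!: derivative_eq_intros)
    from has_derivative_compose[OF this W_derivative]
    show "((\<lambda>\<tau>. \<Phi> \<tau> x) has_field_derivative \<Phi>' \<tau> x) (at \<tau> within UNIV)"
      by (simp add: has_field_derivative_def \<Phi>_def \<Phi>'_def inner_commute mult_commute_abs)
  next
    fix \<tau> :: real
    show "\<Phi> \<tau> integrable_on cbox (-R) R"
      unfolding \<Phi>_def by (intro integrable_continuous continuous_intros cont')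
  next
    show "continuous_on (UNIV \<times> cbox (-R) R) (\<lambda>(\<tau>, x). \<Phi>' \<tau> x)"
      unfolding \<Phi>'_def case_prod_unfold
      by (intro continuous_intros continuous_on_compose2[OF cont(1)] continuous_on_compose2[OF cont(2)]) auto
  qed auto
  then have 1: "((\<lambda>\<tau>. LINT x|lborel. \<Phi> \<tau> x) has_real_derivative (LINT x|lborel. \<Phi>' \<tau> x)) (at \<tau>)"
    by (simp only: I)
  have "((\<lambda>\<tau>. 1 / 2 * (form u u + 2 * \<tau> * form u v + \<tau>\<^sup>2 * form v v) - (LINT x|lborel. \<Phi> \<tau> x))
    has_real_derivative (form u v + \<tau> * form v v) - (LINT x|lborel. \<Phi>' \<tau> x)) (at \<tau>)"
    by (auto intro!: derivative_eq_intros 1)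
  then show ?thesis
    unfolding action_def action_deriv_def form_expand[OF u v] form_add_left[OF u v v] \<Phi>_def \<Phi>'_def .
qed

lemma span_test:
  fixes B :: "(real \<Rightarrow>\<^sub>C (real^'n)) set"
  assumes "B \<subseteq> test_bcontfuns" "u \<in> span B"
  shows "apply_bcontfun u \<in> test_functions"
  using assms span_minimal[OF assms(1) subspace_test_bcontfuns] by (auto simp: test_bcontfuns_def)

lemma integral_W_pos:
  assumes u: "u \<in> test_functions" and "u x0 \<noteq> 0"
  shows "(LINT x|lborel. W x (u x)) > 0"
proof -
  obtain R where R: "R > 0" "\<And>x. \<bar>x\<bar> \<ge> R \<Longrightarrow> u x = 0"
    using test_function_bounded_support[OF u] by blast
  have c: "continuous_on UNIV (\<lambda>x. W x (u x))"
    by (intro continuous_intros test_function_continuous[OF u])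
  have eq: "(LINT x|lborel. W x (u x)) = integral {-R..R} (\<lambda>x. W x (u x))"
    by (rule continuous_bounded_support_integrable(2)[OF c]) (use R W_zero in auto)
  have "x0 \<in> {-R..R}"
    using R(2)[of x0] assms(2) by (cases "\<bar>x0\<bar> \<ge> R") auto
  then have "integral {-R..R} (\<lambda>x. W x (u x)) \<noteq> 0"
    using integral_eq_0_iff[of "-R" R "\<lambda>x. W x (u x)"] continuous_on_subset[OF c subset_UNIV] W_nonneg R(1)
      W_pos[OF assms(2), of x0] by force
  moreover have "(LINT x|lborel. W x (u x)) \<ge> 0"
    using W_nonneg by (intro integral_nonneg_AE) auto
  ultimately show ?thesis
    using eq by simp
qed

lemma action_continuous_on_span:
  fixes B :: "(real \<Rightarrow>\<^sub>C (real^'n)) set"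
  assumes fin: "finite B" and B: "B \<subseteq> test_bcontfuns"
  shows "continuous_on (span B) (\<lambda>u. LINT x|lborel. W x (apply_bcontfun u x))"
    "continuous_on (span B) (\<lambda>u. action u)"
proof -
  obtain R where R: "\<And>u x. u \<in> span B \<Longrightarrow> \<bar>x\<bar> \<ge> R \<Longrightarrow> apply_bcontfun u x = 0"
    using common_support[OF fin B] by metis
  have "continuous_on (span B) (\<lambda>u. LINT x|lborel. indicator {-R..R} x * W x (apply_bcontfun u x))"
    using continuous_on_integral_superposition[OF W_continuous, of R] continuous_on_subset by blast
  then show 1: "continuous_on (span B) (\<lambda>u. LINT x|lborel. W x (apply_bcontfun u x))"
    by (rule continuous_on_eq) (use R W_zero in \<open>auto intro!: integral_cutoff[symmetric]\<close>)
  show "continuous_on (span B) (\<lambda>u. action u)"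
    unfolding action_def by (intro continuous_intros 1 form_continuous_on_span(1)[OF fin B])
qed

text \<open>On the compact unit sphere of the span the integral of W has a positive minimum w and
  the form a maximum c. Along rays the former grows at least like t^\<mu> w, the latter only like
  t^2 c.\<close>

lemma action_negative_far:
  fixes B :: "(real \<Rightarrow>\<^sub>C (real^'n)) set"
  assumes fin: "finite B" and B: "B \<subseteq> test_bcontfuns"
  obtains T where "T \<ge> 1" "\<And>u. u \<in> span B \<Longrightarrow> norm u \<ge> T \<Longrightarrow> action u < 0"
proof -
  define S where "S = {u \<in> span B. norm u = 1}"
  have "S = (span B \<inter> cball 0 1) \<inter> {u. norm u = 1}"
    by (auto simp: S_def)
  moreover have "closed {u :: real \<Rightarrow>\<^sub>C (real^'n). norm u = 1}"
    by (intro closed_Collect_eq continuous_intros)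
  ultimately have compS: "compact S"
    using compact_Int_closed[OF compact_span_Int_cball[OF fin, of 1]] by metis
  have SB: "S \<subseteq> span B"
    by (auto simp: S_def)
  have scale: "action u < 0" if "u \<in> span B" "norm u > 0" and
    *: "\<And>\<sigma>. \<sigma> \<in> S \<Longrightarrow> 1 / 2 * (norm u)\<^sup>2 * form \<sigma> \<sigma> < (LINT x|lborel. W x (norm u *\<^sub>R apply_bcontfun \<sigma> x))" for u
  proof -
    define \<sigma> where "\<sigma> = (1 / norm u) *\<^sub>R u"
    have \<sigma>: "\<sigma> \<in> S"
      using that(1,2) by (auto simp: S_def \<sigma>_def intro: span_scale)
    have u: "apply_bcontfun u = (\<lambda>x. norm u *\<^sub>R apply_bcontfun \<sigma> x)"
      using that(2) by (auto simp: \<sigma>_def)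
    have \<sigma>t: "apply_bcontfun \<sigma> \<in> test_functions"
      using \<sigma> SB span_test[OF B] by blast
    have "action (\<lambda>x. norm u *\<^sub>R apply_bcontfun \<sigma> x) < 0"
      unfolding action_def form_scaleR[OF \<sigma>t] using *[OF \<sigma>] by simp
    then show ?thesis
      by (subst u)
  qed
  show ?thesis
  proof (cases "S = {}")
    case True
    then show ?thesis
    proof (intro that[of 1])
      show "action u < 0" if "u \<in> span B" "norm u \<ge> 1" for u
        by (rule scale) (use that True in auto)
    qed auto
  next
    case False
    obtain \<sigma>0 where \<sigma>0: "\<sigma>0 \<in> S" "\<And>\<sigma>. \<sigma> \<in> S \<Longrightarrow> (LINT x|lborel. W x (apply_bcontfun \<sigma>0 x)) \<le> (LINT x|lborel. W x (apply_bcontfun \<sigma> x))"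
      using continuous_attains_inf[OF compS False continuous_on_subset[OF action_continuous_on_span(1)[OF fin B] SB]] by blast
    obtain \<sigma>1 where \<sigma>1: "\<sigma>1 \<in> S" "\<And>\<sigma>. \<sigma> \<in> S \<Longrightarrow> form \<sigma> \<sigma> \<le> form \<sigma>1 \<sigma>1"
      using continuous_attains_sup[OF compS False continuous_on_subset[OF form_continuous_on_span(1)[OF fin B] SB]] by blast
    define w where "w = (LINT x|lborel. W x (apply_bcontfun \<sigma>0 x))"
    define c where "c = form \<sigma>1 \<sigma>1"
    have "c \<ge> 0"
      unfolding c_def using \<sigma>1(1) SB span_test[OF B] by (intro form_nonneg) auto
    have "w > 0"
    proof -
      have "\<sigma>0 \<noteq> 0"
        using \<sigma>0(1) by (auto simp: S_def)
      then obtain x0 where "apply_bcontfun \<sigma>0 x0 \<noteq> 0"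
        using bcontfun_eqI[of \<sigma>0 0] by auto
      then show ?thesis
        unfolding w_def using \<sigma>0(1) SB span_test[OF B] by (intro integral_W_pos) auto
    qed
    \<comment> \<open>Solves t^(\<mu> - 2) = c / w + 1, so that beyond it t^\<mu> w exceeds t^2 c;
      the maximum with 1 is needed for \<open>W_superquadratic\<close>.\<close>
    define T where "T = max 1 ((c / w + 1) powr (1 / (\<mu> - 2)))"
    show ?thesis
    proof (rule that[of T])
      fix u assume u: "u \<in> span B" "norm u \<ge> T"
      define t where "t = norm u"
      have t: "t \<ge> 1" "t \<ge> (c / w + 1) powr (1 / (\<mu> - 2))"
        using u(2) by (auto simp: t_def T_def)
      have "c / w < t powr (\<mu> - 2)"
      proof -
        have "c / w + 1 = ((c / w + 1) powr (1 / (\<mu> - 2))) powr (\<mu> - 2)"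
          using \<mu>(1) \<open>c \<ge> 0\<close> \<open>w > 0\<close> by (simp add: powr_powr)
        also have "\<dots> \<le> t powr (\<mu> - 2)"
          using t \<mu>(1) by (intro powr_mono2) auto
        finally show ?thesis
          by simp
      qed
      then have cw: "c < t powr (\<mu> - 2) * w"
        using \<open>w > 0\<close> by (simp add: pos_divide_less_eq)
      show "action u < 0"
      proof (rule scale[OF u(1)])
        show "norm u > 0"
          using t(1) unfolding t_def by linarith
        fix \<sigma> assume \<sigma>: "\<sigma> \<in> S"
        have \<sigma>t: "apply_bcontfun \<sigma> \<in> test_functions"
          using \<sigma> SB span_test[OF B] by blast
        have "1 / 2 * (norm u)\<^sup>2 * form \<sigma> \<sigma> \<le> t\<^sup>2 * c"
        proof -
          have "1 / 2 * t\<^sup>2 * form \<sigma> \<sigma> \<le> 1 * t\<^sup>2 * c"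
            using \<sigma>1(2)[OF \<sigma>] form_nonneg[OF \<sigma>t] \<open>c \<ge> 0\<close> by (intro mult_mono) (auto simp: c_def)
          then show ?thesis
            by (simp add: t_def)
        qed
        also have "\<dots> < t\<^sup>2 * (t powr (\<mu> - 2) * w)"
          using cw t by (intro mult_strict_left_mono) auto
        also have "\<dots> = t powr \<mu> * w"
          using t powr_add[of t 2 "\<mu> - 2"] by simp
        also have "\<dots> \<le> t powr \<mu> * (LINT x|lborel. W x (apply_bcontfun \<sigma> x))"
          unfolding w_def using \<sigma>0(2)[OF \<sigma>] by (intro mult_left_mono) auto
        also have "\<dots> = (LINT x|lborel. t powr \<mu> * W x (apply_bcontfun \<sigma> x))"
          by simp
        also have "\<dots> \<le> (LINT x|lborel. W x (t *\<^sub>R apply_bcontfun \<sigma> x))"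
          using W_superquadratic[OF t(1)] by (intro integral_mono integrable_mult_right W_test_integrable test_function_scaleR \<sigma>t)
        finally show "1 / 2 * (norm u)\<^sup>2 * form \<sigma> \<sigma> < (LINT x|lborel. W x (norm u *\<^sub>R apply_bcontfun \<sigma> x))"
          by (simp add: t_def)
      qed
    qed (simp add: T_def)
  qed
qed

text \<open>The end point \<open>e\<close> is fixed before F, so the level of the segment, at most
  half its energy since W is nonnegative, does not depend on F. Adding \<open>e\<close> to F and
  testing the critical point with itself turns this level into the bound E.\<close>

lemma finite_dimensional_critical_points:
  obtains E b where "E > 0" "b > 0"
    "\<And>F :: (real \<Rightarrow>\<^sub>C (real^'n)) set. finite F \<Longrightarrow> F \<subseteq> test_bcontfuns \<Longrightarrow>
      \<exists>u\<in>test_bcontfuns. form (apply_bcontfun u) (apply_bcontfun u) \<le> E \<and> b \<le> norm u \<and> (\<forall>v\<in>F. action_deriv u (apply_bcontfun v) = 0)"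
proof -
  obtain C where C: "C > 0" "\<And>u x. u \<in> test_functions \<Longrightarrow> norm (u x) \<le> C * sqrt (form u u)"
    using test_sup_bound by blast
  obtain r where r: "r > 0" "\<And>x q. norm q \<le> r \<Longrightarrow> norm (gW x q) \<le> (\<alpha> / 4) * norm q"
    using gW_small[of "\<alpha> / 4"] \<alpha>(1) by auto
  \<comment> \<open>With form u u = \<rho> the supremum bound gives |u| at most r, where W costs at
    most (\<alpha>/4)|u|^2, a quarter of the energy; of \<rho>/2 there remains \<rho>/4.\<close>
  define \<rho> where "\<rho> = (r / C)\<^sup>2"
  have \<rho>: "\<rho> > 0"
    using r C by (simp add: \<rho>_def)
  have L2int: "integrable lborel (\<lambda>x. (norm (u x))\<^sup>2)" if u: "u \<in> test_functions" for u :: "real \<Rightarrow> real^'n"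
    using continuous_test_integrable[OF test_function_continuous[OF u] u] by (simp add: power2_norm_eq_inner)
  have geometry: "\<rho> / 4 \<le> action u" if u: "u \<in> test_functions" "form u u = \<rho>" for u
  proof -
    have small: "norm (u x) \<le> r" for x
      using C(2)[OF u(1), of x] u(2) C(1) r(1) by (simp add: \<rho>_def)
    have "(LINT x|lborel. W x (u x)) \<le> (LINT x|lborel. (\<alpha> / 4) * (norm (u x))\<^sup>2)"
      using small r \<alpha>(1) W_test_integrable[OF u(1)] L2int[OF u(1)]
      by (intro integral_mono W_small_quadratic[of _ r]) auto
    also have "\<dots> = 1 / 4 * (\<alpha> * (LINT x|lborel. (norm (u x))\<^sup>2))"
      by simp
    also have "\<dots> \<le> 1 / 4 * form u u"
      using L2_le_form[OF u(1)] by simp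
    finally show ?thesis
      using u(2) by (simp add: action_def)
  qed
  obtain \<eta> :: "real \<Rightarrow> real" where \<eta>: "\<eta> \<in> test_functions" "\<eta> 0 > 0"
    by (rule even_decreasing_bump) blast
  have "(\<lambda>y. \<eta> ((0 - y) / 1) *\<^sub>R (axis undefined 1 :: real^'n)) \<in> test_functions"
    by (rule test_function_affine_scaleR) (use \<eta> in auto)
  then obtain w :: "real \<Rightarrow>\<^sub>C (real^'n)" where w: "w \<in> test_bcontfuns" "apply_bcontfun w = (\<lambda>y. \<eta> ((0 - y) / 1) *\<^sub>R axis undefined 1)"
    by (rule test_function_bcontfun)
  have "apply_bcontfun w 0 \<noteq> 0"
    using \<eta>(2) by (simp add: w(2))
  then have "w \<noteq> 0"
    by auto
  obtain T where T: "T \<ge> 1" "\<And>u. u \<in> span {w} \<Longrightarrow> norm u \<ge> T \<Longrightarrow> action u < 0"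
    using action_negative_far[of "{w}"] w(1) by auto
  \<comment> \<open>A norm above T makes the action negative; a norm above r forces form e e >
    \<rho>, by the supremum bound.\<close>
  define e where "e = ((T + 2 * r + 1) / norm w) *\<^sub>R w"
  have norm_e: "norm e = T + 2 * r + 1"
    using \<open>w \<noteq> 0\<close> T r by (simp add: e_def)
  have eT: "e \<in> test_bcontfuns"
    unfolding e_def using w(1) subspace_test_bcontfuns by (rule subspace_scale[rotated])
  then have e_test: "apply_bcontfun e \<in> test_functions"
    by (simp add: test_bcontfuns_def)
  have e_neg: "action e < 0"
    using norm_e r by (intro T(2)) (auto simp: e_def intro: span_scale span_base)
  have e_form: "\<rho> < form e e"
  proof (rule ccontr)
    assume "\<not> ?thesis"
    then have "sqrt (form e e) \<le> r / C"
      using r C by (intro real_le_lsqrt) (auto simp: \<rho>_def)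
    then have "C * sqrt (form e e) \<le> r"
      using C(1) by (simp add: pos_le_divide_eq mult.commute)
    then have "norm (apply_bcontfun e x) \<le> r" for x
      using C(2)[OF e_test, of x] by linarith
    then have "norm e \<le> r"
      by (rule norm_bound)
    then show False
      using norm_e T r by linarith
  qed
  \<comment> \<open>At a critical point the integral of W is at most form u u / \<mu>, so (1/2 -
    1/\<mu>) form u u is at most the action, hence at most form e e / 2.\<close>
  define E where "E = 1 / 2 * form e e / (1 / 2 - 1 / \<mu>)"
  have mu: "1 / 2 - 1 / \<mu> > 0"
    using \<mu>(1) by (simp add: field_simps)
  have "E > 0"
    unfolding E_def using mu e_form \<rho> by (intro divide_pos_pos) auto
  moreover have "\<exists>u\<in>test_bcontfuns. form (apply_bcontfun u) (apply_bcontfun u) \<le> E \<and> r \<le> norm u \<and> (\<forall>v\<in>F. action_deriv u (apply_bcontfun v) = 0)"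
    if F: "finite F" "F \<subseteq> test_bcontfuns" for F :: "(real \<Rightarrow>\<^sub>C (real^'n)) set"
  proof -
    define B where "B = insert e F"
    have B: "finite B" "B \<subseteq> test_bcontfuns"
      using F eT by (auto simp: B_def)
    note test = span_test[OF B(2)]
    obtain T' where T': "\<And>u. u \<in> span B \<Longrightarrow> norm u \<ge> T' \<Longrightarrow> action u < 0"
      using action_negative_far[OF B] by metis
    have lin: "action_deriv u (apply_bcontfun (\<Sum>b\<in>A. c b *\<^sub>R b)) = (\<Sum>b\<in>A. c b * action_deriv u (apply_bcontfun b))"
      if "finite A" "A \<subseteq> B" "u \<in> test_functions" for u c A
      using that
    proof (induction A)
      case empty
      have "form u (\<lambda>x. 0) = 0"
        by (simp add: form_def case_prod_unfold)
      then show ?case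
        by (simp add: action_deriv_def zero_bcontfun.rep_eq[abs_def])
    next
      case (insert b A)
      have b: "apply_bcontfun b \<in> test_functions"
        using insert.prems B by (auto simp: test_bcontfuns_def)
      have A: "apply_bcontfun (\<Sum>b\<in>A. c b *\<^sub>R b) \<in> test_functions"
        using insert.prems by (intro test span_sum span_scale span_base) auto
      have eq: "apply_bcontfun ((\<Sum>b\<in>A. c b *\<^sub>R b) + c b *\<^sub>R b) = (\<lambda>x. apply_bcontfun (\<Sum>b\<in>A. c b *\<^sub>R b) x + c b *\<^sub>R apply_bcontfun b x)"
        by auto
      have f: "form u (apply_bcontfun ((\<Sum>b\<in>A. c b *\<^sub>R b) + c b *\<^sub>R b))
        = form u (apply_bcontfun (\<Sum>b\<in>A. c b *\<^sub>R b)) + c b * form u (apply_bcontfun b)"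
        unfolding eq form_commute[of u] by (rule form_add_left[OF A b insert.prems(2)])
      have "(LINT x|lborel. gW x (u x) \<bullet> apply_bcontfun ((\<Sum>b\<in>A. c b *\<^sub>R b) + c b *\<^sub>R b) x)
        = (LINT x|lborel. gW x (u x) \<bullet> apply_bcontfun (\<Sum>b\<in>A. c b *\<^sub>R b) x) + c b * (LINT x|lborel. gW x (u x) \<bullet> apply_bcontfun b x)"
        unfolding eq using gW_test_integrable[OF insert.prems(2) A] gW_test_integrable[OF insert.prems(2) b]
        by (simp add: inner_add_right)
      with f have "action_deriv u (apply_bcontfun ((\<Sum>b\<in>A. c b *\<^sub>R b) + c b *\<^sub>R b))
        = action_deriv u (apply_bcontfun (\<Sum>b\<in>A. c b *\<^sub>R b)) + c b * action_deriv u (apply_bcontfun b)"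
        by (simp add: action_deriv_def algebra_simps)
      then show ?case
        using insert by (simp add: add.commute)
    qed
    have zero: "action (apply_bcontfun 0) = 0"
      by (simp add: action_def form_def case_prod_unfold W_zero)
    have "\<exists>u\<in>span B. (\<rho> / 4) / 2 \<le> action (apply_bcontfun u) \<and> action (apply_bcontfun u) \<le> 1 / 2 * form e e \<and> (\<forall>b\<in>B. action_deriv u (apply_bcontfun b) = 0)"
    proof (rule mountain_pass_finite_span[where N = "\<lambda>u. form (apply_bcontfun u) (apply_bcontfun u)" and r = \<rho> and e = e and \<rho> = "\<bar>T'\<bar>"
          and J = "\<lambda>u. action (apply_bcontfun u)" and J' = "\<lambda>u v. action_deriv (apply_bcontfun u) (apply_bcontfun v)"])
      fix u v :: "real \<Rightarrow>\<^sub>C (real^'n)" and \<tau> :: real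
      assume "u \<in> span B" "v \<in> span B"
      then show "((\<lambda>\<tau>. action (apply_bcontfun (u + \<tau> *\<^sub>R v))) has_real_derivative action_deriv (apply_bcontfun (u + \<tau> *\<^sub>R v)) v) (at \<tau>)"
        using action_has_derivative[OF test test, of u v \<tau>] by (simp add: plus_bcontfun.rep_eq[abs_def] scaleR_bcontfun.rep_eq[abs_def])
    next
      fix b assume "b \<in> B"
      then have b: "apply_bcontfun b \<in> test_functions"
        using B by (auto simp: test_bcontfuns_def)
      show "continuous_on (span B) (\<lambda>u. action_deriv (apply_bcontfun u) (apply_bcontfun b))"
        unfolding action_deriv_def
        by (intro continuous_intros form_continuous_on_span(2)[OF B b] continuous_on_subset[OF nonlinearity_continuous[OF b] subset_UNIV])
    next
      fix t :: real assume t: "0 \<le> t" "t \<le> 1"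
    have "form (apply_bcontfun (t *\<^sub>R e)) (apply_bcontfun (t *\<^sub>R e)) = t\<^sup>2 * form e e"
        unfolding scaleR_bcontfun.rep_eq[abs_def]
        by (rule form_scaleR[OF e_test])
      also have "\<dots> \<le> 1 * form e e"
        using t e_form \<rho> by (intro mult_right_mono power_le_one) auto
      moreover have "0 \<le> (LINT x|lborel. W x (apply_bcontfun (t *\<^sub>R e) x))"
        using W_nonneg by (intro integral_nonneg_AE) auto
      ultimately show "action (apply_bcontfun (t *\<^sub>R e)) \<le> 1 / 2 * form e e"
        unfolding action_def by linarith
    next
      fix u assume "u \<in> span B" "\<rho> / 4 / 2 \<le> action u"
      then show "norm u \<le> \<bar>T'\<bar>"
        using T'[of u] \<rho> by (cases "norm u \<ge> T'") auto
    next
      show "form (apply_bcontfun (0 :: real \<Rightarrow>\<^sub>C (real^'n))) (apply_bcontfun (0 :: real \<Rightarrow>\<^sub>C (real^'n))) < \<rho>"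
        using \<rho> by (simp only: form_zero_left)
    qed (use B \<rho> e_form e_neg zero lin test geometry form_continuous_on_span(1)[OF B] action_continuous_on_span(2)[OF B]
        in \<open>auto simp: B_def intro: span_base\<close>)
    then obtain u where u: "u \<in> span B" "\<rho> / 8 \<le> action u" "action u \<le> 1 / 2 * form e e" "\<And>b. b \<in> B \<Longrightarrow> action_deriv u (apply_bcontfun b) = 0"
      by auto
    note ut = test[OF u(1)]
    have "\<exists>c. (\<Sum>b\<in>B. c b *\<^sub>R b) = u"
      using u(1) span_finite[OF B(1)] by auto
    then obtain c where c: "(\<Sum>b\<in>B. c b *\<^sub>R b) = u"
      by blast
    have crit: "action_deriv u u = 0"
      using lin[OF B(1) subset_refl ut, of c] u(4) by (simp add: c)
    have "(1 / 2 - 1 / \<mu>) * form u u \<le> 1 / 2 * form e e"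
    proof -
      have "(LINT x|lborel. W x (apply_bcontfun u x)) \<le> (LINT x|lborel. 1 / \<mu> * (gW x (apply_bcontfun u x) \<bullet> apply_bcontfun u x))"
        using W_AR \<mu>(1) W_test_integrable[OF ut] gW_test_integrable[OF ut ut]
        by (intro integral_mono integrable_mult_right) (auto simp: field_simps)
      also have "\<dots> = 1 / \<mu> * form u u"
        using crit by (simp add: action_deriv_def)
      finally show ?thesis
        using u(3) unfolding action_def by (simp add: algebra_simps)
    qed
    then have "form u u \<le> E"
      unfolding E_def pos_le_divide_eq[OF mu] by (simp only: mult.commute)
    \<comment> \<open>If |u| stayed below r, testing with u would bound its energy by a quarter of
      itself, so the energy would be at most 0 and so would the action, against the positive lower
      level.\<close>
    moreover have "r \<le> norm u"
    proof (rule ccontr)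
      assume "\<not> r \<le> norm u"
      then have small: "norm (apply_bcontfun u x) \<le> r" for x
        using norm_bounded[of u x] by simp
      have "form u u = (LINT x|lborel. gW x (apply_bcontfun u x) \<bullet> apply_bcontfun u x)"
        using crit by (simp add: action_deriv_def)
      also have "\<dots> \<le> (LINT x|lborel. (\<alpha> / 4) * (norm (apply_bcontfun u x))\<^sup>2)"
      proof (intro integral_mono gW_test_integrable ut integrable_mult_right L2int)
        fix x
        have "gW x (apply_bcontfun u x) \<bullet> apply_bcontfun u x \<le> norm (gW x (apply_bcontfun u x)) * norm (apply_bcontfun u x)"
          by (rule norm_cauchy_schwarz)
        also have "\<dots> \<le> (\<alpha> / 4 * norm (apply_bcontfun u x)) * norm (apply_bcontfun u x)"
          using r(2)[OF small] by (intro mult_right_mono) auto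
        finally show "gW x (apply_bcontfun u x) \<bullet> apply_bcontfun u x \<le> (\<alpha> / 4) * (norm (apply_bcontfun u x))\<^sup>2"
          by (simp add: power2_eq_square)
      qed
      also have "\<dots> = 1 / 4 * (\<alpha> * (LINT x|lborel. (norm (apply_bcontfun u x))\<^sup>2))"
        by simp
      also have "\<dots> \<le> 1 / 4 * form u u"
        using L2_le_form[OF ut] by simp
      finally have "form u u \<le> 0"
        by simp
      moreover have "0 \<le> (LINT x|lborel. W x (apply_bcontfun u x))"
        using W_nonneg by (intro integral_nonneg_AE) auto
      ultimately have "action u \<le> 0"
        by (simp add: action_def)
      then show False
        using u(2) \<rho> by simp
    qed
    moreover have "u \<in> test_bcontfuns"
      using ut by (simp add: test_bcontfuns_def)
    ultimately show ?thesis
      using u(4) by (auto simp: B_def)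
  qed
  ultimately show ?thesis
    using that r(1) by blast
qed

end

section \<open>Compactness and existence of a weak solution\<close>

text \<open>Tychonoff's theorem plays the part of the diagonal argument; for a countable index type
  the product is metrizable, so compactness is sequential.\<close>

lemma seq_compact_countable_product:
  fixes v :: "nat \<Rightarrow> 'a::countable \<Rightarrow> 'b::{heine_borel, real_normed_vector}"
  assumes "\<And>n i. norm (v n i) \<le> M"
  obtains r :: "nat \<Rightarrow> nat" where "strict_mono r" "\<And>i. convergent (\<lambda>n. v (r n) i)"
proof -
  let ?S = "PiE UNIV (\<lambda>_::'a. cball (0::'b) M)"
  have "compactin (product_topology (\<lambda>_::'a. euclidean) UNIV) ?S"
    by (simp add: compactin_PiE)
  then have "compact ?S"
    by (simp add: euclidean_product_topology)
  moreover have "\<forall>n. v n \<in> ?S"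
    using assms by auto
  ultimately obtain l r where r: "strict_mono r" "(v \<circ> r) \<longlonglongrightarrow> l"
    using compact_imp_seq_compact unfolding seq_compact_def by metis
  have "(\<lambda>n. v (r n) i) \<longlonglongrightarrow> l i" for i
    using continuous_on_tendsto_compose[OF continuous_on_product_coordinates r(2)] by simp
  then show ?thesis
    using that r(1) by (auto simp: convergent_def)
qed

text \<open>Fatou's lemma in the form needed to pass energy bounds to limits.\<close>

lemma nn_integral_pointwise_limit_le:
  fixes f :: "nat \<Rightarrow> 'a \<Rightarrow> ennreal"
  assumes "\<And>n. f n \<in> borel_measurable M" "\<And>x. (\<lambda>n. f n x) \<longlonglongrightarrow> g x" "\<And>n. integral\<^sup>N M (f n) \<le> C"
  shows "integral\<^sup>N M g \<le> C"
proof -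
  have "integral\<^sup>N M g = (\<integral>\<^sup>+x. liminf (\<lambda>n. f n x) \<partial>M)"
    using lim_imp_Liminf[OF sequentially_bot assms(2)] by simp
  also have "\<dots> \<le> liminf (\<lambda>n. integral\<^sup>N M (f n))"
    by (rule nn_integral_liminf[OF assms(1)])
  also have "\<dots> \<le> liminf (\<lambda>n. C)"
    using assms(3) by (intro Liminf_mono always_eventually allI)
  also have "\<dots> = C"
    by (simp add: Liminf_const)
  finally show ?thesis .
qed

lemma bcontfun_measurable: "apply_bcontfun u \<in> borel_measurable borel"
  by (intro borel_measurable_continuous_onI) simp

lemma bcontfun_tendsto_pointwise:
  assumes "v \<longlonglongrightarrow> u"
  shows "(\<lambda>n. apply_bcontfun (v n) x) \<longlonglongrightarrow> apply_bcontfun u x"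
proof (rule metric_tendsto_imp_tendsto[OF assms always_eventually], rule allI)
  show "dist (apply_bcontfun (v n) x) (apply_bcontfun u x) \<le> dist (v n) u" for n
    by (rule dist_bounded)
qed

lemma dist_triangle_detour: "dist a b \<le> dist a p + dist p q + dist b q"
  using dist_triangle[of a b p] dist_triangle[of p b q] by (simp add: dist_commute)

context frac_hamiltonian
begin

text \<open>The Hoelder bound is listed separately because \<open>holder_gagliardo\<close> covers
  only bounded Lipschitz functions. Limits of test functions inherit it as a pointwise
  condition.\<close>

definition energy_ball :: "real \<Rightarrow> real \<Rightarrow> (real \<Rightarrow>\<^sub>C (real^'n)) set" where
  "energy_ball E H = {u. gagliardo s (apply_bcontfun u) \<le> ennreal E \<and>
    (\<integral>\<^sup>+x. ennreal ((L x *v apply_bcontfun u x) \<bullet> apply_bcontfun u x) \<partial>lebesgue) \<le> ennreal E \<and>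
    (\<forall>x y. norm (apply_bcontfun u x - apply_bcontfun u y) \<le> H * \<bar>x - y\<bar> powr (s - 1 / 2))}"

lemma energy_ball_closed_seq:
  assumes v: "\<And>n. v n \<in> energy_ball E H" "v \<longlonglongrightarrow> u"
  shows "u \<in> energy_ball E H"
proof -
  have lim: "(\<lambda>n. apply_bcontfun (v n) x) \<longlonglongrightarrow> apply_bcontfun u x" for x
    using v(2) by (rule bcontfun_tendsto_pointwise)
  note [measurable] = bcontfun_measurable
  have "gagliardo s (apply_bcontfun u) \<le> ennreal E"
    unfolding gagliardo_def
  proof (rule nn_integral_pointwise_limit_le)
    show "(\<lambda>z. case z of (x, y) \<Rightarrow> ennreal ((norm (apply_bcontfun (v n) x - apply_bcontfun (v n) y))\<^sup>2 / \<bar>x - y\<bar> powr (1 + 2 * s)))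
      \<in> borel_measurable lebesgue" for n
    proof -
      have "(\<lambda>(x, y). ennreal ((norm (apply_bcontfun (v n) x - apply_bcontfun (v n) y))\<^sup>2 / \<bar>x - y\<bar> powr (1 + 2 * s)))
        \<in> borel_measurable (borel \<Otimes>\<^sub>M borel)"
        by measurable
      then show ?thesis
        by (simp add: borel_prod measurable_completion)
    qed
    show "(\<lambda>n. case z of (x, y) \<Rightarrow> ennreal ((norm (apply_bcontfun (v n) x - apply_bcontfun (v n) y))\<^sup>2 / \<bar>x - y\<bar> powr (1 + 2 * s)))
      \<longlonglongrightarrow> (case z of (x, y) \<Rightarrow> ennreal ((norm (apply_bcontfun u x - apply_bcontfun u y))\<^sup>2 / \<bar>x - y\<bar> powr (1 + 2 * s)))" for z
      unfolding case_prod_unfold divide_inverse by (intro tendsto_ennrealI tendsto_intros lim)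
    show "(\<integral>\<^sup>+z. (case z of (x, y) \<Rightarrow> ennreal ((norm (apply_bcontfun (v n) x - apply_bcontfun (v n) y))\<^sup>2 / \<bar>x - y\<bar> powr (1 + 2 * s)))
      \<partial>lebesgue) \<le> ennreal E" for n
      using v(1)[of n] by (simp add: energy_ball_def gagliardo_def)
  qed
  moreover have "(\<integral>\<^sup>+x. ennreal ((L x *v apply_bcontfun u x) \<bullet> apply_bcontfun u x) \<partial>lebesgue) \<le> ennreal E"
  proof (rule nn_integral_pointwise_limit_le)
    show "(\<lambda>x. ennreal ((L x *v apply_bcontfun (v n) x) \<bullet> apply_bcontfun (v n) x)) \<in> borel_measurable lebesgue" for n
      by (intro measurable_completion measurable_compose[OF _ measurable_ennreal])
         (auto intro!: borel_measurable_continuous_onI continuous_intros L_cont)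
    show "(\<lambda>n. ennreal ((L x *v apply_bcontfun (v n) x) \<bullet> apply_bcontfun (v n) x))
      \<longlonglongrightarrow> ennreal ((L x *v apply_bcontfun u x) \<bullet> apply_bcontfun u x)" for x
      by (intro tendsto_ennrealI tendsto_inner lim bounded_linear.tendsto[OF matrix_vector_mul_bounded_linear])
    show "(\<integral>\<^sup>+x. ennreal ((L x *v apply_bcontfun (v n) x) \<bullet> apply_bcontfun (v n) x) \<partial>lebesgue) \<le> ennreal E" for n
      using v(1)[of n] by (simp add: energy_ball_def)
  qed
  moreover have "norm (apply_bcontfun u x - apply_bcontfun u y) \<le> H * \<bar>x - y\<bar> powr (s - 1 / 2)" for x y
  proof (rule tendsto_upperbound)
    show "(\<lambda>n. norm (apply_bcontfun (v n) x - apply_bcontfun (v n) y)) \<longlonglongrightarrow> norm (apply_bcontfun u x - apply_bcontfun u y)"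
      by (intro tendsto_intros lim)
    show "\<forall>\<^sub>F n in sequentially. norm (apply_bcontfun (v n) x - apply_bcontfun (v n) y) \<le> H * \<bar>x - y\<bar> powr (s - 1 / 2)"
      using v(1) by (simp add: energy_ball_def)
  qed auto
  ultimately show ?thesis
    by (simp add: energy_ball_def)
qed

lemma energy_ball_decay:
  assumes E: "E \<ge> 0" and H: "H \<ge> 0" and \<epsilon>: "\<epsilon> > 0"
  shows "\<exists>R. \<forall>u\<in>energy_ball E H. \<forall>x. \<bar>x\<bar> \<ge> R \<longrightarrow> norm (apply_bcontfun u x) < \<epsilon>"
proof (rule uniform_decay_energy[OF L_growth E H _ \<epsilon>])
  show "s - 1 / 2 > 0"
    using s by simp
  fix R assume R: "\<And>u x. (\<integral>\<^sup>+x. ennreal ((L x *v u x) \<bullet> u x) \<partial>lebesgue) \<le> ennreal E \<Longrightarrow>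
    (\<And>x y. norm (u x - u y) \<le> H * \<bar>x - y\<bar> powr (s - 1 / 2)) \<Longrightarrow> \<bar>x\<bar> \<ge> R \<Longrightarrow> norm (u x) < \<epsilon>"
  show ?thesis
  proof (intro exI ballI allI impI)
    fix u and x :: real assume "u \<in> energy_ball E H" "\<bar>x\<bar> \<ge> R"
    then show "norm (apply_bcontfun u x) < \<epsilon>"
      by (intro R) (auto simp: energy_ball_def)
  qed
qed

text \<open>An Arzela-Ascoli argument on the whole line: a subsequence converges at all rationals,
  the Hoelder bound extends this uniformly over bounded sets, and the uniform decay handles the
  rest, so that finitely many grid points decide the distance.\<close>

lemma compact_energy_ball:
  assumes E: "E \<ge> 0" and H: "H \<ge> 0"
  shows "compact (energy_ball E H)"
  unfolding compact_eq_seq_compact_metric seq_compact_def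
proof (intro allI impI)
  fix f :: "nat \<Rightarrow> real \<Rightarrow>\<^sub>C (real^'n)" assume f: "\<forall>n. f n \<in> energy_ball E H"
  define \<beta> where "\<beta> = s - 1 / 2"
  have \<beta>: "\<beta> > 0"
    using s by (simp add: \<beta>_def)
  have fE: "(\<integral>\<^sup>+x. ennreal ((L x *v apply_bcontfun (f n) x) \<bullet> apply_bcontfun (f n) x) \<partial>lebesgue) \<le> ennreal E"
    and fH: "norm (apply_bcontfun (f n) x - apply_bcontfun (f n) y) \<le> H * \<bar>x - y\<bar> powr \<beta>" for n x y
    using f by (auto simp: energy_ball_def \<beta>_def)
  have M: "norm (apply_bcontfun (f n) x) \<le> H + sqrt ((E + 1) / \<alpha>)" for n x
    by (rule sup_bound_energy[OF fE E \<alpha>(1) _ fH H \<beta>]) (rule \<alpha>(2))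
  obtain r where r: "strict_mono r" "\<And>q::rat. convergent (\<lambda>n. apply_bcontfun (f (r n)) (of_rat q))"
    using seq_compact_countable_product[of "\<lambda>n (q::rat). apply_bcontfun (f n) (of_rat q)", OF M] by blast
  have "Cauchy (\<lambda>n. f (r n))"
  proof (rule metric_CauchyI)
    fix \<epsilon> :: real assume "\<epsilon> > 0"
    then have \<epsilon>4: "\<epsilon> / 4 > 0"
      by simp
    obtain R where R: "\<And>n x. \<bar>x\<bar> \<ge> R \<Longrightarrow> norm (apply_bcontfun (f n) x) < \<epsilon> / 4"
      using energy_ball_decay[OF E H \<epsilon>4] f by blast
    define d where "d = (\<epsilon> / 4 / (H + 1)) powr (1 / \<beta>)"
    have d: "d > 0" "H * d powr \<beta> \<le> \<epsilon> / 4"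
    proof -
      show "d > 0"
        using \<epsilon>4 H by (simp add: d_def)
      have "d powr \<beta> = \<epsilon> / 4 / (H + 1)"
        using \<epsilon>4 H \<beta> by (simp add: d_def powr_powr)
      then have "H * d powr \<beta> = \<epsilon> / 4 * (H / (H + 1))"
        by simp
      also have "\<dots> \<le> \<epsilon> / 4 * 1"
        using \<epsilon>4 H by (intro mult_left_mono) auto
      finally show "H * d powr \<beta> \<le> \<epsilon> / 4"
        by simp
    qed
    obtain K :: nat where K: "1 / d < real K"
      using reals_Archimedean2 by blast
    then have "real K > 0"
      using d(1) by (meson divide_pos_pos less_trans zero_less_one)
    have Kd: "1 / real K < d"
      using K d(1) \<open>real K > 0\<close> by (simp add: field_simps)
    \<comment> \<open>The rational grid of mesh 1/K < d over [-R, R]. Moving x to the grid point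
      below it changes each function by at most \<epsilon>/4.\<close>
    define P where "P = (\<lambda>i. of_int i / of_nat K :: rat) ` {\<lfloor>- R * K\<rfloor>..\<lfloor>R * K\<rfloor>}"
    have "finite P"
      by (simp add: P_def)
    have "\<exists>N. \<forall>m\<ge>N. \<forall>n\<ge>N. dist (apply_bcontfun (f (r m)) (of_rat q)) (apply_bcontfun (f (r n)) (of_rat q)) < \<epsilon> / 4" for q
      using convergent_Cauchy[OF r(2)[of q]] \<epsilon>4 unfolding Cauchy_def by blast
    then obtain N where N: "\<And>q m n. m \<ge> N q \<Longrightarrow> n \<ge> N q \<Longrightarrow>
      dist (apply_bcontfun (f (r m)) (of_rat q)) (apply_bcontfun (f (r n)) (of_rat q)) < \<epsilon> / 4"
      by metis
    define N0 where "N0 = Max (insert 0 (N ` P))"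
    have N0: "N q \<le> N0" if "q \<in> P" for q
      unfolding N0_def using \<open>finite P\<close> that by (intro Max_ge) auto
    have near: "dist (apply_bcontfun (f (r m)) x) (apply_bcontfun (f (r n)) x) \<le> 3 * (\<epsilon> / 4)" if "m \<ge> N0" "n \<ge> N0" for m n x
    proof (cases "\<bar>x\<bar> \<ge> R")
      case True
      have "norm (apply_bcontfun (f (r m)) x) < \<epsilon> / 4" "norm (apply_bcontfun (f (r n)) x) < \<epsilon> / 4"
        by (rule R[OF True])+
      then show ?thesis
        using norm_triangle_ineq4[of "apply_bcontfun (f (r m)) x" "apply_bcontfun (f (r n)) x"] \<epsilon>4 by (simp add: dist_norm)
    next
      case False
      define q :: rat where "q = of_int \<lfloor>x * K\<rfloor> / of_nat K"
      have "- R * K \<le> x * K" "x * K \<le> R * K"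
        using False \<open>real K > 0\<close> by (auto intro!: mult_right_mono simp only: abs_le_iff)
      then have "q \<in> P"
        unfolding P_def q_def by (intro imageI) (auto intro: floor_mono)
      have q: "real_of_rat q = of_int \<lfloor>x * K\<rfloor> / K"
        by (simp add: q_def of_rat_divide)
      have "\<bar>x - real_of_rat q\<bar> \<le> 1 / K"
      proof -
        have "\<bar>x * K - of_int \<lfloor>x * K\<rfloor>\<bar> \<le> 1"
          by linarith
        moreover have "x - real_of_rat q = (x * K - of_int \<lfloor>x * K\<rfloor>) / K"
          using \<open>real K > 0\<close> by (simp add: q field_simps)
        ultimately show ?thesis
          using \<open>real K > 0\<close> by (simp add: abs_divide divide_right_mono)
      qed
      then have "\<bar>x - real_of_rat q\<bar> powr \<beta> \<le> d powr \<beta>"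
        using Kd \<beta> by (intro powr_mono2) auto
      then have "H * \<bar>x - real_of_rat q\<bar> powr \<beta> \<le> H * d powr \<beta>"
        using H by (intro mult_left_mono) auto
      then have 1: "dist (apply_bcontfun (f k) x) (apply_bcontfun (f k) (real_of_rat q)) \<le> \<epsilon> / 4" for k
        using fH[of k x "real_of_rat q"] d(2) unfolding dist_norm by linarith
      have 2: "dist (apply_bcontfun (f (r m)) (of_rat q)) (apply_bcontfun (f (r n)) (of_rat q)) < \<epsilon> / 4"
        using N0[OF \<open>q \<in> P\<close>] that by (intro N) auto
      have "dist (apply_bcontfun (f (r m)) x) (apply_bcontfun (f (r n)) x)
        \<le> dist (apply_bcontfun (f (r m)) x) (apply_bcontfun (f (r m)) (of_rat q))
        + dist (apply_bcontfun (f (r m)) (of_rat q)) (apply_bcontfun (f (r n)) (of_rat q))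
        + dist (apply_bcontfun (f (r n)) x) (apply_bcontfun (f (r n)) (of_rat q))"
        by (rule dist_triangle_detour)
      also have "\<dots> \<le> \<epsilon> / 4 + \<epsilon> / 4 + \<epsilon> / 4"
        by (intro add_mono 1 less_imp_le[OF 2])
      finally show ?thesis
        by simp
    qed
    have "dist (f (r m)) (f (r n)) < \<epsilon>" if "m \<ge> N0" "n \<ge> N0" for m n
      using dist_bound[OF near[OF that]] \<epsilon>4 by linarith
    then show "\<exists>M. \<forall>m\<ge>M. \<forall>n\<ge>M. dist (f (r m)) (f (r n)) < \<epsilon>"
      by blast
  qed
  then obtain l where l: "(\<lambda>n. f (r n)) \<longlonglongrightarrow> l"
    using Cauchy_convergent convergent_def by blast
  have "l \<in> energy_ball E H"
    by (rule energy_ball_closed_seq[OF _ l]) (use f in auto)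
  then show "\<exists>l\<in>energy_ball E H. \<exists>r. strict_mono r \<and> (f \<circ> r) \<longlonglongrightarrow> l"
    using r(1) l by (auto simp: o_def)
qed

text \<open>
  Compactness in the supremum norm and the finite intersection property, applied to the closed conditions
  imposed by the single test functions, replace the choice of an exhausting sequence of subspaces.
\<close>
lemma weak_solution_exists:
  obtains E H u where "u \<in> energy_ball E H" "H \<ge> 0" "E \<ge> 0" "u \<noteq> 0"
    "\<And>\<phi>. \<phi> \<in> test_functions \<Longrightarrow> weak_form (apply_bcontfun u) \<phi> = (LINT x|lborel. gW x (apply_bcontfun u x) \<bullet> \<phi> x)"
proof -
  obtain E0 b where E0: "E0 > 0" "b > 0"
    "\<And>F :: (real \<Rightarrow>\<^sub>C (real^'n)) set. finite F \<Longrightarrow> F \<subseteq> test_bcontfuns \<Longrightarrow>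
      \<exists>u\<in>test_bcontfuns. form (apply_bcontfun u) (apply_bcontfun u) \<le> E0 \<and> b \<le> norm u \<and>
        (\<forall>v\<in>F. action_deriv (apply_bcontfun u) (apply_bcontfun v) = 0)"
    using finite_dimensional_critical_points by blast
  \<comment> \<open>The energy form bounds the potential part by E0 and the seminorm by E0 / c_s. In
    H the factor 2 makes the seminorm bound strict, as \<open>holder_gagliardo\<close>
    demands.\<close>
  define E where "E = max E0 (E0 / frac_const s)"
  define H where "H = holder_const s * sqrt (2 * E0 / frac_const s)"
  have EH: "E \<ge> 0" "H \<ge> 0"
    using E0(1) c_pos holder_const_pos[of s] by (auto simp: E_def H_def le_max_iff_disj)
  \<comment> \<open>The lower bound on the norm is a closed condition, so nontriviality survives the
    intersection.\<close>
  define S where "S = energy_ball E H \<inter> {u. b \<le> norm u}"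
  have "closed {u :: real \<Rightarrow>\<^sub>C (real^'n). b \<le> norm u}"
    by (intro closed_Collect_le continuous_intros)
  then have "compact S"
    unfolding S_def by (rule compact_Int_closed[OF compact_energy_ball[OF EH]])
  define A :: "(real \<Rightarrow>\<^sub>C (real^'n)) \<Rightarrow> (real \<Rightarrow>\<^sub>C (real^'n)) set" where
    "A v = {u. weak_form (apply_bcontfun u) (apply_bcontfun v) = (LINT x|lborel. gW x (apply_bcontfun u x) \<bullet> apply_bcontfun v x)}" for v
  have "S \<inter> \<Inter> (A ` test_bcontfuns) \<noteq> {}"
  proof (rule compact_imp_fip[OF \<open>compact S\<close>])
    fix T assume "T \<in> A ` test_bcontfuns"
    then obtain v where v: "T = A v" "apply_bcontfun v \<in> test_functions"
      by (auto simp: test_bcontfuns_def)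
    show "closed T"
      unfolding v(1) A_def by (intro closed_Collect_eq weak_form_continuous nonlinearity_continuous v(2))
  next
    fix F' assume F': "finite F'" "F' \<subseteq> A ` test_bcontfuns"
    then obtain F where F: "finite F" "F \<subseteq> test_bcontfuns" "F' = A ` F"
      using finite_subset_image[OF F'] by blast
    obtain u where u: "u \<in> test_bcontfuns" "form (apply_bcontfun u) (apply_bcontfun u) \<le> E0" "b \<le> norm u"
      "\<And>v. v \<in> F \<Longrightarrow> action_deriv (apply_bcontfun u) (apply_bcontfun v) = 0"
      using E0(3)[OF F(1,2)] by blast
    have ut: "apply_bcontfun u \<in> test_functions"
      using u(1) by (simp add: test_bcontfuns_def)
    have gag: "gagliardo s (apply_bcontfun u) \<le> ennreal (E0 / frac_const s)"
      by (rule order_trans[OF gagliardo_le_form[OF ut]]) (use u(2) c_pos in \<open>auto intro!: ennreal_leI divide_right_mono\<close>)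
    have "u \<in> energy_ball E H"
      unfolding energy_ball_def
    proof (intro CollectI conjI allI)
      show "gagliardo s (apply_bcontfun u) \<le> ennreal E"
        by (rule order_trans[OF gag]) (auto simp: E_def intro!: ennreal_leI)
      have "(\<integral>\<^sup>+x. ennreal ((L x *v apply_bcontfun u x) \<bullet> apply_bcontfun u x) \<partial>lebesgue)
        = ennreal (LINT x|lborel. (L x *v apply_bcontfun u x) \<bullet> apply_bcontfun u x)"
        using nn_integral_eq_integral[OF test_potential_integrable[OF ut ut]] L_nonneg by (simp add: nn_integral_completion)
      also have "\<dots> \<le> ennreal E"
        using potential_le_form[OF ut] u(2) by (intro ennreal_leI) (simp add: E_def)
      finally show "(\<integral>\<^sup>+x. ennreal ((L x *v apply_bcontfun u x) \<bullet> apply_bcontfun u x) \<partial>lebesgue) \<le> ennreal E" .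
      have "gagliardo s (apply_bcontfun u) < ennreal (2 * E0 / frac_const s)"
        by (rule le_less_trans[OF gag]) (use E0(1) c_pos in \<open>auto intro!: ennreal_lessI divide_strict_right_mono\<close>)
      moreover obtain M where "\<And>x. norm (apply_bcontfun u x) \<le> M"
        using test_function_bounded[OF ut] by blast
      moreover obtain M' where "\<And>x y. norm (apply_bcontfun u x - apply_bcontfun u y) \<le> M' * \<bar>x - y\<bar>"
        using test_function_Lipschitz[OF ut] by blast
      ultimately show "norm (apply_bcontfun u x - apply_bcontfun u y) \<le> H * \<bar>x - y\<bar> powr (s - 1 / 2)" for x y
        unfolding H_def by (rule holder_gagliardo[OF s])
    qed
    moreover have "u \<in> A v" if "v \<in> F" for v
      using u(4)[OF that] F(2) that form_eq_weak_form_test[OF ut, of "apply_bcontfun v"]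
      by (auto simp: A_def action_deriv_def test_bcontfuns_def)
    ultimately show "S \<inter> \<Inter> F' \<noteq> {}"
      using u(3) F(3) by (auto simp: S_def)
  qed
  then obtain u where u: "u \<in> S" "\<And>v. v \<in> test_bcontfuns \<Longrightarrow> u \<in> A v"
    by blast
  have "u \<noteq> 0"
    using u(1) E0(2) by (auto simp: S_def)
  moreover have "weak_form (apply_bcontfun u) \<phi> = (LINT x|lborel. gW x (apply_bcontfun u x) \<bullet> \<phi> x)" if \<phi>: "\<phi> \<in> test_functions" for \<phi>
  proof -
    obtain v where "v \<in> test_bcontfuns" "apply_bcontfun v = \<phi>"
      using test_function_bcontfun[OF \<phi>] by blast
    then show ?thesis
      using u(2)[of v] by (simp add: A_def)
  qed
  ultimately show ?thesis
    using that[of u E H] u(1) EH by (auto simp: S_def)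
qed

end

section \<open>Convolution with absolutely continuous kernels\<close>

text \<open>Absolute continuity with integrable derivative, stated through the integral identity.
  Pointwise derivatives would be unsuitable: that of the parametrix is singular at 0.\<close>

definition abs_cont_deriv :: "(real \<Rightarrow> real) \<Rightarrow> (real \<Rightarrow> real) \<Rightarrow> bool" where
  "abs_cont_deriv k k1 \<longleftrightarrow> integrable lborel k1 \<and>
     (\<forall>a b. a \<le> b \<longrightarrow> k b - k a = (LINT x|lborel. indicator {a..b} x * k1 x))"

lemma abs_cont_deriv_integrable: "abs_cont_deriv k k1 \<Longrightarrow> integrable lborel k1"
  by (simp add: abs_cont_deriv_def)

definition conv :: "(real \<Rightarrow> real) \<Rightarrow> (real \<Rightarrow> 'b::euclidean_space) \<Rightarrow> real \<Rightarrow> 'b" where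
  "conv k g x = (LINT y|lborel. k (x - y) *\<^sub>R g y)"

lemma integrable_reflect:
  fixes k :: "real \<Rightarrow> 'b::euclidean_space"
  assumes "integrable lborel k"
  shows "integrable lborel (\<lambda>y. k (x - y))"
  using lborel_integrable_real_affine[OF assms, of "-1" x] by simp

lemma integral_reflect:
  fixes k :: "real \<Rightarrow> 'b::euclidean_space"
  shows "(LINT y|lborel. k (x - y)) = (LINT y|lborel. k y)"
  using lborel_integral_real_affine[of "-1" k x] by simp

lemma integral_shift:
  fixes k :: "real \<Rightarrow> 'b::euclidean_space"
  shows "(LINT y|lborel. k (y + c)) = (LINT y|lborel. k y)"
  using lborel_integral_real_affine[of 1 k c] by (simp add: add.commute)

lemma integrable_shift:
  fixes k :: "real \<Rightarrow> 'b::euclidean_space"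
  assumes "integrable lborel k"
  shows "integrable lborel (\<lambda>y. k (y + c))"
  using lborel_integrable_real_affine[OF assms, of 1 c] by (simp add: add.commute)

lemma integrable_scale:
  fixes k :: "real \<Rightarrow> 'b::euclidean_space"
  assumes "integrable lborel k" "\<epsilon> > 0"
  shows "integrable lborel (\<lambda>z. k (z / \<epsilon>))" "(LINT z|lborel. k (z / \<epsilon>)) = \<epsilon> *\<^sub>R (LINT z|lborel. k z)"
proof -
  show "integrable lborel (\<lambda>z. k (z / \<epsilon>))"
    using lborel_integrable_real_affine[OF assms(1), of "1 / \<epsilon>" 0] assms(2) by simp
  show "(LINT z|lborel. k (z / \<epsilon>)) = \<epsilon> *\<^sub>R (LINT z|lborel. k z)"
    using lborel_integral_real_affine[of "1 / \<epsilon>" k 0] assms(2) by simp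
qed

lemma integrable_scaleR_bounded:
  fixes g :: "'a \<Rightarrow> 'b::euclidean_space" and k :: "'a \<Rightarrow> real"
  assumes k: "integrable N k" and [measurable]: "g \<in> borel_measurable N" and M: "\<And>x. norm (g x) \<le> M"
  shows "integrable N (\<lambda>x. k x *\<^sub>R g x)"
proof (rule Bochner_Integration.integrable_bound)
  have [measurable]: "k \<in> borel_measurable N"
    using k by auto
  show "integrable N (\<lambda>x. k x * M)"
    using k by simp
  show "AE x in N. norm (k x *\<^sub>R g x) \<le> norm (k x * M)"
  proof (intro AE_I2)
    fix x
    have "\<bar>k x\<bar> * norm (g x) \<le> \<bar>k x\<bar> * \<bar>M\<bar>"
      using M[of x] by (intro mult_left_mono) auto
    then show "norm (k x *\<^sub>R g x) \<le> norm (k x * M)"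
      by (simp add: abs_mult)
  qed
  show "(\<lambda>x. k x *\<^sub>R g x) \<in> borel_measurable N"
    by measurable
qed

context
  fixes g :: "real \<Rightarrow> 'b::euclidean_space" and M :: real
  assumes g [measurable]: "g \<in> borel_measurable borel" and M: "\<And>x. norm (g x) \<le> M"
begin

lemma conv_integrable:
  assumes "integrable lborel k"
  shows "integrable lborel (\<lambda>y. k (x - y) *\<^sub>R g y)"
  by (rule integrable_scaleR_bounded[OF integrable_reflect[OF assms] _ M]) simp

text \<open>The modulus of continuity of a convolution with a bounded function is controlled by the
  integral modulus of the kernel.\<close>

lemma conv_diff_norm:
  assumes k: "integrable lborel k"
  shows "norm (conv k g x - conv k g y) \<le> M * (LINT z|lborel. \<bar>k (z + (x - y)) - k z\<bar>)"
proof -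
  have int: "integrable lborel (\<lambda>z. k (x - z) - k (y - z))"
    using integrable_reflect[OF k] by auto
  have "conv k g x - conv k g y = (LINT z|lborel. (k (x - z) - k (y - z)) *\<^sub>R g z)"
    unfolding conv_def using conv_integrable[OF k, of x] conv_integrable[OF k, of y] by (simp add: scaleR_diff_left)
  also have "norm \<dots> \<le> (LINT z|lborel. M * \<bar>k (x - z) - k (y - z)\<bar>)"
  proof (rule Bochner_Integration.integral_norm_bound_integral)
    show "integrable lborel (\<lambda>z. (k (x - z) - k (y - z)) *\<^sub>R g z)"
      by (rule integrable_scaleR_bounded[OF int _ M]) simp
    show "norm ((k (x - z) - k (y - z)) *\<^sub>R g z) \<le> M * \<bar>k (x - z) - k (y - z)\<bar>" for z
      using mult_left_mono[OF M[of z], of "\<bar>k (x - z) - k (y - z)\<bar>"] by (simp add: mult.commute)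
  qed (use int in auto)
  also have "\<dots> = M * (LINT z|lborel. \<bar>k (x - z) - k (y - z)\<bar>)"
    by simp
  also have "(LINT z|lborel. \<bar>k (x - z) - k (y - z)\<bar>) = (LINT z|lborel. \<bar>k (z + (x - y)) - k z\<bar>)"
    using integral_reflect[of "\<lambda>z. \<bar>k (z + (x - y)) - k z\<bar>" y] by (simp add: algebra_simps)
  finally show ?thesis .
qed

lemma conv_norm_le:
  assumes k: "integrable lborel k"
  shows "norm (conv k g x) \<le> M * (LINT z|lborel. \<bar>k z\<bar>)"
proof -
  have "norm (conv k g x) \<le> (LINT z|lborel. M * \<bar>k (x - z)\<bar>)"
    unfolding conv_def
  proof (rule Bochner_Integration.integral_norm_bound_integral[OF conv_integrable[OF k]])
    show "norm (k (x - z) *\<^sub>R g z) \<le> M * \<bar>k (x - z)\<bar>" for z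
      using mult_left_mono[OF M[of z], of "\<bar>k (x - z)\<bar>"] by (simp add: mult.commute)
  qed (use integrable_reflect[OF k] in auto)
  also have "\<dots> = M * (LINT z|lborel. \<bar>k z\<bar>)"
    using integral_reflect[of "\<lambda>z. \<bar>k z\<bar>" x] by simp
  finally show ?thesis .
qed

text \<open>Insert the integral identity for the kernel and exchange the order of integration; no
  pointwise differentiability of k is involved.\<close>

lemma conv_abs_cont:
  assumes k: "integrable lborel k" and ac: "abs_cont_deriv k k1" and ab: "a \<le> b"
  shows "integrable lborel (\<lambda>x. indicator {a..b} x *\<^sub>R conv k1 g x)"
    "conv k g b - conv k g a = (LINT x|lborel. indicator {a..b} x *\<^sub>R conv k1 g x)"
proof -
  have k1: "integrable lborel k1"
    using ac by (simp add: abs_cont_deriv_def)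
  have i: "integrable lborel (indicator {a..b} :: real \<Rightarrow> real)"
    by (rule integrable_real_indicator) (auto simp: emeasure_lborel_Icc_eq)
  have "integrable lborel (\<lambda>z. k1 (- z))"
    using integrable_reflect[OF k1, of 0] by simp
  from integrable_mult_shear[OF i this, of "-1"]
  have "integrable (lborel \<Otimes>\<^sub>M lborel) (\<lambda>z. indicator {a..b} (fst z) * k1 (fst z - snd z))"
    by (simp add: case_prod_unfold)
  from integrable_scaleR_bounded[OF this, of "\<lambda>z. g (snd z)" M] M
  have plane: "integrable (lborel \<Otimes>\<^sub>M lborel) (\<lambda>(x, y). (indicator {a..b} x * k1 (x - y)) *\<^sub>R g y)"
    by (simp add: case_prod_unfold)
  have inner: "(LINT y|lborel. (indicator {a..b} x * k1 (x - y)) *\<^sub>R g y) = indicator {a..b} x *\<^sub>R conv k1 g x" for x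
    by (simp add: conv_def scaleR_scaleR[symmetric] del: scaleR_scaleR)
  show "integrable lborel (\<lambda>x. indicator {a..b} x *\<^sub>R conv k1 g x)"
    using lborel_pair.integrable_fst[OF plane] by (simp only: inner)
  have "conv k g b - conv k g a = (LINT y|lborel. (k (b - y) - k (a - y)) *\<^sub>R g y)"
    unfolding conv_def using conv_integrable[OF k, of a] conv_integrable[OF k, of b] by (simp add: scaleR_diff_left)
  also have "\<dots> = (LINT y|lborel. LINT x|lborel. (indicator {a..b} x * k1 (x - y)) *\<^sub>R g y)"
  proof (rule Bochner_Integration.integral_cong[OF refl])
    fix y
    have "k (b - y) - k (a - y) = (LINT x|lborel. indicator {a - y..b - y} x * k1 x)"
      using ac ab by (simp add: abs_cont_deriv_def)
    also have "\<dots> = (LINT x|lborel. indicator {a - y..b - y} (x + (- y)) * k1 (x + (- y)))"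
      using integral_shift[of "\<lambda>x. indicator {a - y..b - y} x * k1 x" "- y"] by simp
    also have "\<dots> = (LINT x|lborel. indicator {a..b} x * k1 (x - y))"
      by (intro Bochner_Integration.integral_cong) (auto split: split_indicator)
    finally have *: "k (b - y) - k (a - y) = (LINT x|lborel. indicator {a..b} x * k1 (x - y))" .
    have "integrable lborel (\<lambda>x. indicator {a..b} x * k1 (x - y))"
      using integrable_mult_indicator[of "{a..b}" lborel "\<lambda>x. k1 (x + (- y))"] integrable_shift[OF k1, of "- y"] by simp
    then show "(k (b - y) - k (a - y)) *\<^sub>R g y = (LINT x|lborel. (indicator {a..b} x * k1 (x - y)) *\<^sub>R g y)"
      unfolding * by (intro integral_scaleR_left[symmetric]) auto
  qed
  also have "\<dots> = (LINT x|lborel. LINT y|lborel. (indicator {a..b} x * k1 (x - y)) *\<^sub>R g y)"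
    by (rule lborel_pair.Fubini_integral[OF plane])
  finally show "conv k g b - conv k g a = (LINT x|lborel. indicator {a..b} x *\<^sub>R conv k1 g x)"
    by (simp only: inner)
qed

text \<open>The convolution is an indefinite integral of \<open>conv k1 g\<close>; assuming the
  latter continuous upgrades differentiability from almost everywhere to every point.\<close>

lemma conv_has_vector_derivative:
  assumes k: "integrable lborel k" and ac: "abs_cont_deriv k k1" and cont: "continuous_on UNIV (conv k1 g)"
  shows "(conv k g has_vector_derivative conv k1 g x) (at x)"
proof -
  let ?a = "x - 1" and ?b = "x + 1"
  have eq: "conv k g u = conv k g ?a + integral {?a..u} (conv k1 g)" if "u \<in> {?a..?b}" for u
  proof -
    have "set_integrable lborel {?a..u} (conv k1 g)"
      using conv_abs_cont(1)[OF k ac, of ?a u] that by (simp add: set_integrable_def)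
    from set_borel_integral_eq_integral(2)[OF this] conv_abs_cont(2)[OF k ac, of ?a u] that
    show ?thesis
      by (simp add: set_lebesgue_integral_def algebra_simps)
  qed
  have "((\<lambda>u. integral {?a..u} (conv k1 g)) has_vector_derivative conv k1 g x) (at x within {?a..?b})"
    by (rule integral_has_vector_derivative) (auto intro: continuous_on_subset[OF cont])
  then have D: "((\<lambda>u. integral {?a..u} (conv k1 g) + conv k g ?a) has_vector_derivative conv k1 g x) (at x within {?a..?b})"
    by (simp only: has_vector_derivative_add_const)
  have "(conv k g has_vector_derivative conv k1 g x) (at x within {?a..?b})"
  proof (rule has_vector_derivative_transform[OF _ _ D])
    show "conv k g u = integral {?a..u} (conv k1 g) + conv k g ?a" if "u \<in> {?a..?b}" for u
      by (subst eq[OF that]) (rule add.commute)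
  qed simp
  moreover have "at x within {?a..?b} = at x"
    by (rule at_within_interior) auto
  ultimately show ?thesis
    by simp
qed

end

text \<open>The first bound is the triangle inequality, the second writes the difference as an
  integral of k1 and applies Fubini. Keeping both lets each scale use the better one.\<close>

lemma abs_cont_translation:
  assumes k: "integrable lborel k" and ac: "abs_cont_deriv k k1" and h: "h \<ge> 0"
  shows "(LINT z|lborel. \<bar>k (z + h) - k z\<bar>) \<le> min (2 * (LINT z|lborel. \<bar>k z\<bar>)) (h * (LINT z|lborel. \<bar>k1 z\<bar>))"
proof -
  have k1: "integrable lborel k1"
    using ac by (simp add: abs_cont_deriv_def)
  have ki: "integrable lborel (\<lambda>z. \<bar>k (z + h) - k z\<bar>)"
    using k integrable_shift[OF k, of h] by auto
  have "(LINT z|lborel. \<bar>k (z + h) - k z\<bar>) \<le> (LINT z|lborel. \<bar>k (z + h)\<bar> + \<bar>k z\<bar>)"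
    using k integrable_shift[OF k, of h] ki by (intro integral_mono) auto
  also have "\<dots> = 2 * (LINT z|lborel. \<bar>k z\<bar>)"
    using k integrable_shift[OF k, of h] integral_shift[of "\<lambda>z. \<bar>k z\<bar>" h] by simp
  finally have 1: "(LINT z|lborel. \<bar>k (z + h) - k z\<bar>) \<le> 2 * (LINT z|lborel. \<bar>k z\<bar>)" .
  have i: "integrable lborel (indicator {0..h} :: real \<Rightarrow> real)"
    by (rule integrable_real_indicator) (auto simp: emeasure_lborel_Icc_eq)
  have plane: "integrable (lborel \<Otimes>\<^sub>M lborel) (\<lambda>(t, z). indicator {0..h} t * \<bar>k1 (z + 1 * t)\<bar>)"
    using k1 by (intro integrable_mult_shear[OF i, of "\<lambda>z. \<bar>k1 z\<bar>"]) auto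
  have le: "\<bar>k (z + h) - k z\<bar> \<le> (LINT t|lborel. indicator {0..h} t * \<bar>k1 (z + 1 * t)\<bar>)" for z
  proof -
    have "k (z + h) - k z = (LINT x|lborel. indicator {z..z + h} x * k1 x)"
      using ac h by (simp add: abs_cont_deriv_def)
    also have "\<dots> = (LINT t|lborel. indicator {z..z + h} (t + z) * k1 (t + z))"
      using integral_shift[of "\<lambda>x. indicator {z..z + h} x * k1 x" z] by simp
    also have "\<dots> = (LINT t|lborel. indicator {0..h} t * k1 (z + 1 * t))"
      by (intro Bochner_Integration.integral_cong) (auto split: split_indicator simp: add.commute)
    finally have eq: "k (z + h) - k z = (LINT t|lborel. indicator {0..h} t * k1 (z + 1 * t))" .
    have int: "integrable lborel (\<lambda>t. indicator {0..h} t * k1 (z + 1 * t))"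
      using integrable_mult_indicator[of "{0..h}" lborel "\<lambda>x. k1 (x + z)"] integrable_shift[OF k1, of z] by (simp add: add.commute)
    have "\<bar>LINT t|lborel. indicator {0..h} t * k1 (z + 1 * t)\<bar> \<le> (LINT t|lborel. \<bar>indicator {0..h} t * k1 (z + 1 * t)\<bar>)"
      by (rule integral_abs_bound)
    then show ?thesis
      unfolding eq by (simp add: abs_mult)
  qed
  have "(LINT z|lborel. \<bar>k (z + h) - k z\<bar>) \<le> (LINT z|lborel. LINT t|lborel. indicator {0..h} t * \<bar>k1 (z + 1 * t)\<bar>)"
    using le by (intro integral_mono ki lborel_pair.integrable_snd[OF plane]) auto
  also have "\<dots> = (LINT t|lborel. LINT z|lborel. indicator {0..h} t * \<bar>k1 (z + 1 * t)\<bar>)"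
    by (rule lborel_pair.Fubini_integral[OF plane])
  also have "\<dots> = (LINT t|lborel. indicator {0..h} t * (LINT z|lborel. \<bar>k1 z\<bar>))"
    using integral_shift[of "\<lambda>z. \<bar>k1 z\<bar>"] by simp
  also have "\<dots> = h * (LINT z|lborel. \<bar>k1 z\<bar>)"
    using h by simp
  finally show ?thesis
    using 1 by simp
qed

section \<open>Kernels obtained by superposing dilates over scales\<close>

text \<open>Both kernels of the representation formula, \<open>\<rho>\<close> and
  \<open>parametrix\<close>, have this form; the weight w vanishes on nonpositive scales in all
  uses.\<close>

definition dilation_kernel :: "(real \<Rightarrow> real) \<Rightarrow> (real \<Rightarrow> real) \<Rightarrow> real \<Rightarrow> real" where
  "dilation_kernel w k z = (LINT \<epsilon>|lborel. w \<epsilon> * k (z / \<epsilon>))"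

text \<open>Dilation by \<epsilon> multiplies the integral norm by \<epsilon>, which the factor
  1/\<epsilon> cancels, so integrability in the plane reduces to that of w.\<close>

lemma dilation_plane:
  fixes w k1 :: "real \<Rightarrow> real"
  assumes w: "integrable lborel w" "\<And>\<epsilon>. w \<epsilon> \<ge> 0" "\<And>\<epsilon>. \<epsilon> \<le> 0 \<Longrightarrow> w \<epsilon> = 0"
    and k1: "integrable lborel k1"
  shows "integrable (lborel \<Otimes>\<^sub>M lborel) (\<lambda>(\<epsilon>, z). w \<epsilon> / \<epsilon> * k1 ((z + d) / \<epsilon>))"
proof (rule lborel_pair.Fubini_integrable)
  have [measurable]: "w \<in> borel_measurable borel" "k1 \<in> borel_measurable borel"
    using w(1) k1 borel_measurable_integrable by fastforce+
  have inner: "integrable lborel (\<lambda>z. w \<epsilon> / \<epsilon> * k1 ((z + d) / \<epsilon>))"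
    "(LINT z|lborel. \<bar>w \<epsilon> / \<epsilon> * k1 ((z + d) / \<epsilon>)\<bar>) = w \<epsilon> * (LINT z|lborel. \<bar>k1 z\<bar>)" for \<epsilon>
  proof -
    show "integrable lborel (\<lambda>z. w \<epsilon> / \<epsilon> * k1 ((z + d) / \<epsilon>))"
      using integrable_shift[OF integrable_scale(1)[OF k1], of \<epsilon> d] w(3)[of \<epsilon>] by (cases "\<epsilon> > 0") auto
    show "(LINT z|lborel. \<bar>w \<epsilon> / \<epsilon> * k1 ((z + d) / \<epsilon>)\<bar>) = w \<epsilon> * (LINT z|lborel. \<bar>k1 z\<bar>)"
    proof (cases "\<epsilon> > 0")
      case True
      have "(LINT z|lborel. \<bar>k1 ((z + d) / \<epsilon>)\<bar>) = \<epsilon> * (LINT z|lborel. \<bar>k1 z\<bar>)"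
        using integrable_scale(2)[of "\<lambda>z. \<bar>k1 z\<bar>" \<epsilon>] k1 True integral_shift[of "\<lambda>z. \<bar>k1 (z / \<epsilon>)\<bar>" d] by simp
      then show ?thesis
        using True w(2)[of \<epsilon>] by (simp add: abs_mult)
    qed (use w(3)[of \<epsilon>] in auto)
  qed
  show "integrable lborel (\<lambda>\<epsilon>. LINT z|lborel. norm (case (\<epsilon>, z) of (\<epsilon>, z) \<Rightarrow> w \<epsilon> / \<epsilon> * k1 ((z + d) / \<epsilon>)))"
    using w(1) inner(2) by simp
  show "AE \<epsilon> in lborel. integrable lborel (\<lambda>z. case (\<epsilon>, z) of (\<epsilon>, z) \<Rightarrow> w \<epsilon> / \<epsilon> * k1 ((z + d) / \<epsilon>))"
    using inner(1) by simp
  show "(\<lambda>(\<epsilon>, z). w \<epsilon> / \<epsilon> * k1 ((z + d) / \<epsilon>)) \<in> borel_measurable (lborel \<Otimes>\<^sub>M lborel)"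
    by measurable
qed

context
  fixes w k k1 k2 :: "real \<Rightarrow> real" and B :: real
  assumes w: "integrable lborel w" "\<And>\<epsilon>. w \<epsilon> \<ge> 0" "\<And>\<epsilon>. \<epsilon> \<le> 0 \<Longrightarrow> w \<epsilon> = 0"
    and k_bound: "\<And>z. \<bar>k z\<bar> \<le> B" and k_meas [measurable]: "k \<in> borel_measurable borel"
    and ac: "abs_cont_deriv k k1"
begin

text \<open>The dilate k(z/\<epsilon>) has derivative k1(z/\<epsilon>)/\<epsilon>. The integrated
  identity is superposed over scales by Fubini, which tolerates a singular result.\<close>

lemma dilation_kernel_abs_cont:
  "abs_cont_deriv (dilation_kernel w k) (dilation_kernel (\<lambda>\<epsilon>. w \<epsilon> / \<epsilon>) k1)"
proof -
  note k1_integrable = abs_cont_deriv_integrable[OF ac]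
  have plane_shift: "integrable (lborel \<Otimes>\<^sub>M lborel) (\<lambda>(\<epsilon>, z). w \<epsilon> / \<epsilon> * k1 ((z + d) / \<epsilon>))" for d
    by (rule dilation_plane) (use w k1_integrable in auto)
  show ?thesis
    unfolding abs_cont_deriv_def
  proof (intro conjI allI impI)
  show "integrable lborel (dilation_kernel (\<lambda>\<epsilon>. w \<epsilon> / \<epsilon>) k1)"
    using lborel_pair.integrable_snd[OF plane_shift[of 0]] by (simp add: dilation_kernel_def[abs_def])
  fix a b :: real assume ab: "a \<le> b"
  have wk: "integrable lborel (\<lambda>\<epsilon>. w \<epsilon> * k (z / \<epsilon>))" for z
    using integrable_scaleR_bounded[OF w(1), of "\<lambda>\<epsilon>. k (z / \<epsilon>)" B] k_bound by simp
  have inner: "w \<epsilon> * (k (b / \<epsilon>) - k (a / \<epsilon>)) = (LINT z|lborel. indicator {a..b} z * (w \<epsilon> / \<epsilon> * k1 (z / \<epsilon>)))" for \<epsilon>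
  proof (cases "\<epsilon> > 0")
    case True
    have "k (b / \<epsilon>) - k (a / \<epsilon>) = (LINT z|lborel. indicator {a / \<epsilon>..b / \<epsilon>} z * k1 z)"
      using ac ab True by (simp add: abs_cont_deriv_def divide_right_mono)
    also have "\<dots> = (LINT z|lborel. indicator {a / \<epsilon>..b / \<epsilon>} (z / \<epsilon>) * k1 (z / \<epsilon>)) / \<epsilon>"
    proof -
      have "integrable lborel (\<lambda>z. indicator {a / \<epsilon>..b / \<epsilon>} z * k1 z)"
        using integrable_mult_indicator[OF _ k1_integrable, of "{a / \<epsilon>..b / \<epsilon>}"] by simp
      from integrable_scale(2)[OF this True] True show ?thesis
        by simp
    qed
    also have "(LINT z|lborel. indicator {a / \<epsilon>..b / \<epsilon>} (z / \<epsilon>) * k1 (z / \<epsilon>)) = (LINT z|lborel. indicator {a..b} z * k1 (z / \<epsilon>))"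
      using True by (intro Bochner_Integration.integral_cong) (auto split: split_indicator simp: divide_le_cancel)
    finally show ?thesis
      by (simp add: mult.left_commute[of "indicator _ _"])
  qed (use w(3)[of \<epsilon>] in auto)
  have "integrable (lborel \<Otimes>\<^sub>M lborel) (\<lambda>p. indicator (UNIV \<times> {a..b}) p *\<^sub>R (case p of (\<epsilon>, z) \<Rightarrow> w \<epsilon> / \<epsilon> * k1 ((z + 0) / \<epsilon>)))"
    by (rule integrable_mult_indicator[OF _ plane_shift[of 0]]) simp
  moreover have "(\<lambda>p. indicator (UNIV \<times> {a..b}) p *\<^sub>R (case p of (\<epsilon>, z) \<Rightarrow> w \<epsilon> / \<epsilon> * k1 ((z + 0) / \<epsilon>)))
    = (\<lambda>(\<epsilon>, z). indicator {a..b} z * (w \<epsilon> / \<epsilon> * k1 (z / \<epsilon>)))"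
    by (auto split: split_indicator)
  ultimately have plane: "integrable (lborel \<Otimes>\<^sub>M lborel) (\<lambda>(\<epsilon>, z). indicator {a..b} z * (w \<epsilon> / \<epsilon> * k1 (z / \<epsilon>)))"
    by simp
  have "dilation_kernel w k b - dilation_kernel w k a = (LINT \<epsilon>|lborel. w \<epsilon> * (k (b / \<epsilon>) - k (a / \<epsilon>)))"
    unfolding dilation_kernel_def using wk[of a] wk[of b] by (simp add: right_diff_distrib)
  also have "\<dots> = (LINT \<epsilon>|lborel. LINT z|lborel. indicator {a..b} z * (w \<epsilon> / \<epsilon> * k1 (z / \<epsilon>)))"
    by (simp only: inner)
  also have "\<dots> = (LINT z|lborel. LINT \<epsilon>|lborel. indicator {a..b} z * (w \<epsilon> / \<epsilon> * k1 (z / \<epsilon>)))"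
    by (rule lborel_pair.Fubini_integral[OF plane, symmetric])
  also have "\<dots> = (LINT z|lborel. indicator {a..b} z * dilation_kernel (\<lambda>\<epsilon>. w \<epsilon> / \<epsilon>) k1 z)"
    by (simp only: dilation_kernel_def integral_mult_right_zero)
  finally show "dilation_kernel w k b - dilation_kernel w k a
    = (LINT z|lborel. indicator {a..b} z * dilation_kernel (\<lambda>\<epsilon>. w \<epsilon> / \<epsilon>) k1 z)" .
  qed
qed

text \<open>At scale \<epsilon> a shift by d is a shift by d/\<epsilon> of the profile, so
  \<open>abs_cont_translation\<close> is applied scale by scale.\<close>

lemma dilation_kernel_translation:
  assumes ac1: "abs_cont_deriv k1 k2" and d: "d \<ge> 0"
  shows "(LINT z|lborel. \<bar>dilation_kernel (\<lambda>\<epsilon>. w \<epsilon> / \<epsilon>) k1 (z + d) - dilation_kernel (\<lambda>\<epsilon>. w \<epsilon> / \<epsilon>) k1 z\<bar>)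
    \<le> (LINT \<epsilon>|lborel. w \<epsilon> * min (2 * (LINT z|lborel. \<bar>k1 z\<bar>)) (d / \<epsilon> * (LINT z|lborel. \<bar>k2 z\<bar>)))"
proof -
  note k1_integrable = abs_cont_deriv_integrable[OF ac]
  have plane_shift: "integrable (lborel \<Otimes>\<^sub>M lborel) (\<lambda>(\<epsilon>, z). w \<epsilon> / \<epsilon> * k1 ((z + d) / \<epsilon>))" for d
    by (rule dilation_plane) (use w k1_integrable in auto)
  have [measurable]: "w \<in> borel_measurable borel" "k1 \<in> borel_measurable borel"
    using w(1) k1_integrable borel_measurable_integrable by fastforce+
  let ?K = "dilation_kernel (\<lambda>\<epsilon>. w \<epsilon> / \<epsilon>) k1"
  let ?F = "\<lambda>\<epsilon> z. w \<epsilon> / \<epsilon> * k1 ((z + d) / \<epsilon>) - w \<epsilon> / \<epsilon> * k1 ((z + 0) / \<epsilon>)"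
  let ?A = "LINT z|lborel. \<bar>k1 z\<bar>" and ?A2 = "LINT z|lborel. \<bar>k2 z\<bar>"
  have plane: "integrable (lborel \<Otimes>\<^sub>M lborel) (\<lambda>(\<epsilon>, z). ?F \<epsilon> z)"
    using Bochner_Integration.integrable_diff[OF plane_shift[of d] plane_shift[of 0]] by (simp add: case_prod_unfold)
  have planen: "integrable (lborel \<Otimes>\<^sub>M lborel) (\<lambda>(\<epsilon>, z). \<bar>?F \<epsilon> z\<bar>)"
    using Bochner_Integration.integrable_norm[OF plane] by (simp add: case_prod_unfold)
  have Kint: "integrable lborel ?K"
    using dilation_kernel_abs_cont by (simp add: abs_cont_deriv_def)
  \<comment> \<open>Only almost everywhere: splitting the difference requires both scale integrals
    to converge, which Fubini grants for almost every z.\<close>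
  have "AE z in lborel. ?K (z + d) - ?K z = (LINT \<epsilon>|lborel. ?F \<epsilon> z)"
    using lborel_pair.AE_integrable_snd[OF plane_shift[of d]] lborel_pair.AE_integrable_snd[OF plane_shift[of 0]]
    by eventually_elim (simp add: dilation_kernel_def)
  then have "AE z in lborel. \<bar>?K (z + d) - ?K z\<bar> \<le> (LINT \<epsilon>|lborel. \<bar>?F \<epsilon> z\<bar>)"
    by eventually_elim (simp only: integral_abs_bound)
  then have "(LINT z|lborel. \<bar>?K (z + d) - ?K z\<bar>) \<le> (LINT z|lborel. LINT \<epsilon>|lborel. \<bar>?F \<epsilon> z\<bar>)"
    using Kint integrable_shift[OF Kint, of d] lborel_pair.integrable_snd[OF planen] by (intro integral_mono_AE) auto
  also have "\<dots> = (LINT \<epsilon>|lborel. LINT z|lborel. \<bar>?F \<epsilon> z\<bar>)"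
    by (rule lborel_pair.Fubini_integral[OF planen])
  also have "\<dots> \<le> (LINT \<epsilon>|lborel. w \<epsilon> * min (2 * ?A) (d / \<epsilon> * ?A2))"
  proof (rule integral_mono)
    show "integrable lborel (\<lambda>\<epsilon>. LINT z|lborel. \<bar>?F \<epsilon> z\<bar>)"
      by (rule lborel_pair.integrable_fst[OF planen])
    have A: "?A \<ge> 0" "?A2 \<ge> 0"
      by (auto intro: integral_nonneg_AE)
    show "integrable lborel (\<lambda>\<epsilon>. w \<epsilon> * min (2 * ?A) (d / \<epsilon> * ?A2))"
    proof (rule Bochner_Integration.integrable_bound)
      show "integrable lborel (\<lambda>\<epsilon>. w \<epsilon> * (2 * ?A))"
        using w(1) by simp
      have "\<bar>w \<epsilon> * min (2 * ?A) (d / \<epsilon> * ?A2)\<bar> \<le> \<bar>w \<epsilon> * (2 * ?A)\<bar>" for \<epsilon>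
      proof (cases "\<epsilon> > 0")
        case True
        then have "0 \<le> d / \<epsilon> * ?A2"
          using A d by simp
        then have "\<bar>min (2 * ?A) (d / \<epsilon> * ?A2)\<bar> \<le> \<bar>2 * ?A\<bar>"
          using A by auto
        then show ?thesis
          unfolding abs_mult by (intro mult_left_mono) auto
      qed (use w(3)[of \<epsilon>] in auto)
      then show "AE \<epsilon> in lborel. norm (w \<epsilon> * min (2 * ?A) (d / \<epsilon> * ?A2)) \<le> norm (w \<epsilon> * (2 * ?A))"
        by simp
    qed measurable
    fix \<epsilon> :: real
    show "(LINT z|lborel. \<bar>?F \<epsilon> z\<bar>) \<le> w \<epsilon> * min (2 * ?A) (d / \<epsilon> * ?A2)"
    proof (cases "\<epsilon> > 0")
      case True
      have "(LINT z|lborel. \<bar>?F \<epsilon> z\<bar>) = (LINT z|lborel. w \<epsilon> / \<epsilon> * \<bar>k1 (z / \<epsilon> + d / \<epsilon>) - k1 (z / \<epsilon>)\<bar>)"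
      proof (rule Bochner_Integration.integral_cong[OF refl])
        fix z
        have "?F \<epsilon> z = w \<epsilon> / \<epsilon> * (k1 (z / \<epsilon> + d / \<epsilon>) - k1 (z / \<epsilon>))"
          by (simp only: right_diff_distrib add_divide_distrib div_0 add_0_right)
        then show "\<bar>?F \<epsilon> z\<bar> = w \<epsilon> / \<epsilon> * \<bar>k1 (z / \<epsilon> + d / \<epsilon>) - k1 (z / \<epsilon>)\<bar>"
          using True w(2)[of \<epsilon>] by (simp only: abs_mult abs_of_nonneg divide_nonneg_pos)
      qed
      also have "\<dots> = w \<epsilon> / \<epsilon> * (\<epsilon> * (LINT z|lborel. \<bar>k1 (z + d / \<epsilon>) - k1 z\<bar>))"
        using integrable_scale(2)[of "\<lambda>z. \<bar>k1 (z + d / \<epsilon>) - k1 z\<bar>" \<epsilon>] True k1_integrable integrable_shift[OF k1_integrable, of "d / \<epsilon>"]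
        by simp
      also have "\<dots> = w \<epsilon> * (LINT z|lborel. \<bar>k1 (z + d / \<epsilon>) - k1 z\<bar>)"
        using True by simp
      also have "\<dots> \<le> w \<epsilon> * min (2 * ?A) (d / \<epsilon> * ?A2)"
        using d True w(2) by (intro mult_left_mono abs_cont_translation[OF k1_integrable ac1]) auto
      finally show ?thesis .
    qed (use w(3)[of \<epsilon>] in auto)
  qed
  finally show ?thesis .
qed

end

section \<open>An approximate identity with fractional Laplacian profile\<close>

lemma exists_antiderivative:
  fixes f :: "real \<Rightarrow> real"
  assumes "continuous_on UNIV f"
  obtains F where "\<And>x. (F has_real_derivative f x) (at x)" "F 0 = 0"
proof -
  have "isCont f x" for x
    using assms by (simp add: continuous_on_eq_continuous_at)
  then obtain F where F: "\<And>x. (F has_vector_derivative f x) (at x)"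
    using einterval_antiderivative[of "-\<infinity>" "\<infinity>" f] by auto
  show ?thesis
  proof (rule that[of "\<lambda>x. F x - F 0"])
    show "((\<lambda>x. F x - F 0) has_real_derivative f x) (at x)" for x
      using DERIV_diff[OF F[of x, folded has_real_derivative_iff_has_vector_derivative] DERIV_const[of "F 0"]] by simp
  qed simp
qed

lemma FTC_indicator:
  fixes F f :: "real \<Rightarrow> real"
  assumes "a \<le> b" "\<And>x. (F has_real_derivative f x) (at x)" "continuous_on UNIV f"
  shows "(LINT x|lborel. indicator {a..b} x * f x) = F b - F a"
    "integrable lborel (\<lambda>x. indicator {a..b} x * f x)"
proof -
  have "isCont f x" for x
    using assms(3) by (simp add: continuous_on_eq_continuous_at)
  with integral_FTC_Icc_real[of a b F f] assms(1,2) show "(LINT x|lborel. indicator {a..b} x * f x) = F b - F a"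
    by (simp add: mult.commute)
  show "integrable lborel (\<lambda>x. indicator {a..b} x * f x)"
    using borel_integrable_atLeastAtMost'[OF continuous_on_subset[OF assms(3) subset_UNIV], of a b] by (simp add: set_integrable_def)
qed

lemma test_function_abs_cont:
  fixes \<phi> :: "real \<Rightarrow> real"
  assumes "\<phi> \<in> test_functions"
  obtains \<phi>' where "\<phi>' \<in> test_functions" "\<And>x. (\<phi> has_real_derivative \<phi>' x) (at x)" "abs_cont_deriv \<phi> \<phi>'"
proof -
  obtain \<phi>' where \<phi>': "\<phi>' \<in> test_functions" "\<And>x. (\<phi> has_vector_derivative \<phi>' x) (at x)"
    using test_function_has_derivative[OF assms] by blast
  have d: "(\<phi> has_real_derivative \<phi>' x) (at x)" for x
    using \<phi>'(2) by (simp add: has_real_derivative_iff_has_vector_derivative)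
  have "abs_cont_deriv \<phi> \<phi>'"
    unfolding abs_cont_deriv_def
    using test_function_integrable[OF \<phi>'(1)] FTC_indicator(1)[OF _ d test_function_continuous[OF \<phi>'(1)]] by auto
  then show ?thesis
    using that \<phi>'(1) d by blast
qed

lemma second_diff_has_derivative:
  fixes \<phi> \<phi>' :: "real \<Rightarrow> real"
  assumes "\<And>x. (\<phi> has_real_derivative \<phi>' x) (at x)"
  shows "((\<lambda>x. second_diff \<phi> x t) has_real_derivative second_diff \<phi>' x t) (at x)"
proof -
  have 1: "((\<lambda>x. \<phi> (x + t)) has_real_derivative \<phi>' (x + t)) (at x)"
    using DERIV_shift[of \<phi> "\<phi>' (x + t)" x t] assms by (simp add: add.commute)
  have 2: "((\<lambda>x. \<phi> (x - t)) has_real_derivative \<phi>' (x - t)) (at x)"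
    using DERIV_shift[of \<phi> "\<phi>' (x - t)" x "- t"] assms by (simp add: add.commute)
  show ?thesis
    unfolding second_diff_def using assms by (auto intro!: derivative_eq_intros 1 2)
qed

lemma second_diff_continuous:
  fixes \<phi> :: "real \<Rightarrow> real"
  assumes "continuous_on UNIV \<phi>"
  shows "continuous_on UNIV (\<lambda>x. second_diff \<phi> x t)"
  unfolding second_diff_def by (intro continuous_intros continuous_on_compose2[OF assms]) auto

lemma frac_lap_interval:
  fixes \<phi> :: "real \<Rightarrow> real"
  assumes s: "0 < s" "s < 1" and \<phi>: "\<phi> \<in> test_functions"
  shows "(LINT x|lborel. indicator {a..b} x * frac_lap s \<phi> x)
      = (LINT t|lborel. levy s t * (LINT x|lborel. indicator {a..b} x * second_diff \<phi> x t))"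
    "integrable lborel (\<lambda>t. levy s t * (LINT x|lborel. indicator {a..b} x * second_diff \<phi> x t))"
proof -
  have "integrable (lborel \<Otimes>\<^sub>M lborel) (\<lambda>p. indicator (UNIV \<times> {a..b}) p *\<^sub>R (case p of (t, x) \<Rightarrow> levy s t *\<^sub>R second_diff \<phi> x t))"
    by (rule integrable_mult_indicator[OF _ second_diff_integrable_plane[OF s \<phi>]]) simp
  moreover have "(\<lambda>p. indicator (UNIV \<times> {a..b}) p *\<^sub>R (case p of (t, x) \<Rightarrow> levy s t *\<^sub>R second_diff \<phi> x t))
    = (\<lambda>(t, x). levy s t * (indicator {a..b} x * second_diff \<phi> x t))"
    by (auto split: split_indicator)
  ultimately have plane: "integrable (lborel \<Otimes>\<^sub>M lborel) (\<lambda>(t, x). levy s t * (indicator {a..b} x * second_diff \<phi> x t))"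
    by simp
  have "(LINT x|lborel. indicator {a..b} x * frac_lap s \<phi> x)
    = (LINT x|lborel. LINT t|lborel. levy s t * (indicator {a..b} x * second_diff \<phi> x t))"
    by (simp only: frac_lap_def real_scaleR_def integral_mult_right_zero[symmetric] mult.left_commute)
  also have "\<dots> = (LINT t|lborel. LINT x|lborel. levy s t * (indicator {a..b} x * second_diff \<phi> x t))"
    by (rule lborel_pair.Fubini_integral[OF plane])
  finally show "(LINT x|lborel. indicator {a..b} x * frac_lap s \<phi> x)
      = (LINT t|lborel. levy s t * (LINT x|lborel. indicator {a..b} x * second_diff \<phi> x t))"
    by simp
  show "integrable lborel (\<lambda>t. levy s t * (LINT x|lborel. indicator {a..b} x * second_diff \<phi> x t))"
    using lborel_pair.integrable_fst[OF plane] by simp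
qed

text \<open>Second differences commute with differentiation, and Fubini exchanges the Levy integral
  with the integral over [a, b].\<close>

lemma frac_lap_abs_cont:
  fixes \<phi> \<phi>' :: "real \<Rightarrow> real"
  assumes s: "0 < s" "s < 1" and \<phi>: "\<phi> \<in> test_functions" "\<phi>' \<in> test_functions"
    and d: "\<And>x. (\<phi> has_real_derivative \<phi>' x) (at x)"
  shows "abs_cont_deriv (frac_lap s \<phi>) (frac_lap s \<phi>')"
  unfolding abs_cont_deriv_def
proof (intro conjI allI impI)
  show "integrable lborel (frac_lap s \<phi>')"
    by (rule frac_lap_integrable[OF s \<phi>(2)])
  fix a b :: real assume ab: "a \<le> b"
  have "(LINT x|lborel. indicator {a..b} x * second_diff \<phi>' x t) = second_diff \<phi> b t - second_diff \<phi> a t" for t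
    by (rule FTC_indicator(1)[OF ab second_diff_has_derivative[OF d] second_diff_continuous[OF test_function_continuous[OF \<phi>(2)]]])
  then have "(LINT x|lborel. indicator {a..b} x * frac_lap s \<phi>' x)
    = (LINT t|lborel. levy s t * (second_diff \<phi> b t - second_diff \<phi> a t))"
    by (simp add: frac_lap_interval(1)[OF s \<phi>(2)])
  also have "\<dots> = frac_lap s \<phi> b - frac_lap s \<phi> a"
    unfolding frac_lap_def
    using second_diff_integrable[OF s \<phi>(1), of a] second_diff_integrable[OF s \<phi>(1), of b] by (simp add: right_diff_distrib)
  finally show "frac_lap s \<phi> b - frac_lap s \<phi> a = (LINT x|lborel. indicator {a..b} x * frac_lap s \<phi>' x)"
    by simp
qed

lemma frac_lap_Lipschitz:
  fixes \<phi> :: "real \<Rightarrow> real"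
  assumes s: "0 < s" "s < 1" and \<phi>: "\<phi> \<in> test_functions"
  obtains C where "C > 0" "\<And>x y. \<bar>frac_lap s \<phi> x - frac_lap s \<phi> y\<bar> \<le> C * \<bar>x - y\<bar>"
proof -
  obtain \<phi>' where \<phi>': "\<phi>' \<in> test_functions" "\<And>x. (\<phi> has_real_derivative \<phi>' x) (at x)"
    using test_function_abs_cont[OF \<phi>] by metis
  obtain C where C: "\<And>x. \<bar>frac_lap s \<phi>' x\<bar> \<le> C"
    using frac_lap_bounded[OF s \<phi>'(1)] by (metis real_norm_def)
  have le: "\<bar>frac_lap s \<phi> y - frac_lap s \<phi> x\<bar> \<le> C * (y - x)" if "x \<le> y" for x y
  proof -
    have i: "integrable lborel (\<lambda>z. indicator {x..y} z * frac_lap s \<phi>' z)"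
      using integrable_mult_indicator[OF _ frac_lap_integrable[OF s \<phi>'(1)], of "{x..y}"] by simp
    have "\<bar>frac_lap s \<phi> y - frac_lap s \<phi> x\<bar> = norm (LINT z|lborel. indicator {x..y} z * frac_lap s \<phi>' z)"
      using frac_lap_abs_cont[OF s \<phi> \<phi>'] that by (simp add: abs_cont_deriv_def)
    also have "\<dots> \<le> (LINT z|lborel. indicator {x..y} z * C)"
    proof (rule Bochner_Integration.integral_norm_bound_integral[OF i])
      show "integrable lborel (\<lambda>z. indicator {x..y} z * C)"
        by (intro integrable_mult_left integrable_real_indicator) (auto simp: emeasure_lborel_Icc_eq)
      show "norm (indicator {x..y} z * frac_lap s \<phi>' z) \<le> indicator {x..y} z * C" for z
        using C[of z] by (auto split: split_indicator)
    qed
    also have "\<dots> = C * (y - x)"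
      using that by simp
    finally show ?thesis .
  qed
  show ?thesis
  proof (rule that[of "\<bar>C\<bar> + 1"])
    show "\<bar>frac_lap s \<phi> x - frac_lap s \<phi> y\<bar> \<le> (\<bar>C\<bar> + 1) * \<bar>x - y\<bar>" for x y
    proof -
      have "\<bar>frac_lap s \<phi> x - frac_lap s \<phi> y\<bar> \<le> C * \<bar>x - y\<bar>"
        using le[of x y] le[of y x] by (cases "x \<le> y") (auto simp: abs_minus_commute)
      also have "\<dots> \<le> (\<bar>C\<bar> + 1) * \<bar>x - y\<bar>"
        by (intro mult_right_mono) auto
      finally show ?thesis .
    qed
  qed auto
qed

lemma frac_lap_continuous:
  fixes \<phi> :: "real \<Rightarrow> real"
  assumes s: "0 < s" "s < 1" and \<phi>: "\<phi> \<in> test_functions"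
  shows "continuous_on UNIV (frac_lap s \<phi>)"
proof -
  obtain C where C: "C > 0" "\<And>x y. \<bar>frac_lap s \<phi> x - frac_lap s \<phi> y\<bar> \<le> C * \<bar>x - y\<bar>"
    using frac_lap_Lipschitz[OF assms] by blast
  have "C-lipschitz_on UNIV (frac_lap s \<phi>)"
    by (rule lipschitz_onI) (use C in \<open>auto simp: dist_real_def\<close>)
  then show ?thesis
    by (rule lipschitz_on_continuous_on)
qed

text \<open>Substituting \<epsilon> t, the kernel gives \<epsilon>^(-1-2s) and the line element
  \<epsilon>. The reflection in (x - y)/\<epsilon> is invisible because second differences are
  symmetric in t.\<close>

lemma frac_lap_dilation:
  fixes \<phi> :: "real \<Rightarrow> real" and v :: "'b::euclidean_space"
  assumes s: "0 < s" "s < 1" and \<phi>: "\<phi> \<in> test_functions" and \<epsilon>: "\<epsilon> > 0"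
  shows "frac_lap s (\<lambda>y. \<phi> ((x - y) / \<epsilon>) *\<^sub>R v) y = (\<epsilon> powr (- (2 * s)) * frac_lap s \<phi> ((x - y) / \<epsilon>)) *\<^sub>R v"
proof -
  let ?h = "\<lambda>t. levy s t * second_diff \<phi> ((x - y) / \<epsilon>) t"
  have levy: "levy s (\<epsilon> * t) = \<epsilon> powr (- (1 + 2 * s)) * levy s t" for t
    unfolding levy_def powr_minus using \<epsilon> by (simp add: abs_mult powr_mult divide_inverse)
  have sd: "second_diff (\<lambda>y. \<phi> ((x - y) / \<epsilon>) *\<^sub>R v) y (\<epsilon> * t) = second_diff \<phi> ((x - y) / \<epsilon>) t *\<^sub>R v" for t
  proof -
    have e: "(x - (y + \<epsilon> * t)) / \<epsilon> = (x - y) / \<epsilon> - t" "(x - (y - \<epsilon> * t)) / \<epsilon> = (x - y) / \<epsilon> + t"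
      using \<epsilon> by (auto simp: field_simps)
    have "2 *\<^sub>R (p *\<^sub>R v) - q *\<^sub>R v - r *\<^sub>R v = (2 *\<^sub>R p - r - q) *\<^sub>R v" for p q r :: real
      by (simp add: scaleR_diff_left)
    then show ?thesis
      by (simp only: second_diff_def e)
  qed
  have "frac_lap s (\<lambda>y. \<phi> ((x - y) / \<epsilon>) *\<^sub>R v) y
    = \<epsilon> *\<^sub>R (LINT t|lborel. levy s (\<epsilon> * t) *\<^sub>R second_diff (\<lambda>y. \<phi> ((x - y) / \<epsilon>) *\<^sub>R v) y (\<epsilon> * t))"
    unfolding frac_lap_def using \<epsilon>
      lborel_integral_real_affine[of \<epsilon> "\<lambda>t. levy s t *\<^sub>R second_diff (\<lambda>y. \<phi> ((x - y) / \<epsilon>) *\<^sub>R v) y t" 0]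
    by simp
  also have "\<dots> = \<epsilon> *\<^sub>R (LINT t|lborel. (\<epsilon> powr (- (1 + 2 * s)) * ?h t) *\<^sub>R v)"
    by (simp only: levy sd scaleR_scaleR mult.assoc)
  also have "(LINT t|lborel. (\<epsilon> powr (- (1 + 2 * s)) * ?h t) *\<^sub>R v) = (\<epsilon> powr (- (1 + 2 * s)) * frac_lap s \<phi> ((x - y) / \<epsilon>)) *\<^sub>R v"
    using second_diff_integrable[OF s \<phi>, of "(x - y) / \<epsilon>"] by (simp add: frac_lap_def)
  also have "\<epsilon> *\<^sub>R \<dots> = (\<epsilon> powr 1 * \<epsilon> powr (- (1 + 2 * s)) * frac_lap s \<phi> ((x - y) / \<epsilon>)) *\<^sub>R v"
    using \<epsilon> by simp
  also have "\<epsilon> powr 1 * \<epsilon> powr (- (1 + 2 * s)) = \<epsilon> powr (- (2 * s))"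
    unfolding powr_add[symmetric] by simp
  finally show ?thesis .
qed

locale dilation_bump =
  fixes s :: real and \<phi> :: "real \<Rightarrow> real"
  assumes s: "1 / 2 < s" "s < 1"
    and \<phi>: "\<phi> \<in> test_functions" "\<phi> 0 > 0" "\<And>x. \<phi> x \<ge> 0" "\<And>x. \<bar>x\<bar> \<ge> 1 \<Longrightarrow> \<phi> x = 0"
      "\<And>x. \<phi> (- x) = \<phi> x" "\<And>x y. \<bar>x\<bar> \<le> \<bar>y\<bar> \<Longrightarrow> \<phi> y \<le> \<phi> x"
begin

lemma s': "0 < s" "s < 1"
  using s by auto

definition \<psi> :: "real \<Rightarrow> real" where "\<psi> = frac_lap s \<phi>"

text \<open>A probability density: bounds on \<open>\<psi>\<close> pass to \<open>\<rho>\<close>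
  unchanged, and both agree at 0.\<close>

definition large_scales :: "real \<Rightarrow> real" where
  "large_scales \<epsilon> = indicator {1..} \<epsilon> * \<epsilon> powr (- 2)"

definition \<rho> :: "real \<Rightarrow> real" where "\<rho> = dilation_kernel large_scales \<psi>"

lemma \<psi>_continuous: "continuous_on UNIV \<psi>"
  unfolding \<psi>_def by (rule frac_lap_continuous[OF s' \<phi>(1)])

lemma \<psi>_measurable [measurable]: "\<psi> \<in> borel_measurable borel"
  using \<psi>_continuous by (rule borel_measurable_continuous_onI)

lemma \<psi>_integrable: "integrable lborel \<psi>"
  unfolding \<psi>_def by (rule frac_lap_integrable[OF s' \<phi>(1)])

lemma \<psi>_even: "\<psi> (- x) = \<psi> x"
proof -
  have "\<phi> (- x + t) = \<phi> (x - t)" "\<phi> (- x - t) = \<phi> (x + t)" for t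
    using \<phi>(5)[of "x - t"] \<phi>(5)[of "x + t"] by simp_all
  then show ?thesis
    by (simp add: \<psi>_def frac_lap_def second_diff_def \<phi>(5) algebra_simps)
qed

lemma large_scales_integrable: "integrable lborel large_scales"
  unfolding large_scales_def[abs_def] by (rule powr_integrable_at_top) auto

lemma large_scales_nonneg: "large_scales \<epsilon> \<ge> 0"
  by (simp add: large_scales_def)

lemma large_scales_zero: "\<epsilon> \<le> 0 \<Longrightarrow> large_scales \<epsilon> = 0"
  by (simp add: large_scales_def)

lemma \<rho>_integrand: "integrable lborel (\<lambda>\<epsilon>. large_scales \<epsilon> * \<psi> (z / \<epsilon>))"
proof -
  obtain B where "\<And>z. \<bar>\<psi> z\<bar> \<le> B"
    using frac_lap_bounded[OF s' \<phi>(1)] unfolding \<psi>_def real_norm_def by blast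
  then show ?thesis
    using integrable_scaleR_bounded[OF large_scales_integrable, of "\<lambda>\<epsilon>. \<psi> (z / \<epsilon>)" B] by simp
qed

text \<open>Here the shape of \<phi> is used. Its antiderivative \<Phi> is odd, so the integral is
  2\<Phi>(z) - \<Phi>(z + t) - \<Phi>(z - t), with derivative \<phi>(z - t) - \<phi>(z + t) in t,
  nonnegative for t at least 0 as \<phi> decreases away from 0. Beyond 1 the function \<Phi> is
  constant, which gives the vanishing.\<close>

lemma second_diff_interval_nonneg:
  assumes z: "z > 0"
  shows "0 \<le> (LINT x|lborel. indicator {0..z} x * second_diff \<phi> x t)"
    and "\<bar>LINT x|lborel. indicator {0..z} x * second_diff \<phi> x t\<bar> \<le> 2 * (LINT x|lborel. \<phi> x)"
    and "z \<ge> 2 \<Longrightarrow> \<bar>t\<bar> < z / 2 \<Longrightarrow> (LINT x|lborel. indicator {0..z} x * second_diff \<phi> x t) = 0"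
proof -
  have c: "continuous_on UNIV \<phi>"
    by (rule test_function_continuous[OF \<phi>(1)])
  obtain \<Phi> where \<Phi>: "\<And>x. (\<Phi> has_real_derivative \<phi> x) (at x)" "\<Phi> 0 = 0"
    using exists_antiderivative[OF c] by blast
  define g where "g \<tau> = second_diff \<Phi> z \<tau> - second_diff \<Phi> 0 \<tau>" for \<tau>
  have eq: "(LINT x|lborel. indicator {0..z} x * second_diff \<phi> x t) = g t" for t
    unfolding g_def using z
    by (intro FTC_indicator(1)[OF _ second_diff_has_derivative[OF \<Phi>(1)] second_diff_continuous[OF c]]) auto
  have \<Phi>_int: "(LINT x|lborel. indicator {a..b} x * \<phi> x) = \<Phi> b - \<Phi> a" if "a \<le> b" for a b
    by (rule FTC_indicator(1)[OF that \<Phi>(1) c])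
  have \<Phi>_diff: "0 \<le> \<Phi> b - \<Phi> a" "\<Phi> b - \<Phi> a \<le> (LINT x|lborel. \<phi> x)" if "a \<le> b" for a b
  proof -
    show "0 \<le> \<Phi> b - \<Phi> a"
      unfolding \<Phi>_int[OF that, symmetric] using \<phi>(3) by (intro integral_nonneg_AE) auto
    show "\<Phi> b - \<Phi> a \<le> (LINT x|lborel. \<phi> x)"
      unfolding \<Phi>_int[OF that, symmetric]
      using FTC_indicator(2)[OF that \<Phi>(1) c] test_function_integrable[OF \<phi>(1)] \<phi>(3)
      by (intro integral_mono) (auto split: split_indicator)
  qed
  have der_shift: "((\<lambda>\<tau>. \<Phi> (x + \<tau>)) has_real_derivative \<phi> (x + \<tau>)) (at \<tau>)"
    "((\<lambda>\<tau>. \<Phi> (x - \<tau>)) has_real_derivative - \<phi> (x - \<tau>)) (at \<tau>)" for x \<tau>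
  proof -
    have "((\<lambda>\<tau>. x + \<tau>) has_real_derivative 1) (at \<tau>)" "((\<lambda>\<tau>. x - \<tau>) has_real_derivative - 1) (at \<tau>)"
      by (auto intro!: derivative_eq_intros)
    from this[THEN DERIV_chain2[OF \<Phi>(1)]]
    show "((\<lambda>\<tau>. \<Phi> (x + \<tau>)) has_real_derivative \<phi> (x + \<tau>)) (at \<tau>)"
      "((\<lambda>\<tau>. \<Phi> (x - \<tau>)) has_real_derivative - \<phi> (x - \<tau>)) (at \<tau>)"
      by simp_all
  qed
  have odd: "second_diff \<Phi> 0 \<tau> = 0" for \<tau>
  proof -
    have "((\<lambda>\<tau>. \<Phi> (0 + \<tau>) + \<Phi> (0 - \<tau>)) has_real_derivative 0) (at \<tau>)" for \<tau>
      using DERIV_add[OF der_shift(1)[of 0 \<tau>] der_shift(2)[of 0 \<tau>]] \<phi>(5)[of \<tau>] by simp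
    then have "\<Phi> (0 + \<tau>) + \<Phi> (0 - \<tau>) = \<Phi> (0 + 0) + \<Phi> (0 - 0)"
      by (intro DERIV_isconst_all[of "\<lambda>\<tau>. \<Phi> (0 + \<tau>) + \<Phi> (0 - \<tau>)"]) auto
    then show ?thesis
      using \<Phi>(2) by (simp add: second_diff_def)
  qed
  have pos: "0 \<le> g \<tau>" if "\<tau> \<ge> 0" for \<tau>
  proof -
    have "g 0 \<le> g \<tau>"
    proof (rule DERIV_nonneg_imp_nondecreasing[OF that])
      fix x assume x: "0 \<le> x" "x \<le> \<tau>"
      have "(g has_real_derivative 0 - \<phi> (z + x) - (- \<phi> (z - x))) (at x)"
        unfolding g_def odd diff_0_right unfolding second_diff_def
        by (intro DERIV_diff DERIV_const der_shift)
      moreover have "\<phi> (z + x) \<le> \<phi> (z - x)"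
        using x z by (intro \<phi>(6)) auto
      ultimately show "\<exists>y. (g has_real_derivative y) (at x) \<and> 0 \<le> y"
        by force
    qed
    then show ?thesis
      by (simp add: g_def second_diff_def)
  qed
  have even: "g (- \<tau>) = g \<tau>" for \<tau>
    by (simp add: g_def second_diff_def algebra_simps)
  show "0 \<le> (LINT x|lborel. indicator {0..z} x * second_diff \<phi> x t)"
    unfolding eq using pos[of t] pos[of "- t"] even[of t] by (cases "t \<ge> 0") auto
  have "\<bar>\<Phi> z - \<Phi> (z + t)\<bar> \<le> (LINT x|lborel. \<phi> x)" "\<bar>\<Phi> z - \<Phi> (z - t)\<bar> \<le> (LINT x|lborel. \<phi> x)"
    using \<Phi>_diff[of z "z + t"] \<Phi>_diff[of "z + t" z] \<Phi>_diff[of z "z - t"] \<Phi>_diff[of "z - t" z] by (cases "t \<ge> 0"; force)+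
  then show "\<bar>LINT x|lborel. indicator {0..z} x * second_diff \<phi> x t\<bar> \<le> 2 * (LINT x|lborel. \<phi> x)"
    unfolding eq g_def odd by (simp add: second_diff_def)
  show "(LINT x|lborel. indicator {0..z} x * second_diff \<phi> x t) = 0" if zt: "z \<ge> 2" "\<bar>t\<bar> < z / 2"
  proof -
    have const: "\<Phi> a = \<Phi> 1" if "a \<ge> 1" for a
    proof -
      have "\<Phi> a - \<Phi> 1 = (LINT x|lborel. indicator {1..a} x * \<phi> x)"
        using \<Phi>_int[of 1 a] that by simp
      also have "\<dots> = (LINT x|(lborel :: real measure). 0)"
        using \<phi>(4) by (intro Bochner_Integration.integral_cong) (auto split: split_indicator)
      finally show ?thesis
        by simp
    qed
    have "z \<ge> 1" "z + t \<ge> 1" "z - t \<ge> 1"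
      using zt by linarith+
    then have "\<Phi> z = \<Phi> 1" "\<Phi> (z + t) = \<Phi> 1" "\<Phi> (z - t) = \<Phi> 1"
      using const by blast+
    then show ?thesis
      unfolding eq g_def odd by (simp add: second_diff_def)
  qed
qed

text \<open>Fubini writes K as a Levy integral of the quantities just studied. They are nonnegative
  and vanish for |t| < z/2, so only the tail of the Levy density contributes. Any negative power
  would do as decay, since \<open>\<rho>\<close> will be K(z)/z.\<close>

lemma \<psi>_primitive:
  obtains K where "\<And>x. (K has_real_derivative \<psi> x) (at x)" "K 0 = 0"
    "\<And>z. z > 0 \<Longrightarrow> K z \<ge> 0" "\<exists>C. \<forall>z\<ge>2. K z \<le> C * z powr (- 1 / 2)"
proof -
  obtain K where K: "\<And>x. (K has_real_derivative \<psi> x) (at x)" "K 0 = 0"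
    using exists_antiderivative[OF \<psi>_continuous] by blast
  let ?D = "\<lambda>z t. LINT x|lborel. indicator {0..z} x * second_diff \<phi> x t"
  let ?I = "LINT x|lborel. \<phi> x"
  have I: "?I \<ge> 0"
    using \<phi>(3) by (intro integral_nonneg_AE) auto
  have K_eq: "K z = (LINT t|lborel. levy s t * ?D z t)" if "z > 0" for z
    using FTC_indicator(1)[OF _ K(1) \<psi>_continuous, of 0 z] K(2) frac_lap_interval(1)[OF s' \<phi>(1), of 0 z] that
    by (simp add: \<psi>_def)
  have K_nonneg: "K z \<ge> 0" if "z > 0" for z
    unfolding K_eq[OF that] using second_diff_interval_nonneg(1)[OF that] by (intro integral_nonneg_AE) auto
  \<comment> \<open>Half a power of |t| is split off the Levy density; the remaining density of
    order s - 1/4 is still admissible. On |t| at least z/2 that half power is at most sqrt 2 times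
    z^(-1/2).\<close>
  define C where "C = 2 * ?I * sqrt 2 * (LINT t|lborel. min 1 (t\<^sup>2) * levy (s - 1 / 4) t)"
  have levy_int: "integrable lborel (\<lambda>t. min 1 (t\<^sup>2) * levy (s - 1 / 4) t)"
    using s by (intro levy_integrable) auto
  have "K z \<le> C * z powr (- 1 / 2)" if z: "z \<ge> 2" for z
  proof -
    have z0: "z > 0"
      using z by simp
    have "levy s t * ?D z t \<le> (2 * ?I * sqrt 2 * z powr (- 1 / 2)) * (min 1 (t\<^sup>2) * levy (s - 1 / 4) t)" for t
    proof (cases "\<bar>t\<bar> < z / 2")
      case True
      then show ?thesis
        using second_diff_interval_nonneg(3)[OF z0 z True] I by simp
    next
      case False
      then have t: "\<bar>t\<bar> \<ge> 1" "z \<le> 2 * \<bar>t\<bar>"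
        using z by auto
      have min1: "min 1 (t\<^sup>2) = 1"
        using t(1) by (simp add: min_def abs_le_square_iff[of 1 t, simplified])
      have l: "levy s t = levy (s - 1 / 4) t * \<bar>t\<bar> powr (- 1 / 2)"
        using t(1) by (simp add: levy_def powr_minus_divide[symmetric] powr_add[symmetric])
      have t2: "\<bar>t\<bar> powr (- 1 / 2) \<le> sqrt 2 * z powr (- 1 / 2)"
      proof -
        have "(2 * \<bar>t\<bar>) powr (- 1 / 2) \<le> z powr (- 1 / 2)"
          using t z0 by (intro powr_mono2') auto
        then have "sqrt 2 * (2 * \<bar>t\<bar>) powr (- 1 / 2) \<le> sqrt 2 * z powr (- 1 / 2)"
          by (intro mult_left_mono) auto
        moreover have "sqrt 2 * (2 * \<bar>t\<bar>) powr (- 1 / 2) = \<bar>t\<bar> powr (- 1 / 2)"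
          using t(1) by (simp add: powr_mult powr_half_sqrt[symmetric] powr_add[symmetric] mult.assoc[symmetric])
        ultimately show ?thesis
          by linarith
      qed
      have "levy s t * ?D z t \<le> levy s t * (2 * ?I)"
        using second_diff_interval_nonneg(2)[OF z0, of t] by (intro mult_left_mono) auto
      also have "levy s t * (2 * ?I) = levy (s - 1 / 4) t * (2 * ?I) * \<bar>t\<bar> powr (- 1 / 2)"
        by (simp add: l)
      also have "\<dots> \<le> levy (s - 1 / 4) t * (2 * ?I) * (sqrt 2 * z powr (- 1 / 2))"
        using I by (intro mult_left_mono t2) auto
      finally show ?thesis
        by (simp add: min1 mult_ac)
    qed
    then have "K z \<le> (LINT t|lborel. (2 * ?I * sqrt 2 * z powr (- 1 / 2)) * (min 1 (t\<^sup>2) * levy (s - 1 / 4) t))"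
      unfolding K_eq[OF z0] using levy_int frac_lap_interval(2)[OF s' \<phi>(1)]
      by (intro integral_mono integrable_mult_right) auto
    also have "\<dots> = (2 * ?I * sqrt 2 * z powr (- 1 / 2)) * (LINT t|lborel. min 1 (t\<^sup>2) * levy (s - 1 / 4) t)"
      by (rule integral_mult_right_zero)
    finally show ?thesis
      by (simp only: C_def mult_ac)
  qed
  then show ?thesis
    using that[OF K K_nonneg] by blast
qed

end

section \<open>Sign, integrability, mass and scale identity of the averaging kernel\<close>

context dilation_bump
begin

text \<open>At the maximum point of the bump all second differences are nonnegative, and they equal
  2 \<phi>(0) once |t| is at least 1.\<close>

lemma \<psi>_zero_pos: "\<psi> 0 > 0"
proof -
  have i: "integrable lborel (\<lambda>t. levy s t * second_diff \<phi> 0 t)"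
    using second_diff_integrable[OF s' \<phi>(1), of 0] by simp
  define c where "c = levy s 2 * (2 * \<phi> 0)"
  have "c > 0"
    using \<phi>(2) by (simp add: c_def levy_def)
  have "c * indicator {1..2} t \<le> levy s t * second_diff \<phi> 0 t" for t
  proof (cases "t \<in> {1..2}")
    case True
    have "second_diff \<phi> 0 t = 2 * \<phi> 0"
      using True \<phi>(4)[of t] \<phi>(5)[of t] by (simp add: second_diff_def)
    moreover have "levy s 2 \<le> levy s t"
      unfolding levy_def using True s by (intro divide_left_mono powr_mono2) auto
    ultimately show ?thesis
      using True \<phi>(2) by (simp add: c_def)
  next
    case False
    have "0 \<le> second_diff \<phi> 0 t"
      using \<phi>(6)[of 0 t] \<phi>(6)[of 0 "- t"] by (simp add: second_diff_def)
    then show ?thesis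
      using False by simp
  qed
  then have "(LINT t|lborel. c * indicator {1..2} (t::real)) \<le> (LINT t|lborel. levy s t * second_diff \<phi> 0 t)"
    by (intro integral_mono i integrable_mult_right integrable_real_indicator) (auto simp: emeasure_lborel_Icc_eq)
  then show ?thesis
    using \<open>c > 0\<close> by (simp add: \<psi>_def frac_lap_def)
qed

lemma \<rho>_measurable [measurable]: "\<rho> \<in> borel_measurable borel"
proof -
  have [measurable]: "large_scales \<in> borel_measurable borel"
    using borel_measurable_integrable[OF large_scales_integrable] by simp
  show ?thesis
    unfolding \<rho>_def dilation_kernel_def[abs_def] by measurable
qed

lemma \<rho>_even: "\<rho> (- z) = \<rho> z"
  by (simp add: \<rho>_def dilation_kernel_def \<psi>_even)

lemma large_scales_integral: "(LINT \<epsilon>|lborel. large_scales \<epsilon>) = 1"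
  unfolding large_scales_def using powr_integrable_at_top(2)[of "-2" 1] by simp

text \<open>As a function of \<epsilon>, - K(z/\<epsilon>) / z is an antiderivative of the
  integrand.\<close>

lemma dilation_FTC:
  assumes K: "\<And>x. (K has_real_derivative \<psi> x) (at x)" and ab: "0 < a" "a \<le> b" and z: "z \<noteq> 0"
  shows "(LINT \<epsilon>|lborel. indicator {a..b} \<epsilon> * (\<epsilon> powr (- 2) * \<psi> (z / \<epsilon>))) = (K (z / a) - K (z / b)) / z"
proof -
  have "(LINT \<epsilon>|lborel. (\<epsilon> powr (- 2) * \<psi> (z / \<epsilon>)) * indicator {a..b} \<epsilon>) = - K (z / b) / z - (- K (z / a) / z)"
  proof (rule integral_FTC_Icc_real[OF ab(2)])
    fix \<epsilon> assume "a \<le> \<epsilon>" "\<epsilon> \<le> b"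
    then have \<epsilon>: "\<epsilon> > 0"
      using ab by simp
    have "((\<lambda>\<epsilon>. z / \<epsilon>) has_real_derivative - z / \<epsilon>\<^sup>2) (at \<epsilon>)"
      using \<epsilon> by (auto intro!: derivative_eq_intros simp: power2_eq_square)
    from DERIV_chain2[OF K this]
    have "((\<lambda>\<epsilon>. - K (z / \<epsilon>) / z) has_real_derivative - (\<psi> (z / \<epsilon>) * (- z / \<epsilon>\<^sup>2)) / z) (at \<epsilon>)"
      by (intro DERIV_cdivide DERIV_minus)
    moreover have "- (\<psi> (z / \<epsilon>) * (- z / \<epsilon>\<^sup>2)) / z = \<epsilon> powr (- 2) * \<psi> (z / \<epsilon>)"
      using \<epsilon> z by (simp add: powr_minus divide_inverse)
    ultimately show "((\<lambda>\<epsilon>. - K (z / \<epsilon>) / z) has_real_derivative \<epsilon> powr (- 2) * \<psi> (z / \<epsilon>)) (at \<epsilon>)"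
      by simp
    have "isCont \<psi> x" for x
      using \<psi>_continuous by (simp add: continuous_on_eq_continuous_at)
    then show "isCont (\<lambda>\<epsilon>. \<epsilon> powr (- 2) * \<psi> (z / \<epsilon>)) \<epsilon>"
      using \<epsilon> by (intro continuous_intros isCont_o2[of \<epsilon> "\<lambda>\<epsilon>. z / \<epsilon>" \<psi>]) auto
  qed
  then show ?thesis
    by (simp add: mult.commute diff_divide_distrib)
qed

text \<open>Letting the upper scale tend to infinity removes the second boundary term because K(0) =
  0. Sign and tail of \<open>\<rho>\<close> can then be read off K.\<close>

lemma \<rho>_eq:
  assumes K: "\<And>x. (K has_real_derivative \<psi> x) (at x)" "K 0 = 0" and z: "z \<noteq> 0"
  shows "\<rho> z = K z / z"
proof -
  have "(\<lambda>n. LINT \<epsilon>|lborel. indicator {1..real (Suc n)} \<epsilon> * (\<epsilon> powr (- 2) * \<psi> (z / \<epsilon>))) \<longlonglongrightarrow> \<rho> z"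
    unfolding \<rho>_def dilation_kernel_def
  proof (rule integral_dominated_convergence[where w = "\<lambda>\<epsilon>. \<bar>large_scales \<epsilon> * \<psi> (z / \<epsilon>)\<bar>"])
    show "integrable lborel (\<lambda>\<epsilon>. \<bar>large_scales \<epsilon> * \<psi> (z / \<epsilon>)\<bar>)"
      using \<rho>_integrand by auto
    show "AE \<epsilon> in lborel. norm (indicator {1..real (Suc n)} \<epsilon> * (\<epsilon> powr (- 2) * \<psi> (z / \<epsilon>))) \<le> \<bar>large_scales \<epsilon> * \<psi> (z / \<epsilon>)\<bar>" for n
      by (auto simp: large_scales_def abs_mult split: split_indicator)
    show "AE \<epsilon> in lborel. (\<lambda>n. indicator {1..real (Suc n)} \<epsilon> * (\<epsilon> powr (- 2) * \<psi> (z / \<epsilon>))) \<longlonglongrightarrow> large_scales \<epsilon> * \<psi> (z / \<epsilon>)"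
    proof (intro AE_I2 tendsto_eventually)
      fix \<epsilon> :: real
      obtain N :: nat where N: "\<epsilon> \<le> real N"
        using real_arch_simple by blast
      show "\<forall>\<^sub>F n in sequentially. indicator {1..real (Suc n)} \<epsilon> * (\<epsilon> powr (- 2) * \<psi> (z / \<epsilon>)) = large_scales \<epsilon> * \<psi> (z / \<epsilon>)"
        unfolding eventually_sequentially
        by (rule exI[of _ N]) (use N in \<open>auto simp: large_scales_def split: split_indicator\<close>)
    qed
  qed (use borel_measurable_integrable[OF \<rho>_integrand] in auto)
  moreover have "(\<lambda>n. LINT \<epsilon>|lborel. indicator {1..real (Suc n)} \<epsilon> * (\<epsilon> powr (- 2) * \<psi> (z / \<epsilon>))) \<longlonglongrightarrow> K z / z"
  proof -
    have "(\<lambda>n. z / real (Suc n)) \<longlonglongrightarrow> 0"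
      using LIMSEQ_Suc[OF lim_const_over_n[of z]] by simp
    then have "(\<lambda>n. K (z / real (Suc n))) \<longlonglongrightarrow> K 0"
      using DERIV_isCont[OF K(1)] isCont_tendsto_compose by blast
    then have "(\<lambda>n. (K (z / 1) - K (z / real (Suc n))) / z) \<longlonglongrightarrow> (K (z / 1) - K 0) / z"
      using z by (intro tendsto_intros) auto
    then show ?thesis
      using dilation_FTC[OF K(1) zero_less_one _ z] K(2) by simp
  qed
  ultimately show ?thesis
    by (rule LIMSEQ_unique)
qed

text \<open>The integrated form of the scale derivative: the left side is (K(z/\<delta>) - K(z)) /
  z.\<close>

lemma \<rho>_dilation:
  assumes "0 < \<delta>" "\<delta> \<le> 1" "z \<noteq> 0"
  shows "\<rho> (z / \<delta>) / \<delta> - \<rho> z = (LINT \<epsilon>|lborel. indicator {\<delta>..1} \<epsilon> * (\<epsilon> powr (- 2) * \<psi> (z / \<epsilon>)))"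
proof -
  obtain K where K: "\<And>x. (K has_real_derivative \<psi> x) (at x)" "K 0 = 0"
    using \<psi>_primitive by metis
  have "\<rho> (z / \<delta>) / \<delta> - \<rho> z = (K (z / \<delta>) - K (z / 1)) / z"
    using assms by (simp add: \<rho>_eq[OF K] diff_divide_distrib)
  then show ?thesis
    by (simp add: dilation_FTC[OF K(1) assms])
qed

lemma \<rho>_nonneg: "\<rho> z \<ge> 0"
proof -
  obtain K where K: "\<And>x. (K has_real_derivative \<psi> x) (at x)" "K 0 = 0" "\<And>z. z > 0 \<Longrightarrow> K z \<ge> 0"
    using \<psi>_primitive by metis
  have pos: "\<rho> z \<ge> 0" if "z > 0" for z
    using that K(3)[OF that] by (simp add: \<rho>_eq[OF K(1,2)])
  consider "z > 0" | "z = 0" | "- z > 0"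
    by linarith
  then show ?thesis
  proof cases
    case 2
    then show ?thesis
      using \<psi>_zero_pos large_scales_nonneg by (auto simp: \<rho>_def dilation_kernel_def intro!: integral_nonneg_AE)
  qed (use pos[of z] pos[of "- z"] \<rho>_even[of z] in auto)
qed

text \<open>Near 0 the kernel is bounded by the supremum of \<open>\<psi>\<close>; from 2 on it is
  at most a multiple of z^(-3/2). Evenness covers the negative axis.\<close>

lemma \<rho>_integrable: "integrable lborel \<rho>"
proof (rule integrable_even)
  obtain K C where K: "\<And>x. (K has_real_derivative \<psi> x) (at x)" "K 0 = 0" "\<And>z. z \<ge> 2 \<Longrightarrow> K z \<le> C * z powr (- 1 / 2)"
    using \<psi>_primitive by metis
  obtain B where B: "\<And>z. \<bar>\<psi> z\<bar> \<le> B"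
    using frac_lap_bounded[OF s' \<phi>(1)] unfolding \<psi>_def real_norm_def by blast
  have \<rho>B: "\<rho> z \<le> B" for z
  proof -
    have "\<rho> z \<le> (LINT \<epsilon>|lborel. large_scales \<epsilon> * B)"
      unfolding \<rho>_def dilation_kernel_def
    proof (intro integral_mono \<rho>_integrand integrable_mult_left large_scales_integrable)
      show "large_scales \<epsilon> * \<psi> (z / \<epsilon>) \<le> large_scales \<epsilon> * B" for \<epsilon>
        using B[of "z / \<epsilon>"] large_scales_nonneg by (intro mult_left_mono) auto
    qed
    then show ?thesis
      by (simp add: large_scales_integral)
  qed
  show "integrable lborel (\<lambda>z. indicator {0..} z * \<rho> z)"
  proof (rule Bochner_Integration.integrable_bound)
    show "integrable lborel (\<lambda>z. B * indicator {0..2} z + C * (indicator {2..} z * z powr (- 3 / 2)))"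
      by (intro Bochner_Integration.integrable_add integrable_mult_right integrable_real_indicator powr_integrable_at_top)
         (auto simp: emeasure_lborel_Icc_eq)
    have "indicator {0..} z * \<rho> z \<le> B * indicator {0..2} z + C * (indicator {2..} z * z powr (- 3 / 2))" for z :: real
    proof -
      have tail: "\<rho> z \<le> C * z powr (- 3 / 2)" if "z \<ge> 2"
      proof -
        have "\<rho> z \<le> C * z powr (- 1 / 2) / z"
          using K(3)[OF that] that by (simp add: \<rho>_eq[OF K(1,2)] divide_right_mono)
        also have "\<dots> = C * z powr (- 3 / 2)"
          using that powr_diff[of z "- 1 / 2" 1] by simp
        finally show ?thesis .
      qed
      have "B \<ge> 0"
        using B[of 0] by linarith
      then show ?thesis
        using \<rho>B[of z] tail by (auto split: split_indicator simp: add_increasing)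
    qed
    moreover have "0 \<le> indicator {0..} z * \<rho> z" for z :: real
      using \<rho>_nonneg by simp
    ultimately show "AE z in lborel. norm (indicator {0..} z * \<rho> z)
      \<le> norm (B * indicator {0..2} z + C * (indicator {2..} z * z powr (- 3 / 2)))"
      by (intro AE_I2) (metis abs_of_nonneg order_trans real_norm_def)
  qed measurable
qed (use \<rho>_even \<rho>_nonneg in auto)

definition mass :: real where "mass = (LINT z|lborel. \<rho> z)"

text \<open>\<open>\<rho>\<close> is nonnegative and starts at \<psi>(0) > 0; the Lipschitz bound of
  \<open>\<psi>\<close> survives averaging over scales at least 1 and keeps half of that value up to
  \<open>\<eta>\<close>.\<close>

lemma mass_pos: "mass > 0"
proof -
  obtain C where C: "C > 0" "\<And>x y. \<bar>\<psi> x - \<psi> y\<bar> \<le> C * \<bar>x - y\<bar>"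
    using frac_lap_Lipschitz[OF s' \<phi>(1)] unfolding \<psi>_def by blast
  have \<rho>0: "\<rho> 0 = \<psi> 0"
    by (simp add: \<rho>_def dilation_kernel_def large_scales_integral)
  have lower: "\<psi> 0 - C * \<bar>z\<bar> \<le> \<rho> z" for z
  proof -
    have "\<psi> 0 - C * \<bar>z\<bar> = (LINT \<epsilon>|lborel. large_scales \<epsilon> * (\<psi> 0 - C * \<bar>z\<bar>))"
      by (simp add: large_scales_integral)
    also have "\<dots> \<le> \<rho> z"
      unfolding \<rho>_def dilation_kernel_def
    proof (intro integral_mono \<rho>_integrand integrable_mult_left large_scales_integrable)
      fix \<epsilon> :: real
      show "large_scales \<epsilon> * (\<psi> 0 - C * \<bar>z\<bar>) \<le> large_scales \<epsilon> * \<psi> (z / \<epsilon>)"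
      proof (cases "\<epsilon> \<ge> 1")
        case True
        then have "\<bar>z / \<epsilon>\<bar> \<le> \<bar>z\<bar> / 1"
          unfolding abs_divide by (intro frac_le) auto
        then have "C * \<bar>0 - z / \<epsilon>\<bar> \<le> C * \<bar>z\<bar>"
          using C(1) by (intro mult_left_mono) auto
        then have "\<psi> 0 - C * \<bar>z\<bar> \<le> \<psi> (z / \<epsilon>)"
          using C(2)[of 0 "z / \<epsilon>"] by linarith
        then show ?thesis
          using large_scales_nonneg by (intro mult_left_mono) auto
      qed (simp add: large_scales_def)
    qed
    finally show ?thesis .
  qed
  define \<eta> where "\<eta> = \<psi> 0 / (2 * C)"
  have \<eta>: "\<eta> > 0"
    using \<psi>_zero_pos C(1) by (simp add: \<eta>_def)
  have "\<psi> 0 / 2 * indicator {0..\<eta>} z \<le> \<rho> z" for z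
  proof (cases "z \<in> {0..\<eta>}")
    case True
    then have "C * \<bar>z\<bar> \<le> C * \<eta>"
      using C(1) by (intro mult_left_mono) auto
    also have "\<dots> = \<psi> 0 / 2"
      using C(1) by (simp add: \<eta>_def)
    finally show ?thesis
      using lower[of z] True by simp
  qed (use \<rho>_nonneg in simp)
  then have "(LINT z|lborel. \<psi> 0 / 2 * indicator {0..\<eta>} z) \<le> mass"
    unfolding mass_def
    by (intro integral_mono \<rho>_integrable integrable_mult_right integrable_real_indicator) (auto simp: emeasure_lborel_Icc_eq)
  then have "\<psi> 0 / 2 * \<eta> \<le> mass"
    using \<eta> by simp
  moreover have "0 < \<psi> 0 / 2 * \<eta>"
    using \<eta> \<psi>_zero_pos by simp
  ultimately show ?thesis
    by linarith
qed

end

section \<open>Representation of the solution by a parametrix\<close>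

context dilation_bump
begin

text \<open>The exponent combines \<epsilon>^(-2) from the scale identity with \<epsilon>^(2s) from
  homogeneity of the fractional Laplacian; it is integrable at 0 exactly because s > 1/2.\<close>

definition small_scales :: "real \<Rightarrow> real" where
  "small_scales \<epsilon> = indicator {0..1} \<epsilon> * \<epsilon> powr (2 * s - 2)"

lemma small_scales_integrable: "integrable lborel small_scales"
  unfolding small_scales_def[abs_def] using s by (intro powr_integrable_near_0) auto

lemma small_scales_nonneg: "small_scales \<epsilon> \<ge> 0"
  by (simp add: small_scales_def)

lemma small_scales_zero: "\<epsilon> \<le> 0 \<Longrightarrow> small_scales \<epsilon> = 0"
  by (cases "\<epsilon> = 0") (auto simp: small_scales_def)

text \<open>This is the parametrix \<open>|z| powr (2s - 1)\<close>, up to a constant and a smooth cutoff.\<close>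
definition parametrix :: "real \<Rightarrow> real" where "parametrix = dilation_kernel small_scales \<phi>"

lemma \<phi>_integrable: "integrable lborel \<phi>"
  by (rule test_function_integrable[OF \<phi>(1)])

lemma \<phi>_measurable [measurable]: "\<phi> \<in> borel_measurable borel"
  by (rule test_function_measurable[OF \<phi>(1)])

lemma parametrix_plane:
  "integrable (lborel \<Otimes>\<^sub>M lborel) (\<lambda>(\<epsilon>, z). small_scales \<epsilon> * \<phi> (z / \<epsilon>))"
proof -
  \<comment> \<open>The additional factor \<epsilon> compensates the division by \<epsilon> built
    into \<open>dilation_plane\<close>.\<close>
  have "integrable (lborel \<Otimes>\<^sub>M lborel) (\<lambda>(\<epsilon>, z). (\<epsilon> * small_scales \<epsilon>) / \<epsilon> * \<phi> ((z + 0) / \<epsilon>))"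
  proof (rule dilation_plane[OF _ _ _ \<phi>_integrable])
    show "integrable lborel (\<lambda>\<epsilon>. \<epsilon> * small_scales \<epsilon>)"
    proof (rule Bochner_Integration.integrable_bound[OF small_scales_integrable])
      show "(\<lambda>\<epsilon>. \<epsilon> * small_scales \<epsilon>) \<in> borel_measurable lborel"
        using borel_measurable_integrable[OF small_scales_integrable] by measurable
      have "\<bar>\<epsilon>\<bar> * \<bar>small_scales \<epsilon>\<bar> \<le> 1 * \<bar>small_scales \<epsilon>\<bar>" for \<epsilon>
        by (cases "\<epsilon> \<in> {0..1}") (auto simp: small_scales_def intro!: mult_left_le_one_le)
      then show "AE \<epsilon> in lborel. norm (\<epsilon> * small_scales \<epsilon>) \<le> norm (small_scales \<epsilon>)"
        by (simp add: abs_mult)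
    qed
    show "0 \<le> \<epsilon> * small_scales \<epsilon>" for \<epsilon>
      using small_scales_nonneg[of \<epsilon>] small_scales_zero[of \<epsilon>] by (cases "\<epsilon> > 0") auto
    show "\<epsilon> * small_scales \<epsilon> = 0" if "\<epsilon> \<le> 0" for \<epsilon>
      using small_scales_zero[OF that] by simp
  qed
  moreover have "(\<epsilon> * small_scales \<epsilon>) / \<epsilon> = small_scales \<epsilon>" for \<epsilon>
    using small_scales_zero[of 0] by (cases "\<epsilon> = 0") auto
  ultimately show ?thesis
    by simp
qed

lemma parametrix_integrable: "integrable lborel parametrix"
  using lborel_pair.integrable_snd[OF parametrix_plane] by (simp add: parametrix_def dilation_kernel_def[abs_def])

lemma conv_parametrix:
  fixes f :: "real \<Rightarrow> 'b::euclidean_space"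
  assumes [measurable]: "f \<in> borel_measurable borel" and F: "\<And>x. norm (f x) \<le> F"
  shows "conv parametrix f x = (LINT \<epsilon>|lborel. small_scales \<epsilon> *\<^sub>R (LINT z|lborel. \<phi> (z / \<epsilon>) *\<^sub>R f (x - z)))"
    "integrable lborel (\<lambda>\<epsilon>. small_scales \<epsilon> *\<^sub>R (LINT z|lborel. \<phi> (z / \<epsilon>) *\<^sub>R f (x - z)))"
proof -
  have "integrable (lborel \<Otimes>\<^sub>M lborel) (\<lambda>p. (case p of (\<epsilon>, z) \<Rightarrow> small_scales \<epsilon> * \<phi> (z / \<epsilon>)) *\<^sub>R f (x - snd p))"
    by (rule integrable_scaleR_bounded[OF parametrix_plane _ F]) measurable
  then have plane: "integrable (lborel \<Otimes>\<^sub>M lborel) (\<lambda>(\<epsilon>, z). (small_scales \<epsilon> * \<phi> (z / \<epsilon>)) *\<^sub>R f (x - z))"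
    by (simp add: case_prod_unfold)
  have inner: "(LINT z|lborel. (small_scales \<epsilon> * \<phi> (z / \<epsilon>)) *\<^sub>R f (x - z))
    = small_scales \<epsilon> *\<^sub>R (LINT z|lborel. \<phi> (z / \<epsilon>) *\<^sub>R f (x - z))" for \<epsilon>
    by (simp add: scaleR_scaleR[symmetric] del: scaleR_scaleR)
  have "conv parametrix f x = (LINT z|lborel. parametrix z *\<^sub>R f (x - z))"
    unfolding conv_def using integral_reflect[of "\<lambda>z. parametrix z *\<^sub>R f (x - z)" x] by simp
  also have "\<dots> = (LINT z|lborel. LINT \<epsilon>|lborel. (small_scales \<epsilon> * \<phi> (z / \<epsilon>)) *\<^sub>R f (x - z))"
  proof (rule Bochner_Integration.integral_cong[OF refl])
    fix z
    have "integrable lborel (\<lambda>\<epsilon>. small_scales \<epsilon> * \<phi> (z / \<epsilon>))"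
    proof -
      obtain B where "\<And>z. \<bar>\<phi> z\<bar> \<le> B"
        using test_function_bounded[OF \<phi>(1)] by (metis real_norm_def)
      then show ?thesis
        using integrable_scaleR_bounded[OF small_scales_integrable, of "\<lambda>\<epsilon>. \<phi> (z / \<epsilon>)" B] by simp
    qed
    then show "parametrix z *\<^sub>R f (x - z) = (LINT \<epsilon>|lborel. (small_scales \<epsilon> * \<phi> (z / \<epsilon>)) *\<^sub>R f (x - z))"
      unfolding parametrix_def dilation_kernel_def by simp
  qed
  also have "\<dots> = (LINT \<epsilon>|lborel. LINT z|lborel. (small_scales \<epsilon> * \<phi> (z / \<epsilon>)) *\<^sub>R f (x - z))"
    by (rule lborel_pair.Fubini_integral[OF plane])
  finally show "conv parametrix f x = (LINT \<epsilon>|lborel. small_scales \<epsilon> *\<^sub>R (LINT z|lborel. \<phi> (z / \<epsilon>) *\<^sub>R f (x - z)))"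
    by (simp only: inner)
  show "integrable lborel (\<lambda>\<epsilon>. small_scales \<epsilon> *\<^sub>R (LINT z|lborel. \<phi> (z / \<epsilon>) *\<^sub>R f (x - z)))"
    using lborel_pair.integrable_fst[OF plane] by (simp only: inner)
qed

context
  fixes u f :: "real \<Rightarrow> 'b::euclidean_space" and c M F :: real
  assumes u: "continuous_on UNIV u" "\<And>x. norm (u x) \<le> M"
    and f: "f \<in> borel_measurable borel" "\<And>x. norm (f x) \<le> F"
    and c: "c > 0"
    and weak: "\<And>x \<epsilon> v. \<bar>x\<bar> < 1 \<Longrightarrow> 0 < \<epsilon> \<Longrightarrow> \<epsilon> \<le> 1 \<Longrightarrow>
      c * (LINT y|lborel. u y \<bullet> frac_lap s (\<lambda>y. \<phi> ((x - y) / \<epsilon>) *\<^sub>R v) y) = (LINT y|lborel. f y \<bullet> (\<phi> ((x - y) / \<epsilon>) *\<^sub>R v))"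
begin

text \<open>The equation tested with the bump dilated by \<epsilon> and centred at x, in every
  direction v; homogeneity accounts for the power of \<epsilon>.\<close>

lemma weak_scale:
  assumes "\<bar>x\<bar> < 1" "0 < \<epsilon>" "\<epsilon> \<le> 1"
  shows "(LINT z|lborel. \<psi> (z / \<epsilon>) *\<^sub>R u (x - z)) = (\<epsilon> powr (2 * s) / c) *\<^sub>R (LINT z|lborel. \<phi> (z / \<epsilon>) *\<^sub>R f (x - z))"
proof -
  note [measurable] = borel_measurable_continuous_onI[OF u(1)] f(1)
  have \<psi>i: "integrable lborel (\<lambda>y. \<psi> ((x - y) / \<epsilon>) *\<^sub>R u y)"
    using integrable_scaleR_bounded[OF integrable_reflect[OF integrable_scale(1)[OF \<psi>_integrable assms(2)]], of u M x] u(2) by simp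
  have \<phi>i: "integrable lborel (\<lambda>y. \<phi> ((x - y) / \<epsilon>) *\<^sub>R f y)"
    using integrable_scaleR_bounded[OF integrable_reflect[OF integrable_scale(1)[OF \<phi>_integrable assms(2)]], of f F x] f(2) by simp
  have "(c * \<epsilon> powr (- (2 * s))) *\<^sub>R (LINT y|lborel. \<psi> ((x - y) / \<epsilon>) *\<^sub>R u y) = (LINT y|lborel. \<phi> ((x - y) / \<epsilon>) *\<^sub>R f y)"
  proof (subst vector_eq_rdot[symmetric], intro allI)
    fix v
    have "((c * \<epsilon> powr (- (2 * s))) *\<^sub>R (LINT y|lborel. \<psi> ((x - y) / \<epsilon>) *\<^sub>R u y)) \<bullet> v
      = c * (LINT y|lborel. \<epsilon> powr (- (2 * s)) * ((\<psi> ((x - y) / \<epsilon>) *\<^sub>R u y) \<bullet> v))"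
    proof -
      have e: "(LINT y|lborel. (\<psi> ((x - y) / \<epsilon>) *\<^sub>R u y) \<bullet> v) = (LINT y|lborel. \<psi> ((x - y) / \<epsilon>) *\<^sub>R u y) \<bullet> v"
        using \<psi>i by (intro integral_inner_left) auto
      show ?thesis
        unfolding integral_mult_right_zero e by simp
    qed
    also have "\<dots> = c * (LINT y|lborel. u y \<bullet> frac_lap s (\<lambda>y. \<phi> ((x - y) / \<epsilon>) *\<^sub>R v) y)"
      by (simp add: frac_lap_dilation[OF s' \<phi>(1) assms(2)] \<psi>_def mult.assoc)
    also have "\<dots> = (LINT y|lborel. (\<phi> ((x - y) / \<epsilon>) *\<^sub>R f y) \<bullet> v)"
      using weak[OF assms, of v] by simp
    also have "\<dots> = (LINT y|lborel. \<phi> ((x - y) / \<epsilon>) *\<^sub>R f y) \<bullet> v"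
      using \<phi>i by (intro integral_inner_left) auto
    finally show "((c * \<epsilon> powr (- (2 * s))) *\<^sub>R (LINT y|lborel. \<psi> ((x - y) / \<epsilon>) *\<^sub>R u y)) \<bullet> v
      = (LINT y|lborel. \<phi> ((x - y) / \<epsilon>) *\<^sub>R f y) \<bullet> v" .
  qed
  then have "(\<epsilon> powr (2 * s) / c) *\<^sub>R (LINT y|lborel. \<phi> ((x - y) / \<epsilon>) *\<^sub>R f y)
    = (\<epsilon> powr (2 * s) / c * (c * \<epsilon> powr (- (2 * s)))) *\<^sub>R (LINT y|lborel. \<psi> ((x - y) / \<epsilon>) *\<^sub>R u y)"
    by (simp only: scaleR_scaleR[symmetric])
  also have "\<epsilon> powr (2 * s) / c * (c * \<epsilon> powr (- (2 * s))) = 1"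
    using c assms(2) by (simp add: powr_minus)
  finally show ?thesis
    using integral_reflect[of "\<lambda>z. \<psi> (z / \<epsilon>) *\<^sub>R u (x - z)" x] integral_reflect[of "\<lambda>z. \<phi> (z / \<epsilon>) *\<^sub>R f (x - z)" x] by simp
qed

text \<open>The dilates \<rho>(z/\<delta>)/\<delta> average u near x and tend to \<open>mass\<close>
  times u(x). Their difference from \<rho> is an integral over scales in [\<delta>, 1], where
  \<open>weak_scale\<close> replaces \<open>\<psi>\<close> and u by \<open>\<phi>\<close> and f; the
  weight produced is \<open>small_scales\<close>.\<close>

lemma representation:
  assumes x: "\<bar>x\<bar> < 1"
  shows "mass *\<^sub>R u x = conv \<rho> u x + (1 / c) *\<^sub>R conv parametrix f x"
proof -
  note [measurable] = borel_measurable_continuous_onI[OF u(1)] f(1)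
  define \<delta> where "\<delta> n = 1 / real (Suc n)" for n
  have \<delta>: "0 < \<delta> n" "\<delta> n \<le> 1" for n
    by (auto simp: \<delta>_def)
  have \<delta>_lim: "\<delta> \<longlonglongrightarrow> 0"
    unfolding \<delta>_def[abs_def] using LIMSEQ_inverse_real_of_nat by (simp add: inverse_eq_divide)
  define A where "A n = (LINT z|lborel. \<rho> z *\<^sub>R u (x - \<delta> n * z))" for n
  have A_lim: "A \<longlonglongrightarrow> mass *\<^sub>R u x"
  proof -
    have "A \<longlonglongrightarrow> (LINT z|lborel. \<rho> z *\<^sub>R u x)"
      unfolding A_def[abs_def]
    proof (rule integral_dominated_convergence[where w = "\<lambda>z. \<bar>\<rho> z\<bar> * M"])
      show "integrable lborel (\<lambda>z. \<bar>\<rho> z\<bar> * M)"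
        using \<rho>_integrable by auto
      show "AE z in lborel. (\<lambda>n. \<rho> z *\<^sub>R u (x - \<delta> n * z)) \<longlonglongrightarrow> \<rho> z *\<^sub>R u x"
      proof (intro AE_I2 tendsto_scaleR tendsto_const)
        fix z
        have "(\<lambda>n. x - \<delta> n * z) \<longlonglongrightarrow> x - 0 * z"
          by (intro tendsto_intros \<delta>_lim)
        then show "(\<lambda>n. u (x - \<delta> n * z)) \<longlonglongrightarrow> u x"
          using continuous_on_tendsto_compose[OF u(1), of "\<lambda>n. x - \<delta> n * z" x sequentially] by simp
      qed
      show "AE z in lborel. norm (\<rho> z *\<^sub>R u (x - \<delta> n * z)) \<le> \<bar>\<rho> z\<bar> * M" for n
        using u(2) by (auto intro!: mult_left_mono)
    qed measurable
    then show ?thesis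
      using \<rho>_integrable by (simp add: mass_def)
  qed
  define G where "G \<epsilon> = (LINT z|lborel. \<phi> (z / \<epsilon>) *\<^sub>R f (x - z))" for \<epsilon>
  have A_eq: "A n - conv \<rho> u x = (1 / c) *\<^sub>R (LINT \<epsilon>|lborel. indicator {\<delta> n..1} \<epsilon> *\<^sub>R (small_scales \<epsilon> *\<^sub>R G \<epsilon>))" for n
  proof -
    let ?d = "\<delta> n"
    \<comment> \<open>Exponent -1, since \<open>dilation_plane\<close> divides by \<epsilon> once
      more and the scale identity needs -2.\<close>
    let ?w = "\<lambda>\<epsilon>. indicator {?d..1} \<epsilon> * \<epsilon> powr (- 1)"
    have w: "integrable lborel ?w"
    proof (rule integrableI_bounded_set[of "{?d..1}" _ _ "?d powr (- 1)"])
      show "AE \<epsilon> in lborel. \<epsilon> \<in> {?d..1} \<longrightarrow> norm (?w \<epsilon>) \<le> ?d powr (- 1)"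
      proof (intro AE_I2 impI)
        fix \<epsilon> assume \<epsilon>: "\<epsilon> \<in> {?d..1}"
        then have "\<epsilon> powr (- 1) \<le> ?d powr (- 1)"
          using \<delta>[of n] by (intro powr_mono2') auto
        then show "norm (?w \<epsilon>) \<le> ?d powr (- 1)"
          using \<epsilon> by simp
      qed
    qed (auto simp: emeasure_lborel_Icc_eq)
    have "integrable (lborel \<Otimes>\<^sub>M lborel) (\<lambda>(\<epsilon>, z). ?w \<epsilon> / \<epsilon> * \<psi> ((z + 0) / \<epsilon>))"
      by (rule dilation_plane[OF w _ _ \<psi>_integrable]) (use \<delta>[of n] in auto)
    from integrable_scaleR_bounded[OF this, of "\<lambda>p. u (x - snd p)" M] u(2)
    have "integrable (lborel \<Otimes>\<^sub>M lborel) (\<lambda>(\<epsilon>, z). (?w \<epsilon> / \<epsilon> * \<psi> (z / \<epsilon>)) *\<^sub>R u (x - z))"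
      by (simp add: case_prod_unfold)
    moreover have w2: "?w \<epsilon> / \<epsilon> = indicator {?d..1} \<epsilon> * \<epsilon> powr (- 2)" for \<epsilon>
      using \<delta>[of n] powr_diff[of \<epsilon> "- 1" 1] by (auto split: split_indicator)
    ultimately have plane: "integrable (lborel \<Otimes>\<^sub>M lborel) (\<lambda>(\<epsilon>, z). (indicator {?d..1} \<epsilon> * (\<epsilon> powr (- 2) * \<psi> (z / \<epsilon>))) *\<^sub>R u (x - z))"
      by (simp only: w2 mult.assoc)
    have \<rho>d: "integrable lborel (\<lambda>z. (\<rho> (z / ?d) / ?d) *\<^sub>R u (x - z))"
    proof -
      have "integrable lborel (\<lambda>z. \<rho> (z / ?d) / ?d)"
        using integrable_scale(1)[OF \<rho>_integrable \<delta>(1)] by simp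
      from integrable_scaleR_bounded[OF this, of "\<lambda>z. u (x - z)" M] u(2) show ?thesis
        by simp
    qed
    have \<rho>u: "integrable lborel (\<lambda>z. \<rho> z *\<^sub>R u (x - z))"
      using integrable_scaleR_bounded[OF \<rho>_integrable, of "\<lambda>z. u (x - z)" M] u(2) by simp
    have "A n = (LINT z|lborel. (\<rho> (z / ?d) / ?d) *\<^sub>R u (x - z))"
    proof -
      have "integrable lborel (\<lambda>z. \<rho> z *\<^sub>R u (x - ?d * z))"
        using integrable_scaleR_bounded[OF \<rho>_integrable, of "\<lambda>z. u (x - ?d * z)" M] u(2) by simp
      from integrable_scale(2)[OF this \<delta>(1)[of n]]
      have "?d *\<^sub>R A n = (LINT z|lborel. \<rho> (z / ?d) *\<^sub>R u (x - z))"
        using \<delta>(1)[of n] by (simp add: A_def)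
      then have "(1 / ?d) *\<^sub>R (?d *\<^sub>R A n) = (1 / ?d) *\<^sub>R (LINT z|lborel. \<rho> (z / ?d) *\<^sub>R u (x - z))"
        by (simp only:)
      then show ?thesis
        using \<delta>(1)[of n] by (simp flip: integral_scaleR_right)
    qed
    moreover have "conv \<rho> u x = (LINT z|lborel. \<rho> z *\<^sub>R u (x - z))"
      unfolding conv_def using integral_reflect[of "\<lambda>z. \<rho> z *\<^sub>R u (x - z)" x] by simp
    ultimately have "A n - conv \<rho> u x = (LINT z|lborel. (\<rho> (z / ?d) / ?d - \<rho> z) *\<^sub>R u (x - z))"
      using \<rho>d \<rho>u by (simp add: scaleR_diff_left)
    also have "\<dots> = (LINT z|lborel. LINT \<epsilon>|lborel. (indicator {?d..1} \<epsilon> * (\<epsilon> powr (- 2) * \<psi> (z / \<epsilon>))) *\<^sub>R u (x - z))"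
    \<comment> \<open>\<open>\<rho>_dilation\<close> divides by z, so z = 0 is left out as a null
      set.\<close>
    proof (rule integral_cong_AE)
      show "(\<lambda>z. LINT \<epsilon>|lborel. (indicator {?d..1} \<epsilon> * (\<epsilon> powr (- 2) * \<psi> (z / \<epsilon>))) *\<^sub>R u (x - z)) \<in> borel_measurable lborel"
        using lborel_pair.integrable_snd[OF plane] by auto
      have "AE z in lborel. z \<noteq> (0::real)"
        by (rule AE_lborel_singleton)
      then show "AE z in lborel. (\<rho> (z / ?d) / ?d - \<rho> z) *\<^sub>R u (x - z)
        = (LINT \<epsilon>|lborel. (indicator {?d..1} \<epsilon> * (\<epsilon> powr (- 2) * \<psi> (z / \<epsilon>))) *\<^sub>R u (x - z))"
      proof eventually_elim
        case (elim z)
        obtain B where B: "\<And>z. \<bar>\<psi> z\<bar> \<le> B"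
          using frac_lap_bounded[OF s' \<phi>(1)] unfolding \<psi>_def real_norm_def by blast
        have "integrable lborel (\<lambda>\<epsilon>. indicator {?d..1} \<epsilon> * (\<epsilon> powr (- 2) * \<psi> (z / \<epsilon>)))"
        proof (rule integrableI_bounded_set[of "{?d..1}" _ _ "?d powr (- 2) * B"])
          show "AE \<epsilon> in lborel. \<epsilon> \<in> {?d..1} \<longrightarrow> norm (indicator {?d..1} \<epsilon> * (\<epsilon> powr (- 2) * \<psi> (z / \<epsilon>))) \<le> ?d powr (- 2) * B"
            using \<delta>[of n] B by (auto intro!: mult_mono powr_mono2' simp: abs_mult)
        qed (auto simp: emeasure_lborel_Icc_eq)
        then show ?case
          unfolding \<rho>_dilation[OF \<delta>[of n] elim] by simp
      qed
    qed measurable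
    also have "\<dots> = (LINT \<epsilon>|lborel. LINT z|lborel. (indicator {?d..1} \<epsilon> * (\<epsilon> powr (- 2) * \<psi> (z / \<epsilon>))) *\<^sub>R u (x - z))"
      by (rule lborel_pair.Fubini_integral[OF plane])
    also have "\<dots> = (LINT \<epsilon>|lborel. (1 / c) *\<^sub>R (indicator {?d..1} \<epsilon> *\<^sub>R (small_scales \<epsilon> *\<^sub>R G \<epsilon>)))"
    proof (rule Bochner_Integration.integral_cong[OF refl])
      fix \<epsilon> :: real
      have "(LINT z|lborel. (indicator {?d..1} \<epsilon> * (\<epsilon> powr (- 2) * \<psi> (z / \<epsilon>))) *\<^sub>R u (x - z))
        = (indicator {?d..1} \<epsilon> * \<epsilon> powr (- 2)) *\<^sub>R (LINT z|lborel. \<psi> (z / \<epsilon>) *\<^sub>R u (x - z))"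
        by (simp only: mult.assoc[symmetric] scaleR_scaleR[symmetric] integral_scaleR_right)
      also have "\<dots> = (1 / c) *\<^sub>R (indicator {?d..1} \<epsilon> *\<^sub>R (small_scales \<epsilon> *\<^sub>R G \<epsilon>))"
      proof (cases "\<epsilon> \<in> {?d..1}")
        case True
        then have \<epsilon>: "0 < \<epsilon>" "\<epsilon> \<le> 1"
          using \<delta>[of n] by auto
        have "\<epsilon> powr (- 2) * (\<epsilon> powr (2 * s) / c) = 1 / c * small_scales \<epsilon>"
          using \<epsilon> powr_add[of \<epsilon> "- 2" "2 * s"] by (simp add: small_scales_def)
        then show ?thesis
          using True unfolding weak_scale[OF x \<epsilon>] G_def by simp
      qed auto
      finally show "(LINT z|lborel. (indicator {?d..1} \<epsilon> * (\<epsilon> powr (- 2) * \<psi> (z / \<epsilon>))) *\<^sub>R u (x - z))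
        = (1 / c) *\<^sub>R (indicator {?d..1} \<epsilon> *\<^sub>R (small_scales \<epsilon> *\<^sub>R G \<epsilon>))" .
    qed
    also have "\<dots> = (1 / c) *\<^sub>R (LINT \<epsilon>|lborel. indicator {?d..1} \<epsilon> *\<^sub>R (small_scales \<epsilon> *\<^sub>R G \<epsilon>))"
      by (rule integral_scaleR_right)
    finally show ?thesis .
  qed
  have E_lim: "(\<lambda>n. LINT \<epsilon>|lborel. indicator {\<delta> n..1} \<epsilon> *\<^sub>R (small_scales \<epsilon> *\<^sub>R G \<epsilon>)) \<longlonglongrightarrow> conv parametrix f x"
    unfolding conv_parametrix(1)[OF f, of x] G_def[symmetric]
  proof (rule integral_dominated_convergence[where w = "\<lambda>\<epsilon>. norm (small_scales \<epsilon> *\<^sub>R G \<epsilon>)"])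
    have i: "integrable lborel (\<lambda>\<epsilon>. small_scales \<epsilon> *\<^sub>R G \<epsilon>)"
      using conv_parametrix(2)[OF f, of x] by (simp add: G_def)
    then show "integrable lborel (\<lambda>\<epsilon>. norm (small_scales \<epsilon> *\<^sub>R G \<epsilon>))"
      by (rule Bochner_Integration.integrable_norm)
    show m: "(\<lambda>\<epsilon>. small_scales \<epsilon> *\<^sub>R G \<epsilon>) \<in> borel_measurable lborel"
      using i by (rule borel_measurable_integrable)
    show "(\<lambda>\<epsilon>. indicator {\<delta> n..1} \<epsilon> *\<^sub>R (small_scales \<epsilon> *\<^sub>R G \<epsilon>)) \<in> borel_measurable lborel" for n
      by (rule borel_measurable_scaleR[OF _ m]) simp
    show "AE \<epsilon> in lborel. norm (indicator {\<delta> n..1} \<epsilon> *\<^sub>R (small_scales \<epsilon> *\<^sub>R G \<epsilon>)) \<le> norm (small_scales \<epsilon> *\<^sub>R G \<epsilon>)" for n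
      by (auto split: split_indicator)
    show "AE \<epsilon> in lborel. (\<lambda>n. indicator {\<delta> n..1} \<epsilon> *\<^sub>R (small_scales \<epsilon> *\<^sub>R G \<epsilon>)) \<longlonglongrightarrow> small_scales \<epsilon> *\<^sub>R G \<epsilon>"
    proof (intro AE_I2 tendsto_eventually)
      fix \<epsilon> :: real
      show "\<forall>\<^sub>F n in sequentially. indicator {\<delta> n..1} \<epsilon> *\<^sub>R (small_scales \<epsilon> *\<^sub>R G \<epsilon>) = small_scales \<epsilon> *\<^sub>R G \<epsilon>"
      proof (cases "0 < \<epsilon>")
        case True
        have "\<forall>\<^sub>F n in sequentially. \<delta> n < \<epsilon>"
          using order_tendstoD(2)[OF \<delta>_lim True] .
        then show ?thesis
          by eventually_elim (auto simp: small_scales_def split: split_indicator)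
      qed (simp add: small_scales_zero)
    qed
  qed
  have "(\<lambda>n. A n - conv \<rho> u x) \<longlonglongrightarrow> (1 / c) *\<^sub>R conv parametrix f x"
    unfolding A_eq by (rule tendsto_scaleR[OF tendsto_const E_lim])
  moreover have "(\<lambda>n. A n - conv \<rho> u x) \<longlonglongrightarrow> mass *\<^sub>R u x - conv \<rho> u x"
    by (rule tendsto_diff[OF A_lim tendsto_const])
  ultimately have "mass *\<^sub>R u x - conv \<rho> u x = (1 / c) *\<^sub>R conv parametrix f x"
    by (rule LIMSEQ_unique[rotated])
  then show ?thesis
    by (simp add: algebra_simps)
qed

end

end

section \<open>Hoelder moduli of the kernels and local regularity\<close>

lemma conv_holder:
  fixes g :: "real \<Rightarrow> 'b::euclidean_space"
  assumes g: "g \<in> borel_measurable borel" "\<And>x. norm (g x) \<le> M" and k: "integrable lborel k"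
    and C: "\<And>d. 0 \<le> d \<Longrightarrow> d \<le> 1 \<Longrightarrow> (LINT z|lborel. \<bar>k (z + d) - k z\<bar>) \<le> C * d powr \<beta>" and \<beta>: "\<beta> > 0"
  shows "\<bar>x - y\<bar> \<le> 1 \<Longrightarrow> norm (conv k g x - conv k g y) \<le> M * C * \<bar>x - y\<bar> powr \<beta>"
    and "continuous_on UNIV (conv k g)"
proof -
  have "M \<ge> 0"
    using order_trans[OF norm_ge_zero g(2)] .
  have le: "norm (conv k g x - conv k g y) \<le> M * C * \<bar>x - y\<bar> powr \<beta>" if "y \<le> x" "\<bar>x - y\<bar> \<le> 1" for x y
  proof -
    have "norm (conv k g x - conv k g y) \<le> M * (LINT z|lborel. \<bar>k (z + (x - y)) - k z\<bar>)"
      by (rule conv_diff_norm[OF g k])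
    also have "\<dots> \<le> M * (C * (x - y) powr \<beta>)"
      using that \<open>M \<ge> 0\<close> by (intro mult_left_mono C) auto
    finally show ?thesis
      using that by (simp add: mult.assoc)
  qed
  show hold: "norm (conv k g x - conv k g y) \<le> M * C * \<bar>x - y\<bar> powr \<beta>" if "\<bar>x - y\<bar> \<le> 1" for x y
    using le[of y x] le[of x y] that by (cases "y \<le> x") (auto simp: norm_minus_commute abs_minus_commute)
  show "continuous_on UNIV (conv k g)"
  proof (intro continuous_at_imp_continuous_on ballI)
    fix x
    have "((\<lambda>y. conv k g y - conv k g x) \<longlongrightarrow> 0) (at x)"
    proof (rule Lim_null_comparison)
      show "\<forall>\<^sub>F y in at x. norm (conv k g y - conv k g x) \<le> M * C * \<bar>y - x\<bar> powr \<beta>"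
        unfolding eventually_at by (rule exI[of _ 1]) (auto intro!: hold simp: dist_real_def)
      have "((\<lambda>y. M * C * \<bar>y - x\<bar> powr \<beta>) \<longlongrightarrow> M * C * \<bar>x - x\<bar> powr \<beta>) (at x)"
        using \<beta> by (intro tendsto_intros) auto
      then show "((\<lambda>y. M * C * \<bar>y - x\<bar> powr \<beta>) \<longlongrightarrow> 0) (at x)"
        by simp
    qed
    then show "isCont (conv k g) x"
      by (simp add: isCont_def LIM_zero_iff)
  qed
qed

context dilation_bump
begin

lemma scale_modulus_integrable:
  fixes A B d :: real
  assumes w: "integrable lborel w" "\<And>\<epsilon>. \<epsilon> \<le> 0 \<Longrightarrow> w \<epsilon> = 0" and "A \<ge> 0" "B \<ge> 0" "d \<ge> 0"
  shows "integrable lborel (\<lambda>\<epsilon>. w \<epsilon> * min (2 * A) (d / \<epsilon> * B))"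
proof (rule Bochner_Integration.integrable_bound)
  have [measurable]: "w \<in> borel_measurable borel"
    using borel_measurable_integrable[OF w(1)] by simp
  show "integrable lborel (\<lambda>\<epsilon>. w \<epsilon> * (2 * A))"
    using w by simp
  show "(\<lambda>\<epsilon>. w \<epsilon> * min (2 * A) (d / \<epsilon> * B)) \<in> borel_measurable lborel"
    by measurable
  have "\<bar>w \<epsilon> * min (2 * A) (d / \<epsilon> * B)\<bar> \<le> \<bar>w \<epsilon> * (2 * A)\<bar>" for \<epsilon>
  proof (cases "\<epsilon> > 0")
    case True
    then have "0 \<le> d / \<epsilon> * B"
      using assms by simp
    then have "\<bar>min (2 * A) (d / \<epsilon> * B)\<bar> \<le> \<bar>2 * A\<bar>"
      using assms by auto
    then show ?thesis
      unfolding abs_mult by (intro mult_left_mono) auto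
  qed (use w(2)[of \<epsilon>] in auto)
  then show "AE \<epsilon> in lborel. norm (w \<epsilon> * min (2 * A) (d / \<epsilon> * B)) \<le> norm (w \<epsilon> * (2 * A))"
    by simp
qed

text \<open>Scales at least 1 give a modulus linear in d, which for d at most 1 is dominated by
  d^(2s - 1).\<close>

lemma large_scales_modulus:
  assumes "A \<ge> 0" "B \<ge> 0" "0 \<le> d" "d \<le> 1"
  shows "(LINT \<epsilon>|lborel. large_scales \<epsilon> * min (2 * A) (d / \<epsilon> * B)) \<le> B * d powr (2 * s - 1)"
proof -
  have "(LINT \<epsilon>|lborel. large_scales \<epsilon> * min (2 * A) (d / \<epsilon> * B)) \<le> (LINT \<epsilon>|lborel. large_scales \<epsilon> * (d * B))"
  proof (intro integral_mono scale_modulus_integrable large_scales_integrable large_scales_zero integrable_mult_left assms)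
    fix \<epsilon> :: real
    show "large_scales \<epsilon> * min (2 * A) (d / \<epsilon> * B) \<le> large_scales \<epsilon> * (d * B)"
    proof (cases "\<epsilon> \<ge> 1")
      case True
      then have "d / \<epsilon> \<le> d / 1"
        using assms by (intro frac_le) auto
      then have "d / \<epsilon> * B \<le> d * B"
        using assms by (intro mult_right_mono) auto
      then show ?thesis
        using large_scales_nonneg by (intro mult_left_mono) auto
    qed (simp add: large_scales_def)
  qed
  also have "\<dots> = B * d"
    by (simp add: large_scales_integral)
  also have "\<dots> \<le> B * d powr (2 * s - 1)"
  proof (cases "d = 0")
    case False
    have "d powr 1 \<le> d powr (2 * s - 1)"
      using assms s by (intro powr_mono') auto
    then show ?thesis
      using False assms by (intro mult_left_mono) auto
  qed auto
  finally show ?thesis .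
qed

text \<open>Split at \<epsilon> = d: below, the constant bound against \<epsilon>^(2s - 2); above,
  the bound d/\<epsilon>, which leaves d \<epsilon>^(2s - 3). Both integrals have order d^(2s - 1),
  converging at 0 since s > 1/2 and at infinity since s < 1.\<close>

lemma small_scales_modulus:
  assumes "A \<ge> 0" "B \<ge> 0" "0 \<le> d"
  shows "(LINT \<epsilon>|lborel. small_scales \<epsilon> * min (2 * A) (d / \<epsilon> * B)) \<le> (2 * A / (2 * s - 1) + B / (2 - 2 * s)) * d powr (2 * s - 1)"
proof (cases "d = 0")
  case True
  then show ?thesis
    using assms by simp
next
  case False
  then have d: "d > 0"
    using assms by simp
  let ?g = "\<lambda>\<epsilon>. 2 * A * (indicator {0..d} \<epsilon> * \<epsilon> powr (2 * s - 2)) + d * B * (indicator {d..} \<epsilon> * \<epsilon> powr (2 * s - 3))"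
  have i: "integrable lborel (\<lambda>\<epsilon>. indicator {0..d} \<epsilon> * \<epsilon> powr (2 * s - 2))" "integrable lborel (\<lambda>\<epsilon>. indicator {d..} \<epsilon> * \<epsilon> powr (2 * s - 3))"
    using d s by (auto intro!: powr_integrable_near_0 powr_integrable_at_top)
  have "(LINT \<epsilon>|lborel. small_scales \<epsilon> * min (2 * A) (d / \<epsilon> * B)) \<le> (LINT \<epsilon>|lborel. ?g \<epsilon>)"
  proof (intro integral_mono scale_modulus_integrable small_scales_integrable small_scales_zero assms)
    show "integrable lborel ?g"
      using i by simp
    fix \<epsilon> :: real
    consider "\<epsilon> \<le> 0" | "0 < \<epsilon>" "\<epsilon> \<le> d" | "d < \<epsilon>"
      by linarith
    then show "small_scales \<epsilon> * min (2 * A) (d / \<epsilon> * B) \<le> ?g \<epsilon>"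
    proof cases
      case 1
      then show ?thesis
        using assms by (simp add: small_scales_zero)
    next
      case 2
      have "small_scales \<epsilon> * min (2 * A) (d / \<epsilon> * B) \<le> \<epsilon> powr (2 * s - 2) * (2 * A)"
        using 2 assms by (intro mult_mono) (auto simp: small_scales_def)
      also have "\<dots> \<le> ?g \<epsilon>"
        using 2 assms by (simp add: mult_ac)
      finally show ?thesis .
    next
      case 3
      have "small_scales \<epsilon> * min (2 * A) (d / \<epsilon> * B) \<le> \<epsilon> powr (2 * s - 2) * (d / \<epsilon> * B)"
        using 3 d assms by (intro mult_mono) (auto simp: small_scales_def)
      also have "\<dots> = d * B * (\<epsilon> powr (2 * s - 3))"
        using 3 d powr_diff[of \<epsilon> "2 * s - 2" 1] by simp
      also have "\<dots> \<le> ?g \<epsilon>"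
        using 3 d assms by simp
      finally show ?thesis .
    qed
  qed
  also have "\<dots> = 2 * A * (d powr (2 * s - 1) / (2 * s - 1)) + d * B * (d powr (2 * s - 2) / (2 - 2 * s))"
  proof -
    have "(LINT \<epsilon>|lborel. indicator {0..d} \<epsilon> * \<epsilon> powr (2 * s - 2)) = d powr (2 * s - 1) / (2 * s - 1)"
      using powr_integrable_near_0(2)[of "2 * s - 2" d] d s by simp
    moreover have "(LINT \<epsilon>|lborel. indicator {d..} \<epsilon> * \<epsilon> powr (2 * s - 3)) = d powr (2 * s - 2) / (2 - 2 * s)"
    proof -
      have "- (d powr (2 * s - 2)) / (2 * s - 2) = d powr (2 * s - 2) / (2 - 2 * s)"
        by (metis minus_diff_eq minus_divide_divide minus_minus)
      then show ?thesis
        using powr_integrable_at_top(2)[of "2 * s - 3" d] d s by simp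
    qed
    ultimately show ?thesis
      using i by simp
  qed
  also have "d * B * (d powr (2 * s - 2) / (2 - 2 * s)) = B / (2 - 2 * s) * d powr (2 * s - 1)"
    using d powr_add[of d 1 "2 * s - 2"] by simp
  finally show ?thesis
    by (simp add: algebra_simps)
qed

text \<open>Both terms of the representation are convolutions with absolutely continuous kernels, so
  the derivative falls on the kernels and the modulus estimates apply. The formula g is global, but
  equals the derivative of u only on (-1, 1), where the representation holds.\<close>

lemma C1_holder_local:
  fixes u f :: "real \<Rightarrow> 'b::euclidean_space" and c M F :: real
  assumes u: "continuous_on UNIV u" "\<And>x. norm (u x) \<le> M"
    and f: "f \<in> borel_measurable borel" "\<And>x. norm (f x) \<le> F"
    and c: "c > 0"
    and weak: "\<And>x \<epsilon> v. \<bar>x\<bar> < 1 \<Longrightarrow> 0 < \<epsilon> \<Longrightarrow> \<epsilon> \<le> 1 \<Longrightarrow>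
      c * (LINT y|lborel. u y \<bullet> frac_lap s (\<lambda>y. \<phi> ((x - y) / \<epsilon>) *\<^sub>R v) y) = (LINT y|lborel. f y \<bullet> (\<phi> ((x - y) / \<epsilon>) *\<^sub>R v))"
  obtains g C where "C \<ge> 0" "\<And>x. \<bar>x\<bar> < 1 \<Longrightarrow> (u has_vector_derivative g x) (at x)" "\<And>x. norm (g x) \<le> C"
    "\<And>x y. \<bar>x - y\<bar> \<le> 1 \<Longrightarrow> norm (g x - g y) \<le> C * \<bar>x - y\<bar> powr (2 * s - 1)"
proof -
  have um: "u \<in> borel_measurable borel"
    using u(1) by (rule borel_measurable_continuous_onI)
  obtain \<phi>1 where \<phi>1: "\<phi>1 \<in> test_functions" "\<And>x. (\<phi> has_real_derivative \<phi>1 x) (at x)" "abs_cont_deriv \<phi> \<phi>1"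
    using test_function_abs_cont[OF \<phi>(1)] by blast
  obtain \<phi>2 where \<phi>2: "\<phi>2 \<in> test_functions" "\<And>x. (\<phi>1 has_real_derivative \<phi>2 x) (at x)" "abs_cont_deriv \<phi>1 \<phi>2"
    using test_function_abs_cont[OF \<phi>1(1)] by blast
  have \<psi>1: "abs_cont_deriv \<psi> (frac_lap s \<phi>1)"
    unfolding \<psi>_def by (rule frac_lap_abs_cont[OF s' \<phi>(1) \<phi>1(1,2)])
  have \<psi>2: "abs_cont_deriv (frac_lap s \<phi>1) (frac_lap s \<phi>2)"
    by (rule frac_lap_abs_cont[OF s' \<phi>1(1) \<phi>2(1,2)])
  obtain B where B: "\<And>z. \<bar>\<psi> z\<bar> \<le> B"
    using frac_lap_bounded[OF s' \<phi>(1)] unfolding \<psi>_def real_norm_def by blast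
  obtain B' where B': "\<And>z. \<bar>\<phi> z\<bar> \<le> B'"
    using test_function_bounded[OF \<phi>(1)] by (metis real_norm_def)
  define \<rho>1 where "\<rho>1 = dilation_kernel (\<lambda>\<epsilon>. large_scales \<epsilon> / \<epsilon>) (frac_lap s \<phi>1)"
  define E1 where "E1 = dilation_kernel (\<lambda>\<epsilon>. small_scales \<epsilon> / \<epsilon>) \<phi>1"
  have \<rho>_ac: "abs_cont_deriv \<rho> \<rho>1"
    unfolding \<rho>_def \<rho>1_def
    by (rule dilation_kernel_abs_cont[OF large_scales_integrable large_scales_nonneg large_scales_zero B \<psi>_measurable \<psi>1])
  have E_ac: "abs_cont_deriv parametrix E1"
    unfolding parametrix_def E1_def
    by (rule dilation_kernel_abs_cont[OF small_scales_integrable small_scales_nonneg small_scales_zero B' \<phi>_measurable \<phi>1(3)])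
  have int1: "integrable lborel \<rho>1" "integrable lborel E1"
    using \<rho>_ac E_ac by (auto simp: abs_cont_deriv_def)
  let ?N = "\<lambda>k. LINT z|lborel. \<bar>k z :: real\<bar>"
  have N: "?N k \<ge> 0" for k
    by (intro integral_nonneg_AE) auto
  have \<rho>_mod: "(LINT z|lborel. \<bar>\<rho>1 (z + d) - \<rho>1 z\<bar>) \<le> ?N (frac_lap s \<phi>2) * d powr (2 * s - 1)" if "0 \<le> d" "d \<le> 1" for d
    unfolding \<rho>1_def
    using dilation_kernel_translation[OF large_scales_integrable large_scales_nonneg large_scales_zero B \<psi>_measurable \<psi>1 \<psi>2 that(1)]
      large_scales_modulus[OF N N that] by (rule order_trans)
  define C0 where "C0 = 2 * ?N \<phi>1 / (2 * s - 1) + ?N \<phi>2 / (2 - 2 * s)"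
  have E_mod: "(LINT z|lborel. \<bar>E1 (z + d) - E1 z\<bar>) \<le> C0 * d powr (2 * s - 1)" if "0 \<le> d" "d \<le> 1" for d
    unfolding E1_def C0_def
    using dilation_kernel_translation[OF small_scales_integrable small_scales_nonneg small_scales_zero B' \<phi>_measurable \<phi>1(3) \<phi>2(3) that(1)]
      small_scales_modulus[OF N N that(1)] by (rule order_trans)
  have \<beta>: "2 * s - 1 > 0"
    using s by simp
  note H1 = conv_holder[OF um u(2) int1(1) \<rho>_mod \<beta>]
  note H2 = conv_holder[OF f int1(2) E_mod \<beta>]
  have D1: "(conv \<rho> u has_vector_derivative conv \<rho>1 u x) (at x)" for x
    by (rule conv_has_vector_derivative[OF um u(2) \<rho>_integrable \<rho>_ac H1(2)])
  have D2: "(conv parametrix f has_vector_derivative conv E1 f x) (at x)" for x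
    by (rule conv_has_vector_derivative[OF f parametrix_integrable E_ac H2(2)])
  define g where "g x = (1 / mass) *\<^sub>R (conv \<rho>1 u x + (1 / c) *\<^sub>R conv E1 f x)" for x
  define C1 where "C1 = M * ?N (frac_lap s \<phi>2) + 1 / c * (F * C0)"
  define C2 where "C2 = M * ?N \<rho>1 + 1 / c * (F * ?N E1)"
  define C where "C = \<bar>1 / mass * C1\<bar> + \<bar>1 / mass * C2\<bar>"
  have der: "(u has_vector_derivative g x) (at x)" if x: "\<bar>x\<bar> < 1" for x
  proof -
    have eq: "u x = (1 / mass) *\<^sub>R (conv \<rho> u x + (1 / c) *\<^sub>R conv parametrix f x)" if "\<bar>x\<bar> < 1" for x
    proof -
      have "(1 / mass) *\<^sub>R (mass *\<^sub>R u x) = (1 / mass) *\<^sub>R (conv \<rho> u x + (1 / c) *\<^sub>R conv parametrix f x)"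
        by (rule arg_cong[OF representation[OF u f c weak that]])
      then show ?thesis
        using mass_pos by simp
    qed
    have scale: "((\<lambda>x. a *\<^sub>R h x) has_vector_derivative a *\<^sub>R h') (at x)" if "(h has_vector_derivative h') (at x)" for a and h :: "real \<Rightarrow> 'b" and h'
      using bounded_linear.has_vector_derivative[OF bounded_linear_scaleR_right that] .
    have "((\<lambda>x. (1 / mass) *\<^sub>R (conv \<rho> u x + (1 / c) *\<^sub>R conv parametrix f x)) has_vector_derivative g x) (at x)"
      unfolding g_def by (intro scale has_vector_derivative_add D1 D2)
    moreover have "open {x::real. \<bar>x\<bar> < 1}"
      by (intro open_Collect_less continuous_intros)
    ultimately show ?thesis
      by (rule has_vector_derivative_transform_within_open[where S = "{x. \<bar>x\<bar> < 1}"]) (use x eq in auto)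
  qed
  have bound: "norm (g x) \<le> C" for x
  proof -
    have "norm (conv \<rho>1 u x + (1 / c) *\<^sub>R conv E1 f x) \<le> norm (conv \<rho>1 u x) + 1 / c * norm (conv E1 f x)"
      using norm_triangle_ineq[of "conv \<rho>1 u x" "(1 / c) *\<^sub>R conv E1 f x"] c by simp
    also have "\<dots> \<le> C2"
      unfolding C2_def using c by (intro add_mono mult_left_mono conv_norm_le[OF um u(2) int1(1)] conv_norm_le[OF f int1(2)]) auto
    finally have "1 / mass * norm (conv \<rho>1 u x + (1 / c) *\<^sub>R conv E1 f x) \<le> 1 / mass * C2"
      using mass_pos by (intro mult_left_mono) auto
    moreover have "norm (g x) = 1 / mass * norm (conv \<rho>1 u x + (1 / c) *\<^sub>R conv E1 f x)"
      using mass_pos by (simp add: g_def)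
    ultimately show ?thesis
      unfolding C_def by linarith
  qed
  have hold: "norm (g x - g y) \<le> C * \<bar>x - y\<bar> powr (2 * s - 1)" if xy: "\<bar>x - y\<bar> \<le> 1" for x y
  proof -
    let ?p = "\<bar>x - y\<bar> powr (2 * s - 1)"
    have eq: "g x - g y = (1 / mass) *\<^sub>R ((conv \<rho>1 u x - conv \<rho>1 u y) + (1 / c) *\<^sub>R (conv E1 f x - conv E1 f y))"
      by (simp add: g_def algebra_simps)
    have "norm ((conv \<rho>1 u x - conv \<rho>1 u y) + (1 / c) *\<^sub>R (conv E1 f x - conv E1 f y))
      \<le> norm (conv \<rho>1 u x - conv \<rho>1 u y) + 1 / c * norm (conv E1 f x - conv E1 f y)"
      using norm_triangle_ineq[of "conv \<rho>1 u x - conv \<rho>1 u y" "(1 / c) *\<^sub>R (conv E1 f x - conv E1 f y)"] c by simp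
    also have "\<dots> \<le> M * ?N (frac_lap s \<phi>2) * ?p + 1 / c * (F * C0 * ?p)"
      using c by (intro add_mono mult_left_mono H1(1) H2(1) xy) auto
    also have "\<dots> = C1 * ?p"
      by (simp add: C1_def algebra_simps)
    finally have "1 / mass * norm ((conv \<rho>1 u x - conv \<rho>1 u y) + (1 / c) *\<^sub>R (conv E1 f x - conv E1 f y)) \<le> 1 / mass * (C1 * ?p)"
      using mass_pos by (intro mult_left_mono) auto
    moreover have "norm (g x - g y) = 1 / mass * norm ((conv \<rho>1 u x - conv \<rho>1 u y) + (1 / c) *\<^sub>R (conv E1 f x - conv E1 f y))"
      unfolding eq using mass_pos by simp
    moreover have "1 / mass * C1 \<le> C"
      unfolding C_def by linarith
    then have "1 / mass * (C1 * ?p) \<le> C * ?p"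
      unfolding mult.assoc[symmetric] by (rule mult_right_mono) simp
    ultimately show ?thesis
      by linarith
  qed
  have "C \<ge> 0"
    by (simp add: C_def)
  then show ?thesis
    using that der bound hold by blast
qed

end

section \<open>Regularity and the weak formulation for the solution found\<close>

context frac_hamiltonian
begin

text \<open>The right-hand side, gradient of W minus L u, may be unbounded on the line. Bumps
  centred in (-1, 1) with scale at most 1 vanish outside (-2, 2), so it may be cut off to [-2, 2]
  without affecting the tested equations.\<close>

lemma solution_C1_holder:
  fixes u :: "real \<Rightarrow>\<^sub>C (real^'n)"
  assumes weak: "\<And>\<phi>. \<phi> \<in> test_functions \<Longrightarrow>
    weak_form (apply_bcontfun u) \<phi> = (LINT x|lborel. gW x (apply_bcontfun u x) \<bullet> \<phi> x)"
    and lap: "\<And>\<phi>. \<phi> \<in> test_functions \<Longrightarrow> integrable lborel (\<lambda>x. apply_bcontfun u x \<bullet> frac_lap s \<phi> x)"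
  obtains g C where "C \<ge> 0" "\<And>x. \<bar>x\<bar> < 1 \<Longrightarrow> (apply_bcontfun u has_vector_derivative g x) (at x)" "\<And>x. norm (g x) \<le> C"
    "\<And>x y. \<bar>x - y\<bar> \<le> 1 \<Longrightarrow> norm (g x - g y) \<le> C * \<bar>x - y\<bar> powr (2 * s - 1)"
proof -
  obtain \<eta> :: "real \<Rightarrow> real" where \<eta>: "\<eta> \<in> test_functions" "\<And>x. \<eta> x \<ge> 0" "\<eta> 0 > 0"
    "\<And>x. \<bar>x\<bar> \<ge> 1 \<Longrightarrow> \<eta> x = 0" "\<And>x. \<eta> (- x) = \<eta> x" "\<And>x y. \<bar>x\<bar> \<le> \<bar>y\<bar> \<Longrightarrow> \<eta> y \<le> \<eta> x"
    by (rule even_decreasing_bump) blast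
  interpret bump: dilation_bump s \<eta>
    by unfold_locales (use s \<eta> in auto)
  define h where "h x = gW x (apply_bcontfun u x) - L x *v apply_bcontfun u x" for x
  define f where "f x = indicator {-2..2} x *\<^sub>R h x" for x
  have h: "continuous_on UNIV h"
    unfolding h_def by (intro continuous_intros L_cont) auto
  have [measurable]: "h \<in> borel_measurable borel"
    using h by (rule borel_measurable_continuous_onI)
  have fm: "f \<in> borel_measurable borel"
    unfolding f_def[abs_def] by measurable
  have "compact (h ` {-2..2})"
    using h by (intro compact_continuous_image) (auto intro: continuous_on_subset)
  then obtain F where F: "\<forall>y\<in>h ` {-2..2}. norm y \<le> F"
    using compact_imp_bounded bounded_iff by blast
  have fF: "norm (f x) \<le> \<bar>F\<bar>" for x
    using F by (cases "x \<in> {-2..2}") (force simp: f_def)+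
  have eq: "frac_const s * (LINT y|lborel. apply_bcontfun u y \<bullet> frac_lap s (\<lambda>y. \<eta> ((x - y) / \<epsilon>) *\<^sub>R v) y)
    = (LINT y|lborel. f y \<bullet> (\<eta> ((x - y) / \<epsilon>) *\<^sub>R v))" if x: "\<bar>x\<bar> < 1" "0 < \<epsilon>" "\<epsilon> \<le> 1" for x \<epsilon> v
  proof -
    let ?\<Phi> = "\<lambda>y. \<eta> ((x - y) / \<epsilon>) *\<^sub>R v"
    have \<Phi>: "?\<Phi> \<in> test_functions"
      by (rule test_function_affine_scaleR[OF \<eta>(1) x(2)])
    have i1: "integrable lborel (\<lambda>y. gW y (apply_bcontfun u y) \<bullet> ?\<Phi> y)"
      by (rule continuous_test_integrable[OF _ \<Phi>]) (intro continuous_intros; simp)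
    have i2: "integrable lborel (\<lambda>y. (L y *v apply_bcontfun u y) \<bullet> ?\<Phi> y)"
      by (rule continuous_test_integrable[OF _ \<Phi>]) (intro continuous_intros L_cont; simp)
    have "frac_const s * (LINT y|lborel. apply_bcontfun u y \<bullet> frac_lap s ?\<Phi> y)
      = (LINT y|lborel. gW y (apply_bcontfun u y) \<bullet> ?\<Phi> y) - (LINT y|lborel. (L y *v apply_bcontfun u y) \<bullet> ?\<Phi> y)"
      using weak[OF \<Phi>] by (simp add: weak_form_def)
    also have "\<dots> = (LINT y|lborel. h y \<bullet> ?\<Phi> y)"
      using i1 i2 by (simp only: h_def inner_diff_left Bochner_Integration.integral_diff)
    also have "\<dots> = (LINT y|lborel. f y \<bullet> ?\<Phi> y)"
    proof (rule Bochner_Integration.integral_cong[OF refl])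
      fix y
      show "h y \<bullet> ?\<Phi> y = f y \<bullet> ?\<Phi> y"
      proof (cases "y \<in> {-2..2}")
        case False
        then have "\<epsilon> \<le> \<bar>x - y\<bar>"
          using x by (auto simp: abs_if split: if_splits)
        then have "\<bar>(x - y) / \<epsilon>\<bar> \<ge> 1"
          using x(2) by (simp add: abs_divide)
        then show ?thesis
          using \<eta>(4) by simp
      qed (simp add: f_def)
    qed
    finally show ?thesis .
  qed
  show ?thesis
  proof (rule bump.C1_holder_local[OF continuous_on_apply_bcontfun norm_bounded fm fF c_pos eq])
    fix g :: "real \<Rightarrow> real^'n" and C
    assume a: "C \<ge> 0" "\<And>x. \<bar>x\<bar> < 1 \<Longrightarrow> (apply_bcontfun u has_vector_derivative g x) (at x)" "\<And>x. norm (g x) \<le> C"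
      "\<And>x y. \<bar>x - y\<bar> \<le> 1 \<Longrightarrow> norm (g x - g y) \<le> C * \<bar>x - y\<bar> powr (2 * s - 1)"
    show ?thesis
      by (rule that[of C g]) (fact a)+
  qed
qed

text \<open>Finite energy of u allows undoing the integration by parts, returning from
  \<open>weak_form\<close> to the double integral; completion then matches \<open>lborel\<close>
  with \<open>lebesgue\<close>. The second conclusion is what the regularity lemma consumes.\<close>

lemma bcontfun_weak_solution:
  fixes u :: "real \<Rightarrow>\<^sub>C (real^'n)"
  assumes u: "u \<in> energy_ball E H"
    and weak: "\<And>\<phi>. \<phi> \<in> test_functions \<Longrightarrow>
      weak_form (apply_bcontfun u) \<phi> = (LINT x|lborel. gW x (apply_bcontfun u x) \<bullet> \<phi> x)"
  shows "weak_solution s L W (apply_bcontfun u)"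
    and "\<And>\<phi>. \<phi> \<in> test_functions \<Longrightarrow> integrable lborel (\<lambda>x. apply_bcontfun u x \<bullet> frac_lap s \<phi> x)"
proof -
  have gag: "gagliardo s (apply_bcontfun u) < \<infinity>"
    using u by (auto simp: energy_ball_def intro: le_less_trans)
  have pot: "(\<integral>\<^sup>+x. ennreal ((L x *v apply_bcontfun u x) \<bullet> apply_bcontfun u x) \<partial>lebesgue) < \<infinity>"
    using u by (auto simp: energy_ball_def intro: le_less_trans)
  have pair: "integrable lebesgue (\<lambda>(x, y). (apply_bcontfun u x - apply_bcontfun u y) \<bullet> (\<phi> x - \<phi> y) / \<bar>x - y\<bar> powr (1 + 2 * s))"
    if "\<phi> \<in> test_functions" for \<phi> :: "real \<Rightarrow> real^'n"
    using that by (intro gagliardo_product_integrable bcontfun_measurable gag gagliardo_test_function s' test_function_measurable)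
  show "integrable lborel (\<lambda>x. apply_bcontfun u x \<bullet> frac_lap s \<phi> x)" if "\<phi> \<in> test_functions" for \<phi>
    by (rule weak_frac_lap(1)[OF s' that bcontfun_measurable norm_bounded pair[OF that]])
  show "weak_solution s L W (apply_bcontfun u)"
    unfolding weak_solution_def
  proof (intro conjI ballI)
    show "apply_bcontfun u \<in> borel_measurable lebesgue"
      by (intro measurable_completion) (simp add: bcontfun_measurable)
    show "frac_energy s L (apply_bcontfun u) < \<infinity>"
      unfolding frac_energy_def gagliardo_def[symmetric] using gag pot by (simp add: ennreal_mult_less_top)
    fix \<phi> :: "real \<Rightarrow> real^'n" assume \<phi>: "\<phi> \<in> test_functions"
    show "integrable lebesgue (\<lambda>(x, y). (apply_bcontfun u x - apply_bcontfun u y) \<bullet> (\<phi> x - \<phi> y) / \<bar>x - y\<bar> powr (1 + 2 * s))"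
      by (rule pair[OF \<phi>])
    have i1: "integrable lborel (\<lambda>x. (L x *v apply_bcontfun u x) \<bullet> \<phi> x)"
      by (rule continuous_test_integrable[OF _ \<phi>]) (intro continuous_intros L_cont; simp)
    have i2: "integrable lborel (\<lambda>x. gW x (apply_bcontfun u x) \<bullet> \<phi> x)"
      by (rule continuous_test_integrable[OF _ \<phi>]) (intro continuous_intros; simp)
    show "integrable lebesgue (\<lambda>x. (L x *v apply_bcontfun u x) \<bullet> \<phi> x)"
      "integrable lebesgue (\<lambda>x. gW x (apply_bcontfun u x) \<bullet> \<phi> x)"
      using i1 i2 integrable_completion[OF borel_measurable_integrable] by blast+
    have I: "(LINT x|lebesgue. (L x *v apply_bcontfun u x) \<bullet> \<phi> x) = (LINT x|lborel. (L x *v apply_bcontfun u x) \<bullet> \<phi> x)"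
      "(LINT x|lebesgue. gW x (apply_bcontfun u x) \<bullet> \<phi> x) = (LINT x|lborel. gW x (apply_bcontfun u x) \<bullet> \<phi> x)"
      by (rule integral_completion[OF borel_measurable_integrable[OF i1]] integral_completion[OF borel_measurable_integrable[OF i2]])+
    have "form (apply_bcontfun u) \<phi> = (LINT x|lborel. gW x (apply_bcontfun u x) \<bullet> \<phi> x)"
      using form_eq_weak_form[OF bcontfun_measurable norm_bounded gag \<phi>] weak[OF \<phi>] by simp
    then show "frac_const s * (LINT (x, y)|lebesgue. (apply_bcontfun u x - apply_bcontfun u y) \<bullet> (\<phi> x - \<phi> y) / \<bar>x - y\<bar> powr (1 + 2 * s)) +
      (LINT x|lebesgue. (L x *v apply_bcontfun u x) \<bullet> \<phi> x) = (LINT x|lebesgue. gW x (apply_bcontfun u x) \<bullet> \<phi> x)"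
      unfolding I form_def .
  qed
qed

end

section \<open>Passage to the norms of the theorem\<close>

lemma sup_norm_on_le:
  assumes "\<And>x. x \<in> S \<Longrightarrow> norm (f x) \<le> C"
  shows "sup_norm_on S f \<le> ennreal C"
  unfolding sup_norm_on_def using assms by (intro SUP_least ennreal_leI) auto

lemma holder_seminorm_le:
  assumes "\<And>x y. x \<in> S \<Longrightarrow> y \<in> S \<Longrightarrow> norm (f x - f y) \<le> C * \<bar>x - y\<bar> powr \<beta>"
  shows "holder_seminorm \<beta> S f \<le> ennreal C"
  unfolding holder_seminorm_def
  using assms by (intro SUP_least) (auto intro!: ennreal_leI simp: pos_divide_le_eq)

theorem theorem1p4:
  fixes s :: real
    and L :: "real \<Rightarrow> real^'n^'n"
    and W :: "real \<Rightarrow> real^'n \<Rightarrow> real"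
  assumes s: "1/2 < s" "s < 1"
    and L_cont: "continuous_on UNIV L"
    and L_sym: "\<And>x. transpose (L x) = L x"
    and L_coercive: "\<exists>\<alpha>>0. \<forall>x q. (L x *v q) \<bullet> q \<ge> \<alpha> * (norm q)\<^sup>2"
    and L_top: "filterlim (\<lambda>x. INF \<xi>\<in>{\<xi>. norm \<xi> = 1}. (L x *v \<xi>) \<bullet> \<xi>) at_top at_top"
    and L_bot: "filterlim (\<lambda>x. INF \<xi>\<in>{\<xi>. norm \<xi> = 1}. (L x *v \<xi>) \<bullet> \<xi>) at_top at_bot"
    and W_C1: "C1_fun (\<lambda>(x, q). W x q)"
    and W_zero: "\<And>x. W x 0 = 0"
    and W_small: "((\<lambda>q. SUP x. ennreal (norm (grad (W x) q) / norm q)) \<longlongrightarrow> 0) (at 0)"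
    and W_AR: "\<exists>\<mu>>2. \<forall>x q. q \<noteq> 0 \<longrightarrow> 0 < \<mu> * W x q \<and> \<mu> * W x q \<le> grad (W x) q \<bullet> q"
    and W_quad: "\<forall>M>0. \<exists>\<kappa>>0. \<forall>x q. norm q \<le> M \<longrightarrow>
                   \<bar>1/2 * (grad (W x) q \<bullet> q) - W x q\<bar> \<le> \<kappa> * (norm q)\<^sup>2"
  shows "\<exists>Cstar::real>0. \<exists>Cstarstar::real>0. \<exists>q :: real \<Rightarrow> real^'n.
           weak_solution s L W q \<and>
           (\<exists>x. q x \<noteq> 0) \<and>
           q \<in> holder_space (s - 1/2) UNIV \<and>
           holder_norm (s - 1/2) UNIV q \<le> ennreal Cstar \<and>
           q \<in> C1_holder_space (2 * s - 1) {-1/2<..<1/2} \<and>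
           C1_holder_norm (2 * s - 1) {-1/2<..<1/2} q \<le> ennreal Cstarstar \<and>
           (q \<longlongrightarrow> 0) at_top \<and>
           (q \<longlongrightarrow> 0) at_bot"
proof -
  obtain \<alpha> where \<alpha>: "\<alpha> > 0" "\<And>x q. \<alpha> * (norm q)\<^sup>2 \<le> (L x *v q) \<bullet> q"
    using L_coercive by blast
  obtain \<mu> where \<mu>: "\<mu> > 2" "\<And>x q. q \<noteq> 0 \<Longrightarrow> 0 < \<mu> * W x q \<and> \<mu> * W x q \<le> grad (W x) q \<bullet> q"
    using W_AR by blast
  interpret frac_hamiltonian s L W \<alpha> \<mu>
    by (rule frac_hamiltonian.intro, rule s(1), rule s(2), rule L_cont, rule L_sym, rule \<alpha>(1), rule \<alpha>(2),
        rule L_top, rule L_bot, rule W_C1, rule W_zero, rule W_small, rule \<mu>(1), rule \<mu>(2))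
  obtain E H and u :: "real \<Rightarrow>\<^sub>C (real^'n)" where u: "u \<in> energy_ball E H" "H \<ge> 0" "E \<ge> 0" "u \<noteq> 0"
    and weak: "\<And>\<phi>. \<phi> \<in> test_functions \<Longrightarrow>
      weak_form (apply_bcontfun u) \<phi> = (LINT x|lborel. grad (W x) (apply_bcontfun u x) \<bullet> \<phi> x)"
  proof (rule weak_solution_exists)
    fix E H and u :: "real \<Rightarrow>\<^sub>C (real^'n)"
    assume a: "u \<in> energy_ball E H" "H \<ge> 0" "E \<ge> 0" "u \<noteq> 0" "\<And>\<phi>. \<phi> \<in> test_functions \<Longrightarrow>
      weak_form (apply_bcontfun u) \<phi> = (LINT x|lborel. grad (W x) (apply_bcontfun u x) \<bullet> \<phi> x)"
    show ?thesis
      by (rule that[of u E H]) (fact a)+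
  qed
  define q where "q = apply_bcontfun u"
  have sol: "weak_solution s L W q"
    unfolding q_def by (rule bcontfun_weak_solution(1)[OF u(1) weak])
  have nontriv: "\<exists>x. q x \<noteq> 0"
    using u(4) bcontfun_eqI[of u 0] by (auto simp: q_def)
  have q_bound: "norm (q x) \<le> norm u" for x
    unfolding q_def by (rule norm_bounded)
  have q_holder: "norm (q x - q y) \<le> H * \<bar>x - y\<bar> powr (s - 1 / 2)" for x y
    using u(1) by (simp add: energy_ball_def q_def)
  have "holder_norm (s - 1 / 2) UNIV q \<le> ennreal (norm u) + ennreal H"
    unfolding holder_norm_def by (intro add_mono sup_norm_on_le holder_seminorm_le q_bound q_holder)
  \<comment> \<open>The added 1 makes the constant positive regardless of the other
    summands.\<close>
  then have N1: "holder_norm (s - 1 / 2) UNIV q \<le> ennreal (norm u + H + 1)"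
    using u(2) by (auto simp: ennreal_plus[symmetric] simp del: ennreal_plus intro: order_trans ennreal_leI)
  obtain g C where g: "C \<ge> 0" "\<And>x. \<bar>x\<bar> < 1 \<Longrightarrow> (q has_vector_derivative g x) (at x)" "\<And>x. norm (g x) \<le> C"
    "\<And>x y. \<bar>x - y\<bar> \<le> 1 \<Longrightarrow> norm (g x - g y) \<le> C * \<bar>x - y\<bar> powr (2 * s - 1)"
  proof (rule solution_C1_holder[OF weak bcontfun_weak_solution(2)[OF u(1) weak]])
    fix g :: "real \<Rightarrow> real^'n" and C
    assume a: "C \<ge> 0" "\<And>x. \<bar>x\<bar> < 1 \<Longrightarrow> (apply_bcontfun u has_vector_derivative g x) (at x)" "\<And>x. norm (g x) \<le> C"
      "\<And>x y. \<bar>x - y\<bar> \<le> 1 \<Longrightarrow> norm (g x - g y) \<le> C * \<bar>x - y\<bar> powr (2 * s - 1)"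
    show ?thesis
      by (rule that[of C g]) (fact a[folded q_def])+
  qed
  let ?S = "{-1/2<..<1/2} :: real set"
  have vd: "vector_derivative q (at x) = g x" if "x \<in> ?S" for x
    using that by (intro vector_derivative_at g(2)) auto
  \<comment> \<open>Two points of (-1/2, 1/2) are at distance at most 1, so the Hoelder estimate of
    g for such distances covers all pairs.\<close>
  have "C1_holder_norm (2 * s - 1) ?S q \<le> ennreal (norm u) + (ennreal C + ennreal C)"
    unfolding C1_holder_norm_def holder_norm_def
    by (intro add_mono sup_norm_on_le holder_seminorm_le q_bound) (use vd g(3,4) in auto)
  then have N2: "C1_holder_norm (2 * s - 1) ?S q \<le> ennreal (norm u + (C + C) + 1)"
    using g(1) by (auto simp: ennreal_plus[symmetric] simp del: ennreal_plus intro: order_trans ennreal_leI)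
  have diff: "q differentiable_on ?S"
    unfolding differentiable_on_def
  proof
    fix x assume "x \<in> ?S"
    then have "\<bar>x\<bar> < 1"
      by auto
    from differentiableI_vector[OF g(2)[OF this]] show "q differentiable at x within ?S"
      by (rule differentiable_at_withinI)
  qed
  have decay: "\<exists>R. \<forall>x. \<bar>x\<bar> \<ge> R \<longrightarrow> dist (q x) 0 < \<epsilon>" if "\<epsilon> > 0" for \<epsilon>
    using energy_ball_decay[OF u(3,2) that] u(1) by (auto simp: q_def)
  have top: "(q \<longlongrightarrow> 0) at_top"
  proof (rule tendstoI)
    fix \<epsilon> :: real assume "\<epsilon> > 0"
    then obtain R where "\<And>x. \<bar>x\<bar> \<ge> R \<Longrightarrow> dist (q x) 0 < \<epsilon>"
      using decay by blast
    then show "\<forall>\<^sub>F x in at_top. dist (q x) 0 < \<epsilon>"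
      unfolding eventually_at_top_linorder by (intro exI[of _ R]) auto
  qed
  have bot: "(q \<longlongrightarrow> 0) at_bot"
  proof (rule tendstoI)
    fix \<epsilon> :: real assume "\<epsilon> > 0"
    then obtain R where "\<And>x. \<bar>x\<bar> \<ge> R \<Longrightarrow> dist (q x) 0 < \<epsilon>"
      using decay by blast
    then show "\<forall>\<^sub>F x in at_bot. dist (q x) 0 < \<epsilon>"
      unfolding eventually_at_bot_linorder by (intro exI[of _ "- R"]) auto
  qed
  have mem: "q \<in> holder_space (s - 1/2) UNIV" "q \<in> C1_holder_space (2 * s - 1) ?S"
    unfolding holder_space_def C1_holder_space_def using le_less_trans[OF N1] le_less_trans[OF N2] diff by simp_all
  have pos: "norm u + H + 1 > 0" "norm u + (C + C) + 1 > 0"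
    using u(2) g(1) by (auto intro!: add_nonneg_pos)
  show ?thesis
    by (rule exI[of _ "norm u + H + 1"], rule conjI[OF pos(1)],
        rule exI[of _ "norm u + (C + C) + 1"], rule conjI[OF pos(2)], rule exI[of _ q])
       (intro conjI sol nontriv mem N1 N2 top bot)
qed

end
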